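(* Let $m\leq0$, $\varepsilon\in(0,1/2)$ and $\Omega=\mathbb R^n\times\{\xi:|\xi|>1\}$. Suppose that $(x,\xi)\mapsto a_t(x,\xi)$ belongs to $S^m_{1,0}$ uniformly in $t\in(0,1)$ and is supported in $\Omega$; that $\rho\in S^0_{1,0}$ is a function of $\xi$ only; and that $\varphi\in C^\infty(\Omega)$ satisfies: (i) there are constants $C_1,C_2>0$ with $C_1|\xi|\leq|\nabla_x\varphi(x,\xi)|\leq C_2|\xi|$ for all $(x,\xi)\in\Omega$; (ii) for all multi-indices with $|\alpha|,|\beta|\geq1$, $|\partial_x^\alpha\varphi(x,\xi)|\lesssim\langle\xi\rangle$ and $|\partial_\xi^\alpha\partial_x^\beta\varphi(x,\xi)|\lesssim|\xi|^{1-|\alpha|}$ for all $(x,\xi)\in\Omega$. For $t\in(0,1)$ let $\rho(tD)f(x)=\int\rho(t\xi)\widehat f(\xi)e^{ix\cdot\xi}\frac{d\xi}{(2\pi)^n}$ and $T^\varphi_{a_t}f(x)=\int a_t(x,\xi)\widehat f(\xi)e^{i\varphi(x,\xi)}\frac{d\xi}{(2\pi)^n}$, and let $$\sigma_t(x,\xi)=\iint a_t(y,\xi)\rho(t\eta)e^{i(x-y)\cdot\eta+i\varphi(y,\xi)-i\varphi(x,\xi)}\frac{d\eta}{(2\pi)^n}\,dy,$$ the amplitude of $\rho(tD)T^\varphi_{a_t}=T^\varphi_{\sigma_t}$. Then for each integer $M\geq1$ one can write, for $t\in(0,1)$, $$\sigma_t(x,\xi)=\rho(t\nabla_x\varphi(x,\xi))a_t(x,\xi)+\sum_{0<|\alpha|<M}\frac{t^{|\alpha|}}{\alpha!}\sigma_\alpha(t,x,\xi)+t^{M\varepsilon}r(t,x,\xi),$$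 where for all multi-indices $\beta,\gamma$, $$|\partial_\xi^\gamma\partial_x^\beta\sigma_\alpha(t,x,\xi)|\lesssim t^{|\alpha|(\varepsilon-1)}\langle\xi\rangle^{m-|\alpha|(\frac12-\varepsilon)-|\gamma|}\quad(0<|\alpha|<M),$$ and $$\sup_{t\in(0,1)}|\partial_\xi^\gamma\partial_x^\beta r(t,x,\xi)|\lesssim\langle\xi\rangle^{m-M(\frac12-\varepsilon)-|\gamma|}.$$
   Context: $\langle\xi\rangle=(1+|\xi|^2)^{1/2}$. $S^m_{1,0}$ is the class of smooth $a(x,\xi)$ on $\mathbb R^n\times\mathbb R^n$ with $|\partial_\xi^\alpha\partial_x^\beta a(x,\xi)|\leq C_{\alpha\beta}\langle\xi\rangle^{m-|\alpha|}$; "uniformly in $t$" means the constants $C_{\alpha\beta}$ are independent of $t$. $\widehat f(\xi)=\int f(x)e^{-ix\cdot\xi}dx$. Implicit constants are independent of $t,x,\xi$. *)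

theory Defs
  imports "HOL-Analysis.Analysis"
begin

definition jbr :: "real^'n \<Rightarrow> real" where
  "jbr \<xi> = sqrt (1 + (norm \<xi>)\<^sup>2)"

definition dline :: "('n::finite + 'n) \<Rightarrow> (real^'n \<Rightarrow> real^'n \<Rightarrow> 'b) \<Rightarrow> real^'n \<Rightarrow> real^'n \<Rightarrow> real \<Rightarrow> 'b" where
  "dline d F x \<xi> = (case d of
       Inl i \<Rightarrow> (\<lambda>s. F (x + s *\<^sub>R axis i 1) \<xi>)
     | Inr i \<Rightarrow> (\<lambda>s. F x (\<xi> + s *\<^sub>R axis i 1)))"

definition pdir :: "('n::finite + 'n) \<Rightarrow> (real^'n \<Rightarrow> real^'n \<Rightarrow> 'b::real_normed_vector)
    \<Rightarrow> real^'n \<Rightarrow> real^'n \<Rightarrow> 'b" where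
  "pdir d F x \<xi> = vector_derivative (dline d F x \<xi>) (at 0)"

fun Dl :: "('n::finite + 'n) list \<Rightarrow> (real^'n \<Rightarrow> real^'n \<Rightarrow> 'b::real_normed_vector)
    \<Rightarrow> real^'n \<Rightarrow> real^'n \<Rightarrow> 'b" where
  "Dl [] F = F"
| "Dl (d # L) F = pdir d (Dl L F)"

text \<open>dd G B F = \<partial>_\<xi>^\<gamma> \<partial>_x^\<beta> F, the multi-indices \<gamma>, \<beta> being given as lists of
  coordinate indices (the multi-index is the multiplicity count of the list).\<close>
definition dd :: "'n::finite list \<Rightarrow> 'n list \<Rightarrow> (real^'n \<Rightarrow> real^'n \<Rightarrow> 'b::real_normed_vector)
    \<Rightarrow> real^'n \<Rightarrow> real^'n \<Rightarrow> 'b" where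
  "dd G B F = Dl (map Inr G @ map Inl B) F"

definition smooth_on :: "((real^'n::finite) \<times> (real^'n)) set \<Rightarrow> (real^'n \<Rightarrow> real^'n \<Rightarrow> 'b::real_normed_vector) \<Rightarrow> bool" where
  "smooth_on S F \<longleftrightarrow>
     (\<forall>L. continuous_on S (\<lambda>p. Dl L F (fst p) (snd p)) \<and>
          (\<forall>d. \<forall>p\<in>S. dline d (Dl L F) (fst p) (snd p) differentiable (at 0)))"

definition S10 :: "real \<Rightarrow> (real^'n::finite \<Rightarrow> real^'n \<Rightarrow> complex) \<Rightarrow> bool" where
  "S10 m a \<longleftrightarrow> smooth_on UNIV a \<and>
     (\<forall>G B. \<exists>C. \<forall>x \<xi>. norm (dd G B a x \<xi>) \<le> C * jbr \<xi> powr (m - real (length G)))"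

definition grad_x :: "(real^'n::finite \<Rightarrow> real^'n \<Rightarrow> real) \<Rightarrow> real^'n \<Rightarrow> real^'n \<Rightarrow> real^'n" where
  "grad_x \<phi> x \<xi> = (\<chi> i. pdir (Inl i) \<phi> x \<xi>)"

text \<open>The amplitude sigma_t, an oscillatory integral, defined as the limit of the
  absolutely convergent Gaussian-regularised double integrals.\<close>
definition sigma_amp :: "(real^'n::finite \<Rightarrow> real^'n \<Rightarrow> complex) \<Rightarrow> (real^'n \<Rightarrow> complex)
    \<Rightarrow> (real^'n \<Rightarrow> real^'n \<Rightarrow> real) \<Rightarrow> real \<Rightarrow> real^'n \<Rightarrow> real^'n \<Rightarrow> complex" where
  "sigma_amp a \<rho> \<phi> t x \<xi> =
     Lim (at_right 0) (\<lambda>e::real.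
       (LINT y|lborel. LINT \<eta>|lborel.
          of_real (exp (- e * ((norm y)\<^sup>2 + (norm \<eta>)\<^sup>2))) * a y \<xi> * \<rho> (t *\<^sub>R \<eta>)
          * cis ((x - y) \<bullet> \<eta> + \<phi> y \<xi> - \<phi> x \<xi>))
       / of_real ((2 * pi) ^ CARD('n)))"

definition mabs :: "('n::finite \<Rightarrow> nat) \<Rightarrow> nat" where
  "mabs \<alpha> = (\<Sum>i\<in>UNIV. \<alpha> i)"

definition mfact :: "('n::finite \<Rightarrow> nat) \<Rightarrow> nat" where
  "mfact \<alpha> = (\<Prod>i\<in>UNIV. fact (\<alpha> i))"

end

theory Submission
  imports Defs "HOL-Probability.Probability"
begin

text \<open>The amplitude is a limit of Gaussian-regularised oscillatory integrals in \<open>(y, \<eta>)\<close>. Replace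
  \<open>\<rho> (t \<eta>)\<close> by its Taylor polynomial at \<open>\<eta> = \<nabla>\<^sub>x\<phi>(x, \<xi>)\<close>: the limits of the polynomial terms are derivatives
  at \<open>y = x\<close> of \<open>a(y, \<xi>) exp (i (\<phi>(y, \<xi>) - \<phi>(x, \<xi>) - (y - x) \<bullet> \<nabla>\<^sub>x\<phi>(x, \<xi>)))\<close>, and since that phase vanishes to
  second order at \<open>x\<close>, a derivative costs only \<open>\<langle>\<xi>\<rangle>\<close> to the power \<open>1/2\<close>.

  For the remainder of order \<open>N\<close>, localise \<open>y\<close> to Gaussian windows of width \<open>\<langle>\<xi>\<rangle>\<close> to the power \<open>-1/2\<close> and
  rescale \<open>\<eta>\<close> accordingly. The lower bound on \<open>\<nabla>\<^sub>x\<phi>\<close> and integration by parts give the bound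
  \<open>\<mu>\<close> to the power \<open>N\<close> with \<open>\<mu> = t \<langle>\<xi>\<rangle>\<^sup>1\<^sup>/\<^sup>2 / (1 + t \<langle>\<xi>\<rangle>)\<close>, which is at most \<open>\<nu> = t\<^sup>\<epsilon> / \<langle>\<xi>\<rangle>\<^sup>1\<^sup>/\<^sup>2\<^sup>-\<^sup>\<epsilon>\<close>.

  This bounds the remainder but not its derivatives, since only mixed derivatives of \<open>\<phi>\<close> are controlled.
  Differentiation under the integral sign shows, however, that every derivative of the amplitude grows at most
  polynomially in \<open>\<langle>\<xi>\<rangle>\<close>. Interpolating between these crude bounds and the bound for a remainder of large
  order \<open>N\<close>, and absorbing the terms of order between \<open>M\<close> and \<open>N\<close>, yields the derivative bounds.\<close>

section \<open>Iterated partial derivatives\<close>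

text \<open>Crude bounds suffice for two reasons. Since \<epsilon> < 1/2, the factor \<nu> decays in
  \<langle>\<xi>\<rangle>, so a large order beats any fixed power of the bracket; and the exponents
  in the crude bounds do not depend on the order of the remainder. One interpolation halves the
  exponent of \<nu>, so \<open>n\<close> derivatives are paid for by starting from the order
  \<open>2 ^ n * j\<close>.

  The crude bounds themselves must avoid pure frequency derivatives of \<phi>. After powers of 1
  minus the Laplacian have been moved onto \<open>a\<close> times its exponential, \<sigma> is an
  absolutely convergent integral over a displacement \<open>z\<close>, in which \<phi> enters only
  as \<phi>(x + z, \<xi>) - \<phi>(x, \<xi>). Derivatives of this increment are mixed derivatives
  integrated along a segment, and their growth in \<open>z\<close> meets a rapidly decaying kernel.

  The comparison \<mu> \<le> \<nu> is nothing but \<open>X powr (1 - \<epsilon>) \<le> 1 + X\<close>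
  for X = t \<langle>\<xi>\<rangle>.\<close>

definition pd :: "'a::real_normed_vector \<Rightarrow> ('a \<Rightarrow> 'b::real_normed_vector) \<Rightarrow> 'a \<Rightarrow> 'b" where
  "pd b f x = vector_derivative (\<lambda>s. f (x + s *\<^sub>R b)) (at 0)"

fun PD :: "'a::real_normed_vector list \<Rightarrow> ('a \<Rightarrow> 'b::real_normed_vector) \<Rightarrow> 'a \<Rightarrow> 'b" where
  "PD [] f = f"
| "PD (b # L) f = pd b (PD L f)"

lemma PD_append: "PD (A @ B) f = PD A (PD B f)"
  by (induction A) auto

lemma pd_has_derivative:
  assumes "(f has_derivative f') (at x)"
  shows "pd b f x = f' b"
proof -
  have "((\<lambda>s. f (x + s *\<^sub>R b)) has_derivative (\<lambda>s. f' (s *\<^sub>R b))) (at 0)"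
    by (rule has_derivative_compose[of "\<lambda>s. x + s *\<^sub>R b" _ 0 UNIV f f'])
       (use assms in \<open>auto intro!: derivative_eq_intros\<close>)
  moreover have "f' (s *\<^sub>R b) = s *\<^sub>R f' b" for s
    using assms by (simp add: has_derivative_def bounded_linear.linear linear_scale)
  ultimately have "((\<lambda>s. f (x + s *\<^sub>R b)) has_vector_derivative f' b) (at 0)"
    by (simp add: has_vector_derivative_def)
  then show ?thesis unfolding pd_def by (rule vector_derivative_at)
qed

lemma pd_line:
  assumes "f differentiable (at (x + s *\<^sub>R b))"
  shows "((\<lambda>s. f (x + s *\<^sub>R b)) has_vector_derivative pd b f (x + s *\<^sub>R b)) (at s within T)"
proof -
  obtain f' where f': "(f has_derivative f') (at (x + s *\<^sub>R b))"
    using assms unfolding differentiable_def by blast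
  have "((\<lambda>s. f (x + s *\<^sub>R b)) has_derivative (\<lambda>s. f' (s *\<^sub>R b))) (at s within T)"
    by (rule has_derivative_compose[of "\<lambda>s. x + s *\<^sub>R b" _ s T f f'])
       (use f' in \<open>auto intro!: derivative_eq_intros\<close>)
  moreover have "f' (s *\<^sub>R b) = s *\<^sub>R f' b" for s
    using f' by (simp add: has_derivative_def bounded_linear.linear linear_scale)
  ultimately show ?thesis
    using pd_has_derivative[OF f', of b] by (simp add: has_vector_derivative_def)
qed

lemma has_derivative_pd:
  fixes f :: "'a::euclidean_space \<Rightarrow> 'b::real_normed_vector"
  assumes "f differentiable (at x)"
  shows "(f has_derivative (\<lambda>h. \<Sum>b\<in>Basis. (h \<bullet> b) *\<^sub>R pd b f x)) (at x)"
proof -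
  obtain f' where f': "(f has_derivative f') (at x)"
    using assms unfolding differentiable_def by blast
  interpret bounded_linear f' using f' by (rule has_derivative_bounded_linear)
  have "f' h = (\<Sum>b\<in>Basis. (h \<bullet> b) *\<^sub>R pd b f x)" for h
  proof -
    have "f' h = f' (\<Sum>b\<in>Basis. (h \<bullet> b) *\<^sub>R b)" by (simp add: euclidean_representation)
    also have "\<dots> = (\<Sum>b\<in>Basis. (h \<bullet> b) *\<^sub>R pd b f x)"
      by (simp add: sum scaleR pd_has_derivative[OF f'])
    finally show ?thesis .
  qed
  then have "f' = (\<lambda>h. \<Sum>b\<in>Basis. (h \<bullet> b) *\<^sub>R pd b f x)" by blast
  with f' show ?thesis by simp
qed

text \<open>Holds without differentiability, because \<open>pd\<close> depends only on the germ of
  the function at the point. This is what lets identities and vanishing on open sets pass to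
  derivatives.\<close>

lemma pd_cong:
  assumes "open S" "x \<in> S" "\<And>y. y \<in> S \<Longrightarrow> f y = g y"
  shows "pd b f x = pd b g x"
proof -
  have "((\<lambda>s::real. x + s *\<^sub>R b) \<longlongrightarrow> x + 0 *\<^sub>R b) (nhds 0)"
    by (intro tendsto_intros) (simp add: filterlim_ident)
  then have "eventually (\<lambda>s::real. x + s *\<^sub>R b \<in> S) (nhds 0)"
    using assms(1,2) by (simp add: tendsto_def)
  then have "eventually (\<lambda>s::real. f (x + s *\<^sub>R b) = g (x + s *\<^sub>R b)) (nhds 0)"
    by eventually_elim (use assms(3) in auto)
  then show ?thesis
    unfolding pd_def by (intro vector_derivative_cong_eq) (auto simp: assms)
qed

lemma PD_cong:
  assumes "open S" "\<And>y. y \<in> S \<Longrightarrow> f y = g y" "x \<in> S"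
  shows "PD L f x = PD L g x"
  using assms(3)
proof (induction L arbitrary: x)
  case (Cons b L)
  then show ?case using pd_cong[OF assms(1), of x "PD L f" "PD L g" b] by simp
qed (use assms in auto)

lemma differentiable_cong_open:
  assumes "open S" "x \<in> S" "\<And>y. y \<in> S \<Longrightarrow> f y = g y" "f differentiable (at x)"
  shows "g differentiable (at x)"
  using assms unfolding differentiable_def
  by (meson has_derivative_transform_within_open)

section \<open>Mean value estimates, the C^1 criterion and symmetry of mixed partials\<close>

lemma line_bound:
  fixes f :: "real \<Rightarrow> 'b::real_normed_vector"
  assumes "\<And>s. s \<in> closed_segment 0 r \<Longrightarrow> (f has_vector_derivative f' s) (at s within closed_segment 0 r)"
    and "\<And>s. s \<in> closed_segment 0 r \<Longrightarrow> norm (f' s) \<le> B"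
  shows "norm (f r - f 0) \<le> B * \<bar>r\<bar>"
proof -
  have "norm (f r - f 0) \<le> B * norm (r - 0)"
  proof (rule differentiable_bound[where f' = "\<lambda>s h. h *\<^sub>R f' s"])
    show "(f has_derivative (\<lambda>h. h *\<^sub>R f' s)) (at s within closed_segment 0 r)" 
      if "s \<in> closed_segment 0 r" for s
      using assms(1)[OF that] by (simp add: has_vector_derivative_def)
    show "onorm (\<lambda>h. h *\<^sub>R f' s) \<le> B" if "s \<in> closed_segment 0 r" for s
      using assms(2)[OF that] by (intro onorm_le) (simp add: mult.commute[of B] mult_left_mono)
  qed auto
  then show ?thesis by simp
qed

text \<open>\<open>smooth_on\<close> supplies only partial derivatives and joint continuity; this is
  the classical passage to Frechet differentiability. The increment is built up by induction on the
  set \<open>B\<close> of coordinates in which it may be nonzero, and each new coordinate costs one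
  mean value inequality along a segment.\<close>

lemma partials_continuous_imp_has_derivative:
  fixes f :: "'a::euclidean_space \<Rightarrow> 'b::real_normed_vector"
  assumes S: "open S" "x \<in> S"
    and d: "\<And>b y. b \<in> Basis \<Longrightarrow> y \<in> S \<Longrightarrow> ((\<lambda>s. f (y + s *\<^sub>R b)) has_vector_derivative g b y) (at 0)"
    and c: "\<And>b. b \<in> Basis \<Longrightarrow> continuous_on S (g b)"
  shows "(f has_derivative (\<lambda>h. \<Sum>b\<in>Basis. (h \<bullet> b) *\<^sub>R g b x)) (at x)"
proof -
  have d': "((\<lambda>s. f (y + s *\<^sub>R b)) has_vector_derivative g b (y + s *\<^sub>R b)) (at s within T)"
    if "b \<in> Basis" "y + s *\<^sub>R b \<in> S" for b y s T
  proof -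
    have "((\<lambda>r. f ((y + s *\<^sub>R b) + r *\<^sub>R b)) has_vector_derivative g b (y + s *\<^sub>R b)) (at (s - s))"
      using d[OF that] by simp
    then have "(((\<lambda>r. f ((y + s *\<^sub>R b) + r *\<^sub>R b)) \<circ> (\<lambda>r. r - s)) has_vector_derivative (1 *\<^sub>R g b (y + s *\<^sub>R b))) (at s)"
      by (intro vector_diff_chain_at) (auto intro!: derivative_eq_intros)
    then show ?thesis
      by (auto simp: o_def algebra_simps has_vector_derivative_at_within)
  qed
  have key: "\<exists>\<delta>>0. \<forall>h. norm h < \<delta> \<and> h = (\<Sum>b\<in>B. (h \<bullet> b) *\<^sub>R b) \<longrightarrow>
      norm (f (x + h) - f x - (\<Sum>b\<in>B. (h \<bullet> b) *\<^sub>R g b x)) \<le> e * norm h"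
    if "finite B" "B \<subseteq> Basis" "e > 0" for B e
    using that
  proof (induction B arbitrary: e rule: finite_induct)
    case empty
    show ?case by (intro exI[of _ 1]) auto
  next
    case (insert b B)
    then obtain \<delta>1 where \<delta>1: "\<delta>1 > 0" "\<And>h. norm h < \<delta>1 \<Longrightarrow> h = (\<Sum>b\<in>B. (h \<bullet> b) *\<^sub>R b) \<Longrightarrow>
      norm (f (x + h) - f x - (\<Sum>b\<in>B. (h \<bullet> b) *\<^sub>R g b x)) \<le> e/2 * norm h"
      using insert.IH[of "e/2"] by auto
    have bB: "b \<in> Basis" using insert by auto
    have "isCont (g b) x" using c[OF bB] S by (simp add: continuous_on_eq_continuous_at)
    then obtain \<delta>2 where \<delta>2: "\<delta>2 > 0" "\<And>y. norm (y - x) < \<delta>2 \<Longrightarrow> norm (g b y - g b x) < e/2"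
      using insert.prems unfolding continuous_at_eps_delta dist_norm
      by (metis half_gt_zero)
    obtain \<delta>3 where \<delta>3: "\<delta>3 > 0" "ball x \<delta>3 \<subseteq> S" using S open_contains_ball by blast
    define \<delta> where "\<delta> = Min {\<delta>1, \<delta>2, \<delta>3} / 2"
    have \<delta>: "\<delta> > 0" "2 * \<delta> \<le> \<delta>1" "2 * \<delta> \<le> \<delta>2" "2 * \<delta> \<le> \<delta>3" using \<delta>1 \<delta>2 \<delta>3 by (auto simp: \<delta>_def)
    show ?case
    proof (intro exI[of _ \<delta>] conjI allI impI)
      fix h assume "norm h < \<delta> \<and> h = (\<Sum>b\<in>insert b B. (h \<bullet> b) *\<^sub>R b)"
      then have h: "norm h < \<delta>" "h = (\<Sum>b\<in>insert b B. (h \<bullet> b) *\<^sub>R b)" by auto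
      define r where "r = h \<bullet> b"
      define h' where "h' = (\<Sum>b\<in>B. (h \<bullet> b) *\<^sub>R b)"
      have hh: "h = h' + r *\<^sub>R b" using h(2) insert.hyps by (simp add: h'_def r_def add.commute)
      have ip: "h' \<bullet> c = (if c \<in> B then h \<bullet> c else 0)" if "c \<in> Basis" for c
      proof -
        have "h' \<bullet> c = (\<Sum>b\<in>B. (h \<bullet> b) * (if b = c then 1 else 0))"
          unfolding h'_def inner_sum_left
          by (rule sum.cong) (use insert.prems that in \<open>auto simp: inner_Basis\<close>)
        also have "\<dots> = (if c \<in> B then h \<bullet> c else 0)" using insert.hyps by (simp add: if_distrib cong: if_cong)
        finally show ?thesis .
      qed
      have h'e: "h' = (\<Sum>b\<in>B. (h' \<bullet> b) *\<^sub>R b)"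
        by (subst h'_def) (rule sum.cong, use ip insert.prems in auto)
      have r: "\<bar>r\<bar> \<le> norm h" using bB by (simp add: r_def Basis_le_norm)
      have n': "norm h' \<le> norm h"
        by (rule norm_le_componentwise) (auto simp: ip)
      have 1: "norm (f (x + h') - f x - (\<Sum>b\<in>B. (h \<bullet> b) *\<^sub>R g b x)) \<le> e/2 * norm h"
      proof -
        have "norm (f (x + h') - f x - (\<Sum>b\<in>B. (h' \<bullet> b) *\<^sub>R g b x)) \<le> e/2 * norm h'"
          using \<delta>1(2)[of h'] h'e n' h(1) \<delta> by auto
        moreover have "(\<Sum>b\<in>B. (h' \<bullet> b) *\<^sub>R g b x) = (\<Sum>b\<in>B. (h \<bullet> b) *\<^sub>R g b x)"
          by (rule sum.cong) (use ip insert.prems in auto)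
        ultimately show ?thesis using insert.prems(2) order_trans[OF _ mult_left_mono[OF n', of "e/2"]] by auto
      qed
      \<comment> \<open>Subtracting the linear term leaves a function whose derivative along the
        segment is small by continuity of \<open>g b\<close>.\<close>
      define F where "F = (\<lambda>s. f (x + h' + s *\<^sub>R b) - s *\<^sub>R g b x)"
      have near: "norm (h' + s *\<^sub>R b) < 2 * \<delta>" if "s \<in> closed_segment 0 r" for s
      proof -
        have "\<bar>s\<bar> \<le> \<bar>r\<bar>" using that by (auto simp: closed_segment_eq_real_ivl split: if_splits)
        then have "norm (h' + s *\<^sub>R b) \<le> norm h' + \<bar>r\<bar>"
          using bB by (intro norm_triangle_le) auto
        then show ?thesis using n' r h(1) by linarith
      qed
      have "norm (F r - F 0) \<le> e/2 * \<bar>r\<bar>"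
      proof (rule line_bound[where f' = "\<lambda>s. g b (x + h' + s *\<^sub>R b) - g b x"])
        fix s assume s: "s \<in> closed_segment 0 r"
        have "x + h' + s *\<^sub>R b \<in> S" using near[OF s] \<delta> \<delta>3
          by (auto simp: subset_iff dist_norm algebra_simps norm_minus_commute)
        then show "(F has_vector_derivative g b (x + h' + s *\<^sub>R b) - g b x) (at s within closed_segment 0 r)"
          unfolding F_def using d'[OF bB, of "x + h'" s]
          by (auto intro!: derivative_eq_intros)
        show "norm (g b (x + h' + s *\<^sub>R b) - g b x) \<le> e/2"
          using \<delta>2(2)[of "x + h' + s *\<^sub>R b"] near[OF s] \<delta> by (auto simp: algebra_simps intro: less_imp_le)
      qed
      moreover have "F r - F 0 = f (x + h) - f (x + h') - r *\<^sub>R g b x"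
        by (simp add: F_def hh algebra_simps)
      ultimately have 2: "norm (f (x + h) - f (x + h') - r *\<^sub>R g b x) \<le> e/2 * norm h"
        using order_trans[OF _ mult_left_mono[OF r, of "e/2"]] insert.prems(2) by simp
      have "f (x + h) - f x - (\<Sum>b\<in>insert b B. (h \<bullet> b) *\<^sub>R g b x)
        = (f (x + h') - f x - (\<Sum>b\<in>B. (h \<bullet> b) *\<^sub>R g b x)) + (f (x + h) - f (x + h') - r *\<^sub>R g b x)"
        using insert.hyps by (simp add: r_def)
      then show "norm (f (x + h) - f x - (\<Sum>b\<in>insert b B. (h \<bullet> b) *\<^sub>R g b x)) \<le> e * norm h"
        using norm_triangle_le[OF order_trans[OF add_mono[OF 1 2]]] by (simp add: field_simps)
    qed (use \<delta> in auto)
  qed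
  show ?thesis
    unfolding has_derivative_at_alt
  proof (intro conjI allI impI)
    show "bounded_linear (\<lambda>h. \<Sum>b\<in>Basis. (h \<bullet> b) *\<^sub>R g b x)"
      by (intro bounded_linear_sum bounded_linear_scaleR_const bounded_linear_inner_left)
    fix e :: real assume "e > 0"
    from key[OF finite_Basis subset_refl this] obtain \<delta> where \<delta>: "\<delta> > 0" "\<And>h. norm h < \<delta> \<Longrightarrow>
       norm (f (x + h) - f x - (\<Sum>b\<in>Basis. (h \<bullet> b) *\<^sub>R g b x)) \<le> e * norm h"
      by (auto simp: euclidean_representation)
    show "\<exists>d>0. \<forall>y. norm (y - x) < d \<longrightarrow>
        norm (f y - f x - (\<Sum>b\<in>Basis. ((y - x) \<bullet> b) *\<^sub>R g b x)) \<le> e * norm (y - x)"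
      using \<delta>(1) \<delta>(2)[of "_ - x"] by (intro exI[of _ \<delta>]) auto
  qed
qed

text \<open>Symmetry in Young's form: differentiability of the two first partials at the point
  itself takes the place of continuous second derivatives. Both iterated derivatives are limits of
  the same second difference divided by \<open>h * h\<close>.\<close>

lemma pd_commute:
  fixes f :: "'a::euclidean_space \<Rightarrow> 'b::real_normed_vector"
  assumes S: "open S" "x \<in> S"
    and f: "\<And>y. y \<in> S \<Longrightarrow> f differentiable (at y)"
    and fb: "pd b f differentiable (at x)" and fc: "pd c f differentiable (at x)"
  shows "pd b (pd c f) x = pd c (pd b f) x"
proof -
  have key: "\<exists>d>0. \<forall>h. 0 < h \<and> h < d \<longrightarrow>
     norm (f (x + h *\<^sub>R b + h *\<^sub>R c) - f (x + h *\<^sub>R b) - f (x + h *\<^sub>R c) + f x - (h * h) *\<^sub>R pd c (pd b f) x) \<le> e * (h * h)"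
    if fb: "pd b f differentiable (at x)" and e: "e > 0" for b c e
  proof -
    define D where "D = (\<lambda>h. \<Sum>i\<in>Basis. (h \<bullet> i) *\<^sub>R pd i (pd b f) x)"
    have D: "(pd b f has_derivative D) (at x)"
      unfolding D_def by (rule has_derivative_pd[OF fb])
    interpret D: bounded_linear D using D by (rule has_derivative_bounded_linear)
    have Dc: "D c = pd c (pd b f) x" using pd_has_derivative[OF D] by simp
    \<comment> \<open>The linearisation error of \<open>pd b f\<close> is used at two points within
      \<open>h * (norm b + norm c)\<close> of \<open>x\<close>, whence the factor 2; the summand 1
      keeps \<open>K\<close> positive when both directions are zero.\<close>
    define K where "K = 2 * (norm b + norm c) + 1"
    have K: "K > 0" "norm b + norm c \<ge> 0" "K \<ge> 1" by (auto simp: K_def add_nonneg_pos)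
    obtain d1 where d1: "d1 > 0" "\<And>y. norm (y - x) < d1 \<Longrightarrow>
        norm (pd b f y - pd b f x - D (y - x)) \<le> e / K * norm (y - x)"
      using D e K unfolding has_derivative_at_alt by (metis divide_pos_pos)
    obtain d2 where d2: "d2 > 0" "ball x d2 \<subseteq> S" using S open_contains_ball by blast
    define d where "d = min d1 d2 / K"
    have d: "d > 0" "d * K \<le> d1" "d * K \<le> d2" using d1 d2 K by (auto simp: d_def field_simps)
    show ?thesis
    proof (intro exI[of _ d] conjI allI impI)
      fix h assume h: "0 < h \<and> h < d"
      define u where "u = (\<lambda>s. f (x + h *\<^sub>R c + s *\<^sub>R b) - f (x + s *\<^sub>R b) - s *\<^sub>R (h *\<^sub>R D c))"
      have "norm (u h - u 0) \<le> (e * h) * \<bar>h\<bar>"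
      proof (rule line_bound[where f' = "\<lambda>s. pd b f (x + h *\<^sub>R c + s *\<^sub>R b) - pd b f (x + s *\<^sub>R b) - h *\<^sub>R D c"])
        fix s assume "s \<in> closed_segment 0 h"
        then have s: "0 \<le> s" "s \<le> h" using h by (auto simp: closed_segment_eq_real_ivl)
        have n: "norm (h *\<^sub>R c + s *\<^sub>R b) \<le> h * (norm b + norm c)" "norm (s *\<^sub>R b) \<le> h * (norm b + norm c)"
        proof -
          show "norm (s *\<^sub>R b) \<le> h * (norm b + norm c)"
            using s h by (simp add: mult_mono)
          have "norm (h *\<^sub>R c + s *\<^sub>R b) \<le> h * norm c + s * norm b"
            using norm_triangle_ineq[of "h *\<^sub>R c" "s *\<^sub>R b"] s h by simp
          also have "\<dots> \<le> h * norm c + h * norm b" using s by (simp add: mult_right_mono)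
          finally show "norm (h *\<^sub>R c + s *\<^sub>R b) \<le> h * (norm b + norm c)" by (simp add: algebra_simps)
        qed
        have "h * (norm b + norm c) < d * K"
        proof -
          have "h * (norm b + norm c) \<le> h * K" using h K by (intro mult_left_mono) (auto simp: K_def)
          also have "\<dots> < d * K" using h K by (intro mult_strict_right_mono) auto
          finally show ?thesis .
        qed
        then have lt: "h * (norm b + norm c) < d1" "h * (norm b + norm c) < d2" using d by linarith+
        have inS: "x + v \<in> S" if "norm v \<le> h * (norm b + norm c)" for v
          using that lt d2 by (auto simp: subset_iff dist_norm)
        have "x + h *\<^sub>R c + s *\<^sub>R b \<in> S" "x + s *\<^sub>R b \<in> S"
          using inS[OF n(1)] inS[OF n(2)] by (simp_all add: add.assoc)
        then show "(u has_vector_derivative pd b f (x + h *\<^sub>R c + s *\<^sub>R b) - pd b f (x + s *\<^sub>R b) - h *\<^sub>R D c) (at s within closed_segment 0 h)"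
          unfolding u_def by (auto intro!: derivative_eq_intros pd_line f)
        have "norm (pd b f (x + (h *\<^sub>R c + s *\<^sub>R b)) - pd b f x - D (h *\<^sub>R c + s *\<^sub>R b)) \<le> e / K * (h * (norm b + norm c))"
          using d1(2)[of "x + (h *\<^sub>R c + s *\<^sub>R b)"] n(1) lt e K mult_left_mono[OF n(1), of "e / K"] by force
        moreover have "norm (pd b f (x + s *\<^sub>R b) - pd b f x - D (s *\<^sub>R b)) \<le> e / K * (h * (norm b + norm c))"
          using d1(2)[of "x + s *\<^sub>R b"] n(2) lt e K mult_left_mono[OF n(2), of "e / K"] by force
        ultimately have "norm ((pd b f (x + (h *\<^sub>R c + s *\<^sub>R b)) - pd b f x - D (h *\<^sub>R c + s *\<^sub>R b))
           - (pd b f (x + s *\<^sub>R b) - pd b f x - D (s *\<^sub>R b))) \<le> 2 * (e / K * (h * (norm b + norm c)))"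
          using norm_triangle_ineq4 order_trans by (smt (verit))
        also have "\<dots> = e * h * (2 * (norm b + norm c) / K)" by simp
        also have "\<dots> \<le> e * h * 1" using e h K(1)
          by (intro mult_left_mono) (simp_all add: pos_divide_le_eq, simp add: K_def)
        finally show "norm (pd b f (x + h *\<^sub>R c + s *\<^sub>R b) - pd b f (x + s *\<^sub>R b) - h *\<^sub>R D c) \<le> e * h"
          by (simp add: D.add D.scaleR algebra_simps)
      qed
      then show "norm (f (x + h *\<^sub>R b + h *\<^sub>R c) - f (x + h *\<^sub>R b) - f (x + h *\<^sub>R c) + f x - (h * h) *\<^sub>R pd c (pd b f) x) \<le> e * (h * h)"
        using h by (simp add: u_def Dc algebra_simps)
    qed (use d in auto)
  qed
  have "norm (pd b (pd c f) x - pd c (pd b f) x) \<le> e" if e: "e > 0" for e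
  proof -
    obtain d1 d2 where d: "d1 > 0" "d2 > 0"
      and 1: "\<And>h. 0 < h \<Longrightarrow> h < d1 \<Longrightarrow> norm (f (x + h *\<^sub>R b + h *\<^sub>R c) - f (x + h *\<^sub>R b) - f (x + h *\<^sub>R c) + f x - (h * h) *\<^sub>R pd c (pd b f) x) \<le> e/2 * (h * h)"
      and 2: "\<And>h. 0 < h \<Longrightarrow> h < d2 \<Longrightarrow> norm (f (x + h *\<^sub>R c + h *\<^sub>R b) - f (x + h *\<^sub>R c) - f (x + h *\<^sub>R b) + f x - (h * h) *\<^sub>R pd b (pd c f) x) \<le> e/2 * (h * h)"
      using key[OF fb half_gt_zero[OF e], of c] key[OF fc half_gt_zero[OF e], of b] by metis
    define h where "h = min d1 d2 / 2"
    have h: "0 < h" "h < d1" "h < d2" using d by (auto simp: h_def)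
    define X where "X = f (x + h *\<^sub>R b + h *\<^sub>R c) - f (x + h *\<^sub>R b) - f (x + h *\<^sub>R c) + f x"
    have X: "X = f (x + h *\<^sub>R c + h *\<^sub>R b) - f (x + h *\<^sub>R c) - f (x + h *\<^sub>R b) + f x"
      by (simp add: X_def algebra_simps)
    have "norm ((X - (h * h) *\<^sub>R pd c (pd b f) x) - (X - (h * h) *\<^sub>R pd b (pd c f) x)) \<le> e/2 * (h * h) + e/2 * (h * h)"
      using 1[OF h(1,2)] 2[OF h(1,3)] unfolding X_def[symmetric] X[symmetric]
      by (rule order_trans[OF norm_triangle_ineq4 add_mono])
    then have "norm ((h * h) *\<^sub>R (pd b (pd c f) x - pd c (pd b f) x)) \<le> e * (h * h)"
      by (simp add: algebra_simps)
    then show ?thesis using h by simp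
  qed
  then have "norm (pd b (pd c f) x - pd c (pd b f) x) \<le> 0"
    by (rule field_le_epsilon[where y=0, simplified])
  then show ?thesis by simp
qed

section \<open>Symbol estimates\<close>

lemma pd_add:
  assumes "f differentiable (at x)" "g differentiable (at x)"
  shows "pd b (\<lambda>x. f x + g x) x = pd b f x + pd b g x"
  using assms unfolding differentiable_def
  proof -
  obtain f' g' where "(f has_derivative f') (at x)" "(g has_derivative g') (at x)"
    using assms unfolding differentiable_def by blast
  then show ?thesis
    using pd_has_derivative[OF has_derivative_add[of f f' "at x" g g'], of b]
      pd_has_derivative[of f f' x b] pd_has_derivative[of g g' x b] by simp
qed

lemma pd_const [simp]: "pd b (\<lambda>x. c) x = 0"
  by (simp add: pd_def)

lemma pd_mult:
  fixes f g :: "'a::real_normed_vector \<Rightarrow> 'b::real_normed_field"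
  assumes "f differentiable (at x)" "g differentiable (at x)"
  shows "pd b (\<lambda>x. f x * g x) x = pd b f x * g x + f x * pd b g x"
proof -
  obtain f' g' where "(f has_derivative f') (at x)" "(g has_derivative g') (at x)"
    using assms unfolding differentiable_def by blast
  then show ?thesis
    using pd_has_derivative[OF has_derivative_mult[of f f' x UNIV g g'], of b]
      pd_has_derivative[of f f' x b] pd_has_derivative[of g g' x b] by simp
qed

lemma pd_cmult:
  fixes f :: "'a::real_normed_vector \<Rightarrow> 'b::real_normed_field"
  assumes "f differentiable (at x)"
  shows "pd b (\<lambda>x. c * f x) x = c * pd b f x"
  using pd_mult[of "\<lambda>x. c" x f b] assms by simp

lemma pd_exp:
  fixes f :: "'a::real_normed_vector \<Rightarrow> complex"
  assumes "f differentiable (at x)"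
  shows "(\<lambda>x. exp (f x)) differentiable (at x)" "pd b (\<lambda>x. exp (f x)) x = pd b f x * exp (f x)"
proof -
  obtain f' where f': "(f has_derivative f') (at x)" using assms unfolding differentiable_def by blast
  have "((\<lambda>x. exp (f x)) has_derivative (\<lambda>h. f' h * exp (f x))) (at x)"
    using has_derivative_compose[OF f' DERIV_exp[unfolded has_field_derivative_def]]
    by (simp add: mult.commute)
  then show "(\<lambda>x. exp (f x)) differentiable (at x)" "pd b (\<lambda>x. exp (f x)) x = pd b f x * exp (f x)"
    using pd_has_derivative[OF f', of b] pd_has_derivative[of "\<lambda>x. exp (f x)" _ x b]
    unfolding differentiable_def by auto
qed

text \<open>Each derivative in direction \<open>b\<close> multiplies the weight \<open>W\<close> by \<open>w b\<close>, uniformly in the parameter \<open>p\<close>.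
  Suitable weights turn \<open>Sy\<close> into symbol classes, Schwartz seminorms or bounds for families of amplitudes.\<close>
primrec Syk :: "nat \<Rightarrow> 'p set \<Rightarrow> 'a::euclidean_space set \<Rightarrow> ('p \<Rightarrow> 'a \<Rightarrow> 'a \<Rightarrow> real) \<Rightarrow> ('p \<Rightarrow> 'a \<Rightarrow> real) \<Rightarrow> ('p \<Rightarrow> 'a \<Rightarrow> complex) \<Rightarrow> bool" where
  "Syk 0 P S w W F = True"
| "Syk (Suc k) P S w W F = ((\<forall>p\<in>P. \<forall>x\<in>S. F p differentiable (at x)) \<and>
     (\<exists>C\<ge>0. \<forall>p\<in>P. \<forall>x\<in>S. norm (F p x) \<le> C * W p x) \<and>
     (\<forall>b\<in>Basis. Syk k P S w (\<lambda>p x. W p x * w p b x) (\<lambda>p. pd b (F p))))"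

definition Sy :: "'p set \<Rightarrow> 'a::euclidean_space set \<Rightarrow> ('p \<Rightarrow> 'a \<Rightarrow> 'a \<Rightarrow> real) \<Rightarrow> ('p \<Rightarrow> 'a \<Rightarrow> real) \<Rightarrow> ('p \<Rightarrow> 'a \<Rightarrow> complex) \<Rightarrow> bool" where
  "Sy P S w W F = (\<forall>k. Syk k P S w W F)"

lemma Syk_Suc_imp: "Syk (Suc k) P S w W F \<Longrightarrow> Syk k P S w W F"
  by (induction k arbitrary: W F) auto

lemma Syk_cong:
  assumes S: "open S" and W: "\<And>p x. p \<in> P \<Longrightarrow> x \<in> S \<Longrightarrow> W p x = W' p x"
    and F: "\<And>p x. p \<in> P \<Longrightarrow> x \<in> S \<Longrightarrow> F p x = F' p x" and *: "Syk k P S w W F"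
  shows "Syk k P S w W' F'"
  using W F *
proof (induction k arbitrary: W F W' F')
  case (Suc k)
  have "F' p differentiable (at x)" if "p \<in> P" "x \<in> S" for p x
    using Suc.prems that by (intro differentiable_cong_open[OF S, of x "F p" "F' p"]) auto
  moreover obtain C where "C \<ge> 0" "\<And>p x. p \<in> P \<Longrightarrow> x \<in> S \<Longrightarrow> norm (F p x) \<le> C * W p x" using Suc.prems by auto
  then have "\<exists>C\<ge>0. \<forall>p\<in>P. \<forall>x\<in>S. norm (F' p x) \<le> C * W' p x" using Suc.prems by (intro exI[of _ C]) auto
  moreover have "Syk k P S w (\<lambda>p x. W' p x * w p b x) (\<lambda>p. pd b (F' p))" if b: "b \<in> Basis" for b
  proof (rule Suc.IH[of "\<lambda>p x. W p x * w p b x" _ "\<lambda>p. pd b (F p)"])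
    show "pd b (F p) x = pd b (F' p) x" if "p \<in> P" "x \<in> S" for p x
      by (rule pd_cong[OF S that(2)]) (use Suc.prems that in auto)
  qed (use Suc.prems b in auto)
  ultimately show ?case by auto
qed auto

lemma Syk_zero:
  assumes "\<And>p x. p \<in> P \<Longrightarrow> x \<in> S \<Longrightarrow> 0 \<le> W p x" "\<And>p b x. p \<in> P \<Longrightarrow> b \<in> Basis \<Longrightarrow> x \<in> S \<Longrightarrow> 0 \<le> w p b x"
  shows "Syk k P S w W (\<lambda>p x. 0)"
  using assms(1)
proof (induction k arbitrary: W)
  case (Suc k)
  then have "Syk k P S w (\<lambda>p x. W p x * w p b x) (\<lambda>p. pd b (\<lambda>x. 0))" if "b \<in> Basis" for b
    using Suc.IH[of "\<lambda>p x. W p x * w p b x"] assms(2) that by (simp add: pd_const[abs_def])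
  with Suc show ?case by (auto intro!: exI[of _ 0])
qed auto

lemma Syk_const:
  assumes "\<And>p x. p \<in> P \<Longrightarrow> x \<in> S \<Longrightarrow> norm (c p) \<le> C * W p x" "C \<ge> 0"
    "\<And>p x. p \<in> P \<Longrightarrow> x \<in> S \<Longrightarrow> 0 \<le> W p x"
    "\<And>p b x. p \<in> P \<Longrightarrow> b \<in> Basis \<Longrightarrow> x \<in> S \<Longrightarrow> 0 \<le> w p b x"
  shows "Syk k P S w W (\<lambda>p x. c p)"
proof (cases k)
  case (Suc k')
  have "Syk k' P S w (\<lambda>p x. W p x * w p b x) (\<lambda>p. pd b (\<lambda>x. c p))" if "b \<in> Basis" for b
    using Syk_zero[of P S "\<lambda>p x. W p x * w p b x" w k'] assms that by (simp add: pd_const[abs_def])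
  with Suc assms show ?thesis by auto
qed auto

lemma Syk_add:
  assumes S: "open S" and "Syk k P S w W F" "Syk k P S w W G"
  shows "Syk k P S w W (\<lambda>p x. F p x + G p x)"
  using assms(2,3)
proof (induction k arbitrary: W F G)
  case (Suc k)
  obtain C D where C: "C \<ge> 0" "\<And>p x. p \<in> P \<Longrightarrow> x \<in> S \<Longrightarrow> norm (F p x) \<le> C * W p x"
    and D: "D \<ge> 0" "\<And>p x. p \<in> P \<Longrightarrow> x \<in> S \<Longrightarrow> norm (G p x) \<le> D * W p x"
    using Suc.prems by auto
  have "norm (F p x + G p x) \<le> (C + D) * W p x" if "p \<in> P" "x \<in> S" for p x
    using C(2)[OF that] D(2)[OF that] by (simp add: norm_triangle_le distrib_right)
  then have "\<exists>C\<ge>0. \<forall>p\<in>P. \<forall>x\<in>S. norm (F p x + G p x) \<le> C * W p x"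
    using C(1) D(1) by (intro exI[of _ "C + D"]) auto
  moreover have "Syk k P S w (\<lambda>p x. W p x * w p b x) (\<lambda>p. pd b (\<lambda>x. F p x + G p x))" if b: "b \<in> Basis" for b
    by (rule Syk_cong[OF S, where F = "\<lambda>p x. pd b (F p) x + pd b (G p) x" and W = "\<lambda>p x. W p x * w p b x"])
       (use Suc b in \<open>auto simp: pd_add\<close>)
  ultimately show ?case using Suc.prems by auto
qed auto

lemma Syk_scale:
  assumes S: "open S" and "Syk k P S w W F"
  shows "Syk k P S w (\<lambda>p x. W p x * norm (d p)) (\<lambda>p x. d p * F p x)"
  using assms(2)
proof (induction k arbitrary: W F)
  case (Suc k)
  obtain C where C: "C \<ge> 0" "\<And>p x. p \<in> P \<Longrightarrow> x \<in> S \<Longrightarrow> norm (F p x) \<le> C * W p x"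
    using Suc.prems by auto
  have "norm (d p * F p x) \<le> C * (W p x * norm (d p))" if "p \<in> P" "x \<in> S" for p x
    using mult_left_mono[OF C(2)[OF that], of "norm (d p)"] by (simp add: norm_mult mult_ac)
  then have "\<exists>C\<ge>0. \<forall>p\<in>P. \<forall>x\<in>S. norm (d p * F p x) \<le> C * (W p x * norm (d p))"
    using C(1) by (intro exI[of _ "C"]) auto
  moreover have "Syk k P S w (\<lambda>p x. W p x * norm (d p) * w p b x) (\<lambda>p. pd b (\<lambda>x. d p * F p x))" if b: "b \<in> Basis" for b
    by (rule Syk_cong[OF S, where F = "\<lambda>p x. d p * pd b (F p) x" and W = "\<lambda>p x. (W p x * w p b x) * norm (d p)"])
       (use Suc b in \<open>auto simp: pd_cmult\<close>)
  ultimately show ?case using Suc.prems by auto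
qed auto

lemma Syk_mult:
  assumes S: "open S" and "Syk k P S w W F" "Syk k P S w V G"
  shows "Syk k P S w (\<lambda>p x. W p x * V p x) (\<lambda>p x. F p x * G p x)"
  using assms(2,3)
proof (induction k arbitrary: W F V G)
  case (Suc k)
  obtain C D where C: "C \<ge> 0" "\<And>p x. p \<in> P \<Longrightarrow> x \<in> S \<Longrightarrow> norm (F p x) \<le> C * W p x"
    and D: "D \<ge> 0" "\<And>p x. p \<in> P \<Longrightarrow> x \<in> S \<Longrightarrow> norm (G p x) \<le> D * V p x"
    using Suc.prems by auto
  have "norm (F p x * G p x) \<le> (C * D) * (W p x * V p x)" if "p \<in> P" "x \<in> S" for p x
    using mult_mono'[OF C(2)[OF that] D(2)[OF that]] by (simp add: norm_mult mult_ac)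
  then have "\<exists>C\<ge>0. \<forall>p\<in>P. \<forall>x\<in>S. norm (F p x * G p x) \<le> C * (W p x * V p x)"
    using C(1) D(1) by (intro exI[of _ "C * D"]) auto
  moreover have "Syk k P S w (\<lambda>p x. W p x * V p x * w p b x) (\<lambda>p. pd b (\<lambda>x. F p x * G p x))" if b: "b \<in> Basis" for b
  proof (rule Syk_cong[OF S _ _ Syk_add[OF S]])
    show "Syk k P S w (\<lambda>p x. W p x * V p x * w p b x) (\<lambda>p x. pd b (F p) x * G p x)"
      by (rule Syk_cong[OF S _ _ Suc.IH[of "\<lambda>p x. W p x * w p b x" "\<lambda>p. pd b (F p)" V G]])
         (use Suc.prems b Syk_Suc_imp[OF Suc.prems(1)] Syk_Suc_imp[OF Suc.prems(2)] in auto)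
    show "Syk k P S w (\<lambda>p x. W p x * V p x * w p b x) (\<lambda>p x. F p x * pd b (G p) x)"
      by (rule Syk_cong[OF S _ _ Suc.IH[of W F "\<lambda>p x. V p x * w p b x" "\<lambda>p. pd b (G p)"]])
         (use Suc.prems b Syk_Suc_imp[OF Suc.prems(1)] Syk_Suc_imp[OF Suc.prems(2)] in auto)
  qed (use Suc.prems in \<open>auto simp: pd_mult\<close>)
  ultimately show ?case using Suc.prems by auto
qed auto

lemma Syk_mono:
  assumes S: "open S" and *: "Syk k P S w W F" and D: "D \<ge> 0" "D' \<ge> 0"
    and W: "\<And>p x. p \<in> P \<Longrightarrow> x \<in> S \<Longrightarrow> 0 \<le> W p x \<and> W p x \<le> D * W' p x"
    and w: "\<And>p b x. p \<in> P \<Longrightarrow> b \<in> Basis \<Longrightarrow> x \<in> S \<Longrightarrow> 0 \<le> w p b x \<and> w p b x \<le> D' * w' p b x"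
  shows "Syk k P S w' W' F"
  using * W D(1)
proof (induction k arbitrary: W F W' D)
  case (Suc k)
  obtain C where C: "C \<ge> 0" "\<And>p x. p \<in> P \<Longrightarrow> x \<in> S \<Longrightarrow> norm (F p x) \<le> C * W p x"
    using Suc.prems by auto
  have "norm (F p x) \<le> (C * D) * W' p x" if "p \<in> P" "x \<in> S" for p x
    using C(2)[OF that] mult_left_mono[of "W p x" "D * W' p x" C] Suc.prems(2)[OF that] C(1)
    by (simp add: mult.assoc)
  then have "\<exists>C\<ge>0. \<forall>p\<in>P. \<forall>x\<in>S. norm (F p x) \<le> C * W' p x"
    using C(1) Suc.prems(3) by (intro exI[of _ "C * D"]) auto
  moreover have "Syk k P S w' (\<lambda>p x. W' p x * w' p b x) (\<lambda>p. pd b (F p))" if b: "b \<in> Basis" for b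
  proof (rule Suc.IH[of "\<lambda>p x. W p x * w p b x" _ "D * D'"])
    fix p x assume px: "p \<in> P" "x \<in> S"
    have "W p x * w p b x \<le> (D * W' p x) * (D' * w' p b x)"
      using Suc.prems(2)[OF px] w[OF px(1) b px(2)] by (intro mult_mono) auto
    then show "0 \<le> W p x * w p b x \<and> W p x * w p b x \<le> D * D' * (W' p x * w' p b x)"
      using Suc.prems(2)[OF px] w[OF px(1) b px(2)] by (simp add: mult_ac)
  qed (use Suc.prems b D in auto)
  ultimately show ?case using Suc.prems by auto
qed auto

text \<open>The derivative is \<open>pd b f * exp f\<close>, so the induction reproduces the
  exponential and asks for bounds on the gradient of \<open>f\<close> only;
  \<open>Re (f p x) \<le> 0\<close> bounds the exponential itself. Phases, whose own size is not
  controlled, are treated in this way.\<close>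

lemma Syk_exp:
  assumes S: "open S" 
    and d: "\<And>p x. p \<in> P \<Longrightarrow> x \<in> S \<Longrightarrow> f p differentiable (at x)"
    and re: "\<And>p x. p \<in> P \<Longrightarrow> x \<in> S \<Longrightarrow> Re (f p x) \<le> 0"
    and f: "\<And>b. b \<in> Basis \<Longrightarrow> Syk k P S w (\<lambda>p x. w p b x) (\<lambda>p. pd b (f p))"
  shows "Syk k P S w (\<lambda>p x. 1) (\<lambda>p x. exp (f p x))"
  using f
proof (induction k)
  case (Suc k)
  have IH: "Syk k P S w (\<lambda>p x. 1) (\<lambda>p x. exp (f p x))"
    using Suc Syk_Suc_imp by blast
  have "Syk k P S w (\<lambda>p x. 1 * w p b x) (\<lambda>p. pd b (\<lambda>x. exp (f p x)))" if b: "b \<in> Basis" for b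
    by (rule Syk_cong[OF S _ _ Syk_mult[OF S Syk_Suc_imp[OF Suc.prems[OF b]] IH]])
       (auto simp: pd_exp d)
  moreover have "norm (exp (f p x)) \<le> 1 * 1" if "p \<in> P" "x \<in> S" for p x
    using re[OF that] by simp
  moreover have "(\<lambda>x. exp (f p x)) differentiable (at x)" if "p \<in> P" "x \<in> S" for p x
    using pd_exp(1)[OF d[OF that]] .
  ultimately show ?case by (auto simp del: norm_exp_eq_Re intro!: exI[of _ 1])
qed auto

lemma pd_affine:
  fixes f :: "'c::real_normed_vector \<Rightarrow> complex" and A :: "'a::real_normed_vector \<Rightarrow> 'c"
  assumes "f differentiable (at (A x))" "\<And>s. A (x + s *\<^sub>R b) = A x + (s * c) *\<^sub>R e"
  shows "pd b (\<lambda>x. f (A x)) x = of_real c * pd e f (A x)"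
proof -
  have "((\<lambda>s. f (A x + s *\<^sub>R e)) has_vector_derivative pd e f (A x)) (at (0 * c))"
    using pd_line[of f "A x" 0 e UNIV] assms(1) by simp
  then have "(((\<lambda>s. f (A x + s *\<^sub>R e)) \<circ> (\<lambda>s. s * c)) has_vector_derivative (c *\<^sub>R pd e f (A x))) (at 0)"
    by (intro vector_diff_chain_at) (auto intro!: derivative_eq_intros)
  then show ?thesis
    unfolding pd_def[of b] assms(2)
    by (intro vector_derivative_at) (simp add: o_def scaleR_conv_of_real)
qed

text \<open>\<open>A q\<close> has to carry coordinate lines to coordinate lines with speed
  \<open>c q\<close>. This covers dilations, translations and the slices
  \<open>y \<mapsto> (y, \<xi>)\<close>, and every derivative picks up one factor
  \<open>c q\<close>.\<close>

lemma Syk_pullback: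
  fixes F :: "'p \<Rightarrow> 'c::euclidean_space \<Rightarrow> complex" and A :: "'q \<Rightarrow> 'a::euclidean_space \<Rightarrow> 'c"
  assumes S': "open S'" and F: "Syk k P S w W F"
    and \<pi>: "\<And>q. q \<in> Q \<Longrightarrow> \<pi> q \<in> P" and A: "\<And>q x. q \<in> Q \<Longrightarrow> x \<in> S' \<Longrightarrow> A q x \<in> S"
    and Ad: "\<And>q x. q \<in> Q \<Longrightarrow> A q differentiable (at x)"
    and Al: "\<And>q x s b. q \<in> Q \<Longrightarrow> b \<in> Basis \<Longrightarrow> A q (x + s *\<^sub>R b) = A q x + (s * c q) *\<^sub>R \<tau> b"
    and \<tau>: "\<And>b. b \<in> Basis \<Longrightarrow> \<tau> b \<in> Basis"
  shows "Syk k Q S' (\<lambda>q b x. \<bar>c q\<bar> * w (\<pi> q) (\<tau> b) (A q x)) (\<lambda>q x. W (\<pi> q) (A q x)) (\<lambda>q x. F (\<pi> q) (A q x))"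
  using F
proof (induction k arbitrary: W F)
  case (Suc k)
  have d: "F (\<pi> q) differentiable (at (A q x))" if "q \<in> Q" "x \<in> S'" for q x
    using Suc.prems \<pi> A that by auto
  have "(\<lambda>x. F (\<pi> q) (A q x)) differentiable (at x)" if "q \<in> Q" "x \<in> S'" for q x
    using differentiable_chain_at[OF Ad d] that by (simp add: o_def)
  moreover have "Syk k Q S' (\<lambda>q b x. \<bar>c q\<bar> * w (\<pi> q) (\<tau> b) (A q x)) (\<lambda>q x. W (\<pi> q) (A q x) * (\<bar>c q\<bar> * w (\<pi> q) (\<tau> b) (A q x)))
      (\<lambda>q. pd b (\<lambda>x. F (\<pi> q) (A q x)))" if b: "b \<in> Basis" for b
  proof (rule Syk_cong[OF S' _ _ Syk_scale[OF S' Suc.IH[of "\<lambda>p x. W p x * w p (\<tau> b) x" "\<lambda>p. pd (\<tau> b) (F p)"], where d = "\<lambda>q. of_real (c q)"]])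
    show "complex_of_real (c q) * pd (\<tau> b) (F (\<pi> q)) (A q x) = pd b (\<lambda>x. F (\<pi> q) (A q x)) x" if "q \<in> Q" "x \<in> S'" for q x
      by (rule pd_affine[symmetric]) (use d Al b that in auto)
  qed (use Suc.prems \<tau> b in \<open>auto simp: mult_ac\<close>)
  moreover obtain C where "C \<ge> 0" "\<And>p x. p \<in> P \<Longrightarrow> x \<in> S \<Longrightarrow> norm (F p x) \<le> C * W p x"
    using Suc.prems by auto
  then have "\<exists>C\<ge>0. \<forall>q\<in>Q. \<forall>x\<in>S'. norm (F (\<pi> q) (A q x)) \<le> C * W (\<pi> q) (A q x)"
    using \<pi> A by (intro exI[of _ C]) auto
  ultimately show ?case by auto
qed auto

text \<open>The phase is controlled only for frequencies of norm above 1, whereas the final bounds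
  are global. Vanishing in a neighbourhood of each point outside \<open>S\<close>, and not merely at
  the point, is the property that the induction can hand on to derivatives.\<close>

lemma Syk_ext_zero:
  assumes S: "open S" and F: "Syk k P S w W F"
    and z: "\<And>p x. p \<in> P \<Longrightarrow> x \<notin> S \<Longrightarrow> \<exists>U. open U \<and> x \<in> U \<and> (\<forall>y\<in>U. F p y = 0)"
    and W: "\<And>p x. p \<in> P \<Longrightarrow> x \<notin> S \<Longrightarrow> 0 \<le> W p x" and w: "\<And>p b x. p \<in> P \<Longrightarrow> b \<in> Basis \<Longrightarrow> x \<notin> S \<Longrightarrow> 0 \<le> w p b x"
  shows "Syk k P UNIV w W F"
  using F z W
proof (induction k arbitrary: W F)
  case (Suc k)
  have "F p differentiable (at x)" if p: "p \<in> P" for p x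
  proof (cases "x \<in> S")
    case False
    obtain U where U: "open U" "x \<in> U" "\<forall>y\<in>U. F p y = 0" using Suc.prems(2)[OF p False] by blast
    show ?thesis by (rule differentiable_cong_open[OF U(1,2), of "\<lambda>x. 0"]) (use U in auto)
  qed (use Suc.prems p in auto)
  moreover obtain C where C: "C \<ge> 0" "\<And>p x. p \<in> P \<Longrightarrow> x \<in> S \<Longrightarrow> norm (F p x) \<le> C * W p x"
    using Suc.prems by auto
  have "norm (F p x) \<le> C * W p x" if p: "p \<in> P" for p x
  proof (cases "x \<in> S")
    case False
    then show ?thesis using Suc.prems(2)[OF p False] Suc.prems(3)[OF p False] C by force
  qed (use C p in auto)
  moreover have "Syk k P UNIV w (\<lambda>p x. W p x * w p b x) (\<lambda>p. pd b (F p))" if b: "b \<in> Basis" for b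
  proof (rule Suc.IH)
    fix p x assume p: "p \<in> P" "x \<notin> S"
    obtain U where U: "open U" "x \<in> U" "\<forall>y\<in>U. F p y = 0" using Suc.prems(2)[OF p] by blast
    then have "pd b (F p) y = 0" if "y \<in> U" for y
      using pd_cong[OF U(1) that, of "F p" "\<lambda>x. 0" b] by simp
    with U show "\<exists>U. open U \<and> x \<in> U \<and> (\<forall>y\<in>U. pd b (F p) y = 0)" by blast
    show "0 \<le> W p x * w p b x" using Suc.prems(3)[OF p] w[OF p(1) b p(2)] by simp
  qed (use Suc.prems b in auto)
  ultimately show ?case using C(1) by auto
qed auto

text \<open>The recursion of \<open>Syk\<close> differentiates the innermost function first, that
  is, it consumes \<open>L\<close> from its end. The non-recursive form is how hypotheses on all
  derivatives enter the calculus and how bounds on all derivatives leave it.\<close>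

lemma Syk_iff_PD:
  fixes F :: "'p \<Rightarrow> 'a::euclidean_space \<Rightarrow> complex"
  shows "Syk k P S w W F \<longleftrightarrow> (\<forall>L\<in>lists Basis. length L < k \<longrightarrow>
     (\<forall>p\<in>P. \<forall>x\<in>S. PD L (F p) differentiable (at x)) \<and>
     (\<exists>C\<ge>0. \<forall>p\<in>P. \<forall>x\<in>S. norm (PD L (F p) x) \<le> C * (W p x * (\<Prod>b\<leftarrow>L. w p b x))))" (is "_ \<longleftrightarrow> ?R k W F")
proof (induction k arbitrary: W F)
  case (Suc k)
  have "?R (Suc k) W F \<longleftrightarrow> ((\<forall>p\<in>P. \<forall>x\<in>S. F p differentiable (at x)) \<and>
     (\<exists>C\<ge>0. \<forall>p\<in>P. \<forall>x\<in>S. norm (F p x) \<le> C * W p x) \<and>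
     (\<forall>b\<in>Basis. ?R k (\<lambda>p x. W p x * w p b x) (\<lambda>p. pd b (F p))))" (is "?A \<longleftrightarrow> ?B")
  proof
    assume R: ?A
    then have R': "length L < Suc k \<Longrightarrow> L \<in> lists Basis \<Longrightarrow>  (\<forall>p\<in>P. \<forall>x\<in>S. PD L (F p) differentiable (at x)) \<and>
     (\<exists>C\<ge>0. \<forall>p\<in>P. \<forall>x\<in>S. norm (PD L (F p) x) \<le> C * (W p x * (\<Prod>b\<leftarrow>L. w p b x)))" for L by blast
    have "?R k (\<lambda>p x. W p x * w p b x) (\<lambda>p. pd b (F p))" if b: "b \<in> Basis" for b
    proof (intro ballI impI)
      fix L :: "'a list" assume L: "L \<in> lists Basis" "length L < k"
      show "(\<forall>p\<in>P. \<forall>x\<in>S. PD L (pd b (F p)) differentiable (at x)) \<and>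
        (\<exists>C\<ge>0. \<forall>p\<in>P. \<forall>x\<in>S. norm (PD L (pd b (F p)) x) \<le> C * (W p x * w p b x * (\<Prod>b\<leftarrow>L. w p b x)))"
        using R'[of "L @ [b]"] L b by (simp add: PD_append mult_ac)
    qed
    with R'[of "[]"] show ?B by simp
  next
    assume B: ?B
    show ?A
    proof (intro ballI impI)
      fix L :: "'a list" assume L: "L \<in> lists Basis" "length L < Suc k"
      show "(\<forall>p\<in>P. \<forall>x\<in>S. PD L (F p) differentiable (at x)) \<and>
     (\<exists>C\<ge>0. \<forall>p\<in>P. \<forall>x\<in>S. norm (PD L (F p) x) \<le> C * (W p x * (\<Prod>b\<leftarrow>L. w p b x)))"
      proof (cases L rule: rev_cases)
        case Nil
        then show ?thesis using B by auto
      next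
        case (snoc L' b)
        then have "b \<in> Basis" "L' \<in> lists Basis" "length L' < k" using L by auto
        with B snoc show ?thesis by (simp add: PD_append mult_ac)
      qed
    qed
  qed
  then show ?case using Suc by simp
qed auto

lemma Sy_D:
  assumes "Sy P S w W F" "L \<in> lists Basis"
  shows "\<And>p x. p \<in> P \<Longrightarrow> x \<in> S \<Longrightarrow> PD L (F p) differentiable (at x)"
    "\<exists>C\<ge>0. \<forall>p\<in>P. \<forall>x\<in>S. norm (PD L (F p) x) \<le> C * (W p x * (\<Prod>b\<leftarrow>L. w p b x))"
proof -
  have "Syk (Suc (length L)) P S w W F" using assms by (simp add: Sy_def del: Syk.simps)
  then show "\<And>p x. p \<in> P \<Longrightarrow> x \<in> S \<Longrightarrow> PD L (F p) differentiable (at x)"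
    "\<exists>C\<ge>0. \<forall>p\<in>P. \<forall>x\<in>S. norm (PD L (F p) x) \<le> C * (W p x * (\<Prod>b\<leftarrow>L. w p b x))"
    using assms(2) unfolding Syk_iff_PD by auto
qed

lemma Sy_I:
  assumes "\<And>L p x. L \<in> lists Basis \<Longrightarrow> p \<in> P \<Longrightarrow> x \<in> S \<Longrightarrow> PD L (F p) differentiable (at x)"
    "\<And>L. L \<in> lists Basis \<Longrightarrow> \<exists>C\<ge>0. \<forall>p\<in>P. \<forall>x\<in>S. norm (PD L (F p) x) \<le> C * (W p x * (\<Prod>b\<leftarrow>L. w p b x))"
  shows "Sy P S w W F"
  unfolding Sy_def Syk_iff_PD by (intro allI ballI impI conjI assms)

lemma Sy_diff0: "Sy P S w W F \<Longrightarrow> p \<in> P \<Longrightarrow> x \<in> S \<Longrightarrow> F p differentiable (at x)"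
  using Sy_D(1)[of P S w W F "[]"] by simp

lemma Sy_bound0: "Sy P S w W F \<Longrightarrow> \<exists>C\<ge>0. \<forall>p\<in>P. \<forall>x\<in>S. norm (F p x) \<le> C * W p x"
  using Sy_D(2)[of P S w W F "[]"] by simp

lemma Sy_pd: "Sy P S w W F \<Longrightarrow> b \<in> Basis \<Longrightarrow> Sy P S w (\<lambda>p x. W p x * w p b x) (\<lambda>p. pd b (F p))"
  unfolding Sy_def
proof
  fix k assume *: "\<forall>k. Syk k P S w W F" and b: "b \<in> Basis"
  from *[rule_format, of "Suc k"] b show "Syk k P S w (\<lambda>p x. W p x * w p b x) (\<lambda>p. pd b (F p))" by simp
qed

lemma Sy_add: "open S \<Longrightarrow> Sy P S w W F \<Longrightarrow> Sy P S w W G \<Longrightarrow> Sy P S w W (\<lambda>p x. F p x + G p x)"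
  by (simp add: Sy_def Syk_add)

lemma Sy_scale: "open S \<Longrightarrow> Sy P S w W F \<Longrightarrow> Sy P S w (\<lambda>p x. W p x * norm (d p)) (\<lambda>p x. d p * F p x)"
  by (simp add: Sy_def Syk_scale)

lemma Sy_mult: "open S \<Longrightarrow> Sy P S w W F \<Longrightarrow> Sy P S w V G \<Longrightarrow> Sy P S w (\<lambda>p x. W p x * V p x) (\<lambda>p x. F p x * G p x)"
  by (simp add: Sy_def Syk_mult)

lemma Sy_cong':
  assumes "Sy P S w W F" "open S" "\<And>p x. p \<in> P \<Longrightarrow> x \<in> S \<Longrightarrow> W p x = W' p x"
    "\<And>p x. p \<in> P \<Longrightarrow> x \<in> S \<Longrightarrow> F p x = F' p x"
  shows "Sy P S w W' F'"
  unfolding Sy_def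
proof
  fix k
  have "Syk k P S w W F" using assms(1) by (simp add: Sy_def)
  then show "Syk k P S w W' F'" 
    by (intro Syk_cong[where S = S and P = P and W = W and F = F and W' = W' and F' = F']) (assumption | rule assms)+
qed

lemma Sy_mono:
  assumes "Sy P S w W F" "open S" 
    and "\<And>p x. p \<in> P \<Longrightarrow> x \<in> S \<Longrightarrow> 0 \<le> W p x \<and> W p x \<le> D * W' p x"
    and "\<And>p b x. p \<in> P \<Longrightarrow> b \<in> Basis \<Longrightarrow> x \<in> S \<Longrightarrow> 0 \<le> w p b x \<and> w p b x \<le> D' * w' p b x"
    and "D \<ge> 0" "D' \<ge> 0"
  shows "Sy P S w' W' F"
  unfolding Sy_def
proof
  fix k
  have "Syk k P S w W F" using assms(1) by (simp add: Sy_def)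
  then show "Syk k P S w' W' F" 
    by (intro Syk_mono[where S = S and P = P and W = W and F = F and W' = W' and w' = w' and w = w and D = D and D' = D']) (assumption | rule assms)+
qed

lemma Sy_zero:
  assumes "\<And>p x. p \<in> P \<Longrightarrow> x \<in> S \<Longrightarrow> 0 \<le> W p x" "\<And>p b x. p \<in> P \<Longrightarrow> b \<in> Basis \<Longrightarrow> x \<in> S \<Longrightarrow> 0 \<le> w p b x"
  shows "Sy P S w W (\<lambda>p x. 0)"
  unfolding Sy_def by (intro allI Syk_zero[where W = W and w = w and P = P and S = S]) (assumption | rule assms)+

lemma Sy_const:
  assumes "\<And>p x. p \<in> P \<Longrightarrow> x \<in> S \<Longrightarrow> norm (c p) \<le> C * W p x" "C \<ge> 0"
    "\<And>p x. p \<in> P \<Longrightarrow> x \<in> S \<Longrightarrow> 0 \<le> W p x"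
    "\<And>p b x. p \<in> P \<Longrightarrow> b \<in> Basis \<Longrightarrow> x \<in> S \<Longrightarrow> 0 \<le> w p b x"
  shows "Sy P S w W (\<lambda>p x. c p)"
  unfolding Sy_def by (intro allI Syk_const[where W = W and w = w and P = P and S = S and c = c and C = C]) (assumption | rule assms)+

text \<open>A scalar independent of the parameter goes into the constant, whereas
  \<open>Sy_scale\<close> records the size of the scalar in the weight.\<close>

lemma Sy_cmult: 
  assumes "open S" "Sy P S w W F"
  shows "Sy P S w W (\<lambda>p x. c * F p x)"
proof -
  have "Syk k P S w W F \<Longrightarrow> Syk k P S w W (\<lambda>p x. c * F p x)" for k W F
  proof (induction k arbitrary: W F)
    case (Suc k)
    obtain C where C: "C \<ge> 0" "\<And>p x. p \<in> P \<Longrightarrow> x \<in> S \<Longrightarrow> norm (F p x) \<le> C * W p x" using Suc.prems by auto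
    then have "\<exists>C\<ge>0. \<forall>p\<in>P. \<forall>x\<in>S. norm (c * F p x) \<le> C * W p x"
      by (intro exI[of _ "norm c * C"]) (auto simp: norm_mult mult.assoc intro!: mult_left_mono)
    moreover have "Syk k P S w (\<lambda>p x. W p x * w p b x) (\<lambda>p. pd b (\<lambda>x. c * F p x))" if b: "b \<in> Basis" for b
      by (rule Syk_cong[OF assms(1) _ _ Suc.IH[of "\<lambda>p x. W p x * w p b x" "\<lambda>p. pd b (F p)"]])
         (use Suc.prems b in \<open>auto simp: pd_cmult\<close>)
    ultimately show ?case using Suc.prems by auto
  qed auto
  then show ?thesis using assms unfolding Sy_def by blast
qed

lemma Sy_diff: 
  assumes "open S" "Sy P S w W F" "Sy P S w W G"
  shows "Sy P S w W (\<lambda>p x. F p x - G p x)"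
  using Sy_add[OF assms(1,2) Sy_cmult[OF assms(1,3), of "-1"]] by simp

lemma Sy_sum:
  assumes "open S" "finite I" "\<And>i. i \<in> I \<Longrightarrow> Sy P S w W (F i)"
    "\<And>p x. p \<in> P \<Longrightarrow> x \<in> S \<Longrightarrow> 0 \<le> W p x" "\<And>p b x. p \<in> P \<Longrightarrow> b \<in> Basis \<Longrightarrow> x \<in> S \<Longrightarrow> 0 \<le> w p b x"
  shows "Sy P S w W (\<lambda>p x. \<Sum>i\<in>I. F i p x)"
  using assms(2,3)
proof (induction I rule: finite_induct)
  case empty
  then show ?case using Sy_zero[of P S W w] assms by simp
next
  case (insert i I)
  then show ?case using Sy_add[OF assms(1), of P w W "F i" "\<lambda>p x. \<Sum>i\<in>I. F i p x"] by simp
qed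

lemma Sy_exp:
  assumes "open S" 
    and "\<And>p x. p \<in> P \<Longrightarrow> x \<in> S \<Longrightarrow> f p differentiable (at x)"
    and "\<And>p x. p \<in> P \<Longrightarrow> x \<in> S \<Longrightarrow> Re (f p x) \<le> 0"
    and "\<And>b. b \<in> Basis \<Longrightarrow> Sy P S w (\<lambda>p x. w p b x) (\<lambda>p. pd b (f p))"
  shows "Sy P S w (\<lambda>p x. 1) (\<lambda>p x. exp (f p x))"
  unfolding Sy_def
proof
  fix k show "Syk k P S w (\<lambda>p x. 1) (\<lambda>p x. exp (f p x))"
    
    by (rule Syk_exp[where S = S and P = P and f = f and w = w])
       (use assms in \<open>auto simp: Sy_def\<close>)
qed

lemma Sy_pullback:
  fixes F :: "'p \<Rightarrow> 'c::euclidean_space \<Rightarrow> complex" and A :: "'q \<Rightarrow> 'a::euclidean_space \<Rightarrow> 'c"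
  assumes "Sy P S w W F" "open S'"
    and "\<And>q. q \<in> Q \<Longrightarrow> \<pi> q \<in> P" "\<And>q x. q \<in> Q \<Longrightarrow> x \<in> S' \<Longrightarrow> A q x \<in> S"
    and "\<And>q x. q \<in> Q \<Longrightarrow> A q differentiable (at x)"
    and "\<And>q x s b. q \<in> Q \<Longrightarrow> b \<in> Basis \<Longrightarrow> A q (x + s *\<^sub>R b) = A q x + (s * c q) *\<^sub>R \<tau> b"
    and "\<And>b. b \<in> Basis \<Longrightarrow> \<tau> b \<in> Basis"
  shows "Sy Q S' (\<lambda>q b x. \<bar>c q\<bar> * w (\<pi> q) (\<tau> b) (A q x)) (\<lambda>q x. W (\<pi> q) (A q x)) (\<lambda>q x. F (\<pi> q) (A q x))"
  unfolding Sy_def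
proof
  fix k
  have "Syk k P S w W F" using assms(1) by (simp add: Sy_def)
  then show "Syk k Q S' (\<lambda>q b x. \<bar>c q\<bar> * w (\<pi> q) (\<tau> b) (A q x)) (\<lambda>q x. W (\<pi> q) (A q x)) (\<lambda>q x. F (\<pi> q) (A q x))"
    
    by (intro Syk_pullback[where S = S and P = P and W = W and F = F and w = w and S' = S' and Q = Q and \<pi> = \<pi> and A = A and \<tau> = \<tau> and c = c])
       (assumption | rule assms)+
qed

lemma Sy_reindex:
  assumes "Sy P S w W F" "open S'" "S' \<subseteq> S" "\<And>q. q \<in> Q \<Longrightarrow> \<pi> q \<in> P"
  shows "Sy Q S' (\<lambda>q. w (\<pi> q)) (\<lambda>q. W (\<pi> q)) (\<lambda>q. F (\<pi> q))"
proof -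
  have "Sy Q S' (\<lambda>q b x. \<bar>1\<bar> * w (\<pi> q) b x) (\<lambda>q x. W (\<pi> q) x) (\<lambda>q x. F (\<pi> q) x)"
    
    by (rule Sy_pullback[where S = S and P = P and W = W and F = F and w = w and S' = S' and Q = Q and \<pi> = \<pi> and A = "\<lambda>q x. x" and \<tau> = "\<lambda>b. b" and c = "\<lambda>_. 1"])
       (use assms in auto)
  then show ?thesis by simp
qed

lemma Sy_ext_zero:
  assumes "open S" "Sy P S w W F"
    and "\<And>p x. p \<in> P \<Longrightarrow> x \<notin> S \<Longrightarrow> \<exists>U. open U \<and> x \<in> U \<and> (\<forall>y\<in>U. F p y = 0)"
    and "\<And>p x. p \<in> P \<Longrightarrow> x \<notin> S \<Longrightarrow> 0 \<le> W p x" "\<And>p b x. p \<in> P \<Longrightarrow> b \<in> Basis \<Longrightarrow> x \<notin> S \<Longrightarrow> 0 \<le> w p b x"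
  shows "Sy P UNIV w W F"
  unfolding Sy_def
proof
  fix k
  have "Syk k P S w W F" using assms(2) by (simp add: Sy_def)
  then show "Syk k P UNIV w W F" 
    by (intro Syk_ext_zero[where S = S and P = P and W = W and F = F and w = w]) (assumption | rule assms)+
qed

section \<open>Reordering of derivatives and translation from the operators of the statement\<close>

lemma PD_snoc_commute:
  fixes f :: "'a::euclidean_space \<Rightarrow> 'b::real_normed_vector"
  assumes S: "open S" and d: "\<And>L x. L \<in> lists Basis \<Longrightarrow> x \<in> S \<Longrightarrow> PD L f differentiable (at x)"
    and "L \<in> lists Basis" "b \<in> Basis" "x \<in> S"
  shows "PD (b # L) f x = PD (L @ [b]) f x"
  using assms(3-)
proof (induction L arbitrary: x rule: list.induct)
  case (Cons c L)
  have "PD (b # c # L) f x = pd c (pd b (PD L f)) x"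
    using pd_commute[OF S Cons.prems(3), of "PD L f" b c] d[of L] d[of "b # L"] d[of "c # L"] Cons.prems assms(4) by auto
  also have "\<dots> = pd c (PD (L @ [b]) f) x"
    by (rule pd_cong[OF S]) (use Cons assms(4) in auto)
  finally show ?case by simp
qed auto

text \<open>The hypotheses and conclusions speak of sorted derivatives \<open>dd G B\<close>, the
  calculus of arbitrary lists of directions; for a smooth function only the multiset of directions
  matters.\<close>

lemma PD_perm:
  fixes f :: "'a::euclidean_space \<Rightarrow> 'b::real_normed_vector"
  assumes S: "open S" and d: "\<And>L x. L \<in> lists Basis \<Longrightarrow> x \<in> S \<Longrightarrow> PD L f differentiable (at x)"
    and "L \<in> lists Basis" "mset L = mset L'" "x \<in> S"
  shows "PD L f x = PD L' f x"
  using assms(3-)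
proof (induction L arbitrary: L' x rule: list.induct)
  case (Cons b L)
  then obtain A B where AB: "L' = A @ b # B" using split_list[of b L'] by (metis list.set_intros(1) set_mset_mset)
  have s: "set L' = set (b # L)" using Cons.prems by (metis set_mset_mset)
  have l: "A \<in> lists Basis" "B \<in> lists Basis" "b \<in> Basis" proof -
    have "set L' \<subseteq> Basis" using s Cons.prems(1) by auto
    then show "A \<in> lists Basis" "B \<in> lists Basis" "b \<in> Basis" unfolding AB by auto
  qed
  have "PD L' f x = PD A (PD (b # B) f) x" by (simp add: AB PD_append)
  also have "\<dots> = PD A (PD (B @ [b]) f) x"
    by (rule PD_cong[OF S _ Cons.prems(3)]) (use PD_snoc_commute[OF S d] l in auto)
  also have "\<dots> = PD ((A @ B) @ [b]) f x" by (simp add: PD_append)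
  also have "\<dots> = PD (b # (A @ B)) f x" using PD_snoc_commute[OF S d, of "A @ B" b x] l Cons.prems by auto
  also have "\<dots> = pd b (PD L f) x"
    unfolding PD.simps by (rule pd_cong[OF S Cons.prems(3)], rule Cons.IH[symmetric]) (use Cons.prems AB in auto)
  finally show ?case by simp
qed auto

definition edir :: "('n::finite + 'n) \<Rightarrow> (real^'n) \<times> (real^'n)" where
  "edir d = (case d of Inl i \<Rightarrow> (axis i 1, 0) | Inr i \<Rightarrow> (0, axis i 1))"

lemma Dl_eq_PD: "Dl L F x \<xi> = PD (map edir L) (\<lambda>p. F (fst p) (snd p)) (x, \<xi>)"
proof (induction L arbitrary: x \<xi>)
  case (Cons d L)
  show ?case
    by (cases d) (simp_all add: pdir_def pd_def dline_def edir_def Cons.IH)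
qed auto

lemma Basis_vec_axis: "(Basis :: (real^'n) set) = range (\<lambda>i. axis i 1)"
  by (auto simp: Basis_vec_def)

lemma Basis_edir: "(Basis :: ((real^'n) \<times> (real^'n)) set) = range edir"
proof -
  have "range edir = edir ` (range Inl \<union> range Inr)" by (simp add: UNIV_sum)
  also have "\<dots> = (\<lambda>i::'n. (axis i 1, 0)) ` UNIV \<union> (\<lambda>i. (0, axis i 1)) ` UNIV"
    by (simp add: image_Un image_image edir_def)
  also have "\<dots> = Basis" unfolding Basis_prod_def Basis_vec_axis by (simp add: image_image)
  finally show ?thesis by simp
qed

lemma lists_Basis_edir: "L \<in> lists Basis \<longleftrightarrow> (\<exists>L'. L = map edir L')"
  unfolding Basis_edir by (auto simp: lists_image)

lemma dline_eq: "dline d F x \<xi> = (\<lambda>s. F (fst ((x,\<xi>) + s *\<^sub>R edir d)) (snd ((x,\<xi>) + s *\<^sub>R edir d)))"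
  by (cases d) (auto simp: dline_def edir_def)

text \<open>The partial derivatives of \<open>Dl L F\<close> are again of the form
  \<open>Dl (d # L) F\<close> and hence continuous, so the C^1 criterion applies to every iterated
  derivative.\<close>

lemma smooth_on_imp_PD_differentiable:
  assumes "open S" "smooth_on S F" "L \<in> lists Basis" "p \<in> S"
  shows "PD L (\<lambda>p. F (fst p) (snd p)) differentiable (at p)"
proof -
  define f where "f = (\<lambda>p. F (fst p) (snd p))"
  obtain L' where L': "L = map edir L'" using assms(3) lists_Basis_edir by blast
  have "(PD L f has_derivative (\<lambda>h. \<Sum>b\<in>Basis. (h \<bullet> b) *\<^sub>R PD (b # L) f p)) (at p)"
  proof (rule partials_continuous_imp_has_derivative[OF assms(1,4)])
    fix b :: "(real^'a) \<times> (real^'a)" assume "b \<in> Basis"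
    then obtain d where d: "b = edir d" unfolding Basis_edir by auto
    show "continuous_on S (PD (b # L) f)"
      using assms(2)[unfolded smooth_on_def, rule_format, of "d # L'"]
      by (simp only: Dl_eq_PD prod.collapse list.map d L' f_def)
    fix y assume y: "y \<in> S"
    have "dline d (Dl L' F) (fst y) (snd y) differentiable (at 0)"
      using assms(2) y unfolding smooth_on_def by blast
    then have "(\<lambda>s. PD L f (y + s *\<^sub>R b)) differentiable (at 0)"
      unfolding dline_eq Dl_eq_PD prod.collapse by (simp only: L' f_def d)
    then show "((\<lambda>s. PD L f (y + s *\<^sub>R b)) has_vector_derivative PD (b # L) f y) (at 0)"
      by (simp add: pd_def vector_derivative_works)
  qed
  then show ?thesis unfolding f_def differentiable_def by blast
qed

lemma PD_differentiable_imp_smooth_on: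
  assumes "\<And>L p. L \<in> lists Basis \<Longrightarrow> p \<in> S \<Longrightarrow> PD L (\<lambda>p. F (fst p) (snd p)) differentiable (at p)"
  shows "smooth_on S F"
  unfolding smooth_on_def
proof (intro allI conjI ballI)
  fix L :: "('a + 'a) list"
  have L: "map edir L \<in> lists Basis" using lists_Basis_edir by blast
  show "continuous_on S (\<lambda>p. Dl L F (fst p) (snd p))"
    unfolding Dl_eq_PD prod.collapse
    using assms[OF L] differentiable_imp_continuous_within continuous_at_imp_continuous_on by blast
  fix d p assume p: "p \<in> S"
  have "(\<lambda>s. PD (map edir L) (\<lambda>p. F (fst p) (snd p)) (p + s *\<^sub>R edir d)) differentiable (at 0)"
    using pd_line[of "PD (map edir L) (\<lambda>p. F (fst p) (snd p))" p 0 "edir d" UNIV] assms[OF L p]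
    by (auto simp: has_vector_derivative_def differentiable_def)
  then show "dline d (Dl L F) (fst p) (snd p) differentiable (at 0)"
    unfolding dline_eq Dl_eq_PD prod.collapse .
qed

text \<open>The phase is real valued, while the weight calculus is set up for complex
  functions.\<close>

lemma PD_of_real:
  fixes f :: "'a::euclidean_space \<Rightarrow> real"
  assumes S: "open S" and d: "\<And>L x. L \<in> lists Basis \<Longrightarrow> x \<in> S \<Longrightarrow> PD L f differentiable (at x)"
    and "L \<in> lists Basis" "x \<in> S"
  shows "PD L (\<lambda>x. complex_of_real (f x)) x = of_real (PD L f x) \<and> PD L (\<lambda>x. complex_of_real (f x)) differentiable (at x)"
  using assms(3,4)
proof (induction L arbitrary: x rule: list.induct)
  case Nil
  show ?case using d[of "[]" x] Nil
    by (auto simp: differentiable_def intro!: has_derivative_of_real)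
next
  case (Cons b L)
  have *: "PD (b # L) (\<lambda>x. complex_of_real (f x)) y = of_real (PD (b # L) f y)" if y: "y \<in> S" for y
  proof -
    have "PD (b # L) (\<lambda>x. complex_of_real (f x)) y = pd b (\<lambda>y. complex_of_real (PD L f y)) y"
      unfolding PD.simps by (rule pd_cong[OF S y]) (use Cons in auto)
    also have "\<dots> = of_real (PD (b # L) f y)"
    proof -
      obtain g where g: "(PD L f has_derivative g) (at y)" using d[of L y] y Cons.prems
        unfolding differentiable_def by auto
      show ?thesis using pd_has_derivative[OF has_derivative_of_real[OF g], of b] pd_has_derivative[OF g, of b] by simp
    qed
    finally show ?thesis .
  qed
  have "(\<lambda>y. complex_of_real (PD (b # L) f y)) differentiable (at x)"
    using d[of "b # L" x] Cons.prems unfolding differentiable_def by (auto intro: has_derivative_of_real)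
  then have "PD (b # L) (\<lambda>x. complex_of_real (f x)) differentiable (at x)"
    by (rule differentiable_cong_open[OF S Cons.prems(2), rotated]) (use * in simp)
  with * Cons.prems show ?case by blast
qed

section \<open>Schwartz functions and the Fourier transform\<close>

text \<open>The square of the bracket \<open>jbr\<close>, on any Euclidean space. Being a
  polynomial, it differentiates without square roots, and it is the Fourier multiplier of a
  differential operator.\<close>

definition J :: "'a::euclidean_space \<Rightarrow> real" where "J x = 1 + x \<bullet> x"

lemma J_ge1: "1 \<le> J x" by (simp add: J_def)
lemma J_pos: "0 < J x" using J_ge1[of x] by linarith
lemma J_nz [simp]: "J x \<noteq> 0" using J_pos[of x] by linarith
lemma J_minus [simp]: "J (- x) = J x" by (simp add: J_def)
lemma J_norm: "J x = 1 + (norm x)\<^sup>2" by (simp add: J_def power2_norm_eq_inner)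
lemma continuous_J [continuous_intros]: "continuous_on S f \<Longrightarrow> continuous_on S (\<lambda>x. J (f x))"
  unfolding J_def by (intro continuous_intros)
lemma measurable_J [measurable]: "J \<in> borel_measurable borel"
  unfolding J_def by measurable
lemma norm_le_J: "norm x \<le> J x"
  using zero_le_power2[of "norm x - 1/2"] by (simp add: J_norm power2_eq_square algebra_simps)
lemma J_power_ge1: "1 \<le> J x ^ k" by (simp add: J_ge1)
lemma J_inv_le1: "1 / J x ^ k \<le> 1"
  using J_power_ge1[of x k] by (simp add: divide_le_eq)
lemma J_power_mono: "k \<le> l \<Longrightarrow> J x ^ k \<le> J x ^ l" by (simp add: J_ge1 power_increasing)

text \<open>Peetre's inequality, from
  \<open>2 * (x \<bullet> y) \<le> x \<bullet> x + y \<bullet> y\<close>. It exchanges decay around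
  one point for decay around another.\<close>

lemma J_peetre: "J (x + y) \<le> 2 * (J x * J y)"
proof -
  have "2 * (x \<bullet> y) \<le> x \<bullet> x + y \<bullet> y"
    using inner_ge_zero[of "x - y"] by (simp add: inner_diff inner_commute)
  then have "J (x + y) \<le> 1 + 2 * (x \<bullet> x) + 2 * (y \<bullet> y)"
    by (simp add: J_def inner_add inner_commute)
  also have "\<dots> \<le> 2 * (J x * J y)"
    by (simp add: J_def algebra_simps)
  finally show ?thesis .
qed

lemma nn_integral_inverse_1_plus_square: "(\<integral>\<^sup>+x. ennreal (1 / (1 + x\<^sup>2)) \<partial>lborel) < \<infinity>"
proof -
  have half: "(\<integral>\<^sup>+x. ennreal (1 / (1 + x\<^sup>2)) * indicator {0..} x \<partial>lborel) = ennreal (pi/2 - arctan 0)"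
  proof (rule nn_integral_FTC_atLeast)
    show "DERIV arctan x :> 1 / (1 + x\<^sup>2)" for x
      using DERIV_arctan[of x] by (simp add: inverse_eq_divide)
    show "((\<lambda>x. arctan x) \<longlongrightarrow> pi/2) at_top" by (rule tendsto_arctan_at_top)
  qed auto
  have "(\<integral>\<^sup>+x. ennreal (1 / (1 + x\<^sup>2)) \<partial>lborel)
     \<le> (\<integral>\<^sup>+x. ennreal (1 / (1 + x\<^sup>2)) * indicator {0..} x + ennreal (1 / (1 + (-x)\<^sup>2)) * indicator {0..} (- x) \<partial>lborel)"
    by (intro nn_integral_mono) (auto simp: indicator_def)
  also have "\<dots> = (\<integral>\<^sup>+x. ennreal (1 / (1 + x\<^sup>2)) * indicator {0..} x \<partial>lborel) + (\<integral>\<^sup>+x. ennreal (1 / (1 + (-x)\<^sup>2)) * indicator {0..} (- x) \<partial>lborel)"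
    by (intro nn_integral_add) auto
  also have "(\<integral>\<^sup>+x. ennreal (1 / (1 + (-x)\<^sup>2)) * indicator {0..} (- x :: real) \<partial>lborel) = (\<integral>\<^sup>+x. ennreal (1 / (1 + x\<^sup>2)) * indicator {0..} x \<partial>distr lborel borel uminus)"
    by (subst nn_integral_distr) auto
  finally show ?thesis
    unfolding lborel_distr_uminus half by (simp add: ennreal_plus[symmetric] del: ennreal_plus)
      (metis ennreal_less_top ennreal_add_less_top infinity_ennreal_def le_less_trans)
qed

text \<open>Each of the \<open>DIM('a)\<close> factors \<open>1 + (x \<bullet> b)\<^sup>2\<close> is
  at most \<open>J x\<close>, so the function is dominated by a product of integrable functions of
  one variable.\<close>

lemma integrable_J: "integrable lborel (\<lambda>x::'a::euclidean_space. 1 / J x ^ DIM('a))"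
proof (rule integrableI_bounded)
  show "(\<lambda>x::'a. 1 / J x ^ DIM('a)) \<in> borel_measurable lborel" by measurable
  have "ennreal (norm (1 / J x ^ DIM('a))) \<le> (\<Prod>b\<in>Basis. ennreal (1 / (1 + (x \<bullet> b)\<^sup>2)))" for x :: 'a
  proof -
    have "(\<Prod>b\<in>Basis. 1 + (x \<bullet> b)\<^sup>2) \<le> (\<Prod>b\<in>(Basis::'a set). J x)"
    proof (rule prod_mono)
      fix b :: 'a assume "b \<in> Basis"
      then have "\<bar>x \<bullet> b\<bar> \<le> norm x" by (rule Basis_le_norm)
      then have "(x \<bullet> b)\<^sup>2 \<le> (norm x)\<^sup>2" by (rule abs_le_square_iff[THEN iffD1, of "x \<bullet> b" "norm x", simplified])
      then show "0 \<le> 1 + (x \<bullet> b)\<^sup>2 \<and> 1 + (x \<bullet> b)\<^sup>2 \<le> J x" by (simp add: J_norm)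
    qed
    moreover have "0 < (\<Prod>b\<in>Basis. 1 + (x \<bullet> b)\<^sup>2)" by (intro prod_pos) (auto intro: add_pos_nonneg)
    ultimately have "1 / J x ^ DIM('a) \<le> (\<Prod>b\<in>Basis. 1 / (1 + (x \<bullet> b)\<^sup>2))"
      by (simp add: prod_dividef frac_le)
    then show ?thesis using J_pos[of x] by (simp add: prod_ennreal ennreal_leI)
  qed
  then have "(\<integral>\<^sup>+x. ennreal (norm (1 / J x ^ DIM('a))) \<partial>(lborel :: 'a measure)) \<le> (\<integral>\<^sup>+x. (\<Prod>b\<in>(Basis::'a set). ennreal (1 / (1 + (x \<bullet> b)\<^sup>2))) \<partial>lborel)"
    by (intro nn_integral_mono) auto
  also have "\<dots> = (\<Prod>b\<in>(Basis::'a set). \<integral>\<^sup>+x. ennreal (1 / (1 + x\<^sup>2)) \<partial>lborel)"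
    by (rule nn_integral_lborel_prod) auto
  also have "\<dots> < \<infinity>" using nn_integral_inverse_1_plus_square
    by (simp add: power_less_top_ennreal)
  finally show "(\<integral>\<^sup>+x. ennreal (norm (1 / J x ^ DIM('a))) \<partial>(lborel :: 'a measure)) < \<infinity>" .
qed

lemma gaussian_integral: 
  "has_bochner_integral lborel (\<lambda>x::'a::euclidean_space. exp (- (x \<bullet> x))) (sqrt pi ^ DIM('a))"
proof (rule has_bochner_integral_nn_integral)
  have 1: "has_bochner_integral lborel (\<lambda>x::real. exp (- x\<^sup>2)) (2 * (sqrt pi / 2))"
    using has_bochner_integral_even_function[OF gaussian_moment_0] by simp
  have 2: "(\<integral>\<^sup>+x. ennreal (exp (- x\<^sup>2)) \<partial>lborel) = ennreal (sqrt pi)"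
    using nn_integral_eq_integral[OF integrable.intros[OF 1]] has_bochner_integral_integral_eq[OF 1] by simp
  have "(\<integral>\<^sup>+x. ennreal (exp (- (x \<bullet> x))) \<partial>(lborel :: 'a measure)) = (\<integral>\<^sup>+x. (\<Prod>b\<in>(Basis::'a set). ennreal (exp (- (x \<bullet> b)\<^sup>2))) \<partial>lborel)"
  proof (rule nn_integral_cong)
    fix x :: 'a
    have "x \<bullet> x = (\<Sum>b\<in>Basis. (x \<bullet> b)\<^sup>2)" by (subst euclidean_inner) (simp add: power2_eq_square)
    then have "- (x \<bullet> x) = (\<Sum>b\<in>Basis. - (x \<bullet> b)\<^sup>2)" by (simp add: sum_negf)
    then show "ennreal (exp (- (x \<bullet> x))) = (\<Prod>b\<in>(Basis::'a set). ennreal (exp (- (x \<bullet> b)\<^sup>2)))"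
      by (simp only: prod_ennreal exp_sum finite_Basis exp_ge_zero)
  qed
  also have "\<dots> = (\<Prod>b\<in>(Basis::'a set). \<integral>\<^sup>+x. ennreal (exp (- x\<^sup>2)) \<partial>lborel)"
    by (rule nn_integral_lborel_prod) auto
  also have "\<dots> = ennreal (sqrt pi ^ DIM('a))" by (simp add: 2 ennreal_power)
  finally show "(\<integral>\<^sup>+x. ennreal (exp (- (x \<bullet> x))) \<partial>(lborel :: 'a measure)) = ennreal (sqrt pi ^ DIM('a))" .
qed auto

lemma integral_lborel_shift:
  fixes f :: "'a::euclidean_space \<Rightarrow> 'b::{banach, second_countable_topology}"
  shows "(LINT x|lborel. f (a + x)) = (LINT x|lborel. f x)" 
    and "f \<in> borel_measurable borel \<Longrightarrow> integrable lborel (\<lambda>x. f (a + x)) \<longleftrightarrow> integrable lborel f"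
proof -
  show 2: "integrable lborel (\<lambda>x. f (a + x)) \<longleftrightarrow> integrable lborel f" if "f \<in> borel_measurable borel"
    using integrable_distr_eq[of "(+) a" lborel borel f] that by (simp add: lborel_distr_plus)
  show "(LINT x|lborel. f (a + x)) = (LINT x|lborel. f x)"
  proof (cases "f \<in> borel_measurable borel")
    case True
    then show ?thesis using integral_distr[of "(+) a" lborel borel f] by (simp add: lborel_distr_plus)
  next
    \<comment> \<open>Without measurability neither function is integrable, and both integrals take
      the default value 0.\<close>
    case False
    have "(\<lambda>x. f (a + x)) \<notin> borel_measurable borel"
    proof
      assume "(\<lambda>x. f (a + x)) \<in> borel_measurable borel"
      then have "(\<lambda>x. f (a + (- a + x))) \<in> borel_measurable borel" by measurable
      with False show False by simp
    qed
    then have "\<not> integrable lborel (\<lambda>x. f (a + x))" "\<not> integrable lborel f"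
      using False borel_measurable_integrable[of lborel f] borel_measurable_integrable[of lborel "\<lambda>x. f (a + x)"]
      by auto
    then show ?thesis by (simp add: not_integrable_integral_eq)
  qed
qed

text \<open>\<open>pd b f\<close> is integrated over the segments from \<open>x\<close> to
  \<open>b + x\<close> and over all \<open>x\<close>. In one order this returns the integral in
  question; in the other it is the integral of \<open>f (b + x) - f x\<close>, which is 0 by
  translation invariance.\<close>

lemma integral_pd_zero:
  fixes f :: "'a::euclidean_space \<Rightarrow> complex"
  assumes d: "\<And>x. f differentiable (at x)" and c: "continuous_on UNIV (pd b f)"
    and i: "integrable lborel f" and i': "integrable lborel (pd b f)"
  shows "(LINT x|lborel. pd b f x) = 0"
proof -
  let ?g = "\<lambda>s::real. \<lambda>x. indicator {0..1} s *\<^sub>R pd b f (s *\<^sub>R b + x)"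
  have [measurable]: "pd b f \<in> borel_measurable borel" using c by (rule borel_measurable_continuous_onI)
  have [measurable]: "f \<in> borel_measurable borel" using i by auto
  have sh: "integrable lborel (\<lambda>x. pd b f (a + x))" for a
    using i' by (simp add: integral_lborel_shift(2))
  have "integrable (lborel \<Otimes>\<^sub>M lborel) (case_prod ?g)"
  proof (rule lborel_pair.Fubini_integrable)
    have "(\<lambda>s. LINT x|lborel. norm (?g s x)) = (\<lambda>s. indicator {0..1} s * (LINT x|lborel. norm (pd b f x)))"
      using integral_lborel_shift(1)[of "\<lambda>x. norm (pd b f x)" "_ *\<^sub>R b"] by (auto simp: fun_eq_iff)
    then show "integrable lborel (\<lambda>s. LINT x|lborel. norm (case (s, x) of (s, x) \<Rightarrow> ?g s x))"
      unfolding prod.case by (simp only:) simp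
    show "AE s in lborel. integrable lborel (\<lambda>x. case (s, x) of (s, x) \<Rightarrow> ?g s x)"
      using sh by (intro always_eventually) simp
  qed measurable
  then have "(LINT x|lborel. LINT s|lborel. ?g s x) = (LINT s|lborel. LINT x|lborel. ?g s x)"
    by (rule lborel_pair.Fubini_integral)
  also have "\<dots> = (LINT s|(lborel :: real measure). indicator {0..1} s *\<^sub>R (LINT x|lborel. pd b f x))"
    by (simp only: integral_scaleR_right integral_lborel_shift(1)[of "pd b f"])
  also have "\<dots> = (LINT s|(lborel :: real measure). indicator {0..1} s) *\<^sub>R (LINT x|lborel. pd b f x)"
    by (rule integral_scaleR_left) simp
  also have "\<dots> = (LINT x|lborel. pd b f x)" by simp
  also have "(LINT x|lborel. LINT s|lborel. ?g s x) = (LINT x|lborel. f (b + x) - f x)"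
  proof (rule Bochner_Integration.integral_cong)
    fix x
    have "(LINT s|lborel. indicator {0..1} s *\<^sub>R pd b f (x + s *\<^sub>R b)) = f (x + 1 *\<^sub>R b) - f (x + 0 *\<^sub>R b)"
      by (rule integral_FTC_atLeastAtMost[where F = "\<lambda>s. f (x + s *\<^sub>R b)"])
         (auto intro!: pd_line d continuous_on_compose2[OF c] continuous_intros)
    then show "(LINT s|lborel. ?g s x) = f (b + x) - f x" by (simp add: add.commute)
  qed simp
  also have "\<dots> = 0"
    using integral_lborel_shift[of f b] i by simp
  finally show ?thesis by simp
qed

section \<open>Schwartz functions and functions of polynomial growth\<close>

lemma Sy_rec:
  assumes "\<And>p x. p \<in> P \<Longrightarrow> x \<in> S \<Longrightarrow> F p differentiable (at x)"
    "\<exists>C\<ge>0. \<forall>p\<in>P. \<forall>x\<in>S. norm (F p x) \<le> C * W p x"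
    "\<And>b. b \<in> Basis \<Longrightarrow> Sy P S w (\<lambda>p x. W p x * w p b x) (\<lambda>p. pd b (F p))"
  shows "Sy P S w W F"
  unfolding Sy_def
proof
  fix k show "Syk k P S w W F" using assms by (cases k) (auto simp: Sy_def)
qed

lemma pd_inner: "(\<lambda>x. complex_of_real (x \<bullet> v)) differentiable (at x)" "pd b (\<lambda>x. complex_of_real (x \<bullet> v)) x = of_real (b \<bullet> v)"
proof -
  have *: "((\<lambda>x. complex_of_real (x \<bullet> v)) has_derivative (\<lambda>x. complex_of_real (x \<bullet> v))) (at x)"
    by (intro has_derivative_of_real has_derivative_inner_left has_derivative_ident)
  then show "(\<lambda>x. complex_of_real (x \<bullet> v)) differentiable (at x)" by (rule differentiableI)
  show "pd b (\<lambda>x. complex_of_real (x \<bullet> v)) x = of_real (b \<bullet> v)" using pd_has_derivative[OF *] .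
qed

lemma Sy_coord:
  assumes "v \<in> Basis" 
  shows "Sy P UNIV (\<lambda>_ _ _. 1) (\<lambda>_ x. J x) (\<lambda>_ x. complex_of_real (x \<bullet> v))"
proof (rule Sy_rec)
  show "\<exists>C\<ge>0. \<forall>p\<in>P. \<forall>x\<in>UNIV. norm (complex_of_real (x \<bullet> v)) \<le> C * J x"
    using Basis_le_norm[OF assms] norm_le_J by (intro exI[of _ 1]) (auto intro: order_trans)
  fix b :: 'a assume b: "b \<in> Basis"
  show "Sy P UNIV (\<lambda>_ _ _. 1) (\<lambda>p x. J x * 1) (\<lambda>p. pd b (\<lambda>x. complex_of_real (x \<bullet> v)))"
    unfolding pd_inner(2)[abs_def]
    by (rule Sy_const[where C = 1]) (use J_ge1 J_pos assms b in \<open>auto simp: inner_Basis intro: less_imp_le\<close>)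
qed (rule pd_inner)

lemma pd_J: "(\<lambda>x. complex_of_real (J x)) differentiable (at x)" "pd b (\<lambda>x. complex_of_real (J x)) x = 2 * of_real (x \<bullet> b)"
proof -
  have *: "((\<lambda>x. complex_of_real (J x)) has_derivative (\<lambda>h. complex_of_real (2 * (x \<bullet> h)))) (at x)"
    unfolding J_def by (auto intro!: derivative_eq_intros simp: inner_commute)
  then show "(\<lambda>x. complex_of_real (J x)) differentiable (at x)" by (rule differentiableI)
  show "pd b (\<lambda>x. complex_of_real (J x)) x = 2 * of_real (x \<bullet> b)" using pd_has_derivative[OF *] by simp
qed

lemma Sy_one: "Sy P UNIV (\<lambda>_ _ _. 1) (\<lambda>_ x. 1) (\<lambda>_ x. 1)"
  by (rule Sy_const[where C = 1]) auto

lemma pd_J_inverse: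
  "(\<lambda>x. 1 / complex_of_real (J x) ^ k) differentiable (at x)"
  "pd b (\<lambda>x. 1 / complex_of_real (J x) ^ k) x = - (2 * of_nat k) * (of_real (x \<bullet> b) * (1 / complex_of_real (J x) ^ Suc k))"
proof -
  obtain f' where f': "((\<lambda>x. complex_of_real (J x)) has_derivative f') (at x)" using pd_J(1) unfolding differentiable_def by blast
  have fb: "f' b = 2 * of_real (x \<bullet> b)" using pd_has_derivative[OF f', of b] pd_J(2)[of b x] by simp
  have nz: "complex_of_real (J x) \<noteq> 0" by simp
  have "((\<lambda>z::complex. 1 / z ^ k) has_field_derivative - of_nat k / z ^ Suc k) (at z)" if "z \<noteq> 0" for z
  proof (cases k)
    case (Suc m)
    show ?thesis unfolding Suc
      using that by (cases m) (auto intro!: derivative_eq_intros simp: field_simps, metis Suc_pred not_gr_zero power_Suc)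
  qed auto
  from has_derivative_compose[OF f' this[OF nz, unfolded has_field_derivative_def]]
  have *: "((\<lambda>x. 1 / complex_of_real (J x) ^ k) has_derivative (\<lambda>h. - of_nat k / complex_of_real (J x) ^ Suc k * f' h)) (at x)"
    by simp
  then show "(\<lambda>x. 1 / complex_of_real (J x) ^ k) differentiable (at x)" by (rule differentiableI)
  show "pd b (\<lambda>x. 1 / complex_of_real (J x) ^ k) x = - (2 * of_nat k) * (of_real (x \<bullet> b) * (1 / complex_of_real (J x) ^ Suc k))"
    using pd_has_derivative[OF *, of b] by (simp add: fb)
qed

text \<open>A derivative produces a coordinate times \<open>1 / J x ^ Suc k\<close>, and the
  coordinate is at most \<open>J x\<close>; so the decay is kept although derivatives have constant
  weight.\<close>

lemma Sy_J_inverse: "Sy P UNIV (\<lambda>_ _ _. 1) (\<lambda>_ (x::'a::euclidean_space). 1 / J x ^ k) (\<lambda>_ x. 1 / complex_of_real (J x) ^ k)"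
proof -
  have "Syk l P UNIV (\<lambda>_ _ _. 1) (\<lambda>_ (x::'a). 1 / J x ^ k) (\<lambda>_ x. 1 / complex_of_real (J x) ^ k)" for l
  proof (induction l arbitrary: k)
    case (Suc l)
    have "Syk l P UNIV (\<lambda>_ _ _. 1) (\<lambda>p x. 1 / J x ^ k * 1) (\<lambda>p. pd b (\<lambda>x. 1 / complex_of_real (J x) ^ k))" if b: "b \<in> Basis" for b :: 'a
    proof -
      have "Syk l P UNIV (\<lambda>_ _ _. 1) (\<lambda>p x. J x) (\<lambda>p x. - (2 * of_nat k) * complex_of_real (x \<bullet> b))"
        using Sy_cmult[OF open_UNIV Sy_coord[OF b], of P "- (2 * of_nat k)"] unfolding Sy_def by blast
      from Syk_mult[OF open_UNIV this Suc[of "Suc k"]] show ?thesis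
        by (rule Syk_cong[OF open_UNIV, rotated 2]) (auto simp: pd_J_inverse)
    qed
    moreover have "norm (1 / complex_of_real (J x) ^ k) \<le> 1 * (1 / J x ^ k)" for x
      using J_pos[of x] by (simp add: norm_divide norm_power)
    ultimately show ?case using pd_J_inverse(1) by (auto intro!: exI[of _ "1::real"])
  qed auto
  then show ?thesis by (simp add: Sy_def)
qed

text \<open>Schwartz space. The one-point parameter set expresses that no uniformity over a family
  is asked for.\<close>

definition Sch :: "('a::euclidean_space \<Rightarrow> complex) \<Rightarrow> bool" where
  "Sch f \<longleftrightarrow> (\<forall>K. Sy {()} UNIV (\<lambda>_ _ _. 1) (\<lambda>_ x. 1 / J x ^ K) (\<lambda>_. f))"

text \<open>All derivatives obey the same polynomial bound, with no gain from differentiation: these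
  are multipliers of the Schwartz space.\<close>

abbreviation tempered :: "nat \<Rightarrow> ('a::euclidean_space \<Rightarrow> complex) \<Rightarrow> bool" where
  "tempered q f \<equiv> Sy {()} UNIV (\<lambda>_ _ _. 1) (\<lambda>_ x. J x ^ q) (\<lambda>_. f)"

lemma Sch_D: "Sch f \<Longrightarrow> Sy {()} UNIV (\<lambda>_ _ _. 1) (\<lambda>_ x. 1 / J x ^ K) (\<lambda>_. f)"
  by (simp add: Sch_def)

lemma differentiable_imp_measurable:
  fixes f :: "'a::euclidean_space \<Rightarrow> complex"
  assumes "\<And>x. f differentiable (at x)"
  shows "continuous_on UNIV f" "f \<in> borel_measurable borel"
proof -
  show "continuous_on UNIV f"
    using assms by (simp add: continuous_at_imp_continuous_on differentiable_imp_continuous_within)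
  then show "f \<in> borel_measurable borel" by (rule borel_measurable_continuous_onI)
qed

lemma integrable_J_bound:
  fixes f :: "'a::euclidean_space \<Rightarrow> complex"
  assumes "f \<in> borel_measurable borel" "\<And>x. norm (f x) \<le> C / J x ^ DIM('a)"
  shows "integrable lborel f"
proof (rule Bochner_Integration.integrable_bound)
  show "integrable lborel (\<lambda>x::'a. C * (1 / J x ^ DIM('a)))" using integrable_J by (intro integrable_mult_right) auto
  show "AE x in lborel. norm (f x) \<le> norm (C * (1 / J x ^ DIM('a)))"
  proof (intro always_eventually allI)
    fix x show "norm (f x) \<le> norm (C * (1 / J x ^ DIM('a)))"
      by (rule order_trans[OF assms(2)]) (simp only: times_divide_eq_right mult_1_right real_norm_def abs_ge_self)
  qed
qed (use assms in simp)

lemma integrable_Sch: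
  fixes f :: "'a::euclidean_space \<Rightarrow> complex"
  assumes "Sch f" shows "integrable lborel f" "continuous_on UNIV f" "f \<in> borel_measurable borel" "f differentiable (at x)"
proof -
  have d: "f differentiable (at x)" for x using Sy_diff0[OF Sch_D[OF assms]] by auto
  from d show "f differentiable (at x)" .
  from d show "continuous_on UNIV f" and m: "f \<in> borel_measurable borel" by (auto intro: differentiable_imp_measurable)
  obtain C where "\<And>x. norm (f x) \<le> C * (1 / J x ^ DIM('a))"
    using Sy_bound0[OF Sch_D[OF assms, of "DIM('a)"]] by auto
  then show "integrable lborel f" by (intro integrable_J_bound[OF m]) auto
qed

lemma Sch_pd: "Sch f \<Longrightarrow> b \<in> Basis \<Longrightarrow> Sch (pd b f)"
  unfolding Sch_def
proof
  fix K assume *: "\<forall>K. Sy {()} UNIV (\<lambda>_ _ _. 1) (\<lambda>_ x. 1 / J x ^ K) (\<lambda>_. f)" and b: "b \<in> Basis"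
  from Sy_pd[OF *[rule_format, of K] b] show "Sy {()} UNIV (\<lambda>_ _ _. 1) (\<lambda>_ x. 1 / J x ^ K) (\<lambda>_. pd b f)" by simp
qed

lemma Sch_diff: "Sch f \<Longrightarrow> Sch g \<Longrightarrow> Sch (\<lambda>x. f x - g x)"
  unfolding Sch_def by (intro allI Sy_diff) auto

lemma Sch_sum:
  assumes "finite I" "\<And>i. i \<in> I \<Longrightarrow> Sch (f i)" shows "Sch (\<lambda>x. \<Sum>i\<in>I. f i x)"
  unfolding Sch_def
proof
  fix K
  show "Sy {()} UNIV (\<lambda>_ _ _. 1) (\<lambda>_ x. 1 / J x ^ K) (\<lambda>_ x. \<Sum>i\<in>I. f i x)"
    by (rule Sy_sum[OF open_UNIV assms(1)]) (use assms(2) in \<open>auto simp: Sch_def less_imp_le[OF J_pos]\<close>)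
qed

lemma Sch_mult:
  assumes "Sch f" "tempered q g"
  shows "Sch (\<lambda>x. f x * g x)" "Sch (\<lambda>x. g x * f x)"
proof -
  have "Sy {()} UNIV (\<lambda>_ _ _. 1) (\<lambda>_ x. 1 / J x ^ K) (\<lambda>_ x. f x * g x)" for K
    by (rule Sy_cong'[OF Sy_mult[OF open_UNIV Sch_D[OF assms(1), of "K + q"] assms(2)]])
       (auto simp: power_add)
  then show "Sch (\<lambda>x. f x * g x)" by (simp add: Sch_def)
  then show "Sch (\<lambda>x. g x * f x)" by (simp add: mult.commute)
qed

text \<open>The operator 1 minus the Laplacian, whose Fourier multiplier is \<open>J\<close>; its
  powers trade smoothness for decay.\<close>

definition lap :: "('a::euclidean_space \<Rightarrow> complex) \<Rightarrow> 'a \<Rightarrow> complex" where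
  "lap f x = f x - (\<Sum>b\<in>Basis. pd b (pd b f) x)"

lemma Sch_lap: "Sch f \<Longrightarrow> Sch (lap f)"
  unfolding lap_def by (intro Sch_diff Sch_sum Sch_pd) auto

lemma Sch_lap_power: "Sch f \<Longrightarrow> Sch ((lap ^^ k) f)"
  by (induction k) (auto intro: Sch_lap)

lemma Sch_PD: "Sch f \<Longrightarrow> L \<in> lists Basis \<Longrightarrow> Sch (PD L f)"
  by (induction L rule: list.induct) (auto intro: Sch_pd)

lemma pd_cis: 
  "(\<lambda>x. cis (x \<bullet> v)) differentiable (at x)" "pd b (\<lambda>x. cis (x \<bullet> v)) x = \<i> * of_real (b \<bullet> v) * cis (x \<bullet> v)"
proof -
  have d: "(\<lambda>x. \<i> * complex_of_real (x \<bullet> v)) differentiable (at x)" by (intro derivative_intros pd_inner) 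
  show "(\<lambda>x. cis (x \<bullet> v)) differentiable (at x)" "pd b (\<lambda>x. cis (x \<bullet> v)) x = \<i> * of_real (b \<bullet> v) * cis (x \<bullet> v)"
    using pd_exp(1)[OF d] pd_exp(2)[OF d, of b] by (simp_all add: cis_conv_exp pd_cmult pd_inner)
qed

lemma tempered_cis: "tempered 0 (\<lambda>x. cis (x \<bullet> v))"
proof -
  have "Sy {()} UNIV (\<lambda>_ _ _. norm v) (\<lambda>_ x. 1) (\<lambda>_ x. exp (\<i> * complex_of_real (x \<bullet> v)))"
  proof (rule Sy_exp)
    fix b :: 'a assume b: "b \<in> Basis"
    have "pd b (\<lambda>x. \<i> * complex_of_real (x \<bullet> v)) = (\<lambda>x. \<i> * of_real (b \<bullet> v))"
      by (auto simp: pd_cmult pd_inner)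
    then show "Sy {()} UNIV (\<lambda>_ _ _. norm v) (\<lambda>_ x. norm v) (\<lambda>_. pd b (\<lambda>x. \<i> * complex_of_real (x \<bullet> v)))"
      using Basis_le_norm[OF b, of v]
      by (auto intro!: Sy_const[where C = 1] simp: norm_mult inner_commute)
  qed (auto intro!: derivative_intros pd_inner)
  from Sy_mono[OF this open_UNIV, of 1 "\<lambda>_ _. 1" "norm v" "\<lambda>_ _ _. 1"] show ?thesis
    by (simp add: cis_conv_exp)
qed

lemma pd_cis_neg:
  "(\<lambda>x. cis (- (x \<bullet> v))) differentiable (at x)" "pd b (\<lambda>x. cis (- (x \<bullet> v))) x = - (\<i> * of_real (b \<bullet> v) * cis (- (x \<bullet> v)))"
  using pd_cis(1)[of "- v" x] pd_cis(2)[of b "- v" x] by simp_all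

lemma tempered_cis_neg: "tempered 0 (\<lambda>x. cis (- (x \<bullet> v)))"
  using tempered_cis[of "- v"] by simp

section \<open>Fourier transform and integration by parts\<close>

definition FT :: "('a::euclidean_space \<Rightarrow> complex) \<Rightarrow> 'a \<Rightarrow> complex" where
  "FT f v = (LINT y|lborel. f y * cis (- (y \<bullet> v)))"

lemma measurable_cis [measurable]: "cis \<in> borel_measurable borel"
  by (intro borel_measurable_continuous_onI continuous_intros)

lemma integrable_cis:
  assumes "integrable lborel f"
  shows "integrable lborel (\<lambda>y. f y * cis (- (y \<bullet> v)))"
  by (rule Bochner_Integration.integrable_bound[OF assms]) (use assms in \<open>auto simp: norm_mult\<close>)

lemma FT_bound: "integrable lborel f \<Longrightarrow> norm (FT f v) \<le> (LINT y|lborel. norm (f y))"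
  unfolding FT_def by (rule order_trans[OF integral_norm_bound]) (simp add: norm_mult)

lemma FT_measurable: 
  assumes [measurable]: "f \<in> borel_measurable borel" shows "FT f \<in> borel_measurable borel"
  unfolding FT_def by measurable

lemma FT_diff:
  assumes "integrable lborel f" "integrable lborel g"
  shows "FT (\<lambda>x. f x - g x) v = FT f v - FT g v"
  unfolding FT_def left_diff_distrib
  by (rule Bochner_Integration.integral_diff; rule integrable_cis; fact)

lemma FT_sum:
  assumes "\<And>i. i \<in> I \<Longrightarrow> integrable lborel (f i)"
  shows "FT (\<lambda>x. \<Sum>i\<in>I. f i x) v = (\<Sum>i\<in>I. FT (f i) v)"
  unfolding FT_def sum_distrib_right
  by (rule Bochner_Integration.integral_sum) (use assms integrable_cis in blast)

lemma FT_cmult: "FT (\<lambda>x. c * f x) v = c * FT f v"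
  unfolding FT_def mult.assoc by simp

lemma FT_pd:
  assumes f: "Sch f" and b: "b \<in> Basis"
  shows "FT (pd b f) v = \<i> * of_real (v \<bullet> b) * FT f v"
proof -
  have S: "Sch (\<lambda>y. f y * cis (- (y \<bullet> v)))" by (rule Sch_mult(1)[OF f tempered_cis_neg])
  have p: "pd b (\<lambda>y. f y * cis (- (y \<bullet> v))) y = pd b f y * cis (- (y \<bullet> v)) - \<i> * of_real (v \<bullet> b) * (f y * cis (- (y \<bullet> v)))" for y
    by (subst pd_mult) (auto simp: pd_cis_neg integrable_Sch[OF f] inner_commute)
  have "0 = (LINT y|lborel. pd b (\<lambda>y. f y * cis (- (y \<bullet> v))) y)"
    by (rule integral_pd_zero[symmetric]) (use S Sch_pd[OF S b] integrable_Sch in auto)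
  also have "\<dots> = FT (pd b f) v - \<i> * of_real (v \<bullet> b) * FT f v"
  proof -
    have "(LINT y|lborel. pd b (\<lambda>y. f y * cis (- (y \<bullet> v))) y)
      = (LINT y|lborel. pd b f y * cis (- (y \<bullet> v))) - (LINT y|lborel. \<i> * of_real (v \<bullet> b) * (f y * cis (- (y \<bullet> v))))"
      unfolding p
      by (rule Bochner_Integration.integral_diff)
         (rule integrable_cis integrable_mult_right integrable_Sch f Sch_pd b)+
    then show ?thesis by (simp add: FT_def)
  qed
  finally show ?thesis by simp
qed

lemma FT_PD:
  assumes f: "Sch f" and L: "L \<in> lists Basis"
  shows "FT (PD L f) v = (\<Prod>b\<leftarrow>L. \<i> * of_real (v \<bullet> b)) * FT f v"
  using L
proof (induction L rule: list.induct)
  case (Cons b L)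
  then show ?case using FT_pd[OF Sch_PD[OF f, of L], of b v] by simp
qed simp

lemma FT_lap:
  assumes f: "Sch f" shows "FT (lap f) v = of_real (J v) * FT f v"
proof -
  have i: "integrable lborel (pd b (pd b f))" if "b \<in> Basis" for b
    using that f by (intro integrable_Sch Sch_pd)
  have "FT (lap f) v = FT (\<lambda>x. f x - (\<Sum>b\<in>Basis. pd b (pd b f) x)) v" by (simp add: lap_def[abs_def])
  also have "\<dots> = FT f v - FT (\<lambda>x. \<Sum>b\<in>Basis. pd b (pd b f) x) v"
    by (rule FT_diff[OF integrable_Sch(1)[OF f]]) (rule Bochner_Integration.integrable_sum, rule i)
  also have "\<dots> = FT f v - (\<Sum>b\<in>Basis. FT (pd b (pd b f)) v)"
    using i by (subst FT_sum) auto
  also have "\<dots> = FT f v - (\<Sum>b\<in>Basis. - of_real ((v \<bullet> b) * (v \<bullet> b)) * FT f v)"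
    using f by (simp add: FT_pd Sch_pd algebra_simps power2_eq_square)
  also have "\<dots> = of_real (J v) * FT f v"
    unfolding J_def euclidean_inner[of v v] by (simp add: sum_distrib_right sum_distrib_left algebra_simps sum_negf)
  finally show ?thesis .
qed

lemma FT_lap_power: "Sch f \<Longrightarrow> FT ((lap ^^ k) f) v = of_real (J v) ^ k * FT f v"
  by (induction k) (auto simp: FT_lap Sch_lap_power)

lemma FT_decay:
  assumes f: "Sch f" shows "norm (FT f v) \<le> (LINT y|lborel. norm ((lap ^^ j) f y)) / J v ^ j"
proof -
  have "norm (FT f v) * J v ^ j = norm (FT ((lap ^^ j) f) v)"
    using J_pos[of v] by (simp add: FT_lap_power[OF f] norm_mult norm_power)
  also have "\<dots> \<le> (LINT y|lborel. norm ((lap ^^ j) f y))"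
    by (intro FT_bound integrable_Sch Sch_lap_power f)
  finally show ?thesis using J_pos[of v] by (simp add: pos_le_divide_eq)
qed

lemma FT_multiplication:
  assumes f: "integrable lborel f" and g: "integrable lborel g"
  shows "(LINT x|lborel. f x * FT g x) = (LINT x|lborel. FT f x * g x)"
proof -
  let ?h = "\<lambda>x y. f x * g y * cis (- (x \<bullet> y))"
  have [measurable]: "f \<in> borel_measurable borel" "g \<in> borel_measurable borel" using f g by auto
  have "integrable (lborel \<Otimes>\<^sub>M lborel) (case_prod ?h)"
  proof (rule lborel_pair.Fubini_integrable)
    show "integrable lborel (\<lambda>x. LINT y|lborel. norm (case (x, y) of (x, y) \<Rightarrow> ?h x y))"
      using f g by (simp add: norm_mult)
    show "AE x in lborel. integrable lborel (\<lambda>y. case (x, y) of (x, y) \<Rightarrow> ?h x y)"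
      using integrable_cis[OF g] by (intro always_eventually) (simp add: mult.assoc inner_commute)
  qed measurable
  from lborel_pair.Fubini_integral[OF this] show ?thesis
    unfolding FT_def by (simp add: mult.assoc mult.left_commute inner_commute mult.commute flip: integral_mult_right_zero integral_mult_left_zero)
qed

lemma FT_shift: "FT (\<lambda>v. f v * cis (v \<bullet> a)) w = FT f (w - a)"
  unfolding FT_def by (rule Bochner_Integration.integral_cong) (auto simp: mult.assoc cis_mult inner_diff_right)

lemma Sch_div_J: "Sch f \<Longrightarrow> Sch (\<lambda>v. f v / of_real (J v) ^ k)"
proof -
  assume f: "Sch f"
  have "tempered 0 (\<lambda>x. 1 / complex_of_real (J x) ^ k)"
    by (rule Sy_mono[OF Sy_J_inverse open_UNIV, where D = 1 and D' = 1])
       (auto simp: less_imp_le[OF J_pos] J_inv_le1)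
  from Sch_mult(1)[OF f this] show ?thesis by simp
qed

text \<open>Integration by parts seen on the Fourier side: the factor \<open>J ^ k\<close> is moved
  from \<open>P\<close> to the transform of \<open>h\<close>, so that growth of \<open>P\<close> is
  exchanged for derivatives of \<open>h\<close>. The shift by \<open>a\<close> is a modulation of
  \<open>P\<close> and commutes with division by \<open>J\<close>.\<close>

lemma oscillatory_ibp:
  assumes h: "Sch h" and P: "Sch P"
  shows "(LINT w|lborel. h w * FT P (w - a)) = (LINT w|lborel. (lap ^^ k) h w * FT (\<lambda>v. P v / of_real (J v) ^ k) (w - a))"
proof -
  define g where "g = (\<lambda>v. P v * cis (v \<bullet> a))"
  have g: "Sch g" unfolding g_def by (rule Sch_mult(1)[OF P tempered_cis])
  have g': "FT (\<lambda>v. P v / of_real (J v) ^ k) (w - a) = FT (\<lambda>v. g v / of_real (J v) ^ k) w" for w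
    using FT_shift[of "\<lambda>v. P v / of_real (J v) ^ k" a w] by (simp add: g_def field_simps)
  have "(LINT w|lborel. h w * FT P (w - a)) = (LINT w|lborel. h w * FT g w)"
    by (simp add: g_def FT_shift)
  also have "\<dots> = (LINT w|lborel. FT h w * g w)"
    by (intro FT_multiplication integrable_Sch h g)
  also have "\<dots> = (LINT w|lborel. FT ((lap ^^ k) h) w * (g w / of_real (J w) ^ k))"
    by (simp add: FT_lap_power[OF h])
  also have "\<dots> = (LINT w|lborel. (lap ^^ k) h w * FT (\<lambda>v. g v / of_real (J v) ^ k) w)"
    by (intro FT_multiplication[symmetric] integrable_Sch Sch_lap_power Sch_div_J h g)
  finally show ?thesis by (simp add: g')
qed

text \<open>\<open>1 \<le> v p x\<close> allows the undifferentiated summand to be charged with the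
  weight of the second derivatives.\<close>

lemma Sy_lap:
  assumes F: "Sy P UNIV (\<lambda>p b x. v p x) W F" and W: "\<And>p x. p \<in> P \<Longrightarrow> 0 \<le> W p x" and v: "\<And>p x. p \<in> P \<Longrightarrow> 1 \<le> v p x"
  shows "Sy P UNIV (\<lambda>p b x. v p x) (\<lambda>p x. W p x * v p x ^ 2) (\<lambda>p. lap (F p))"
proof -
  have nn: "0 \<le> v p x" if "p \<in> P" for p x using v[OF that, of x] by linarith
  have "Sy P UNIV (\<lambda>p b x. v p x) (\<lambda>p x. W p x * v p x ^ 2) (\<lambda>p. pd b (pd b (F p)))" if b: "b \<in> Basis" for b
    using Sy_pd[OF Sy_pd[OF F b] b] by (simp add: power2_eq_square mult.assoc)
  then have "Sy P UNIV (\<lambda>p b x. v p x) (\<lambda>p x. W p x * v p x ^ 2) (\<lambda>p x. \<Sum>b\<in>Basis. pd b (pd b (F p)) x)"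
    by (intro Sy_sum) (auto simp: nn W)
  moreover have "Sy P UNIV (\<lambda>p b x. v p x) (\<lambda>p x. W p x * v p x ^ 2) F"
  proof (rule Sy_mono[OF F open_UNIV, of 1 _ 1])
    fix p x assume p: "p \<in> P"
    have "1 \<le> v p x ^ 2" using v[OF p] by (rule one_le_power)
    from mult_left_mono[OF this W[OF p, of x]] show "0 \<le> W p x \<and> W p x \<le> 1 * (W p x * v p x ^ 2)"
      by (simp add: W p)
  qed (use nn in auto)
  ultimately have "Sy P UNIV (\<lambda>p b x. v p x) (\<lambda>p x. W p x * v p x ^ 2) (\<lambda>p x. F p x - (\<Sum>b\<in>Basis. pd b (pd b (F p)) x))"
    by (rule Sy_diff[OF open_UNIV, rotated])
  then show ?thesis unfolding lap_def .
qed

lemma Sy_lap_power: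
  assumes F: "Sy P UNIV (\<lambda>p b x. v p x) W F" and W: "\<And>p x. p \<in> P \<Longrightarrow> 0 \<le> W p x" and v: "\<And>p x. p \<in> P \<Longrightarrow> 1 \<le> v p x"
  shows "Sy P UNIV (\<lambda>p b x. v p x) (\<lambda>p x. W p x * v p x ^ (2 * k)) (\<lambda>p. (lap ^^ k) (F p))"
proof (induction k)
  case (Suc k)
  have "0 \<le> v p x" if "p \<in> P" for p x using v[OF that, of x] by linarith
  then show ?case using Sy_lap[OF Suc _ v] by (simp add: W power_add power2_eq_square mult_ac)
qed (use F in simp)

section \<open>Gaussian regularisation\<close>

lemma integral_lborel_prod:
  fixes f :: "'a::euclidean_space \<Rightarrow> real \<Rightarrow> complex"
  assumes i: "\<And>b. b \<in> Basis \<Longrightarrow> integrable lborel (f b)"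
  shows "(LINT x|lborel. (\<Prod>b\<in>Basis. f b (x \<bullet> b))) = (\<Prod>b\<in>Basis. LINT s|lborel. f b s)"
proof -
  interpret product_sigma_finite "\<lambda>_::'a. lborel :: real measure" ..
  have m [measurable]: "f b \<in> borel_measurable borel" if "b \<in> Basis" for b
    using i[OF that] by simp
  have "(LINT x|lborel. (\<Prod>b\<in>Basis. f b (x \<bullet> b)))
    = (LINT y|(\<Pi>\<^sub>M b\<in>Basis. lborel). (\<Prod>b\<in>Basis. f b ((\<Sum>c\<in>Basis. y c *\<^sub>R c) \<bullet> b)))"
    by (subst lborel_eq, subst integral_distr) auto
  also have "\<dots> = (LINT y|(\<Pi>\<^sub>M b\<in>Basis. lborel). (\<Prod>b\<in>Basis. f b (y b)))"
    by (intro Bochner_Integration.integral_cong prod.cong refl) (simp add: inner_sum_left_Basis)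
  also have "\<dots> = (\<Prod>b\<in>Basis. LINT s|lborel. f b s)"
    by (rule product_integral_prod) (use i in auto)
  finally show ?thesis .
qed

text \<open>Read off from the characteristic function of the standard normal distribution by the
  substitution \<open>sqrt 2 * s\<close>.\<close>

lemma FT_gaussian_real:
  "integrable lborel (\<lambda>s::real. complex_of_real (exp (- s\<^sup>2)) * cis (- (s * v)))"
  "(LINT s|lborel. complex_of_real (exp (- s\<^sup>2)) * cis (- (s * v))) = of_real (sqrt pi * exp (- v\<^sup>2 / 4))"
proof -
  have i: "integrable lborel (\<lambda>s::real. exp (- s\<^sup>2))"
    using integrable.intros[OF gaussian_integral[where 'a = real]] by (simp add: power2_eq_square)
  show "integrable lborel (\<lambda>s::real. complex_of_real (exp (- s\<^sup>2)) * cis (- (s * v)))"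
    by (rule Bochner_Integration.integrable_bound[OF i]) (auto simp: norm_mult)
  have "complex_of_real (exp (- (- v / sqrt 2)\<^sup>2 / 2)) = char std_normal_distribution (- v / sqrt 2)"
    by (simp add: char_std_normal_distribution)
  also have "\<dots> = (LINT x|lborel. std_normal_density x *\<^sub>R iexp (- v / sqrt 2 * x))"
    unfolding char_def by (subst integral_density) auto
  also have "\<dots> = sqrt 2 *\<^sub>R (LINT s|lborel. std_normal_density (0 + sqrt 2 * s) *\<^sub>R iexp (- v / sqrt 2 * (0 + sqrt 2 * s)))"
    by (subst lborel_integral_real_affine[where t = 0 and c = "sqrt 2"]) auto
  also have "\<dots> = sqrt 2 *\<^sub>R (LINT s|lborel. (1 / sqrt (2 * pi)) *\<^sub>R (complex_of_real (exp (- s\<^sup>2)) * cis (- (s * v))))"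
    by (intro arg_cong[where f = "\<lambda>x. sqrt 2 *\<^sub>R x"] Bochner_Integration.integral_cong refl)
       (simp add: std_normal_density_def cis_conv_exp scaleR_conv_of_real power_mult_distrib mult_ac)
  also have "\<dots> = (1 / sqrt pi) *\<^sub>R (LINT s|lborel. complex_of_real (exp (- s\<^sup>2)) * cis (- (s * v)))"
    by (simp add: real_sqrt_mult)
  finally have "sqrt pi *\<^sub>R complex_of_real (exp (- (- v / sqrt 2)\<^sup>2 / 2)) = (LINT s|lborel. complex_of_real (exp (- s\<^sup>2)) * cis (- (s * v)))"
    by (simp only: scaleR_scaleR) simp
  then show "(LINT s|lborel. complex_of_real (exp (- s\<^sup>2)) * cis (- (s * v))) = of_real (sqrt pi * exp (- v\<^sup>2 / 4))"
    by (simp add: power_divide scaleR_conv_of_real)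
qed

definition gauss :: "real \<Rightarrow> 'a::euclidean_space \<Rightarrow> complex" where
  "gauss e x = of_real (exp (- e * (x \<bullet> x)))"

lemma FT_gauss: "FT (gauss 1) (v :: 'a::euclidean_space) = of_real (sqrt pi ^ DIM('a) * exp (- (v \<bullet> v) / 4))"
proof -
  have "gauss 1 x * cis (- (x \<bullet> v)) = (\<Prod>b\<in>Basis. complex_of_real (exp (- (x \<bullet> b)\<^sup>2)) * cis (- ((x \<bullet> b) * (v \<bullet> b))))" for x
  proof -
    have *: "- (x \<bullet> x) = (\<Sum>b\<in>Basis. - (x \<bullet> b)\<^sup>2)" by (subst euclidean_inner) (simp add: power2_eq_square sum_negf)
    have **: "- (x \<bullet> v) = (\<Sum>b\<in>Basis. - ((x \<bullet> b) * (v \<bullet> b)))" by (subst euclidean_inner) (simp add: sum_negf)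
    have c: "cis (\<Sum>b\<in>B. f b) = (\<Prod>b\<in>B. cis (f b))" if "finite B" for B and f :: "'a \<Rightarrow> real"
      using that by (induction B rule: finite_induct) (auto simp: cis_mult[symmetric])
    show ?thesis
      unfolding gauss_def mult_minus1 * ** c[OF finite_Basis] exp_sum[OF finite_Basis] of_real_prod prod.distrib ..
  qed
  then have "FT (gauss 1) v = (\<Prod>b\<in>(Basis::'a set). LINT s|lborel. complex_of_real (exp (- s\<^sup>2)) * cis (- (s * (v \<bullet> b))))"
    unfolding FT_def by (simp add: integral_lborel_prod[OF FT_gaussian_real(1)])
  also have "\<dots> = of_real (\<Prod>b\<in>(Basis::'a set). sqrt pi * exp (- (v \<bullet> b)\<^sup>2 / 4))"
    by (simp add: FT_gaussian_real(2))
  also have "(\<Prod>b\<in>(Basis::'a set). sqrt pi * exp (- (v \<bullet> b)\<^sup>2 / 4)) = sqrt pi ^ DIM('a) * exp (- (v \<bullet> v) / 4)"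
    by (subst euclidean_inner) (simp add: prod.distrib exp_sum[symmetric] power2_eq_square sum_negf sum_divide_distrib)
  finally show ?thesis .
qed

lemma integral_lborel_affine:
  fixes f :: "'a::euclidean_space \<Rightarrow> 'b::{banach, second_countable_topology}"
  assumes c: "c \<noteq> 0" and f [measurable]: "f \<in> borel_measurable borel"
  shows "(LINT x|lborel. f x) = \<bar>c\<bar> ^ DIM('a) *\<^sub>R (LINT x|lborel. f (t + c *\<^sub>R x))"
    and "integrable lborel (\<lambda>x. f (t + c *\<^sub>R x)) \<longleftrightarrow> integrable lborel f"
proof -
  show "(LINT x|lborel. f x) = \<bar>c\<bar> ^ DIM('a) *\<^sub>R (LINT x|lborel. f (t + c *\<^sub>R x))"
    apply (subst lborel_affine[OF c, of t])
    apply (subst integral_density)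
       apply (auto simp: integral_distr)
    done
  have "integrable lborel f \<longleftrightarrow> integrable lborel (\<lambda>x. \<bar>c\<bar> ^ DIM('a) *\<^sub>R f (t + c *\<^sub>R x))"
    apply (subst lborel_affine[OF c, of t])
    apply (subst integrable_density)
       apply (auto simp: integrable_distr_eq)
    done
  also have "\<dots> \<longleftrightarrow> integrable lborel (\<lambda>x. f (t + c *\<^sub>R x))"
  proof
    assume "integrable lborel (\<lambda>x. \<bar>c\<bar> ^ DIM('a) *\<^sub>R f (t + c *\<^sub>R x))"
    from integrable_scaleR_right[OF this, of "1 / \<bar>c\<bar> ^ DIM('a)"] c
    show "integrable lborel (\<lambda>x. f (t + c *\<^sub>R x))" by simp
  qed (rule integrable_scaleR_right)
  finally show "integrable lborel (\<lambda>x. f (t + c *\<^sub>R x)) \<longleftrightarrow> integrable lborel f" by simp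
qed

text \<open>Fourier inversion at the origin. The mass \<open>(2 * pi) ^ DIM('a)\<close> is the
  normalisation of the approximate identity that appears in
  \<open>osc_limit_monomial\<close>.\<close>

lemma integral_FT_gauss:
  "integrable lborel (FT (gauss 1 :: 'a::euclidean_space \<Rightarrow> complex))"
  "(LINT v|(lborel :: 'a measure). FT (gauss 1) v) = complex_of_real ((2 * pi) ^ DIM('a))"
proof -
  let ?f = "\<lambda>x::'a. exp (- (x \<bullet> x)) :: real"
  have i: "integrable lborel (\<lambda>v::'a. ?f (0 + (1/2) *\<^sub>R v))"
    using integral_lborel_affine(2)[of "1/2" ?f 0] integrable.intros[OF gaussian_integral] by auto
  have j: "(LINT v|lborel. ?f (0 + (1/2) *\<^sub>R v)) = 2 ^ DIM('a) * sqrt pi ^ DIM('a)"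
    using integral_lborel_affine(1)[of "1/2" ?f 0] has_bochner_integral_integral_eq[OF gaussian_integral[where 'a='a]]
    by (simp add: field_simps)
  have e: "FT (gauss 1) v = complex_of_real (sqrt pi ^ DIM('a) * ?f (0 + (1/2) *\<^sub>R v))" for v :: 'a
    by (simp add: FT_gauss)
  show "integrable lborel (FT (gauss 1 :: 'a \<Rightarrow> complex))"
    unfolding e[abs_def] using i by (intro integrable_of_real integrable_mult_right) auto
  have "(sqrt pi ^ DIM('a)) * (2 ^ DIM('a) * sqrt pi ^ DIM('a)) = (2 * pi) ^ DIM('a)"
    by (simp add: power_mult_distrib flip: power_mult_distrib[of "sqrt pi" "sqrt pi"])
  moreover have "(LINT v|(lborel :: 'a measure). FT (gauss 1) v) = complex_of_real (sqrt pi ^ DIM('a) * (2 ^ DIM('a) * sqrt pi ^ DIM('a)))"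
  proof -
    have "FT (gauss 1) = (\<lambda>v::'a. complex_of_real (sqrt pi ^ DIM('a) * ?f (0 + (1/2) *\<^sub>R v)))" by (rule ext) (rule e)
    then show ?thesis by (simp only: integral_complex_of_real integral_mult_right_zero j)
  qed
  ultimately show "(LINT v|(lborel :: 'a measure). FT (gauss 1) v) = complex_of_real ((2 * pi) ^ DIM('a))" by (simp only:)
qed

lemma gauss_eq_exp: "gauss e x = exp (of_real (- e) * of_real (x \<bullet> x))"
  by (simp add: gauss_def exp_of_real[symmetric])

lemma pd_gauss: "gauss e differentiable (at x)" "pd b (gauss e) x = of_real (- 2 * e) * (of_real (x \<bullet> b) * gauss e x)"
proof -
  have *: "((\<lambda>x. complex_of_real (- e) * complex_of_real (x \<bullet> x)) has_derivative (\<lambda>h. of_real (- e) * complex_of_real (2 * (x \<bullet> h)))) (at x)"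
    by (auto intro!: derivative_eq_intros simp: inner_commute)
  note d = differentiableI[OF *]
  show "gauss e differentiable (at x)" "pd b (gauss e) x = of_real (- 2 * e) * (of_real (x \<bullet> b) * gauss e x)"
    using pd_exp(1)[OF d] pd_exp(2)[OF d, of b] pd_has_derivative[OF *, of b]
    unfolding gauss_eq_exp[abs_def] by (simp_all add: algebra_simps)
qed

text \<open>The constant \<open>real K ^ K\<close> comes from raising
  \<open>J x \<le> real K * exp ((x \<bullet> x) / real K)\<close> to the power
  \<open>K\<close>.\<close>

lemma gauss_bound: "\<exists>C\<ge>0. \<forall>x. norm (gauss 1 x) \<le> C * (1 / J x ^ K)"
proof (cases "K = 0")
  case False
  have "norm (gauss 1 x) \<le> real K ^ K * (1 / J x ^ K)" for x :: 'a
  proof -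
    let ?s = "x \<bullet> x"
    have "J x \<le> real K * exp (?s / real K)"
    proof -
      have "1 + ?s / real K \<le> exp (?s / real K)" by (rule exp_ge_add_one_self)
      then have "real K * (1 + ?s / real K) \<le> real K * exp (?s / real K)" by (intro mult_left_mono) auto
      moreover have "J x \<le> real K * (1 + ?s / real K)" using False by (simp add: J_def algebra_simps)
      ultimately show ?thesis by linarith
    qed
    then have "J x ^ K \<le> (real K * exp (?s / real K)) ^ K" using J_pos[of x] by (intro power_mono) auto
    also have "\<dots> = real K ^ K * exp ?s"
      using False by (simp add: power_mult_distrib exp_of_nat_mult[symmetric])
    finally show ?thesis using J_pos[of x]
      by (simp add: gauss_def exp_minus norm_inverse norm_divide field_simps)
  qed
  then show ?thesis by (intro exI[of _ "real K ^ K"]) auto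
qed (auto simp: gauss_def intro!: exI[of _ 1])

lemma Sch_gauss1: "Sch (gauss 1 :: 'a::euclidean_space \<Rightarrow> complex)"
proof -
  have "Syk l {()} UNIV (\<lambda>_ _ _. 1) (\<lambda>_ (x::'a). 1 / J x ^ K) (\<lambda>_. gauss 1)" for l K
  proof (induction l arbitrary: K)
    case (Suc l)
    have "Syk l {()} UNIV (\<lambda>_ _ _. 1) (\<lambda>p x. 1 / J x ^ K * 1) (\<lambda>p. pd b (gauss 1))" if b: "b \<in> Basis" for b :: 'a
    proof -
      have "Syk l {()} UNIV (\<lambda>_ _ _. 1) (\<lambda>p (x::'a). J x) (\<lambda>p x. (- 2) * complex_of_real (x \<bullet> b))"
        using Sy_cmult[OF open_UNIV Sy_coord[OF b], of "{()}" "- 2"] unfolding Sy_def by blast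
      from Syk_mult[OF open_UNIV this Suc[of "Suc K"]] show ?thesis
        by (rule Syk_cong[OF open_UNIV, rotated 2]) (auto simp: pd_gauss)
    qed
    then show ?case using pd_gauss(1) gauss_bound[of K] by auto
  qed auto
  then show ?thesis by (simp add: Sch_def Sy_def)
qed

text \<open>\<open>gauss e\<close> is \<open>gauss 1\<close> dilated by \<open>sqrt e\<close>, so
  each derivative gains \<open>sqrt e\<close>. Hence the bounds are uniform as the regularisation is
  removed, and all proper derivatives vanish in the limit.\<close>

lemma Sy_gauss: 
  assumes "\<And>p. p \<in> P \<Longrightarrow> 0 \<le> e p"
  shows "Sy P UNIV (\<lambda>p _ _. sqrt (e p)) (\<lambda>_ _. 1) (\<lambda>p. gauss (e p))"
proof -
  have "Sy {()} UNIV (\<lambda>_ _ _. 1) (\<lambda>_ _. 1) (\<lambda>_. gauss 1)" using Sch_D[OF Sch_gauss1, of 0] by simp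
  then have "Sy P UNIV (\<lambda>q b x. \<bar>sqrt (e q)\<bar> * 1) (\<lambda>q x. 1) (\<lambda>q x. gauss 1 (sqrt (e q) *\<^sub>R x))"
    by (rule Sy_pullback[where \<pi> = "\<lambda>_. ()" and A = "\<lambda>q x. sqrt (e q) *\<^sub>R x" and \<tau> = "\<lambda>b. b" and c = "\<lambda>q. sqrt (e q)"])
       (auto simp: scaleR_add_right mult.commute intro!: derivative_intros)
  then have "Sy P UNIV (\<lambda>p _ _. sqrt (e p)) (\<lambda>_ _. 1) (\<lambda>q x. gauss 1 (sqrt (e q) *\<^sub>R x))"
    by (rule Sy_mono[where D = 1 and D' = 1]) (use assms in auto)
  then show ?thesis
    by (rule Sy_cong') (auto simp: gauss_def assms)
qed

text \<open>A statement for fixed \<open>e\<close>: the constant \<open>1 / (min 1 e) ^ K\<close>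
  blows up as \<open>e\<close> tends to 0, so it justifies integrals and exact identities, while
  uniform bounds rest on \<open>Sy_gauss\<close>.\<close>

lemma Sch_gauss:
  assumes e: "0 < e" shows "Sch (gauss e :: 'a::euclidean_space \<Rightarrow> complex)"
  unfolding Sch_def
proof
  fix K
  let ?D = "1 / (min 1 e) ^ K"
  have "Sy {()} UNIV (\<lambda>q b x. \<bar>sqrt e\<bar> * 1) (\<lambda>q x. 1 / J (sqrt e *\<^sub>R x) ^ K) (\<lambda>q x. gauss 1 (sqrt e *\<^sub>R (x::'a)))"
    by (rule Sy_pullback[OF Sch_D[OF Sch_gauss1], where \<pi> = "\<lambda>_. ()" and A = "\<lambda>q x. sqrt e *\<^sub>R x" and \<tau> = "\<lambda>b. b" and c = "\<lambda>q. sqrt e"])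
       (auto simp: scaleR_add_right mult.commute intro!: derivative_intros)
  then have "Sy {()} UNIV (\<lambda>_ _ _. 1) (\<lambda>_ x. 1 / J x ^ K) (\<lambda>q x. gauss 1 (sqrt e *\<^sub>R (x::'a)))"
  proof (rule Sy_mono[where D = ?D and D' = "sqrt e"])
    fix x :: 'a
    have "min 1 e * J x \<le> J (sqrt e *\<^sub>R x)"
    proof -
      have "J (sqrt e *\<^sub>R x) = 1 + e * (x \<bullet> x)" using e by (simp add: J_def flip: mult.assoc)
      moreover have "min 1 e * (x \<bullet> x) \<le> e * (x \<bullet> x)" by (rule mult_right_mono) auto
      moreover have "min 1 e \<le> 1" by simp
      ultimately show ?thesis unfolding J_def distrib_left by linarith
    qed
    then have "(min 1 e * J x) ^ K \<le> J (sqrt e *\<^sub>R x) ^ K" using e J_pos[of x] by (intro power_mono) auto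
    then have "1 / J (sqrt e *\<^sub>R x) ^ K \<le> 1 / (min 1 e * J x) ^ K" using e J_pos[of x] by (intro divide_left_mono) (auto simp: J_pos)
    then show "0 \<le> 1 / J (sqrt e *\<^sub>R x) ^ K \<and> 1 / J (sqrt e *\<^sub>R x) ^ K \<le> ?D * (1 / J x ^ K)"
      using J_pos[of "sqrt e *\<^sub>R x"] by (simp add: power_mult_distrib)
  qed (use e in auto)
  then show "Sy {()} UNIV (\<lambda>_ _ _. 1) (\<lambda>_ x. 1 / J x ^ K) (\<lambda>_. gauss e :: 'a \<Rightarrow> complex)"
    by (rule Sy_cong') (use e in \<open>auto simp: gauss_def\<close>)
qed

section \<open>Removal of the regularisation\<close>

lemma dominated_convergence_at_right:
  fixes f :: "real \<Rightarrow> 'a \<Rightarrow> complex"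
  assumes "\<And>e. 0 < e \<Longrightarrow> e < 1 \<Longrightarrow> f e \<in> borel_measurable M" "g \<in> borel_measurable M" "integrable M w"
    and b: "\<And>e x. 0 < e \<Longrightarrow> e < 1 \<Longrightarrow> norm (f e x) \<le> w x"
    and l: "\<And>x. ((\<lambda>e. f e x) \<longlongrightarrow> g x) (at_right 0)"
  shows "((\<lambda>e. integral\<^sup>L M (f e)) \<longlongrightarrow> integral\<^sup>L M g) (at_right 0)"
proof -
  \<comment> \<open>The substitution \<open>e = inverse s\<close> turns the one-sided limit into a
    limit at infinity; the value 0 for \<open>s \<le> 1\<close> makes every member of the family
    measurable.\<close>
  define h where "h = (\<lambda>s. if s > 1 then f (inverse s) else (\<lambda>_. 0))"
  have ev: "eventually (\<lambda>s::real. s > 1) at_top" by (rule eventually_gt_at_top)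
  have "((\<lambda>s. integral\<^sup>L M (h s)) \<longlongrightarrow> integral\<^sup>L M g) at_top"
  proof (rule integral_dominated_convergence_at_top[where w = w])
    show "h s \<in> borel_measurable M" for s
      using assms(1)[of "inverse s"] by (auto simp: h_def inverse_less_1_iff)
    show "\<forall>\<^sub>F s in at_top. AE x in M. norm (h s x) \<le> w x"
      using ev by eventually_elim (use b in \<open>auto simp: h_def inverse_less_1_iff\<close>)
    have "((\<lambda>s. h s x) \<longlongrightarrow> g x) at_top" for x
    proof -
      have "((\<lambda>s. f (inverse s) x) \<longlongrightarrow> g x) at_top" using l[of x] by (simp add: filterlim_at_right_to_top)
      moreover have "\<forall>\<^sub>F s in at_top. f (inverse s) x = h s x"
        using ev by eventually_elim (simp add: h_def)
      ultimately show ?thesis by (rule Lim_transform_eventually)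
    qed
    then show "AE x in M. ((\<lambda>s. h s x) \<longlongrightarrow> g x) at_top" by simp
  qed (use assms in auto)
  moreover have "\<forall>\<^sub>F s in at_top. integral\<^sup>L M (h s) = integral\<^sup>L M (f (inverse s))"
    using ev by eventually_elim (simp add: h_def)
  ultimately show ?thesis
    unfolding filterlim_at_right_to_top by (rule Lim_transform_eventually)
qed

text \<open>The evaluation points \<open>Y e\<close> move because the Gaussian approximate identity is rescaled by \<open>sqrt e\<close>.\<close>
primrec conv :: "nat \<Rightarrow> (real \<Rightarrow> 'a::euclidean_space) \<Rightarrow> 'a \<Rightarrow> (real \<Rightarrow> 'a \<Rightarrow> complex) \<Rightarrow> ('a \<Rightarrow> complex) \<Rightarrow> bool" where
  "conv 0 Y y F f = True"
| "conv (Suc k) Y y F f = ((\<forall>e\<in>{0<..<1}. \<forall>x. F e differentiable (at x)) \<and> (\<forall>x. f differentiable (at x)) \<and>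
     ((\<lambda>e. F e (Y e)) \<longlongrightarrow> f y) (at_right 0) \<and> (\<forall>b\<in>Basis. conv k Y y (\<lambda>e. pd b (F e)) (pd b f)))"

lemma conv_Suc_imp: "conv (Suc k) Y y F f \<Longrightarrow> conv k Y y F f"
  by (induction k arbitrary: F f) auto

lemma eventually_at_right_01: "eventually (\<lambda>e::real. e \<in> {0<..<1}) (at_right 0)"
  by (auto simp: eventually_at_right_field intro!: exI[of _ 1])

lemma conv_cong:
  assumes "conv k Y y F f" "\<And>e. e \<in> {0<..<1} \<Longrightarrow> F e = G e" "f = g"
  shows "conv k Y y G g"
  using assms
proof (induction k arbitrary: F f G g)
  case (Suc k)
  have "((\<lambda>e. G e (Y e)) \<longlongrightarrow> g y) (at_right 0)"
    by (rule Lim_transform_eventually[of "\<lambda>e. F e (Y e)"])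
       (use Suc.prems in \<open>auto intro: eventually_mono[OF eventually_at_right_01]\<close>)
  moreover have "conv k Y y (\<lambda>e. pd b (G e)) (pd b g)" if "b \<in> Basis" for b
    using Suc.IH[of "\<lambda>e. pd b (F e)" "pd b f" "\<lambda>e. pd b (G e)" "pd b g"] Suc.prems that by auto
  ultimately show ?case using Suc.prems by auto
qed auto

lemma conv_add:
  assumes "conv k Y y F f" "conv k Y y G g"
  shows "conv k Y y (\<lambda>e x. F e x + G e x) (\<lambda>x. f x + g x)"
  using assms
proof (induction k arbitrary: F f G g)
  case (Suc k)
  have "conv k Y y (\<lambda>e. pd b (\<lambda>x. F e x + G e x)) (pd b (\<lambda>x. f x + g x))" if b: "b \<in> Basis" for b
    by (rule conv_cong[OF Suc.IH[of "\<lambda>e. pd b (F e)" "pd b f" "\<lambda>e. pd b (G e)" "pd b g"]])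
       (use Suc.prems b in \<open>auto simp: pd_add fun_eq_iff\<close>)
  then show ?case using Suc.prems by (auto intro!: tendsto_add)
qed auto

lemma conv_mult:
  assumes "conv k Y y F f" "conv k Y y G g"
  shows "conv k Y y (\<lambda>e x. F e x * G e x) (\<lambda>x. f x * g x)"
  using assms
proof (induction k arbitrary: F f G g)
  case (Suc k)
  have "conv k Y y (\<lambda>e. pd b (\<lambda>x. F e x * G e x)) (pd b (\<lambda>x. f x * g x))" if b: "b \<in> Basis" for b
    by (rule conv_cong[OF conv_add[OF
          Suc.IH[of "\<lambda>e. pd b (F e)" "pd b f" G g] Suc.IH[of F f "\<lambda>e. pd b (G e)" "pd b g"]]])
       (use Suc.prems b conv_Suc_imp[OF Suc.prems(1)] conv_Suc_imp[OF Suc.prems(2)] in \<open>auto simp: pd_mult fun_eq_iff\<close>)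
  then show ?case using Suc.prems by (auto intro!: tendsto_mult)
qed auto

lemma conv_zero: "conv k Y (y::'a::euclidean_space) (\<lambda>e x. 0) (\<lambda>x. 0)"
proof (induction k)
  case (Suc k)
  have "pd b (\<lambda>x. 0::complex) = (\<lambda>x. 0)" for b :: 'a by (simp add: fun_eq_iff)
  with Suc show ?case by simp
qed auto

lemma conv_const: "conv k Y (y::'a::euclidean_space) (\<lambda>e x. c) (\<lambda>x. c)"
proof (cases k)
  case (Suc k)
  have "pd b (\<lambda>x. c) = (\<lambda>x. 0::complex)" for b :: 'a by (simp add: fun_eq_iff)
  with Suc conv_zero[of _ Y y] show ?thesis by simp
qed auto

lemma conv_fixed:
  assumes "Sy {()} UNIV w W (\<lambda>_. f)" "(Y \<longlongrightarrow> y) (at_right 0)"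
  shows "conv k Y y (\<lambda>e. f) f"
  using assms(1)
proof (induction k arbitrary: W f)
  case (Suc k)
  have d: "f differentiable (at x)" for x using Sy_diff0[OF Suc.prems] by auto
  have "isCont f y" using d by (simp add: differentiable_imp_continuous_within)
  then have "((\<lambda>e. f (Y e)) \<longlongrightarrow> f y) (at_right 0)" using assms(2) by (rule isCont_tendsto_compose)
  with d Suc Sy_pd[OF Suc.prems] show ?case by auto
qed auto

lemma conv_sum:
  assumes "finite I" "\<And>i. i \<in> I \<Longrightarrow> conv k Y y (F i) (f i)"
  shows "conv k Y y (\<lambda>e x. \<Sum>i\<in>I. F i e x) (\<lambda>x. \<Sum>i\<in>I. f i x)"
  using assms
proof (induction I rule: finite_induct)
  case (insert i I)
  then show ?case using conv_add[of k Y y "F i" "f i"] by simp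
qed (simp add: conv_zero)

lemma conv_pd: "conv (Suc k) Y y F f \<Longrightarrow> b \<in> Basis \<Longrightarrow> conv k Y y (\<lambda>e. pd b (F e)) (pd b f)"
  by simp

lemma conv_PD:
  assumes "\<And>k. conv k Y y F f" "L \<in> lists Basis" shows "conv k Y y (\<lambda>e. PD L (F e)) (PD L f)"
  using assms(2)
proof (induction L arbitrary: k rule: list.induct)
  case (Cons b L)
  then show ?case using conv_pd[of k Y y "\<lambda>e. PD L (F e)" "PD L f" b] by (simp del: conv.simps)
qed (use assms(1) in simp)

lemma conv_lap:
  assumes "\<And>k. conv k Y y F f" shows "conv k Y y (\<lambda>e. lap (F e)) (lap f)"
proof -
  have "conv k Y y (\<lambda>e x. (\<lambda>x. -1) x * (\<Sum>b\<in>Basis. pd b (pd b (F e)) x)) (\<lambda>x. (\<lambda>x. -1) x * (\<Sum>b\<in>Basis. pd b (pd b f) x))"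
    by (intro conv_mult conv_const conv_sum conv_pd assms) auto
  from conv_add[OF assms this] show ?thesis unfolding lap_def[abs_def] by simp
qed

lemma conv_lap_power:
  assumes "\<And>k. conv k Y y F f" shows "conv k Y y (\<lambda>e. (lap ^^ j) (F e)) ((lap ^^ j) f)"
proof (induction j arbitrary: k)
  case (Suc j)
  show ?case using conv_lap[OF Suc] by simp
qed (use assms in simp)

lemma conv_D: "(\<And>k. conv k Y y F f) \<Longrightarrow> ((\<lambda>e. F e (Y e)) \<longlongrightarrow> f y) (at_right 0)"
proof -
  assume "\<And>k. conv k Y y F f"
  from this[of "Suc 0"] show ?thesis by simp
qed

lemma Sy_PD:
  assumes "Sy P S w W F" "L \<in> lists Basis" 
  shows "Sy P S w (\<lambda>p x. W p x * (\<Prod>b\<leftarrow>L. w p b x)) (\<lambda>p. PD L (F p))"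
  using assms(2)
proof (induction L rule: list.induct)
  case (Cons b L)
  then show ?case using Sy_pd[of P S w "\<lambda>p x. W p x * (\<Prod>b\<leftarrow>L. w p b x)" "\<lambda>p. PD L (F p)" b] by (simp add: mult_ac)
qed (use assms in simp)

text \<open>Derivatives of \<open>gauss e\<close> are bounded at all points by a positive power of
  \<open>sqrt e\<close>, so they tend to 0 along any moving point; convergence of \<open>Y\<close>
  matters only for the undifferentiated function.\<close>

lemma conv_gauss:
  assumes Y: "(Y \<longlongrightarrow> (y::'a::euclidean_space)) (at_right 0)"
  shows "conv k Y y gauss (\<lambda>x. 1)"
proof -
  have g: "Sy {0<..<1::real} UNIV (\<lambda>p _ _. sqrt p) (\<lambda>_ _. 1) (\<lambda>p. gauss p :: 'a \<Rightarrow> complex)"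
    by (rule Sy_gauss) auto
  have small: "conv k Y y (\<lambda>e. G e) (\<lambda>x. 0)"
    if "Sy {0<..<1::real} UNIV (\<lambda>p _ _. sqrt p) (\<lambda>p _. sqrt p ^ Suc j) G" for G :: "real \<Rightarrow> 'a \<Rightarrow> complex" and j k
    using that
  proof (induction k arbitrary: G j)
    case (Suc k)
    obtain C where C: "C \<ge> 0" "\<And>p x. p \<in> {0<..<1} \<Longrightarrow> norm (G p x) \<le> C * sqrt p ^ Suc j"
      using Sy_bound0[OF Suc.prems] by auto
    have "((\<lambda>e. G e (Y e)) \<longlongrightarrow> 0) (at_right 0)"
    proof (rule tendsto_0_le[where K = C])
      have "((\<lambda>p. sqrt p ^ Suc j) \<longlongrightarrow> sqrt 0 ^ Suc j) (at_right 0)" by (intro tendsto_intros)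
      then show "((\<lambda>p. sqrt p ^ Suc j) \<longlongrightarrow> 0) (at_right 0)" by simp
      show "\<forall>\<^sub>F x in at_right 0. norm (G x (Y x)) \<le> norm (sqrt x ^ Suc j) * C"
        using eventually_at_right_01
      proof eventually_elim
        case (elim p)
        then show ?case using C(2)[OF elim, of "Y p"] by (simp add: mult.commute)
      qed
    qed
    moreover have "conv k Y y (\<lambda>e. pd b (G e)) (pd b (\<lambda>x. 0))" if b: "b \<in> Basis" for b
    proof -
      have "Sy {0<..<1::real} UNIV (\<lambda>p _ _. sqrt p) (\<lambda>p _. sqrt p ^ Suc (Suc j)) (\<lambda>e. pd b (G e))"
        using Sy_pd[OF Suc.prems b] by (simp add: mult_ac)
      from Suc.IH[OF this] show ?thesis by (simp add: pd_const[abs_def])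
    qed
    ultimately show ?case using Sy_diff0[OF Suc.prems] by auto
  qed auto
  show ?thesis
  proof (cases k)
    case (Suc k')
    have "((\<lambda>e. complex_of_real (exp (- e * (Y e \<bullet> Y e)))) \<longlongrightarrow> complex_of_real (exp (- 0 * (y \<bullet> y)))) (at_right 0)"
      by (intro tendsto_intros Y)
    then have "((\<lambda>e. gauss e (Y e)) \<longlongrightarrow> 1) (at_right 0)" by (simp add: gauss_def)
    moreover have "conv k' Y y (\<lambda>e. pd b (gauss e)) (pd b (\<lambda>x. 1))" if b: "b \<in> Basis" for b
      using small[of 0 "\<lambda>e. pd b (gauss e)" k'] Sy_pd[OF g b] by (simp add: pd_const[abs_def])
    ultimately show ?thesis using Suc Sy_diff0[OF g] by auto
  qed auto
qed

text \<open>With \<open>u y = a t y \<xi> * cis (\<phi> y \<xi>)\<close> and \<open>p \<eta> = \<rho> (t *\<^sub>R \<eta>)\<close> this is the double integral in \<^const>\<open>sigma_amp\<close>,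
  up to the factors \<open>cis (\<phi> x \<xi>)\<close> and \<open>(2 * pi) ^ CARD('n)\<close>.\<close>
definition osc :: "('a::euclidean_space \<Rightarrow> complex) \<Rightarrow> ('a \<Rightarrow> complex) \<Rightarrow> 'a \<Rightarrow> real \<Rightarrow> complex" where
  "osc u p x e = (LINT y|lborel. gauss e y * u y * FT (\<lambda>\<eta>. gauss e \<eta> * p \<eta>) (y - x))"

lemma tempered_imp_Sy:
  assumes "tempered q f" shows "Sy P UNIV (\<lambda>_ _ _. 1) (\<lambda>_ x. J x ^ q) (\<lambda>_. f)"
  using Sy_reindex[OF assms open_UNIV, of P "\<lambda>_. ()"] by simp

lemma integrable_J': "integrable lborel (\<lambda>x::'a::euclidean_space. c / J x ^ DIM('a))"
  using integrable_mult_right[OF integrable_J, of c] by simp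

text \<open>Dividing the multiplier by \<open>J ^ DIM('a)\<close> makes it integrable at the price
  of derivatives of \<open>u\<close>. The derivatives of the quotient are integrable as well, so its
  transform decays like \<open>1 / J ^ DIM('a)\<close>. Both facts are uniform in \<open>e\<close>,
  and dominated convergence yields an absolutely convergent integral.\<close>

lemma osc_limit:
  fixes u p :: "'a::euclidean_space \<Rightarrow> complex"
  assumes u: "tempered 0 u" and p: "tempered 0 p"
  shows "(osc u p x \<longlongrightarrow> (LINT y|lborel. (lap ^^ DIM('a)) u y * FT (\<lambda>\<eta>. p \<eta> / of_real (J \<eta>) ^ DIM('a)) (y - x))) (at_right 0)"
proof -
  let ?n = "DIM('a)" and ?E = "{0<..<1::real}"
  define q where "q = (\<lambda>e \<eta>. gauss e \<eta> * p \<eta> / of_real (J \<eta>) ^ ?n)"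
  define q0 where "q0 = (\<lambda>\<eta>. p \<eta> / of_real (J \<eta>) ^ ?n)"
  have g: "Sy ?E UNIV (\<lambda>_ _ _. 1) (\<lambda>_ _. 1) (\<lambda>e. gauss e :: 'a \<Rightarrow> complex)"
    by (rule Sy_mono[OF Sy_gauss[of ?E "\<lambda>e. e"], where D = 1 and D' = 1]) auto
  have gu: "Sy ?E UNIV (\<lambda>_ _ _. 1) (\<lambda>_ _. 1) (\<lambda>e y. gauss e y * u y)"
    using Sy_mult[OF open_UNIV g tempered_imp_Sy[OF u]] by simp
  obtain C1 where C1: "C1 \<ge> 0" "\<And>e y. e \<in> ?E \<Longrightarrow> norm ((lap ^^ ?n) (\<lambda>y. gauss e y * u y) y) \<le> C1"
    using Sy_bound0[OF Sy_lap_power[OF gu, where k = ?n]] by auto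
  have q: "Sy ?E UNIV (\<lambda>_ _ _. 1) (\<lambda>_ x. 1 / J x ^ ?n) q"
    using Sy_mult[OF open_UNIV Sy_mult[OF open_UNIV g tempered_imp_Sy[OF p]] Sy_J_inverse[where k = ?n]] by (simp add: q_def)
  obtain C2 where C2: "C2 \<ge> 0" "\<And>e y. e \<in> ?E \<Longrightarrow> norm ((lap ^^ ?n) (q e) y) \<le> C2 * (1 / J y ^ ?n)"
    using Sy_bound0[OF Sy_lap_power[OF q, where k = ?n]] by (auto simp: less_imp_le[OF J_pos])
  obtain C3 where C3: "C3 \<ge> 0" "\<And>e y. e \<in> ?E \<Longrightarrow> norm (q e y) \<le> C3 * (1 / J y ^ ?n)"
    using Sy_bound0[OF q] by auto
  have q0: "Sy {()} UNIV (\<lambda>_ _ _. 1) (\<lambda>_ x. 1 / J x ^ ?n) (\<lambda>_. q0)"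
    using Sy_mult[OF open_UNIV p Sy_J_inverse[where k = ?n]] by (simp add: q0_def)
  have [measurable]: "q0 \<in> borel_measurable borel" using Sy_diff0[OF q0] by (intro differentiable_imp_measurable) auto
  have Sq: "Sch (q e)" and Sgu: "Sch (\<lambda>y. gauss e y * u y)" and Sgp: "Sch (\<lambda>y. gauss e y * p y)" if "e \<in> ?E" for e
    unfolding q_def by (intro Sch_div_J Sch_mult(1)[OF _ p] Sch_mult(1)[OF _ u] Sch_gauss; use that in simp)+
  define A where "A = (LINT y|lborel. C2 * (1 / J (y::'a) ^ ?n))"
  have FTq: "norm (FT (q e) z) \<le> A / J z ^ ?n" if e: "e \<in> ?E" for e z
  proof (rule order_trans[OF FT_decay[OF Sq[OF e], of z ?n]])
    have "(LINT y|lborel. norm ((lap ^^ ?n) (q e) y)) \<le> A"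
      unfolding A_def
      by (rule Bochner_Integration.integral_mono)
         (use C2(2)[OF e] integrable_J' in \<open>auto intro!: integrable_Sch integrable_norm Sch_lap_power Sq e\<close>)
    then show "(LINT y|lborel. norm ((lap ^^ ?n) (q e) y)) / J z ^ ?n \<le> A / J z ^ ?n"
      using J_pos[of z] by (intro divide_right_mono) auto
  qed
  have [measurable]: "FT (q e) \<in> borel_measurable borel" "(lap ^^ ?n) (\<lambda>y. gauss e y * u y) \<in> borel_measurable borel" if "e \<in> ?E" for e
    by (rule FT_measurable[OF integrable_Sch(3)[OF Sq[OF that]]], rule integrable_Sch(3)[OF Sch_lap_power[OF Sgu[OF that]]])
  have lapu: "Sy {()} UNIV (\<lambda>_ _ _. 1) (\<lambda>_ x. J x ^ 0 * 1 ^ (2 * ?n)) (\<lambda>_. (lap ^^ ?n) u)"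
    by (rule Sy_lap_power[OF u]) auto
  have [measurable]: "(lap ^^ ?n) u \<in> borel_measurable borel"
    by (rule differentiable_imp_measurable(2)) (rule Sy_diff0[OF lapu]; simp)
  have "((\<lambda>e. LINT y|lborel. (lap ^^ ?n) (\<lambda>y. gauss e y * u y) y * FT (q e) (y - x)) \<longlongrightarrow>
      (LINT y|lborel. (lap ^^ ?n) u y * FT q0 (y - x))) (at_right 0)"
  proof (rule dominated_convergence_at_right[where w = "\<lambda>y. C1 * (A / J (- x + y) ^ ?n)"])
    have "integrable lborel (\<lambda>y. 1 / J (- x + y) ^ ?n)"
      using integral_lborel_shift(2)[of "\<lambda>y. 1 / J y ^ ?n" "- x"] integrable_J by simp
    then show "integrable lborel (\<lambda>y. C1 * (A / J (- x + y) ^ ?n))"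
      using integrable_mult_right[of "C1 * A" lborel "\<lambda>y. 1 / J (- x + y) ^ ?n"] by simp
    show "norm ((lap ^^ ?n) (\<lambda>y. gauss e y * u y) y * FT (q e) (y - x)) \<le> C1 * (A / J (- x + y) ^ ?n)" if "0 < e" "e < 1" for e y
      unfolding norm_mult using C1 FTq[of e "y - x"] that
      by (intro mult_mono) auto
    fix y
    have "((\<lambda>e. (lap ^^ ?n) (\<lambda>y. gauss e y * u y) y) \<longlongrightarrow> (lap ^^ ?n) (\<lambda>y. 1 * u y) y) (at_right 0)"
      by (rule conv_D, rule conv_lap_power, rule conv_mult[OF conv_gauss conv_fixed[OF u]]) auto
    moreover have "((\<lambda>e. FT (q e) z) \<longlongrightarrow> FT q0 z) (at_right 0)" for z
      unfolding FT_def
    proof (rule dominated_convergence_at_right[where w = "\<lambda>y. C3 * (1 / J y ^ ?n)"])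
      show "((\<lambda>e. q e y * cis (- (y \<bullet> z))) \<longlongrightarrow> q0 y * cis (- (y \<bullet> z))) (at_right 0)" for y
      proof -
        have "((\<lambda>e. gauss e y) \<longlongrightarrow> 1) (at_right 0)" by (rule conv_D, rule conv_gauss) auto
        then have "((\<lambda>e. gauss e y * p y / of_real (J y) ^ ?n * cis (- (y \<bullet> z))) \<longlongrightarrow> 1 * p y / of_real (J y) ^ ?n * cis (- (y \<bullet> z))) (at_right 0)"
          by (intro tendsto_intros) auto
        then show ?thesis by (simp add: q_def q0_def)
      qed
      show "(\<lambda>y. q e y * cis (- (y \<bullet> z))) \<in> borel_measurable lborel" if "0 < e" "e < 1" for e
      proof -
        have [measurable]: "q e \<in> borel_measurable borel" using integrable_Sch(3)[OF Sq[of e]] that by auto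
        show ?thesis by measurable
      qed
    qed (use C3 integrable_J' in \<open>auto simp: norm_mult\<close>)
    ultimately show "((\<lambda>e. (lap ^^ ?n) (\<lambda>y. gauss e y * u y) y * FT (q e) (y - x)) \<longlongrightarrow> (lap ^^ ?n) u y * FT q0 (y - x)) (at_right 0)"
      by (intro tendsto_mult) auto
  qed (use FT_measurable[of q0] in measurable)
  moreover have "\<forall>\<^sub>F e in at_right 0. (LINT y|lborel. (lap ^^ ?n) (\<lambda>y. gauss e y * u y) y * FT (q e) (y - x)) = osc u p x e"
    using eventually_at_right_01
    by eventually_elim (simp add: osc_def q_def oscillatory_ibp[OF Sgu Sgp, of _ _ x ?n])
  ultimately show ?thesis unfolding q0_def by (rule Lim_transform_eventually)
qed

lemma tempered_linear_power:
  assumes "L \<in> lists Basis"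
  shows "tempered (length L) (\<lambda>v. \<Prod>b\<leftarrow>L. complex_of_real (v \<bullet> b))"
  using assms
proof (induction L rule: list.induct)
  case (Cons b L)
  then show ?case using Sy_mult[OF open_UNIV Sy_coord[of b]] by simp
qed (use Sy_one in simp)

lemma tempered_shift:
  assumes f: "tempered q f" shows "tempered q (\<lambda>v. f (a + v))"
proof -
  have "Sy {()} UNIV (\<lambda>_ _ _. \<bar>1\<bar> * 1) (\<lambda>_ v. J (a + v) ^ q) (\<lambda>_ v. f (a + v))"
    by (rule Sy_pullback[OF f, where \<pi> = "\<lambda>_. ()" and A = "\<lambda>q x. a + x" and \<tau> = "\<lambda>b. b" and c = "\<lambda>q. 1"])
       (auto intro!: derivative_intros)
  then show ?thesis
  proof (rule Sy_mono[where D = "(2 * J a) ^ q" and D' = 1])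
    fix v
    have "J (a + v) ^ q \<le> (2 * (J a * J v)) ^ q" using J_peetre[of a v] J_pos[of "a + v"] by (intro power_mono) auto
    then show "0 \<le> J (a + v) ^ q \<and> J (a + v) ^ q \<le> (2 * J a) ^ q * J v ^ q"
      using J_pos[of "a + v"] by (simp add: power_mult_distrib mult_ac)
  qed (use J_pos[of a] in auto)
qed

lemma Sch_shift:
  assumes f: "Sch f" shows "Sch (\<lambda>v. f (a + v))"
  unfolding Sch_def
proof
  fix K
  have "Sy {()} UNIV (\<lambda>_ _ _. \<bar>1\<bar> * 1) (\<lambda>_ v. 1 / J (a + v) ^ K) (\<lambda>_ v. f (a + v))"
    by (rule Sy_pullback[OF Sch_D[OF f], where \<pi> = "\<lambda>_. ()" and A = "\<lambda>q x. a + x" and \<tau> = "\<lambda>b. b" and c = "\<lambda>q. 1"])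
       (auto intro!: derivative_intros)
  then show "Sy {()} UNIV (\<lambda>_ _ _. 1) (\<lambda>_ x. 1 / J x ^ K) (\<lambda>_ v. f (a + v))"
  proof (rule Sy_mono[where D = "(2 * J a) ^ K" and D' = 1])
    fix v
    have "J v \<le> 2 * (J a * J (a + v))" using J_peetre[of "- a" "a + v"] by simp
    then have "J v ^ K \<le> (2 * (J a * J (a + v))) ^ K" using J_pos[of v] by (intro power_mono) auto
    then show "0 \<le> 1 / J (a + v) ^ K \<and> 1 / J (a + v) ^ K \<le> (2 * J a) ^ K * (1 / J v ^ K)"
      using J_pos[of "a + v"] J_pos[of v] by (simp add: power_mult_distrib field_simps)
  qed (use J_pos[of a] in auto)
qed

lemma FT_gauss_scale:
  assumes e: "0 < e"
  shows "FT (gauss e) (v::'a::euclidean_space) = of_real (1 / sqrt e ^ DIM('a)) * FT (gauss 1) ((1 / sqrt e) *\<^sub>R v)"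
proof -
  have "FT (gauss e) v = \<bar>1 / sqrt e\<bar> ^ DIM('a) *\<^sub>R (LINT y|lborel. gauss e (0 + (1 / sqrt e) *\<^sub>R y) * cis (- ((0 + (1 / sqrt e) *\<^sub>R y) \<bullet> v)))"
    unfolding FT_def
  proof (rule integral_lborel_affine(1))
    have [measurable]: "gauss e \<in> borel_measurable (borel :: 'a measure)" by (rule integrable_Sch(3)[OF Sch_gauss[OF e]])
    show "(\<lambda>x. gauss e x * cis (- (x \<bullet> v))) \<in> borel_measurable borel" by measurable
  qed (use e in auto)
  then show ?thesis
    using e by (simp add: FT_def gauss_def scaleR_conv_of_real power_divide)
qed

text \<open>A monomial may grow, so \<open>osc_limit\<close> does not apply. Modulation by
  \<open>cis (- ((y - x) \<bullet> \<zeta>))\<close> recentres the frequency at \<zeta>, the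
  monomial then becomes the derivative \<open>PD L\<close>, and the remaining multiplier is a
  Gaussian whose transform concentrates at \<open>x\<close> on the scale
  \<open>sqrt e\<close>.\<close>

lemma osc_limit_monomial:
  fixes u :: "'a::euclidean_space \<Rightarrow> complex"
  assumes u: "tempered 0 u" and L: "L \<in> lists Basis"
  shows "(osc u (\<lambda>\<eta>. \<Prod>b\<leftarrow>L. of_real ((\<eta> - \<zeta>) \<bullet> b)) x \<longlongrightarrow>
     of_real ((2 * pi) ^ DIM('a)) * (- \<i>) ^ length L * PD L (\<lambda>y. u y * cis (- ((y - x) \<bullet> \<zeta>))) x) (at_right 0)"
proof -
  let ?n = "DIM('a)" and ?E = "{0<..<1::real}"
  define q where "q = (\<lambda>v. \<Prod>b\<leftarrow>L. complex_of_real (v \<bullet> b))"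
  define u' where "u' = (\<lambda>y. u y * cis (- ((y - x) \<bullet> \<zeta>)))"
  \<comment> \<open>The regularising Gaussian in the recentred frequency \<open>v\<close>, with the
    translation to \<open>x\<close> written as a modulation.\<close>
  define g where "g = (\<lambda>e v. gauss e (\<zeta> + v) * cis (v \<bullet> x))"
  have q: "tempered (length L) q" unfolding q_def by (rule tempered_linear_power[OF L])
  have c: "cis (- ((y - x) \<bullet> \<zeta>)) = cis (x \<bullet> \<zeta>) * cis (- (y \<bullet> \<zeta>))" for y by (simp add: cis_mult inner_diff_left)
  have u': "tempered 0 u'"
    unfolding u'_def c using Sy_mult[OF open_UNIV u Sy_cmult[OF open_UNIV tempered_cis_neg]] by simp
  have g: "Sch (g e)" if "e \<in> ?E" for e
    unfolding g_def by (intro Sch_mult(1)[OF _ tempered_cis] Sch_shift Sch_gauss) (use that in auto)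
  have gq: "Sch (\<lambda>v. g e v * q v)" if "e \<in> ?E" for e by (rule Sch_mult(1)[OF g[OF that] q])
  have gu': "Sch (\<lambda>y. gauss e y * u' y)" if "e \<in> ?E" for e
    by (intro Sch_mult(1)[OF _ u'] Sch_gauss) (use that in auto)
  have qi: "(\<Prod>b\<leftarrow>L. \<i> * complex_of_real (v \<bullet> b)) = \<i> ^ length L * q v" for v
    unfolding q_def by (induction L) (auto simp: mult_ac)
  have i: "(- \<i>) ^ length L * \<i> ^ length L = 1" by (simp flip: power_mult_distrib)
  have eq: "osc u (\<lambda>\<eta>. \<Prod>b\<leftarrow>L. of_real ((\<eta> - \<zeta>) \<bullet> b)) x e
     = (- \<i>) ^ length L * (LINT w|lborel. PD L (\<lambda>y. gauss e y * u' y) (x + sqrt e *\<^sub>R w) * (cis (\<zeta> \<bullet> (sqrt e *\<^sub>R w)) * FT (gauss 1) w))"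
    if e: "e \<in> ?E" for e
  proof -
    have m: "gauss e \<in> borel_measurable borel" "q \<in> borel_measurable borel" 
      using integrable_Sch(3)[OF Sch_gauss[of e]] e Sy_diff0[OF q] by (auto intro!: differentiable_imp_measurable)
    have 1: "gauss e y * u y * FT (\<lambda>\<eta>. gauss e \<eta> * (\<Prod>b\<leftarrow>L. of_real ((\<eta> - \<zeta>) \<bullet> b))) (y - x)
      = gauss e y * u' y * FT (\<lambda>v. g e v * q v) y" for y
    proof -
      have "FT (\<lambda>\<eta>. gauss e \<eta> * (\<Prod>b\<leftarrow>L. of_real ((\<eta> - \<zeta>) \<bullet> b))) (y - x)
        = (LINT v|lborel. gauss e (\<zeta> + v) * q v * cis (- ((\<zeta> + v) \<bullet> (y - x))))"
        unfolding FT_def q_def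
        by (subst integral_lborel_shift(1)[of _ \<zeta>, symmetric]) simp
      also have "\<dots> = (LINT v|lborel. cis (- ((y - x) \<bullet> \<zeta>)) * (g e v * q v * cis (- (v \<bullet> y))))"
      proof (rule Bochner_Integration.integral_cong[OF refl])
        fix v
        have "cis (- ((\<zeta> + v) \<bullet> (y - x))) = cis (- ((y - x) \<bullet> \<zeta>)) * (cis (v \<bullet> x) * cis (- (v \<bullet> y)))"
          by (simp add: cis_mult inner_simps inner_commute)
        then show "gauss e (\<zeta> + v) * q v * cis (- ((\<zeta> + v) \<bullet> (y - x))) = cis (- ((y - x) \<bullet> \<zeta>)) * (g e v * q v * cis (- (v \<bullet> y)))"
          by (simp add: g_def)
      qed
      also have "\<dots> = cis (- ((y - x) \<bullet> \<zeta>)) * FT (\<lambda>v. g e v * q v) y" unfolding FT_def by simp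
      finally show ?thesis by (simp add: u'_def)
    qed
    have 2: "FT (g e) y = cis (\<zeta> \<bullet> (y - x)) * FT (gauss e) (y - x)" for y
    proof -
      have "FT (gauss e) (y - x) = (LINT v|lborel. gauss e (\<zeta> + v) * cis (- ((\<zeta> + v) \<bullet> (y - x))))"
        unfolding FT_def by (subst integral_lborel_shift(1)[of _ \<zeta>, symmetric]) simp
      then have "cis (\<zeta> \<bullet> (y - x)) * FT (gauss e) (y - x) = (LINT v|lborel. cis (\<zeta> \<bullet> (y - x)) * (gauss e (\<zeta> + v) * cis (- ((\<zeta> + v) \<bullet> (y - x)))))"
        by simp
      also have "\<dots> = FT (g e) y" unfolding FT_def
      proof (rule Bochner_Integration.integral_cong[OF refl])
        fix v
        have "cis (\<zeta> \<bullet> (y - x)) * cis (- ((\<zeta> + v) \<bullet> (y - x))) = cis (v \<bullet> x) * cis (- (v \<bullet> y))"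
          by (simp add: cis_mult inner_simps)
        then show "cis (\<zeta> \<bullet> (y - x)) * (gauss e (\<zeta> + v) * cis (- ((\<zeta> + v) \<bullet> (y - x)))) = g e v * cis (- (v \<bullet> y))"
          by (simp add: g_def mult.left_commute mult.assoc)
      qed
      finally show ?thesis by simp
    qed
    have PDS: "Sch (PD L (\<lambda>y. gauss e y * u' y))" by (rule Sch_PD[OF gu'[OF e] L])
    have "osc u (\<lambda>\<eta>. \<Prod>b\<leftarrow>L. of_real ((\<eta> - \<zeta>) \<bullet> b)) x e = (LINT y|lborel. gauss e y * u' y * FT (\<lambda>v. g e v * q v) y)"
      unfolding osc_def 1 ..
    also have "\<dots> = (LINT v|lborel. FT (\<lambda>y. gauss e y * u' y) v * (g e v * q v))"
      by (rule FT_multiplication) (auto intro!: integrable_Sch gu' gq e)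
    also have "\<dots> = (LINT v|lborel. (- \<i>) ^ length L * (FT (PD L (\<lambda>y. gauss e y * u' y)) v * g e v))"
      unfolding FT_PD[OF gu'[OF e] L] qi
      by (rule Bochner_Integration.integral_cong[OF refl]) (use i in \<open>simp add: mult_ac\<close>)
    also have "\<dots> = (- \<i>) ^ length L * (LINT v|lborel. FT (PD L (\<lambda>y. gauss e y * u' y)) v * g e v)" by simp
    also have "(LINT v|lborel. FT (PD L (\<lambda>y. gauss e y * u' y)) v * g e v) = (LINT y|lborel. PD L (\<lambda>y. gauss e y * u' y) y * FT (g e) y)"
      by (rule FT_multiplication[symmetric]) (auto intro!: integrable_Sch PDS g e)
    \<comment> \<open>The substitution \<open>y = x + sqrt e *\<^sub>R w\<close> turns the
      concentrating kernel into the fixed one \<open>FT (gauss 1)\<close>; the Jacobian cancels the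
      factor \<open>1 / sqrt e ^ ?n\<close> of \<open>FT (gauss e)\<close>.\<close>
    also have "\<dots> = \<bar>sqrt e\<bar> ^ ?n *\<^sub>R (LINT w|lborel. PD L (\<lambda>y. gauss e y * u' y) (x + sqrt e *\<^sub>R w) * FT (g e) (x + sqrt e *\<^sub>R w))"
    proof (rule integral_lborel_affine(1))
      have [measurable]: "PD L (\<lambda>y. gauss e y * u' y) \<in> borel_measurable borel" "FT (g e) \<in> borel_measurable borel"
        using integrable_Sch(3)[OF PDS] FT_measurable[OF integrable_Sch(3)[OF g[OF e]]] by auto
      show "(\<lambda>y. PD L (\<lambda>y. gauss e y * u' y) y * FT (g e) y) \<in> borel_measurable borel" by measurable
    qed (use e in auto)
    also have "(LINT w|lborel. PD L (\<lambda>y. gauss e y * u' y) (x + sqrt e *\<^sub>R w) * FT (g e) (x + sqrt e *\<^sub>R w))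
      = (LINT w|lborel. of_real (1 / sqrt e ^ ?n) * (PD L (\<lambda>y. gauss e y * u' y) (x + sqrt e *\<^sub>R w) * (cis (\<zeta> \<bullet> (sqrt e *\<^sub>R w)) * FT (gauss 1) w)))"
      by (rule Bochner_Integration.integral_cong[OF refl]) (use e in \<open>simp add: 2 FT_gauss_scale[of e]\<close>)
    also have "\<dots> = of_real (1 / sqrt e ^ ?n) * (LINT w|lborel. PD L (\<lambda>y. gauss e y * u' y) (x + sqrt e *\<^sub>R w) * (cis (\<zeta> \<bullet> (sqrt e *\<^sub>R w)) * FT (gauss 1) w))"
      by (rule integral_mult_right_zero)
    also have "\<bar>sqrt e\<bar> ^ ?n *\<^sub>R \<dots> = (LINT w|lborel. PD L (\<lambda>y. gauss e y * u' y) (x + sqrt e *\<^sub>R w) * (cis (\<zeta> \<bullet> (sqrt e *\<^sub>R w)) * FT (gauss 1) w))"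
      using e by (simp add: scaleR_conv_of_real)
    finally show ?thesis .
  qed
  have g: "Sy ?E UNIV (\<lambda>_ _ _. 1) (\<lambda>_ _. 1) (\<lambda>e. gauss e :: 'a \<Rightarrow> complex)"
    by (rule Sy_mono[OF Sy_gauss[of ?E "\<lambda>e. e"], where D = 1 and D' = 1]) auto
  have gu: "Sy ?E UNIV (\<lambda>_ _ _. 1) (\<lambda>_ _. 1) (\<lambda>e y. gauss e y * u' y)"
    using Sy_mult[OF open_UNIV g tempered_imp_Sy[OF u']] by simp
  have p1: "(\<Prod>b\<leftarrow>L. 1::real) = 1" by (induction L) auto
  obtain C where C: "C \<ge> 0" "\<And>e y. e \<in> ?E \<Longrightarrow> norm (PD L (\<lambda>y. gauss e y * u' y) y) \<le> C"
    using Sy_bound0[OF Sy_PD[OF gu L]] p1 by auto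
  have "((\<lambda>e. LINT w|lborel. PD L (\<lambda>y. gauss e y * u' y) (x + sqrt e *\<^sub>R w) * (cis (\<zeta> \<bullet> (sqrt e *\<^sub>R w)) * FT (gauss 1) w))
     \<longlongrightarrow> (LINT w|(lborel :: 'a measure). PD L u' x * FT (gauss 1) w)) (at_right 0)"
  proof (rule dominated_convergence_at_right[where w = "\<lambda>w. C * norm (FT (gauss 1) w)"])
    fix w :: 'a
    have "((\<lambda>e. x + sqrt e *\<^sub>R w) \<longlongrightarrow> x + sqrt 0 *\<^sub>R w) (at_right 0)" by (intro tendsto_intros)
    then have Y: "((\<lambda>e. x + sqrt e *\<^sub>R w) \<longlongrightarrow> x) (at_right 0)" by simp
    have "((\<lambda>e. PD L (\<lambda>y. gauss e y * u' y) (x + sqrt e *\<^sub>R w)) \<longlongrightarrow> PD L (\<lambda>y. 1 * u' y) x) (at_right 0)"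
      by (rule conv_D, rule conv_PD[OF _ L], rule conv_mult[OF conv_gauss[OF Y] conv_fixed[OF u' Y]])
    moreover have "((\<lambda>e. cis (\<zeta> \<bullet> (sqrt e *\<^sub>R w)) * FT (gauss 1) w) \<longlongrightarrow> cis (\<zeta> \<bullet> (sqrt 0 *\<^sub>R w)) * FT (gauss 1) w) (at_right 0)"
      unfolding cis_conv_exp by (intro tendsto_intros)
    ultimately show "((\<lambda>e. PD L (\<lambda>y. gauss e y * u' y) (x + sqrt e *\<^sub>R w) * (cis (\<zeta> \<bullet> (sqrt e *\<^sub>R w)) * FT (gauss 1) w)) \<longlongrightarrow> PD L u' x * FT (gauss 1) w) (at_right 0)"
      by (auto intro!: tendsto_mult)
  next
    show "(\<lambda>w. PD L (\<lambda>y. gauss e y * u' y) (x + sqrt e *\<^sub>R w) * (cis (\<zeta> \<bullet> (sqrt e *\<^sub>R w)) * FT (gauss 1) w)) \<in> borel_measurable lborel"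
      if "0 < e" "e < 1" for e
    proof -
      have [measurable]: "PD L (\<lambda>y. gauss e y * u' y) \<in> borel_measurable borel" "FT (gauss 1 :: 'a \<Rightarrow> complex) \<in> borel_measurable borel"
        using integrable_Sch(3)[OF Sch_PD[OF gu' L]] FT_measurable[OF integrable_Sch(3)[OF Sch_gauss1]] that by auto
      show ?thesis by measurable
    qed
  next
    have [measurable]: "FT (gauss 1 :: 'a \<Rightarrow> complex) \<in> borel_measurable borel"
      by (rule FT_measurable[OF integrable_Sch(3)[OF Sch_gauss1]])
    show "(\<lambda>w::'a. PD L u' x * FT (gauss 1) w) \<in> borel_measurable lborel" by measurable
  qed (use C integral_FT_gauss(1) in \<open>auto simp: norm_mult intro!: mult_right_mono integrable_mult_right\<close>)
  then have "((\<lambda>e. (- \<i>) ^ length L * (LINT w|lborel. PD L (\<lambda>y. gauss e y * u' y) (x + sqrt e *\<^sub>R w) * (cis (\<zeta> \<bullet> (sqrt e *\<^sub>R w)) * FT (gauss 1) w)))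
     \<longlongrightarrow> (- \<i>) ^ length L * (LINT w|(lborel :: 'a measure). PD L u' x * FT (gauss 1) w)) (at_right 0)"
    by (rule tendsto_mult_left)
  then have "(osc u (\<lambda>\<eta>. \<Prod>b\<leftarrow>L. of_real ((\<eta> - \<zeta>) \<bullet> b)) x \<longlongrightarrow> (- \<i>) ^ length L * (LINT w|(lborel :: 'a measure). PD L u' x * FT (gauss 1) w)) (at_right 0)"
    by (rule Lim_transform_eventually) (use eq in \<open>auto intro: eventually_mono[OF eventually_at_right_01]\<close>)
  moreover have "(LINT w|(lborel :: 'a measure). PD L u' x * FT (gauss 1) w) = of_real ((2 * pi) ^ ?n) * PD L u' x"
    by (simp add: integral_FT_gauss)
  ultimately have "(osc u (\<lambda>\<eta>. \<Prod>b\<leftarrow>L. of_real ((\<eta> - \<zeta>) \<bullet> b)) x \<longlongrightarrow> (- \<i>) ^ length L * (of_real ((2 * pi) ^ ?n) * PD L u' x)) (at_right 0)"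
    by (simp only:)
  then show ?thesis unfolding u'_def by (simp only: mult_ac)
qed

section \<open>Taylor polynomials of the multiplier\<close>

fun splits :: "'a list \<Rightarrow> ('a list \<times> 'a list) list" where
  "splits [] = [([], [])]"
| "splits (b # L) = map (\<lambda>(A, B). (b # A, B)) (splits L) @ map (\<lambda>(A, B). (A, b # B)) (splits L)"

lemma splits_props:
  assumes "(A, B) \<in> set (splits L)"
  shows "length A + length B = length L" "set A \<subseteq> set L" "set B \<subseteq> set L"
  using assms by (induction L arbitrary: A B) fastforce+

lemma pd_sum_list:
  fixes f :: "'i \<Rightarrow> 'a::real_normed_vector \<Rightarrow> complex"
  assumes "\<And>i. i \<in> set I \<Longrightarrow> f i differentiable (at x)"
  shows "(\<lambda>x. \<Sum>i\<leftarrow>I. f i x) differentiable (at x) \<and> pd b (\<lambda>x. \<Sum>i\<leftarrow>I. f i x) x = (\<Sum>i\<leftarrow>I. pd b (f i) x)"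
  using assms by (induction I) (auto simp: pd_add)

lemma PD_leibniz:
  fixes f g :: "'a::euclidean_space \<Rightarrow> complex"
  assumes S: "open S"
    and f: "\<And>L x. L \<in> lists Basis \<Longrightarrow> x \<in> S \<Longrightarrow> PD L f differentiable (at x)"
    and g: "\<And>L x. L \<in> lists Basis \<Longrightarrow> x \<in> S \<Longrightarrow> PD L g differentiable (at x)"
    and "L \<in> lists Basis" "x \<in> S"
  shows "PD L (\<lambda>x. f x * g x) x = (\<Sum>(A, B)\<leftarrow>splits L. PD A f x * PD B g x)"
  using assms(4,5)
proof (induction L arbitrary: x rule: list.induct)
  case (Cons b L)
  have d: "PD A f differentiable (at y)" "PD B g differentiable (at y)" if "(A, B) \<in> set (splits L)" "y \<in> S" for A B y
    using splits_props[OF that(1)] Cons.prems(1) that(2) by (auto intro!: f g)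
  have "PD (b # L) (\<lambda>x. f x * g x) x = pd b (\<lambda>x. \<Sum>i\<leftarrow>splits L. (\<lambda>(A, B) x. PD A f x * PD B g x) i x) x"
    unfolding PD.simps
  proof (rule pd_cong[OF S Cons.prems(2)])
    fix y assume "y \<in> S"
    then have "PD L (\<lambda>x. f x * g x) y = (\<Sum>(A, B)\<leftarrow>splits L. PD A f y * PD B g y)" using Cons by auto
    also have "\<dots> = (\<Sum>i\<leftarrow>splits L. (\<lambda>(A, B) x. PD A f x * PD B g x) i y)"
      by (intro arg_cong[where f = sum_list] map_cong) auto
    finally show "PD L (\<lambda>x. f x * g x) y = (\<Sum>i\<leftarrow>splits L. (\<lambda>(A, B) x. PD A f x * PD B g x) i y)" .
  qed
  also have "\<dots> = (\<Sum>i\<leftarrow>splits L. pd b ((\<lambda>(A, B) x. PD A f x * PD B g x) i) x)"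
    by (rule pd_sum_list[THEN conjunct2]) (use d Cons.prems in \<open>auto intro!: derivative_intros\<close>)
  also have "\<dots> = (\<Sum>(A, B)\<leftarrow>splits L. PD (b # A) f x * PD B g x + PD A f x * PD (b # B) g x)"
    by (intro arg_cong[where f = sum_list] map_cong) (use d Cons.prems in \<open>auto simp: pd_mult\<close>)
  also have "\<dots> = (\<Sum>(A, B)\<leftarrow>splits (b # L). PD A f x * PD B g x)"
    by (simp add: sum_list_addf o_def case_prod_beta')
  finally show ?case .
qed simp

definition smo :: "('a::euclidean_space \<Rightarrow> complex) \<Rightarrow> bool" where
  "smo f \<longleftrightarrow> (\<forall>L\<in>lists Basis. \<forall>x. PD L f differentiable (at x))"

lemma smo_pd: "smo f \<Longrightarrow> b \<in> Basis \<Longrightarrow> smo (pd b f)"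
proof -
  assume f: "smo f" and b: "b \<in> Basis"
  have "PD L (pd b f) differentiable (at x)" if "L \<in> lists Basis" for L x
    using f b that unfolding smo_def by (metis PD_append PD.simps append_in_lists_conv Cons_in_lists_iff lists.Nil)
  then show ?thesis by (simp add: smo_def)
qed

lemma smo_PD: "smo f \<Longrightarrow> L \<in> lists Basis \<Longrightarrow> smo (PD L f)"
  by (induction L rule: list.induct) (auto intro: smo_pd)

lemma smo_D: "smo f \<Longrightarrow> f differentiable (at x)"
  unfolding smo_def by (metis PD.simps(1) lists.Nil)

lemma smo_commute: "smo f \<Longrightarrow> b \<in> Basis \<Longrightarrow> c \<in> Basis \<Longrightarrow> pd b (pd c f) = pd c (pd b f)"
  by (rule ext, rule pd_commute[OF open_UNIV UNIV_I]) (auto intro: smo_D smo_pd)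

lemma Sy_smo: "Sy P UNIV w W F \<Longrightarrow> p \<in> P \<Longrightarrow> smo (F p)"
  unfolding smo_def using Sy_D(1)[of P UNIV w W F] by blast

text \<open>The \<open>k\<close>-th differential of \<open>f\<close> at \<zeta>, evaluated on
  \<open>k\<close> copies of \<open>h\<close>, without the factor \<open>1 / fact k\<close>.\<close>

primrec tay :: "nat \<Rightarrow> ('a::euclidean_space \<Rightarrow> complex) \<Rightarrow> 'a \<Rightarrow> 'a \<Rightarrow> complex" where
  "tay 0 f \<zeta> h = f \<zeta>"
| "tay (Suc k) f \<zeta> h = (\<Sum>b\<in>Basis. of_real (h \<bullet> b) * tay k (pd b f) \<zeta> h)"

lemma pd_sum:
  fixes f :: "'i \<Rightarrow> 'a::real_normed_vector \<Rightarrow> complex"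
  assumes "finite I" "\<And>i. i \<in> I \<Longrightarrow> f i differentiable (at x)"
  shows "(\<lambda>x. \<Sum>i\<in>I. f i x) differentiable (at x) \<and> pd b (\<lambda>x. \<Sum>i\<in>I. f i x) x = (\<Sum>i\<in>I. pd b (f i) x)"
  using assms by (induction I rule: finite_induct) (auto simp: pd_add)

lemma pd_coord_shift: 
  "(\<lambda>x. complex_of_real ((x - a) \<bullet> v)) differentiable (at x)" "pd b (\<lambda>x. complex_of_real ((x - a) \<bullet> v)) x = of_real (b \<bullet> v)"
proof -
  have *: "((\<lambda>x. complex_of_real ((x - a) \<bullet> v)) has_derivative (\<lambda>x. complex_of_real (x \<bullet> v))) (at x)"
    by (auto intro!: derivative_eq_intros)
  then show "(\<lambda>x. complex_of_real ((x - a) \<bullet> v)) differentiable (at x)" by (rule differentiableI)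
  show "pd b (\<lambda>x. complex_of_real ((x - a) \<bullet> v)) x = of_real (b \<bullet> v)" using pd_has_derivative[OF *] .
qed

text \<open>The rule for differentiating a homogeneous polynomial; symmetry of mixed partials makes
  the \<open>Suc k\<close> contributions of the product rule equal.\<close>

lemma pd_tay:
  assumes "smo f"
  shows "(\<lambda>\<eta>. tay k f \<zeta> (\<eta> - \<zeta>)) differentiable (at \<eta>)"
    and "c \<in> Basis \<Longrightarrow> pd c (\<lambda>\<eta>. tay (Suc k) f \<zeta> (\<eta> - \<zeta>)) \<eta> = of_nat (Suc k) * tay k (pd c f) \<zeta> (\<eta> - \<zeta>)"
proof -
  have *: "smo f \<Longrightarrow> (\<lambda>\<eta>. tay k f \<zeta> (\<eta> - \<zeta>)) differentiable (at \<eta>)" for f k \<eta>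
  proof (induction k arbitrary: f)
    case (Suc k)
    have "(\<lambda>\<eta>. \<Sum>b\<in>Basis. of_real ((\<eta> - \<zeta>) \<bullet> b) * tay k (pd b f) \<zeta> (\<eta> - \<zeta>)) differentiable (at \<eta>)"
      by (rule pd_sum[THEN conjunct1]) (use Suc in \<open>auto intro!: differentiable_mult pd_coord_shift(1) Suc.IH smo_pd\<close>)
    then show ?case by simp
  qed auto
  then show "(\<lambda>\<eta>. tay k f \<zeta> (\<eta> - \<zeta>)) differentiable (at \<eta>)" using assms by blast
  show "pd c (\<lambda>\<eta>. tay (Suc k) f \<zeta> (\<eta> - \<zeta>)) \<eta> = of_nat (Suc k) * tay k (pd c f) \<zeta> (\<eta> - \<zeta>)" if c: "c \<in> Basis"
    using assms
  proof (induction k arbitrary: f)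
    case 0
    have "pd c (\<lambda>\<eta>. tay (Suc 0) f \<zeta> (\<eta> - \<zeta>)) \<eta> = (\<Sum>b\<in>Basis. pd c (\<lambda>\<eta>. of_real ((\<eta> - \<zeta>) \<bullet> b) * pd b f \<zeta>) \<eta>)"
      using pd_sum[of Basis "\<lambda>b \<eta>. of_real ((\<eta> - \<zeta>) \<bullet> b) * pd b f \<zeta>" \<eta> c] by (auto intro!: differentiable_mult pd_coord_shift(1))
    also have "\<dots> = (\<Sum>b\<in>Basis. of_real (c \<bullet> b) * pd b f \<zeta>)"
      by (rule sum.cong) (auto simp: pd_mult pd_coord_shift)
    also have "\<dots> = (\<Sum>b\<in>Basis. if b = c then pd b f \<zeta> else 0)"
      by (rule sum.cong) (use c in \<open>auto simp: inner_Basis\<close>)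
    also have "\<dots> = pd c f \<zeta>" using c by simp
    finally show ?case by simp
  next
    case (Suc k)
    have d: "(\<lambda>\<eta>. tay (Suc k) (pd b f) \<zeta> (\<eta> - \<zeta>)) differentiable (at \<eta>)" if "b \<in> Basis" for b
      using *[OF smo_pd[OF Suc.prems that]] .
    have "pd c (\<lambda>\<eta>. tay (Suc (Suc k)) f \<zeta> (\<eta> - \<zeta>)) \<eta> = pd c (\<lambda>\<eta>. \<Sum>b\<in>Basis. of_real ((\<eta> - \<zeta>) \<bullet> b) * tay (Suc k) (pd b f) \<zeta> (\<eta> - \<zeta>)) \<eta>"
      by (simp only: tay.simps(2)[of "Suc k"])
    also have "\<dots> = (\<Sum>b\<in>Basis. pd c (\<lambda>\<eta>. of_real ((\<eta> - \<zeta>) \<bullet> b) * tay (Suc k) (pd b f) \<zeta> (\<eta> - \<zeta>)) \<eta>)"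
      by (rule pd_sum[THEN conjunct2]) (auto simp del: tay.simps intro!: differentiable_mult pd_coord_shift(1) d)
    also have "\<dots> = (\<Sum>b\<in>Basis. of_real (c \<bullet> b) * tay (Suc k) (pd b f) \<zeta> (\<eta> - \<zeta>) +
        of_real ((\<eta> - \<zeta>) \<bullet> b) * (of_nat (Suc k) * tay k (pd b (pd c f)) \<zeta> (\<eta> - \<zeta>)))"
    proof (rule sum.cong[OF refl])
      fix b :: 'a assume b: "b \<in> Basis"
      show "pd c (\<lambda>\<eta>. of_real ((\<eta> - \<zeta>) \<bullet> b) * tay (Suc k) (pd b f) \<zeta> (\<eta> - \<zeta>)) \<eta> = of_real (c \<bullet> b) * tay (Suc k) (pd b f) \<zeta> (\<eta> - \<zeta>) +
        of_real ((\<eta> - \<zeta>) \<bullet> b) * (of_nat (Suc k) * tay k (pd b (pd c f)) \<zeta> (\<eta> - \<zeta>))"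
        using pd_mult[OF pd_coord_shift(1)[of \<zeta> b \<eta>] d[OF b], of c] Suc.IH[OF smo_pd[OF Suc.prems b]]
        by (simp only: pd_coord_shift smo_commute[OF Suc.prems c b])
    qed
    also have "\<dots> = (\<Sum>b\<in>Basis. of_real (c \<bullet> b) * tay (Suc k) (pd b f) \<zeta> (\<eta> - \<zeta>)) + of_nat (Suc k) * tay (Suc k) (pd c f) \<zeta> (\<eta> - \<zeta>)"
      by (simp add: sum.distrib sum_distrib_left mult_ac)
    also have "(\<Sum>b\<in>Basis. of_real (c \<bullet> b) * tay (Suc k) (pd b f) \<zeta> (\<eta> - \<zeta>)) = (\<Sum>b\<in>Basis. if b = c then tay (Suc k) (pd b f) \<zeta> (\<eta> - \<zeta>) else 0)"
      by (rule sum.cong) (use c in \<open>auto simp: inner_Basis simp del: tay.simps\<close>)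
    also have "\<dots> = tay (Suc k) (pd c f) \<zeta> (\<eta> - \<zeta>)" using c by (simp del: tay.simps)
    finally show ?case by (simp del: tay.simps add: algebra_simps)
  qed
qed

definition rem :: "nat \<Rightarrow> ('a::euclidean_space \<Rightarrow> complex) \<Rightarrow> 'a \<Rightarrow> 'a \<Rightarrow> complex" where
  "rem N f \<zeta> \<eta> = f \<eta> - (\<Sum>k<N. tay k f \<zeta> (\<eta> - \<zeta>) / fact k)"

lemma rem_0 [simp]: "rem 0 f \<zeta> = f" by (simp add: rem_def fun_eq_iff)

lemma rem_differentiable: "smo f \<Longrightarrow> rem N f \<zeta> differentiable (at \<eta>)"
  unfolding rem_def[abs_def]
  by (rule differentiable_diff[OF smo_D pd_sum[THEN conjunct1]])
     (auto simp: divide_inverse intro!: differentiable_mult pd_tay(1))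

text \<open>The truncated subtraction is intended: at order 0 nothing has been subtracted, and the
  remainder is \<open>f\<close> itself.\<close>

lemma pd_rem:
  assumes f: "smo f" and c: "c \<in> Basis"
  shows "pd c (rem N f \<zeta>) = rem (N - 1) (pd c f) \<zeta>"
proof (cases N)
  case (Suc n)
  show ?thesis
  proof
    fix \<eta>
    have dk: "(\<lambda>\<eta>. (1 / fact k) * tay k f \<zeta> (\<eta> - \<zeta>)) differentiable (at \<eta>)" for k
      by (intro differentiable_mult pd_tay(1)[OF f]) auto
    have "pd c (rem N f \<zeta>) \<eta> = pd c (\<lambda>\<eta>. f \<eta> + (-1) * (\<Sum>k<Suc n. (1 / fact k) * tay k f \<zeta> (\<eta> - \<zeta>))) \<eta>"
      by (intro arg_cong[where f = "\<lambda>g. pd c g \<eta>"]) (simp add: rem_def fun_eq_iff Suc)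
    also have "\<dots> = pd c f \<eta> + (-1) * (\<Sum>k<Suc n. pd c (\<lambda>\<eta>. (1 / fact k) * tay k f \<zeta> (\<eta> - \<zeta>)) \<eta>)"
    proof -
      have s: "(\<lambda>\<eta>. \<Sum>k<Suc n. (1 / fact k) * tay k f \<zeta> (\<eta> - \<zeta>)) differentiable (at \<eta>)"
        "pd c (\<lambda>\<eta>. \<Sum>k<Suc n. (1 / fact k) * tay k f \<zeta> (\<eta> - \<zeta>)) \<eta> = (\<Sum>k<Suc n. pd c (\<lambda>\<eta>. (1 / fact k) * tay k f \<zeta> (\<eta> - \<zeta>)) \<eta>)"
        using pd_sum[of "{..<Suc n}" "\<lambda>k \<eta>. (1 / fact k) * tay k f \<zeta> (\<eta> - \<zeta>)" \<eta> c] dk by blast+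
      show ?thesis
        using pd_add[OF smo_D[OF f] differentiable_mult[OF differentiable_const s(1)], of c "-1"] pd_cmult[OF s(1), of c "-1"] s(2)
        by (simp only:)
    qed
    also have "(\<Sum>k<Suc n. pd c (\<lambda>\<eta>. (1 / fact k) * tay k f \<zeta> (\<eta> - \<zeta>)) \<eta>) = (\<Sum>k<n. pd c (\<lambda>\<eta>. (1 / fact (Suc k)) * tay (Suc k) f \<zeta> (\<eta> - \<zeta>)) \<eta>)"
      by (subst sum.lessThan_Suc_shift) (simp add: pd_const)
    also have "\<dots> = (\<Sum>k<n. tay k (pd c f) \<zeta> (\<eta> - \<zeta>) / fact k)"
    proof (rule sum.cong[OF refl])
      fix k
      have "pd c (\<lambda>\<eta>. (1 / fact (Suc k)) * tay (Suc k) f \<zeta> (\<eta> - \<zeta>)) \<eta> = (1 / fact (Suc k)) * (of_nat (Suc k) * tay k (pd c f) \<zeta> (\<eta> - \<zeta>))"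
        using pd_cmult[OF pd_tay(1)[OF f, of "Suc k"]] pd_tay(2)[OF f c] by metis
      then show "pd c (\<lambda>\<eta>. (1 / fact (Suc k)) * tay (Suc k) f \<zeta> (\<eta> - \<zeta>)) \<eta> = tay k (pd c f) \<zeta> (\<eta> - \<zeta>) / fact k"
        by (simp add: field_simps del: of_nat_Suc tay.simps)
    qed
    also have "pd c f \<eta> + (-1) * \<dots> = rem (N - 1) (pd c f) \<zeta> \<eta>" by (simp add: rem_def Suc)
    finally show "pd c (rem N f \<zeta>) \<eta> = rem (N - 1) (pd c f) \<zeta> \<eta>" .
  qed
qed simp

lemma PD_rem:
  assumes f: "smo f" and L: "L \<in> lists Basis"
  shows "PD L (rem N f \<zeta>) = rem (N - length L) (PD L f) \<zeta>"
  using L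
proof (induction L rule: list.induct)
  case (Cons b L)
  then show ?case using pd_rem[OF smo_PD[OF f, of L], of b "N - length L" \<zeta>] by simp
qed simp

lemma rem_at_center: "rem (Suc N) f \<zeta> \<zeta> = 0"
proof -
  have "tay k f \<zeta> 0 = (if k = 0 then f \<zeta> else 0)" for k by (cases k) auto
  then have "rem (Suc N) f \<zeta> \<zeta> = f \<zeta> - (\<Sum>k<Suc N. (if k = 0 then f \<zeta> else 0) / fact k)" by (simp add: rem_def)
  also have "(\<Sum>k<Suc N. (if k = 0 then f \<zeta> else 0) / fact k) = f \<zeta>" by (subst sum.lessThan_Suc_shift) simp
  finally show ?thesis by simp
qed

text \<open>Induction on \<open>N\<close>, since a derivative of a remainder is a remainder of order
  one less. The factor \<open>DIM('a)\<close> per order comes from the sum over the basis; the gain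
  \<open>1 / fact N\<close> is given up. The claim is made along the whole segment so that the
  induction hypothesis is available at intermediate points.\<close>

lemma rem_bound:
  fixes f :: "'a::euclidean_space \<Rightarrow> complex"
  assumes "smo f" "\<And>L s. L \<in> lists Basis \<Longrightarrow> length L = N \<Longrightarrow> 0 \<le> s \<Longrightarrow> s \<le> 1 \<Longrightarrow> norm (PD L f (\<zeta> + s *\<^sub>R h)) \<le> A"
    "0 \<le> s" "s \<le> 1" "0 \<le> A"
  shows "norm (rem N f \<zeta> (\<zeta> + s *\<^sub>R h)) \<le> (real DIM('a) * norm h) ^ N * A"
  using assms
proof (induction N arbitrary: f s)
  case 0
  then show ?case using 0(2)[of "[]" s] by simp
next
  case (Suc N)
  let ?B = "(real DIM('a) * norm h) ^ N * A"
  have IH: "norm (rem N (pd b f) \<zeta> (\<zeta> + r *\<^sub>R h)) \<le> ?B" if b: "b \<in> Basis" and r: "0 \<le> r" "r \<le> 1" for b r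
  proof (rule Suc.IH[OF smo_pd[OF Suc.prems(1) b] _ r Suc.prems(5)])
    fix L :: "'a list" and s assume L: "L \<in> lists Basis" "length L = N" "0 \<le> s" "s \<le> (1::real)"
    then show "norm (PD L (pd b f) (\<zeta> + s *\<^sub>R h)) \<le> A"
      using Suc.prems(2)[of "L @ [b]" s] b by (simp add: PD_append)
  qed
  have dR: "rem (Suc N) f \<zeta> differentiable (at y)" for y by (rule rem_differentiable[OF Suc.prems(1)])
  define F where "F = (\<lambda>r. rem (Suc N) f \<zeta> (\<zeta> + r *\<^sub>R h))"
  define F' where "F' = (\<lambda>r. \<Sum>b\<in>Basis. (h \<bullet> b) *\<^sub>R rem N (pd b f) \<zeta> (\<zeta> + r *\<^sub>R h))"
  have "norm (F s - F 0) \<le> (real DIM('a) * norm h * ?B) * \<bar>s\<bar>"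
  proof (rule line_bound[where f' = F'])
    fix r assume "r \<in> closed_segment 0 s"
    then have r: "0 \<le> r" "r \<le> 1" using Suc.prems by (auto simp: closed_segment_eq_real_ivl)
    have "pd h (rem (Suc N) f \<zeta>) (\<zeta> + r *\<^sub>R h) = F' r"
      using pd_has_derivative[OF has_derivative_pd[OF dR]] by (simp add: F'_def pd_rem[OF Suc.prems(1)])
    then show "(F has_vector_derivative F' r) (at r within closed_segment 0 s)"
      unfolding F_def using pd_line[of "rem (Suc N) f \<zeta>" \<zeta> r h, OF dR] by simp
    have "norm (F' r) \<le> (\<Sum>b\<in>(Basis::'a set). norm h * ?B)"
      unfolding F'_def
    proof (rule order_trans[OF norm_sum], rule sum_mono)
      fix b :: 'a assume b: "b \<in> Basis"
      show "norm ((h \<bullet> b) *\<^sub>R rem N (pd b f) \<zeta> (\<zeta> + r *\<^sub>R h)) \<le> norm h * ?B"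
        using Basis_le_norm[OF b, of h] IH[OF b r] by (simp add: mult_mono)
    qed
    then show "norm (F' r) \<le> real DIM('a) * norm h * ?B" by simp
  qed
  also have "\<dots> \<le> real DIM('a) * norm h * ?B * 1"
    using Suc.prems by (intro mult_left_mono mult_nonneg_nonneg) auto
  finally show ?case by (simp add: F_def rem_at_center mult_ac)
qed

lemma lists_length_Suc:
  "{L. L \<in> lists B \<and> length L = Suc k} = (\<lambda>(b, L). L @ [b]) ` (B \<times> {L. L \<in> lists B \<and> length L = k})"
proof (intro set_eqI iffI)
  fix L assume "L \<in> {L. L \<in> lists B \<and> length L = Suc k}"
  then show "L \<in> (\<lambda>(b, L). L @ [b]) ` (B \<times> {L. L \<in> lists B \<and> length L = k})"
    by (cases L rule: rev_cases) (auto simp: image_iff)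
qed auto

lemma finite_lists_Basis: "finite {L. L \<in> lists (Basis :: 'a::euclidean_space set) \<and> length L = k}"
  using finite_lists_length_eq[of "Basis :: 'a set" k] by (rule back_subst[of finite]) auto

text \<open>Ordered lists take the place of multi-indices, so each multi-index occurs with its
  multinomial multiplicity; \<open>term_symbol\<close> regroups the lists later.\<close>

lemma tay_eq_sum:
  "tay k f \<zeta> h = (\<Sum>L | L \<in> lists Basis \<and> length L = k. PD L f \<zeta> * (\<Prod>b\<leftarrow>L. of_real (h \<bullet> b)))"
proof (induction k arbitrary: f)
  case 0
  have "{L. L \<in> lists (Basis::'a set) \<and> length L = 0} = {[]}" by auto
  then show ?case by simp
next
  case (Suc k)
  have inj: "inj_on (\<lambda>(b, L). L @ [b]) ((Basis::'a set) \<times> {L. L \<in> lists Basis \<and> length L = k})"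
    by (auto simp: inj_on_def)
  have "(\<Sum>L | L \<in> lists Basis \<and> length L = Suc k. PD L f \<zeta> * (\<Prod>b\<leftarrow>L. of_real (h \<bullet> b)))
    = (\<Sum>(b, L)\<in>Basis \<times> {L. L \<in> lists Basis \<and> length L = k}. PD (L @ [b]) f \<zeta> * (\<Prod>b\<leftarrow>L @ [b]. of_real (h \<bullet> b)))"
    unfolding lists_length_Suc by (subst sum.reindex[OF inj]) (simp add: case_prod_beta)
  also have "\<dots> = (\<Sum>b\<in>Basis. of_real (h \<bullet> b) * (\<Sum>L | L \<in> lists Basis \<and> length L = k. PD L (pd b f) \<zeta> * (\<Prod>b\<leftarrow>L. of_real (h \<bullet> b))))"
    by (simp add: sum.cartesian_product[symmetric] PD_append sum_distrib_left mult_ac)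
  finally show ?case by (simp add: Suc)
qed

lemma tempered_mono:
  assumes "tempered q f" "q \<le> r" shows "tempered r f"
  by (rule Sy_mono[OF assms(1) open_UNIV, where D = 1 and D' = 1])
     (use assms(2) in \<open>auto simp: J_power_mono less_imp_le[OF J_pos]\<close>)

lemma tempered_monomial:
  assumes "L \<in> lists Basis" shows "tempered (length L) (\<lambda>\<eta>. \<Prod>b\<leftarrow>L. complex_of_real ((\<eta> - \<zeta>) \<bullet> b))"
  using tempered_shift[OF tempered_linear_power[OF assms], of "- \<zeta>"] by simp

lemma tempered_tay:
  assumes "k \<le> N" shows "tempered N (\<lambda>\<eta>. tay k f \<zeta> (\<eta> - \<zeta>))"
  unfolding tay_eq_sum
  by (intro Sy_sum Sy_cmult tempered_mono[OF tempered_monomial])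
     (use assms finite_lists_Basis in \<open>auto simp: less_imp_le[OF J_pos]\<close>)

section \<open>The regularised integral as a linear functional of the multiplier\<close>

lemma osc_integrable:
  fixes u p :: "'a::euclidean_space \<Rightarrow> complex"
  assumes u: "tempered 0 u" and p: "tempered q p" and e: "0 < e"
  shows "integrable lborel (\<lambda>y. gauss e y * u y * FT (\<lambda>\<eta>. gauss e \<eta> * p \<eta>) (y - x))"
proof -
  have S: "Sch (\<lambda>y. gauss e y * u y)" "Sch (\<lambda>y. gauss e y * p y)"
    by (intro Sch_mult(1)[OF Sch_gauss[OF e] u] Sch_mult(1)[OF Sch_gauss[OF e] p])+
  note [measurable] = integrable_Sch(3)[OF S(1)] FT_measurable[OF integrable_Sch(3)[OF S(2)]]
  show ?thesis
  proof (rule Bochner_Integration.integrable_bound)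
    show "integrable lborel (\<lambda>y. norm (gauss e y * u y) * (LINT y|lborel. norm (gauss e y * p y)))"
      by (intro integrable_mult_left integrable_norm integrable_Sch S)
    show "AE y in lborel. norm (gauss e y * u y * FT (\<lambda>\<eta>. gauss e \<eta> * p \<eta>) (y - x)) \<le> norm (norm (gauss e y * u y) * (LINT y|lborel. norm (gauss e y * p y)))"
    proof (intro always_eventually allI)
      fix y
      have "norm (FT (\<lambda>\<eta>. gauss e \<eta> * p \<eta>) (y - x)) \<le> \<bar>LINT y|lborel. norm (gauss e y * p y)\<bar>"
        by (rule order_trans[OF FT_bound[OF integrable_Sch(1)[OF S(2)]] abs_ge_self])
      then show "norm (gauss e y * u y * FT (\<lambda>\<eta>. gauss e \<eta> * p \<eta>) (y - x)) \<le> norm (norm (gauss e y * u y) * (LINT y|lborel. norm (gauss e y * p y)))"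
        unfolding norm_mult[of "gauss e y * u y"] real_norm_def abs_mult abs_norm_cancel by (rule mult_left_mono) simp
    qed
  qed measurable
qed

lemma osc_diff:
  assumes u: "tempered 0 u" and p: "tempered q p" and p': "tempered q' p'" and e: "0 < e"
  shows "osc u (\<lambda>\<eta>. p \<eta> - p' \<eta>) x e = osc u p x e - osc u p' x e"
proof -
  have i: "integrable lborel (\<lambda>y. gauss e y * p y)" "integrable lborel (\<lambda>y. gauss e y * p' y)"
    by (intro integrable_Sch Sch_mult(1)[OF Sch_gauss[OF e] p] Sch_mult(1)[OF Sch_gauss[OF e] p'])+
  show ?thesis
    unfolding osc_def Bochner_Integration.integral_diff[OF osc_integrable[OF u p e] osc_integrable[OF u p' e], symmetric]
      right_diff_distrib FT_diff[OF i] ..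
qed

lemma osc_cmult: "osc u (\<lambda>\<eta>. c * p \<eta>) x e = c * osc u p x e"
proof -
  have "FT (\<lambda>\<eta>. gauss e \<eta> * (c * p \<eta>)) z = c * FT (\<lambda>\<eta>. gauss e \<eta> * p \<eta>) z" for z
    unfolding FT_cmult[symmetric] by (simp add: mult_ac)
  then show ?thesis unfolding osc_def by (simp add: mult_ac flip: integral_mult_right_zero)
qed

lemma osc_sum:
  assumes u: "tempered 0 u" and "finite I" and p: "\<And>i. i \<in> I \<Longrightarrow> tempered q (p i)" and e: "0 < e"
  shows "osc u (\<lambda>\<eta>. \<Sum>i\<in>I. p i \<eta>) x e = (\<Sum>i\<in>I. osc u (p i) x e)"
proof -
  have "FT (\<lambda>\<eta>. gauss e \<eta> * (\<Sum>i\<in>I. p i \<eta>)) z = (\<Sum>i\<in>I. FT (\<lambda>\<eta>. gauss e \<eta> * p i \<eta>) z)" for z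
    unfolding sum_distrib_left
    by (rule FT_sum) (intro integrable_Sch Sch_mult(1)[OF Sch_gauss[OF e] p])
  then have "osc u (\<lambda>\<eta>. \<Sum>i\<in>I. p i \<eta>) x e = (LINT y|lborel. (\<Sum>i\<in>I. gauss e y * u y * FT (\<lambda>\<eta>. gauss e \<eta> * p i \<eta>) (y - x)))"
    by (simp add: osc_def sum_distrib_left)
  also have "\<dots> = (\<Sum>i\<in>I. osc u (p i) x e)"
    unfolding osc_def by (rule Bochner_Integration.integral_sum) (rule osc_integrable[OF u p e])
  finally show ?thesis .
qed

text \<open>Linearity is applied at fixed \<open>e\<close>, where the Gaussians make the integrals
  for all the Taylor terms converge; afterwards each piece has its own limit, the given one for
  \<open>p\<close> and \<open>osc_limit_monomial\<close> for the monomials.\<close>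

lemma osc_rem_limit:
  fixes u p :: "'a::euclidean_space \<Rightarrow> complex"
  assumes u: "tempered 0 u" and p: "tempered 0 p" and l: "(osc u p x \<longlongrightarrow> l) (at_right 0)"
  shows "(osc u (rem N p \<zeta>) x \<longlongrightarrow> l - (\<Sum>k<N. (\<Sum>L | L \<in> lists Basis \<and> length L = k. PD L p \<zeta> *
      (of_real ((2 * pi) ^ DIM('a)) * (- \<i>) ^ length L * PD L (\<lambda>y. u y * cis (- ((y - x) \<bullet> \<zeta>))) x)) / fact k)) (at_right 0)"
proof -
  define mon where "mon = (\<lambda>L \<eta>. \<Prod>b\<leftarrow>L. complex_of_real ((\<eta> - \<zeta>) \<bullet> b))"
  have m: "tempered N (mon L)" if "L \<in> lists Basis" "length L \<le> N" for L
    unfolding mon_def using tempered_mono[OF tempered_monomial[OF that(1)] that(2)] .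
  have eq: "osc u (rem N p \<zeta>) x e = osc u p x e - (\<Sum>k<N. (\<Sum>L | L \<in> lists Basis \<and> length L = k. PD L p \<zeta> * osc u (mon L) x e) / fact k)"
    if e: "0 < e" for e
  proof -
    have t: "tempered N (\<lambda>\<eta>. \<Sum>L | L \<in> lists Basis \<and> length L = k. PD L p \<zeta> * mon L \<eta>)" if "k < N" for k
      by (intro Sy_sum Sy_cmult m) (use that finite_lists_Basis in \<open>auto simp: less_imp_le[OF J_pos]\<close>)
    have t2: "tempered N (\<lambda>\<eta>. \<Sum>k<N. (1 / fact k) * (\<Sum>L | L \<in> lists Basis \<and> length L = k. PD L p \<zeta> * mon L \<eta>))"
      by (rule Sy_sum) (use t in \<open>auto simp del: times_divide_eq_left mult_1 intro!: Sy_cmult simp: less_imp_le[OF J_pos]\<close>)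
    have "rem N p \<zeta> = (\<lambda>\<eta>. p \<eta> - (\<Sum>k<N. (1 / fact k) * (\<Sum>L | L \<in> lists Basis \<and> length L = k. PD L p \<zeta> * mon L \<eta>)))"
      by (simp add: rem_def fun_eq_iff tay_eq_sum mon_def)
    then have "osc u (rem N p \<zeta>) x e = osc u p x e - osc u (\<lambda>\<eta>. \<Sum>k<N. (1 / fact k) * (\<Sum>L | L \<in> lists Basis \<and> length L = k. PD L p \<zeta> * mon L \<eta>)) x e"
      by (simp only: osc_diff[OF u p t2 e])
    also have "osc u (\<lambda>\<eta>. \<Sum>k<N. (1 / fact k) * (\<Sum>L | L \<in> lists Basis \<and> length L = k. PD L p \<zeta> * mon L \<eta>)) x e
       = (\<Sum>k<N. osc u (\<lambda>\<eta>. (1 / fact k) * (\<Sum>L | L \<in> lists Basis \<and> length L = k. PD L p \<zeta> * mon L \<eta>)) x e)"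
      by (rule osc_sum[OF u _ _ e, where q = N]) (simp, rule Sy_cmult[OF open_UNIV t], simp)
    also have "\<dots> = (\<Sum>k<N. (\<Sum>L | L \<in> lists Basis \<and> length L = k. PD L p \<zeta> * osc u (mon L) x e) / fact k)"
    proof (rule sum.cong[OF refl])
      fix k assume k: "k \<in> {..<N}"
      have "osc u (\<lambda>\<eta>. \<Sum>L | L \<in> lists Basis \<and> length L = k. PD L p \<zeta> * mon L \<eta>) x e = (\<Sum>L | L \<in> lists Basis \<and> length L = k. osc u (\<lambda>\<eta>. PD L p \<zeta> * mon L \<eta>) x e)"
        by (rule osc_sum[OF u finite_lists_Basis _ e]) (use k in \<open>auto intro!: Sy_cmult m\<close>)
      then show "osc u (\<lambda>\<eta>. (1 / fact k) * (\<Sum>L | L \<in> lists Basis \<and> length L = k. PD L p \<zeta> * mon L \<eta>)) x e = (\<Sum>L | L \<in> lists Basis \<and> length L = k. PD L p \<zeta> * osc u (mon L) x e) / fact k"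
        unfolding osc_cmult by simp
    qed
    finally show ?thesis .
  qed
  have lim: "(osc u (mon L) x \<longlongrightarrow> of_real ((2 * pi) ^ DIM('a)) * (- \<i>) ^ length L * PD L (\<lambda>y. u y * cis (- ((y - x) \<bullet> \<zeta>))) x) (at_right 0)"
    if "L \<in> {L. L \<in> lists Basis \<and> length L = k}" for L k
    unfolding mon_def using that by (intro osc_limit_monomial[OF u]) auto
  have "((\<lambda>e. osc u p x e - (\<Sum>k<N. (\<Sum>L | L \<in> lists Basis \<and> length L = k. PD L p \<zeta> * osc u (mon L) x e) / fact k)) \<longlongrightarrow>
     l - (\<Sum>k<N. (\<Sum>L | L \<in> lists Basis \<and> length L = k. PD L p \<zeta> *
      (of_real ((2 * pi) ^ DIM('a)) * (- \<i>) ^ length L * PD L (\<lambda>y. u y * cis (- ((y - x) \<bullet> \<zeta>))) x)) / fact k)) (at_right 0)"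
    by (intro tendsto_diff tendsto_sum tendsto_divide tendsto_mult_left l lim tendsto_const) auto
  then show ?thesis
    by (rule Lim_transform_eventually) (use eq in \<open>auto intro: eventually_mono[OF eventually_at_right_01]\<close>)
qed

section \<open>Bound for the Taylor remainder\<close>

lemma PD_affine:
  assumes f: "smo f" and L: "L \<in> lists Basis"
  shows "PD L (\<lambda>v. f (a + s *\<^sub>R v)) = (\<lambda>v. of_real s ^ length L * PD L f (a + s *\<^sub>R v))"
  using L
proof (induction L rule: list.induct)
  case (Cons b L)
  have L: "L \<in> lists Basis" using Cons.prems by simp
  have d: "PD L f differentiable (at x)" for x using smo_D[OF smo_PD[OF f L]] .
  have d': "(\<lambda>v. PD L f (a + s *\<^sub>R v)) differentiable (at x)" for x
    using differentiable_chain_at[of "\<lambda>v. a + s *\<^sub>R v" x "PD L f"] d by (auto simp: o_def intro!: derivative_intros)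
  show ?case
  proof
    fix v
    have "PD (b # L) (\<lambda>v. f (a + s *\<^sub>R v)) v = pd b (\<lambda>v. of_real s ^ length L * PD L f (a + s *\<^sub>R v)) v"
      using Cons by simp
    also have "\<dots> = of_real s ^ length L * pd b (\<lambda>v. PD L f (a + s *\<^sub>R v)) v"
      by (rule pd_cmult[OF d'])
    also have "pd b (\<lambda>v. PD L f (a + s *\<^sub>R v)) v = of_real s * pd b (PD L f) (a + s *\<^sub>R v)"
      by (rule pd_affine) (auto simp: d algebra_simps)
    finally show "PD (b # L) (\<lambda>v. f (a + s *\<^sub>R v)) v = of_real s ^ length (b # L) * PD (b # L) f (a + s *\<^sub>R v)"
      by simp
  qed
qed simp

lemma J_scale_le: "J (s *\<^sub>R v) \<le> max 1 (s\<^sup>2) * J v"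
proof -
  have "s\<^sup>2 * (v \<bullet> v) \<le> max 1 (s\<^sup>2) * (v \<bullet> v)" by (rule mult_right_mono) auto
  moreover have "1 \<le> max 1 (s\<^sup>2)" by simp
  ultimately show ?thesis by (simp add: J_def power2_eq_square mult.assoc distrib_left)
qed

lemma J_mono: "norm x \<le> norm y \<Longrightarrow> J x \<le> J y"
  by (simp add: J_norm power_mono)

lemma norm_LINT_le:
  fixes f :: "'a \<Rightarrow> complex"
  assumes "integrable M f" "integrable M g" "\<And>x. norm (f x) \<le> g x"
  shows "norm (LINT x|M. f x) \<le> (LINT x|M. g x)"
  by (rule order_trans[OF integral_norm_bound Bochner_Integration.integral_mono]) (use assms in auto)

lemma Sch_affine:
  assumes f: "Sch f" and s: "s \<noteq> 0" shows "Sch (\<lambda>v. f (a + s *\<^sub>R v))"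
  unfolding Sch_def
proof
  fix K
  let ?M = "max 1 ((1/s)\<^sup>2) * (2 * J a)"
  have "Sy {()} UNIV (\<lambda>_ _ _. \<bar>s\<bar> * 1) (\<lambda>_ v. 1 / J (a + s *\<^sub>R v) ^ K) (\<lambda>_ v. f (a + s *\<^sub>R v))"
    by (rule Sy_pullback[OF Sch_D[OF f], where \<pi> = "\<lambda>_. ()" and A = "\<lambda>q x. a + s *\<^sub>R x" and \<tau> = "\<lambda>b. b" and c = "\<lambda>q. s"])
       (auto simp: algebra_simps intro!: derivative_intros)
  then show "Sy {()} UNIV (\<lambda>_ _ _. 1) (\<lambda>_ x. 1 / J x ^ K) (\<lambda>_ v. f (a + s *\<^sub>R v))"
  proof (rule Sy_mono[where D = "?M ^ K" and D' = "\<bar>s\<bar>"])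
    fix v
    have "J v = J ((1/s) *\<^sub>R (- a + (a + s *\<^sub>R v)))" using s by simp
    also have "\<dots> \<le> max 1 ((1/s)\<^sup>2) * J (- a + (a + s *\<^sub>R v))" by (rule J_scale_le)
    also have "\<dots> \<le> max 1 ((1/s)\<^sup>2) * (2 * (J (- a) * J (a + s *\<^sub>R v)))"
      by (intro mult_left_mono J_peetre) auto
    finally have "J v \<le> ?M * J (a + s *\<^sub>R v)" by (simp add: mult_ac)
    then have "J v ^ K \<le> (?M * J (a + s *\<^sub>R v)) ^ K" using J_pos[of v] by (intro power_mono) auto
    then show "0 \<le> 1 / J (a + s *\<^sub>R v) ^ K \<and> 1 / J (a + s *\<^sub>R v) ^ K \<le> ?M ^ K * (1 / J v ^ K)"
      using J_pos[of "a + s *\<^sub>R v"] J_pos[of v] by (simp add: power_mult_distrib field_simps)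
  qed (use J_pos[of a] in auto)
qed

text \<open>Each derivative costs a factor \<open>J w\<close>, which is recovered by starting from
  the decay of order \<open>K + length L\<close>.\<close>

lemma Sy_imp_Sch:
  assumes h: "\<And>K. Sy Par UNIV (\<lambda>_ _ w. J w) (\<lambda>_ w. 1 / J w ^ K) h" and p: "p \<in> Par"
  shows "Sch (h p)"
  unfolding Sch_def
proof (intro allI Sy_I)
  fix K and L :: "'b list" assume L: "L \<in> lists Basis"
  show "PD L (h p) differentiable (at x)" for x using Sy_D(1)[OF h[of 0] L p] by simp
  have "(\<Prod>b\<leftarrow>L. J w) = J w ^ length L" for w :: 'b by (induction L) auto
  moreover have "(\<Prod>b\<leftarrow>L. 1::real) = 1" by (induction L) auto
  ultimately show "\<exists>C\<ge>0. \<forall>_\<in>{()}. \<forall>x\<in>UNIV. norm (PD L (h p) x) \<le> C * (1 / J x ^ K * (\<Prod>b\<leftarrow>L. 1))"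
    using Sy_D(2)[OF h[of "K + length L"] L] p by (auto simp: power_add)
qed

text \<open>Integration by parts makes the multiplier integrable. Derivatives of the multiplier then
  give decay in \<open>w - a\<close>, the decay of \<open>h\<close> gives decay in \<open>w\<close>,
  and Peetre's inequality merges the two into decay in \<open>a\<close>. Membership in
  \<open>Sch\<close> legitimises the identity; the constant depends on the uniform bounds
  alone.\<close>

lemma oscillatory_bound:
  fixes h P :: "'p \<Rightarrow> 'a::euclidean_space \<Rightarrow> complex"
  assumes h: "\<And>K. Sy Par UNIV (\<lambda>_ _ w. J w) (\<lambda>_ w. 1 / J w ^ K) h"
    and P: "Sy Par UNIV (\<lambda>_ _ v. J v) (\<lambda>p v. B p * J v ^ A) P"
    and B: "\<And>p. p \<in> Par \<Longrightarrow> 0 \<le> B p" and SP: "\<And>p. p \<in> Par \<Longrightarrow> Sch (P p)"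
  shows "\<exists>C\<ge>0. \<forall>p\<in>Par. \<forall>a. norm (LINT w|lborel. h p w * FT (P p) (w - a)) \<le> C * B p / J a ^ D"
proof -
  let ?n = "DIM('a)"
  \<comment> \<open>\<open>A\<close> compensates the growth of the multiplier, \<open>2 * D\<close>
    the cost of \<open>lap ^^ D\<close>, and \<open>?n\<close> leaves an integrable
    function.\<close>
  define k where "k = A + 2 * D + ?n"
  define g where "g = (\<lambda>p v. P p v / of_real (J v) ^ k)"
  define I0 where "I0 = (LINT v|lborel. 1 / J (v::'a) ^ ?n)"
  have I0: "I0 \<ge> 0" unfolding I0_def by (rule integral_nonneg_AE) (auto simp: less_imp_le[OF J_pos])
  have "Sy Par UNIV (\<lambda>_ _ v. J v) (\<lambda>_ v::'a. 1 / J v ^ k) (\<lambda>_ v. 1 / complex_of_real (J v) ^ k)"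
    by (rule Sy_mono[OF Sy_J_inverse open_UNIV, where D = 1 and D' = 1]) (auto simp: J_ge1 less_imp_le[OF J_pos])
  from Sy_mult[OF open_UNIV P this] have g: "Sy Par UNIV (\<lambda>_ _ v. J v) (\<lambda>p v. B p * J v ^ A * (1 / J v ^ k)) g"
    by (simp add: g_def)
  have Sh: "Sch (h p)" if "p \<in> Par" for p using Sy_imp_Sch[OF h that] .
  have Sg: "Sch (g p)" if "p \<in> Par" for p unfolding g_def by (rule Sch_div_J[OF SP[OF that]])
  have "Sy Par UNIV (\<lambda>_ _ v. J v) (\<lambda>p v. B p * J v ^ A * (1 / J v ^ k) * J v ^ (2 * D)) (\<lambda>p. (lap ^^ D) (g p))"
    by (rule Sy_lap_power[OF g]) (auto simp: B J_ge1 less_imp_le[OF J_pos])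
  from Sy_bound0[OF this] obtain C2 where C2: "C2 \<ge> 0" 
    "\<And>p v. p \<in> Par \<Longrightarrow> norm ((lap ^^ D) (g p) v) \<le> C2 * (B p * J v ^ A * (1 / J v ^ k) * J v ^ (2 * D))" by auto
  have C2': "norm ((lap ^^ D) (g p) v) \<le> (C2 * B p) * (1 / J v ^ ?n)" if "p \<in> Par" for p v
    using C2(2)[OF that, of v] by (simp add: k_def power_add)
  have FTg: "norm (FT (g p) z) \<le> C2 * B p * I0 / J z ^ D" if p: "p \<in> Par" for p z
  proof (rule order_trans[OF FT_decay[OF Sg[OF p], of z D]])
    have "(LINT y|lborel. norm ((lap ^^ D) (g p) y)) \<le> (LINT v|lborel. (C2 * B p) * (1 / J (v::'a) ^ ?n))"
      by (rule Bochner_Integration.integral_mono)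
         (use C2'[OF p] in \<open>auto intro!: integrable_norm integrable_Sch(1) Sch_lap_power Sg p integrable_J'\<close>)
    also have "\<dots> = C2 * B p * I0" unfolding I0_def by (rule integral_mult_right_zero)
    finally show "(LINT y|lborel. norm ((lap ^^ D) (g p) y)) / J z ^ D \<le> C2 * B p * I0 / J z ^ D"
      using J_pos[of z] by (intro divide_right_mono) auto
  qed
  \<comment> \<open>Of the decay of \<open>h\<close>, the part \<open>2 * k\<close> pays for
    \<open>lap ^^ k\<close>, \<open>D\<close> is spent in Peetre's inequality and \<open>?n\<close>
    on integrability.\<close>
  have "Sy Par UNIV (\<lambda>_ _ v. J v) (\<lambda>_ v. 1 / J v ^ (2 * k + (D + ?n)) * J v ^ (2 * k)) (\<lambda>p. (lap ^^ k) (h p))"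
    by (rule Sy_lap_power[OF h]) (auto simp: J_ge1 less_imp_le[OF J_pos])
  from Sy_bound0[OF this] obtain C1 where C1: "C1 \<ge> 0" 
    "\<And>p v. p \<in> Par \<Longrightarrow> norm ((lap ^^ k) (h p) v) \<le> C1 * (1 / J v ^ (2 * k + (D + ?n)) * J v ^ (2 * k))" by auto
  have C1': "norm ((lap ^^ k) (h p) v) \<le> C1 / (J v ^ D * J v ^ ?n)" if "p \<in> Par" for p v
    using C1(2)[OF that, of v] by (simp add: power_add)
  let ?C = "C1 * C2 * I0 * 2 ^ D * I0"
  show ?thesis
  proof (intro exI[of _ ?C] conjI ballI allI)
    show "0 \<le> ?C" using C1 C2 I0 by simp
    fix p a assume p: "p \<in> Par"
    define G where "G = (\<lambda>w. (lap ^^ k) (h p) w * FT (g p) (w - a))"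
    have b: "norm (G w) \<le> (C1 * C2 * B p * I0 * 2 ^ D / J a ^ D) * (1 / J w ^ ?n)" for w
    proof -
      have "J a = J ((w - a) + (- w))" by simp
      also have "\<dots> \<le> 2 * (J (w - a) * J (- w))" by (rule J_peetre)
      finally have "J a ^ D \<le> (2 * (J (w - a) * J w)) ^ D" using J_pos[of a] by (intro power_mono) auto
      then have Ja: "1 / (J w ^ D * J (w - a) ^ D) \<le> 2 ^ D / J a ^ D"
        using J_pos[of w] J_pos[of "w - a"] J_pos[of a] by (simp add: power_mult_distrib field_simps)
      have "norm (G w) \<le> (C1 / (J w ^ D * J w ^ ?n)) * (C2 * B p * I0 / J (w - a) ^ D)"
        unfolding G_def norm_mult using C1'[OF p] FTg[OF p] C1(1) J_pos[of w] by (intro mult_mono) auto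
      also have "\<dots> = (C1 * C2 * B p * I0 / J w ^ ?n) * (1 / (J w ^ D * J (w - a) ^ D))" by (simp add: mult_ac)
      also have "\<dots> \<le> (C1 * C2 * B p * I0 / J w ^ ?n) * (2 ^ D / J a ^ D)"
        using C1(1) C2(1) B[OF p] I0 J_pos[of w] by (intro mult_left_mono Ja) auto
      finally show ?thesis by (simp add: mult_ac)
    qed
    have [measurable]: "(lap ^^ k) (h p) \<in> borel_measurable borel" "FT (g p) \<in> borel_measurable borel"
      by (rule integrable_Sch(3)[OF Sch_lap_power[OF Sh[OF p]]], rule FT_measurable[OF integrable_Sch(3)[OF Sg[OF p]]])
    have iG: "integrable lborel G"
      by (rule integrable_J_bound[where C = "C1 * C2 * B p * I0 * 2 ^ D / J a ^ D"]) (use b in \<open>auto simp: G_def\<close>)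
    have "(LINT w|lborel. h p w * FT (P p) (w - a)) = (LINT w|lborel. G w)"
      unfolding G_def g_def by (rule oscillatory_ibp[OF Sh[OF p] SP[OF p]])
    also have "norm \<dots> \<le> (LINT w|lborel. (C1 * C2 * B p * I0 * 2 ^ D / J a ^ D) * (1 / J (w::'a) ^ ?n))"
      by (rule norm_LINT_le[OF iG integrable_mult_right[OF integrable_J] b])
    also have "\<dots> = (C1 * C2 * B p * I0 * 2 ^ D / J a ^ D) * I0" unfolding I0_def by (rule integral_mult_right_zero)
    finally show "norm (LINT w|lborel. h p w * FT (P p) (w - a)) \<le> ?C * B p / J a ^ D" by (simp add: mult_ac)
  qed
qed

text \<open>Gaussian windows of width \<open>c\<close>, integrated over their centres, add up to the
  constant \<open>(c * sqrt pi) ^ DIM('a)\<close>. By Fubini's theorem the integral of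
  \<open>G\<close> is a superposition of its windowed integrals.\<close>

lemma window_bound:
  fixes G :: "'a::euclidean_space \<Rightarrow> complex"
  assumes G: "integrable lborel G" and c: "0 < c" and k: "integrable lborel \<kappa>"
    and b: "\<And>y0. norm (LINT y|lborel. gauss 1 ((1/c) *\<^sub>R (y - y0)) * G y) \<le> \<kappa> y0"
  shows "(c * sqrt pi) ^ DIM('a) * norm (LINT y|lborel. G y) \<le> (LINT y0|lborel. \<kappa> y0)"
proof -
  let ?f = "\<lambda>y y0. gauss 1 ((1/c) *\<^sub>R (y - y0)) * G y"
  let ?Z = "(c * sqrt pi) ^ DIM('a)"
  have [measurable]: "G \<in> borel_measurable borel" using G by auto
  have [measurable]: "gauss 1 \<in> borel_measurable (borel :: 'a measure)" by (rule integrable_Sch(3)[OF Sch_gauss1])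
  have g1: "integrable lborel (gauss 1 :: 'a \<Rightarrow> complex)" by (rule integrable_Sch(1)[OF Sch_gauss1])
  have ng: "norm (gauss 1 x) = exp (- (x \<bullet> x))" for x :: 'a by (simp add: gauss_def)
  have gi: "integrable lborel (\<lambda>y0. gauss 1 ((1/c) *\<^sub>R (y - y0)))" for y :: 'a
    using integral_lborel_affine(2)[of "- (1/c)" "gauss 1 :: 'a \<Rightarrow> complex" "(1/c) *\<^sub>R y"] g1 c
    by (simp add: scaleR_diff_right)
  have Zn: "(LINT y0|lborel. norm (gauss 1 ((1/c) *\<^sub>R (y - y0)))) = ?Z" for y :: 'a
  proof -
    have "(LINT x|lborel. norm (gauss 1 (x::'a))) = sqrt pi ^ DIM('a)"
      unfolding ng using has_bochner_integral_integral_eq[OF gaussian_integral[where 'a='a]] .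
    then show ?thesis
      using integral_lborel_affine(1)[of "- (1/c)" "\<lambda>x::'a. norm (gauss 1 x)" "(1/c) *\<^sub>R y"] c
      by (simp add: scaleR_diff_right power_mult_distrib field_simps)
  qed
  have ngc: "gauss 1 x = complex_of_real (norm (gauss 1 x))" for x :: 'a by (simp add: gauss_def)
  have Z: "(LINT y0|lborel. gauss 1 ((1/c) *\<^sub>R (y - y0))) = complex_of_real ?Z" for y :: 'a
  proof -
    have "(LINT y0|lborel. gauss 1 ((1/c) *\<^sub>R (y - y0))) = (LINT y0|lborel. complex_of_real (norm (gauss 1 ((1/c) *\<^sub>R (y - y0)))))"
      by (rule Bochner_Integration.integral_cong[OF refl]) (rule ngc)
    also have "\<dots> = complex_of_real (LINT y0|lborel. norm (gauss 1 ((1/c) *\<^sub>R (y - y0))))" by (rule integral_complex_of_real)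
    finally show ?thesis by (simp only: Zn)
  qed
  have "integrable (lborel \<Otimes>\<^sub>M lborel) (case_prod ?f)"
  proof (rule lborel_pair.Fubini_integrable)
    have "(\<lambda>y. LINT y0|lborel. norm (?f y y0)) = (\<lambda>y. ?Z * norm (G y))"
      by (simp only: norm_mult integral_mult_left_zero Zn)
    then show "integrable lborel (\<lambda>y. LINT y0|lborel. norm (case (y, y0) of (y, y0) \<Rightarrow> ?f y y0))"
      unfolding prod.case using G by (simp only:) (intro integrable_mult_right integrable_norm)
    show "AE y in lborel. integrable lborel (\<lambda>y0. case (y, y0) of (y, y0) \<Rightarrow> ?f y y0)"
      by (intro always_eventually) (simp add: gi)
  qed measurable
  from lborel_pair.Fubini_integral[OF this]
  have "(LINT y0|lborel. LINT y|lborel. ?f y y0) = (LINT y|lborel. LINT y0|lborel. ?f y y0)" .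
  also have "\<dots> = complex_of_real ?Z * (LINT y|lborel. G y)"
    by (simp only: integral_mult_left_zero Z integral_mult_right_zero)
  finally have "?Z * norm (LINT y|lborel. G y) = norm (LINT y0|lborel. LINT y|lborel. ?f y y0)"
    using c by (simp add: norm_mult norm_power)
  also have "\<dots> \<le> (LINT y0|lborel. \<kappa> y0)"
  proof (rule norm_LINT_le[OF _ k])
    show "integrable lborel (\<lambda>y0. LINT y|lborel. ?f y y0)"
      using lborel_pair.integrable_fst'[OF \<open>integrable (lborel \<Otimes>\<^sub>M lborel) (case_prod ?f)\<close>[THEN lborel_pair.integrable_product_swap]] by simp
  qed (rule b)
  finally show ?thesis .
qed

text \<open>Here \<open>z\<close> plays the role of the phase gradient. Either the frequency is at
  least of order \<open>lam\<close>, and then the bracket of \<open>t\<close> times the frequency is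
  at least of order \<open>1 + t * lam\<close>; or \<open>sqrt lam *\<^sub>R v\<close> cancels a
  fixed portion of \<open>z\<close>, which forces \<open>J v\<close> to be at least of order
  \<open>lam\<close> and thereby pays for the missing factor.\<close>

lemma elliptic_ineq:
  fixes z v :: "'a::euclidean_space"
  assumes lam: "1 \<le> lam" and t: "0 < t" "t < 1" and C1: "0 < C1" and z: "C1 * lam \<le> norm z"
  shows "t * sqrt lam / sqrt (J (t *\<^sub>R (z + sqrt lam *\<^sub>R v))) \<le> max (2 / min 1 (C1/2)) (8 / C1\<^sup>2) * (t * sqrt lam / (1 + t * lam) * J v)"
proof -
  let ?\<eta> = "z + sqrt lam *\<^sub>R v" and ?mu = "t * sqrt lam / (1 + t * lam)"
  let ?K = "max (2 / min 1 (C1/2)) (8 / C1\<^sup>2)"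
  have mu: "0 \<le> ?mu" using lam t by simp
  have tl: "0 < t * lam" using lam t by simp
  have s1: "1 \<le> sqrt (J (t *\<^sub>R ?\<eta>))" using J_ge1 by simp
  have pos: "0 \<le> t * sqrt lam" using lam t by simp
  show ?thesis
  proof (cases "C1 * lam / 2 \<le> norm ?\<eta>")
    case True
    let ?d = "min 1 (C1/2)"
    have "?d * (1 + t * lam) \<le> 1 + t * norm ?\<eta>"
    proof -
      have "?d * (t * lam) \<le> (C1/2) * (t * lam)" using tl by (intro mult_right_mono) auto
      also have "\<dots> \<le> t * norm ?\<eta>" using mult_left_mono[OF True, of t] t by (simp add: mult_ac)
      finally show ?thesis by (simp add: distrib_left)
    qed
    also have "1 + t * norm ?\<eta> \<le> 2 * sqrt (J (t *\<^sub>R ?\<eta>))"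
    proof (rule power2_le_imp_le)
      let ?a = "t * norm ?\<eta>"
      have "(1 + r)\<^sup>2 \<le> 4 * (1 + r\<^sup>2)" for r :: real
      proof -
        define s where "s = r\<^sup>2"
        have "2 * r \<le> 1 + s" using zero_le_power2[of "r - 1"] by (simp add: power2_diff s_def)
        moreover have "0 \<le> s" by (simp add: s_def)
        ultimately have "1 + 2 * r + s \<le> 4 * (1 + s)" by simp
        then show ?thesis by (simp add: power2_sum s_def)
      qed
      moreover have "(2 * sqrt (J (t *\<^sub>R ?\<eta>)))\<^sup>2 = 4 * (1 + ?a\<^sup>2)"
        using J_pos[of "t *\<^sub>R ?\<eta>"] t by (simp add: power_mult_distrib J_norm)
      ultimately show "(1 + ?a)\<^sup>2 \<le> (2 * sqrt (J (t *\<^sub>R ?\<eta>)))\<^sup>2" by simp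
    qed (use J_pos[of "t *\<^sub>R ?\<eta>"] in simp)
    finally have le: "?d * (1 + t * lam) \<le> 2 * sqrt (J (t *\<^sub>R ?\<eta>))" .
    have dpos: "0 < ?d" using C1 by simp
    have "t * sqrt lam / sqrt (J (t *\<^sub>R ?\<eta>)) \<le> t * sqrt lam / (?d * (1 + t * lam) / 2)"
    proof (rule divide_left_mono)
      have p: "0 < ?d * (1 + t * lam) / 2" using dpos tl by (intro divide_pos_pos mult_pos_pos) auto
      show "?d * (1 + t * lam) / 2 \<le> sqrt (J (t *\<^sub>R ?\<eta>))" using le by linarith
      show "0 < sqrt (J (t *\<^sub>R ?\<eta>)) * (?d * (1 + t * lam) / 2)" using p s1 by (intro mult_pos_pos) linarith+
    qed (rule pos)
    also have "\<dots> = (2 / ?d) * ?mu" by simp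
    also have "\<dots> \<le> ?K * ?mu" by (rule mult_right_mono[OF _ mu]) simp
    also have "\<dots> \<le> ?K * (?mu * J v)"
    proof (rule mult_left_mono)
      show "?mu \<le> ?mu * J v" using mult_left_mono[OF J_ge1[of v] mu] by simp
      show "0 \<le> ?K" using dpos by (simp add: le_max_iff_disj)
    qed
    finally show ?thesis .
  next
    case False
    have "norm z \<le> norm ?\<eta> + norm (sqrt lam *\<^sub>R v)"
      using norm_triangle_ineq4[of ?\<eta> "sqrt lam *\<^sub>R v"] by simp
    then have "C1 * lam / 2 \<le> sqrt lam * norm v" using False z lam by simp
    then have "(C1 * lam / 2)\<^sup>2 \<le> (sqrt lam * norm v)\<^sup>2" using C1 lam by (intro power_mono) auto
    moreover have "(C1 * lam / 2)\<^sup>2 = lam * (C1\<^sup>2 * lam) / 4" by (simp add: power2_eq_square)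
    moreover have "(sqrt lam * norm v)\<^sup>2 = lam * (norm v)\<^sup>2" using lam by (simp add: power_mult_distrib)
    ultimately have "lam * (C1\<^sup>2 * lam) \<le> lam * (4 * (norm v)\<^sup>2)" by simp
    then have "C1\<^sup>2 * lam \<le> 4 * (norm v)\<^sup>2" using lam by (simp add: mult_le_cancel_left_pos)
    then have "C1\<^sup>2 * lam \<le> 4 * J v" by (simp add: J_norm)
    then have lJ: "lam \<le> 4 / C1\<^sup>2 * J v" using C1 by (simp add: field_simps)
    have "t * sqrt lam / sqrt (J (t *\<^sub>R ?\<eta>)) \<le> t * sqrt lam / 1"
      using s1 pos by (intro divide_left_mono) auto
    also have "\<dots> = ?mu * (1 + t * lam)" using tl by simp
    also have "\<dots> \<le> ?mu * (2 * lam)"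
    proof (rule mult_left_mono[OF _ mu])
      have "t * lam \<le> lam" using mult_right_mono[of t 1 lam] t lam by simp
      then show "1 + t * lam \<le> 2 * lam" using lam by linarith
    qed
    also have "\<dots> \<le> ?mu * (2 * (4 / C1\<^sup>2 * J v))" using lJ mu by (intro mult_left_mono) auto
    also have "\<dots> = (8 / C1\<^sup>2) * (?mu * J v)" by (simp add: mult_ac)
    also have "\<dots> \<le> ?K * (?mu * J v)" by (intro mult_right_mono mult_nonneg_nonneg mu) (auto simp: less_imp_le[OF J_pos])
    finally show ?thesis .
  qed
qed

section \<open>Uniform estimates for a family of localised integrals\<close>

lemma lipschitz_pd:
  fixes g :: "'a::euclidean_space \<Rightarrow> complex"
  assumes d: "\<And>x. g differentiable (at x)" and b: "\<And>b x. b \<in> Basis \<Longrightarrow> norm (pd b g x) \<le> M"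
  shows "norm (g y - g x) \<le> real DIM('a) * M * norm (y - x)"
proof -
  define h where "h = y - x"
  have "norm (g (x + 1 *\<^sub>R h) - g (x + 0 *\<^sub>R h)) \<le> (real DIM('a) * M * norm h) * \<bar>1\<bar>"
  proof (rule line_bound[where f = "\<lambda>s. g (x + s *\<^sub>R h)" and f' = "\<lambda>s. pd h g (x + s *\<^sub>R h)"])
    fix s
    show "((\<lambda>s. g (x + s *\<^sub>R h)) has_vector_derivative pd h g (x + s *\<^sub>R h)) (at s within closed_segment 0 1)"
      by (rule pd_line[OF d])
    have "pd h g (x + s *\<^sub>R h) = (\<Sum>b\<in>Basis. (h \<bullet> b) *\<^sub>R pd b g (x + s *\<^sub>R h))"
      by (rule pd_has_derivative[OF has_derivative_pd[OF d]])
    also have "norm \<dots> \<le> (\<Sum>b\<in>(Basis::'a set). norm h * M)"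
    proof (rule order_trans[OF norm_sum], rule sum_mono)
      fix c :: 'a assume c: "c \<in> Basis"
      show "norm ((h \<bullet> c) *\<^sub>R pd c g (x + s *\<^sub>R h)) \<le> norm h * M"
        using Basis_le_norm[OF c, of h] b[OF c] by (simp add: mult_mono)
    qed
    finally show "norm (pd h g (x + s *\<^sub>R h)) \<le> real DIM('a) * M * norm h" by (simp add: mult_ac)
  qed
  then show ?thesis by (simp add: h_def)
qed

text \<open>The index \<open>q\<close> stands for the pair of \<open>t\<close> and the frequency,
  and \<open>lam q\<close> for the bracket of the frequency. Only derivatives in the space variable
  occur, so the frequency can be frozen into a parameter; what has to be carried along is uniformity
  in \<open>q\<close>.\<close>

locale osc_family =
  fixes Q :: "'q set" and lam tt :: "'q \<Rightarrow> real" and a :: "'q \<Rightarrow> 'a::euclidean_space \<Rightarrow> complex"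
    and \<phi> :: "'q \<Rightarrow> 'a \<Rightarrow> real" and gr :: "'q \<Rightarrow> 'a \<Rightarrow> 'a" and \<rho> :: "'a \<Rightarrow> complex" and C1 :: real
  assumes a: "Sy Q UNIV (\<lambda>_ _ _. 1) (\<lambda>_ _. 1) a"
    and \<phi>_diff: "\<And>q y. q \<in> Q \<Longrightarrow> (\<lambda>y. complex_of_real (\<phi> q y)) differentiable (at y)"
    and \<phi>: "\<And>b. b \<in> Basis \<Longrightarrow> Sy Q UNIV (\<lambda>_ _ _. 1) (\<lambda>q _. lam q) (\<lambda>q. pd b (\<lambda>y. complex_of_real (\<phi> q y)))"
    and gr: "\<And>q b y. q \<in> Q \<Longrightarrow> b \<in> Basis \<Longrightarrow> pd b (\<lambda>y. complex_of_real (\<phi> q y)) y = of_real (gr q y \<bullet> b)"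
    and C1: "C1 > 0" and gr_lower: "\<And>q y. q \<in> Q \<Longrightarrow> C1 * lam q \<le> norm (gr q y)"
    and lam: "\<And>q. q \<in> Q \<Longrightarrow> 1 \<le> lam q" and tt: "\<And>q. q \<in> Q \<Longrightarrow> 0 < tt q" "\<And>q. q \<in> Q \<Longrightarrow> tt q < 1"
    and \<rho>: "Sy {()} UNIV (\<lambda>_ _ x. 1 / sqrt (J x)) (\<lambda>_ _. 1) (\<lambda>_. \<rho>)"
begin

abbreviation "\<Phi> q \<equiv> (\<lambda>y. complex_of_real (\<phi> q y))"

definition mu :: "'q \<Rightarrow> real" where "mu q = tt q * sqrt (lam q) / (1 + tt q * lam q)"

text \<open>The width of a window in which the phase deviates from its linearisation by a bounded amount.\<close>
definition cc :: "'q \<Rightarrow> real" where "cc q = 1 / sqrt (lam q)"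

lemma cc: "q \<in> Q \<Longrightarrow> 0 < cc q" "q \<in> Q \<Longrightarrow> cc q \<le> 1" "q \<in> Q \<Longrightarrow> lam q * (cc q * cc q) = 1" "q \<in> Q \<Longrightarrow> cc q * sqrt (lam q) = 1"
  using lam by (force simp: cc_def)+

lemma mu: "q \<in> Q \<Longrightarrow> 0 \<le> mu q" "q \<in> Q \<Longrightarrow> mu q \<le> 1"
proof -
  assume q: "q \<in> Q"
  have l: "1 \<le> sqrt (lam q)" using lam[OF q] by simp
  have "sqrt (lam q) * 1 \<le> sqrt (lam q) * sqrt (lam q)" using l by (intro mult_left_mono) auto
  then have "tt q * sqrt (lam q) \<le> tt q * lam q" using tt[OF q] lam[OF q] by (intro mult_left_mono) auto
  moreover have D: "0 < 1 + tt q * lam q" using tt(1)[OF q] lam[OF q] by (intro add_pos_nonneg) auto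
  ultimately show "mu q \<le> 1" unfolding mu_def pos_divide_le_eq[OF D] mult_1 by linarith
  show "0 \<le> mu q" using tt[OF q] lam[OF q] D by (auto simp: mu_def)
qed

lemma hessian_bound:
  "\<exists>M\<ge>0. \<forall>q\<in>Q. \<forall>b\<in>Basis. \<forall>x y. norm (pd b (\<Phi> q) y - pd b (\<Phi> q) x) \<le> M * lam q * norm (y - x)"
proof -
  have "\<exists>M\<ge>0. \<forall>q\<in>Q. \<forall>y. norm (pd b' (pd b (\<Phi> q)) y) \<le> M * lam q" if "b \<in> Basis" "b' \<in> Basis" for b b'
    using Sy_bound0[OF Sy_pd[OF \<phi>[OF that(1)] that(2)]] by auto
  then obtain M where M: "\<And>b b'. b \<in> Basis \<Longrightarrow> b' \<in> Basis \<Longrightarrow> 0 \<le> M b b'"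
    "\<And>b b' q y. b \<in> Basis \<Longrightarrow> b' \<in> Basis \<Longrightarrow> q \<in> Q \<Longrightarrow> norm (pd b' (pd b (\<Phi> q)) y) \<le> M b b' * lam q" by metis
  define M0 where "M0 = (\<Sum>b\<in>Basis. \<Sum>b'\<in>Basis. M b b')"
  have M0: "M b b' \<le> M0" if "b \<in> Basis" "b' \<in> Basis" for b b'
  proof -
    have "M b b' \<le> (\<Sum>b'\<in>Basis. M b b')" using that M(1) by (intro member_le_sum) auto
    also have "\<dots> \<le> M0" unfolding M0_def using that M(1) by (intro member_le_sum[of b _ "\<lambda>b. \<Sum>b'\<in>Basis. M b b'"] sum_nonneg) auto
    finally show ?thesis .
  qed
  have M00: "0 \<le> M0" unfolding M0_def using M(1) by (intro sum_nonneg) auto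
  show ?thesis
  proof (intro exI[of _ "real DIM('a) * M0"] conjI ballI allI)
    fix q b x y assume q: "q \<in> Q" and b: "b \<in> (Basis :: 'a set)"
    have "norm (pd b (\<Phi> q) y - pd b (\<Phi> q) x) \<le> real DIM('a) * (M0 * lam q) * norm (y - x)"
    proof (rule lipschitz_pd)
      show "pd b (\<Phi> q) differentiable (at x)" for x using Sy_diff0[OF \<phi>[OF b] q] by simp
      fix b' x assume b': "b' \<in> (Basis :: 'a set)"
      have "M b b' * lam q \<le> M0 * lam q" using M0[OF b b'] lam[OF q] by (intro mult_right_mono) auto
      then show "norm (pd b' (pd b (\<Phi> q)) x) \<le> M0 * lam q" using M(2)[OF b b' q, of x] by linarith
    qed
    then show "norm (pd b (\<Phi> q) y - pd b (\<Phi> q) x) \<le> real DIM('a) * M0 * lam q * norm (y - x)" by (simp add: mult_ac)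
  qed (use M00 in simp)
qed

lemma gr_lipschitz: "\<exists>M\<ge>0. \<forall>q\<in>Q. \<forall>x y. norm (gr q y - gr q x) \<le> M * lam q * norm (y - x)"
proof -
  obtain M where M: "M \<ge> 0" "\<And>q b x y. q \<in> Q \<Longrightarrow> b \<in> Basis \<Longrightarrow> norm (pd b (\<Phi> q) y - pd b (\<Phi> q) x) \<le> M * lam q * norm (y - x)"
    using hessian_bound by blast
  show ?thesis
  proof (intro exI[of _ "real DIM('a) * M"] conjI ballI allI)
    fix q x y assume q: "q \<in> Q"
    have "norm (gr q y - gr q x) \<le> (\<Sum>b\<in>Basis. \<bar>(gr q y - gr q x) \<bullet> b\<bar>)" by (rule norm_le_l1)
    also have "\<dots> \<le> (\<Sum>b\<in>(Basis::'a set). M * lam q * norm (y - x))"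
    proof (rule sum_mono)
      fix b :: 'a assume b: "b \<in> Basis"
      have "\<bar>(gr q y - gr q x) \<bullet> b\<bar> = norm (complex_of_real (gr q y \<bullet> b) - complex_of_real (gr q x \<bullet> b))"
        by (simp add: inner_diff_left flip: of_real_diff)
      also have "\<dots> \<le> M * lam q * norm (y - x)" using M(2)[OF q b, of y x] by (simp add: gr[OF q b])
      finally show "\<bar>(gr q y - gr q x) \<bullet> b\<bar> \<le> M * lam q * norm (y - x)" .
    qed
    finally show "norm (gr q y - gr q x) \<le> real DIM('a) * M * lam q * norm (y - x)" by (simp add: mult_ac)
  qed (use M in simp)
qed

definition Par1 :: "('q \<times> 'a \<times> real) set" where "Par1 = {(q, y0, e). q \<in> Q \<and> 0 < e \<and> e < 1}"

text \<open>The phase in the window variable \<open>w\<close>, with its linear part at the centre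
  \<open>y0\<close> removed and its value at \<open>y0\<close> kept.\<close>

definition pha :: "'q \<times> 'a \<times> real \<Rightarrow> 'a \<Rightarrow> complex" where
  "pha = (\<lambda>(q, y0, e) w. \<i> * (of_real (\<phi> q (y0 + cc q *\<^sub>R w)) - of_real (cc q) * of_real (w \<bullet> gr q y0)))"

definition hfun :: "'q \<times> 'a \<times> real \<Rightarrow> 'a \<Rightarrow> complex" where
  "hfun = (\<lambda>(q, y0, e) w. gauss 1 w * (gauss e (y0 + cc q *\<^sub>R w) * (a q (y0 + cc q *\<^sub>R w) * exp (pha (q, y0, e) w))))"

lemma pd_pha:
  assumes p: "(q, y0, e) \<in> Par1" and b: "b \<in> Basis"
  shows "pha (q, y0, e) differentiable (at w)"
    and "pd b (pha (q, y0, e)) w = \<i> * of_real (cc q) * (pd b (\<Phi> q) (y0 + cc q *\<^sub>R w) - pd b (\<Phi> q) y0)"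
proof -
  have q: "q \<in> Q" using p by (simp add: Par1_def)
  let ?A = "\<lambda>w. y0 + cc q *\<^sub>R w"
  have d1: "(\<lambda>w. \<Phi> q (?A w)) differentiable (at w)" for w
    using differentiable_chain_at[of ?A w "\<Phi> q"] \<phi>_diff[OF q] by (auto simp: o_def intro!: derivative_intros)
  have p1: "pd b (\<lambda>w. \<Phi> q (?A w)) w = of_real (cc q) * pd b (\<Phi> q) (?A w)" for w
    by (rule pd_affine[of "\<Phi> q"]) (auto simp: \<phi>_diff[OF q] algebra_simps)
  have d2: "(\<lambda>w. - of_real (cc q) * complex_of_real (w \<bullet> gr q y0)) differentiable (at w)" for w
    by (intro differentiable_mult pd_inner(1)) auto
  have p2: "pd b (\<lambda>w. - of_real (cc q) * complex_of_real (w \<bullet> gr q y0)) w = - of_real (cc q) * pd b (\<Phi> q) y0" for w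
    by (simp only: pd_cmult[OF pd_inner(1)] pd_inner(2) gr[OF q b] inner_commute)
  have eq: "pha (q, y0, e) = (\<lambda>w. \<i> * (\<Phi> q (?A w) + - of_real (cc q) * complex_of_real (w \<bullet> gr q y0)))"
    by (simp add: pha_def fun_eq_iff)
  have d3: "(\<lambda>w. \<Phi> q (?A w) + - of_real (cc q) * complex_of_real (w \<bullet> gr q y0)) differentiable (at w)" for w
    by (intro differentiable_add d1 d2)
  show "pha (q, y0, e) differentiable (at w)" unfolding eq by (intro differentiable_mult d3) auto
  show "pd b (pha (q, y0, e)) w = \<i> * of_real (cc q) * (pd b (\<Phi> q) (y0 + cc q *\<^sub>R w) - pd b (\<Phi> q) y0)"
    unfolding eq pd_cmult[OF d3] pd_add[OF d1 d2] p1 p2 by (simp add: algebra_simps)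
qed

text \<open>The gradient in \<open>w\<close> is \<open>cc q\<close> times an increment of the
  gradient of \<phi> over the distance \<open>cc q * norm w\<close>, hence at most a constant times
  \<open>lam q * (cc q * cc q) * norm w\<close>, which is \<open>norm w\<close>. Further derivatives
  are bounded, because they bring only more factors \<open>cc q \<le> 1\<close>.\<close>

lemma Sy_exp_pha: "Sy Par1 UNIV (\<lambda>_ _ w. J w) (\<lambda>_ _. 1) (\<lambda>p w. exp (pha p w))"
proof (rule Sy_exp)
  obtain b0 :: 'a where "b0 \<in> Basis" using nonempty_Basis by blast
  then show "pha p differentiable (at w)" if "p \<in> Par1" for p w
    using pd_pha(1)[of "fst p" "fst (snd p)" "snd (snd p)"] that by simp
  show "Re (pha p w) \<le> 0" for p w by (simp add: pha_def case_prod_beta)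
  fix b :: 'a assume b: "b \<in> Basis"
  let ?F = "\<lambda>(q, y0, e::real) w. \<i> * of_real (cc q) * (pd b (\<Phi> q) (y0 + cc q *\<^sub>R w) - pd b (\<Phi> q) y0)"
  have d: "pd b (\<Phi> q) differentiable (at y)" if "q \<in> Q" for q y using Sy_diff0[OF \<phi>[OF b] that] by simp
  have dA: "(\<lambda>w. pd b (\<Phi> q) (y0 + cc q *\<^sub>R w)) differentiable (at w)" if "q \<in> Q" for q y0 w
    using differentiable_chain_at[of "\<lambda>w. y0 + cc q *\<^sub>R w" w "pd b (\<Phi> q)"] d[OF that] by (auto simp: o_def intro!: derivative_intros)
  have dB: "(\<lambda>w. pd b (\<Phi> q) (y0 + cc q *\<^sub>R w) + - pd b (\<Phi> q) y0) differentiable (at w)" if "q \<in> Q" for q y0 w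
    by (intro differentiable_add dA that) auto
  have "Sy Par1 UNIV (\<lambda>_ _ w. J w) (\<lambda>_ w. J w) ?F"
  proof (rule Sy_rec)
    show "?F p differentiable (at w)" if "p \<in> Par1" for p w
      using that by (auto simp: Par1_def intro!: differentiable_mult differentiable_diff dA)
    obtain M where M: "M \<ge> 0" "\<And>q x y. q \<in> Q \<Longrightarrow> norm (pd b (\<Phi> q) y - pd b (\<Phi> q) x) \<le> M * lam q * norm (y - x)"
      using hessian_bound b by blast
    show "\<exists>C\<ge>0. \<forall>p\<in>Par1. \<forall>w\<in>UNIV. norm (?F p w) \<le> C * J w"
    proof (intro exI[of _ M] conjI ballI)
      fix p and w :: 'a assume "p \<in> Par1"
      then obtain q y0 e where p: "p = (q, y0, e)" "q \<in> Q" by (auto simp: Par1_def)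
      have "norm (?F p w) = cc q * norm (pd b (\<Phi> q) (y0 + cc q *\<^sub>R w) - pd b (\<Phi> q) y0)"
        using cc(1)[OF p(2)] by (simp add: p norm_mult)
      also have "\<dots> \<le> cc q * (M * lam q * norm (cc q *\<^sub>R w))"
        using M(2)[OF p(2), of "y0 + cc q *\<^sub>R w" y0] cc(1)[OF p(2)] by (intro mult_left_mono) auto
      also have "\<dots> = M * (lam q * (cc q * cc q)) * norm w" using cc(1)[OF p(2)] by simp
      also have "\<dots> \<le> M * J w" using cc(3)[OF p(2)] M(1) norm_le_J[of w] by (simp add: mult_left_mono)
      finally show "norm (?F p w) \<le> M * J w" .
    qed (use M in simp)
    fix b' :: 'a assume b': "b' \<in> Basis"
    have S: "Sy Q UNIV (\<lambda>_ _ _. 1) (\<lambda>q _. lam q) (\<lambda>q. pd b' (pd b (\<Phi> q)))"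
      using Sy_pd[OF \<phi>[OF b] b'] by simp
    have "Sy Par1 UNIV (\<lambda>p _ _. \<bar>cc (fst p)\<bar> * 1) (\<lambda>p _. lam (fst p)) (\<lambda>p w. pd b' (pd b (\<Phi> (fst p))) (fst (snd p) + cc (fst p) *\<^sub>R w))"
      by (rule Sy_pullback[OF S, where \<pi> = fst and A = "\<lambda>p w. fst (snd p) + cc (fst p) *\<^sub>R w" and \<tau> = "\<lambda>b. b" and c = "\<lambda>p. cc (fst p)"])
         (auto simp: Par1_def algebra_simps intro!: derivative_intros)
    from Sy_scale[OF open_UNIV this, of "\<lambda>p. \<i> * of_real (cc (fst p) * cc (fst p))"]
    have "Sy Par1 UNIV (\<lambda>p _ _. \<bar>cc (fst p)\<bar> * 1) (\<lambda>p _. lam (fst p) * norm (\<i> * complex_of_real (cc (fst p) * cc (fst p))))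
       (\<lambda>p w. \<i> * of_real (cc (fst p) * cc (fst p)) * pd b' (pd b (\<Phi> (fst p))) (fst (snd p) + cc (fst p) *\<^sub>R w))" .
    then have "Sy Par1 UNIV (\<lambda>_ _ w. J w) (\<lambda>_ w. J w * J w) (\<lambda>p w. \<i> * of_real (cc (fst p) * cc (fst p)) * pd b' (pd b (\<Phi> (fst p))) (fst (snd p) + cc (fst p) *\<^sub>R w))"
    proof (rule Sy_mono[where D = 1 and D' = 1])
      fix p and w :: 'a assume "p \<in> Par1"
      then have q: "fst p \<in> Q" by (auto simp: Par1_def)
      have "lam (fst p) * norm (\<i> * complex_of_real (cc (fst p) * cc (fst p))) = 1"
        using cc(1,3)[OF q] by (simp add: norm_mult)
      moreover have "1 \<le> J w * J w" using mult_mono[OF J_ge1[of w] J_ge1[of w]] by (simp add: less_imp_le[OF J_pos])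
      ultimately show "0 \<le> lam (fst p) * norm (\<i> * complex_of_real (cc (fst p) * cc (fst p))) \<and> lam (fst p) * norm (\<i> * complex_of_real (cc (fst p) * cc (fst p))) \<le> 1 * (J w * J w)"
        by simp
      show "0 \<le> \<bar>cc (fst p)\<bar> * 1 \<and> \<bar>cc (fst p)\<bar> * 1 \<le> 1 * J w" using cc(1,2)[OF q] J_ge1[of w] by simp
    qed auto
    then show "Sy Par1 UNIV (\<lambda>_ _ w. J w) (\<lambda>_ w. J w * J w) (\<lambda>p. pd b' (?F p))"
    proof (rule Sy_cong')
      fix p and w :: 'a assume "p \<in> Par1"
      then obtain q y0 e where p: "p = (q, y0, e)" "q \<in> Q" by (auto simp: Par1_def)
      have "pd b' (?F p) w = pd b' (\<lambda>w. \<i> * of_real (cc q) * (pd b (\<Phi> q) (y0 + cc q *\<^sub>R w) + - pd b (\<Phi> q) y0)) w"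
        by (simp add: p)
      also have "\<dots> = \<i> * of_real (cc q) * pd b' (\<lambda>w. pd b (\<Phi> q) (y0 + cc q *\<^sub>R w) + - pd b (\<Phi> q) y0) w"
        by (rule pd_cmult[OF dB[OF p(2)]])
      also have "pd b' (\<lambda>w. pd b (\<Phi> q) (y0 + cc q *\<^sub>R w) + - pd b (\<Phi> q) y0) w = pd b' (\<lambda>w. pd b (\<Phi> q) (y0 + cc q *\<^sub>R w)) w + pd b' (\<lambda>w. - pd b (\<Phi> q) y0) w"
        by (rule pd_add[OF dA[OF p(2)] differentiable_const])
      also have "pd b' (\<lambda>w. pd b (\<Phi> q) (y0 + cc q *\<^sub>R w)) w = of_real (cc q) * pd b' (pd b (\<Phi> q)) (y0 + cc q *\<^sub>R w)"
        by (rule pd_affine[of "pd b (\<Phi> q)"]) (auto simp: d[OF p(2)] algebra_simps)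
      finally have "pd b' (?F p) w = \<i> * of_real (cc q) * (of_real (cc q) * pd b' (pd b (\<Phi> q)) (y0 + cc q *\<^sub>R w) + 0)"
        by (simp only: pd_const)
      then show "\<i> * of_real (cc (fst p) * cc (fst p)) * pd b' (pd b (\<Phi> (fst p))) (fst (snd p) + cc (fst p) *\<^sub>R w) = pd b' (?F p) w"
        by (simp add: p)
    qed auto
  qed
  then show "Sy Par1 UNIV (\<lambda>_ _ w. J w) (\<lambda>_ w. J w) (\<lambda>p. pd b (pha p))"
    by (rule Sy_cong') (auto simp: pd_pha(2)[OF _ b])
qed simp

lemma Sy_hfun: "Sy Par1 UNIV (\<lambda>_ _ w. J w) (\<lambda>_ w. 1 / J w ^ K) hfun"
proof -
  have A: "Sy Par1 UNIV (\<lambda>_ _ w. J w) (\<lambda>_ w. 1 / J w ^ K) (\<lambda>_. gauss 1)"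
    using Sy_reindex[OF Sch_D[OF Sch_gauss1, of K] open_UNIV, of Par1 "\<lambda>_. ()"]
    by (rule Sy_mono[where D = 1 and D' = 1]) (auto simp: J_ge1 less_imp_le[OF J_pos])
  have "Sy Par1 UNIV (\<lambda>p _ _. sqrt (snd (snd p))) (\<lambda>_ _. 1) (\<lambda>p. gauss (snd (snd p)) :: 'a \<Rightarrow> complex)"
    by (rule Sy_gauss) (auto simp: Par1_def)
  then have "Sy Par1 UNIV (\<lambda>p _ _. \<bar>cc (fst p)\<bar> * sqrt (snd (snd p))) (\<lambda>_ _. 1) (\<lambda>p w. gauss (snd (snd p)) (fst (snd p) + cc (fst p) *\<^sub>R w))"
    by (rule Sy_pullback[where \<pi> = "\<lambda>p. p" and A = "\<lambda>p w. fst (snd p) + cc (fst p) *\<^sub>R w" and \<tau> = "\<lambda>b. b" and c = "\<lambda>p. cc (fst p)"])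
       (auto simp: algebra_simps intro!: derivative_intros)
  then have B: "Sy Par1 UNIV (\<lambda>_ _ w. J w) (\<lambda>_ _. 1) (\<lambda>p w. gauss (snd (snd p)) (fst (snd p) + cc (fst p) *\<^sub>R w))"
  proof (rule Sy_mono[where D = 1 and D' = 1])
    fix p and w :: 'a assume "p \<in> Par1"
    then have q: "fst p \<in> Q" "0 < snd (snd p)" "snd (snd p) < 1" by (auto simp: Par1_def)
    have "cc (fst p) * sqrt (snd (snd p)) \<le> 1 * 1" using cc(1,2)[OF q(1)] q by (intro mult_mono) auto
    then show "0 \<le> \<bar>cc (fst p)\<bar> * sqrt (snd (snd p)) \<and> \<bar>cc (fst p)\<bar> * sqrt (snd (snd p)) \<le> 1 * J w"
      using cc(1)[OF q(1)] q J_ge1[of w] by auto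
  qed auto
  have "Sy Par1 UNIV (\<lambda>p _ _. \<bar>cc (fst p)\<bar> * 1) (\<lambda>_ _. 1) (\<lambda>p w. a (fst p) (fst (snd p) + cc (fst p) *\<^sub>R w))"
    by (rule Sy_pullback[OF a, where \<pi> = fst and A = "\<lambda>p w. fst (snd p) + cc (fst p) *\<^sub>R w" and \<tau> = "\<lambda>b. b" and c = "\<lambda>p. cc (fst p)"])
       (auto simp: Par1_def algebra_simps intro!: derivative_intros)
  then have C: "Sy Par1 UNIV (\<lambda>_ _ w. J w) (\<lambda>_ _. 1) (\<lambda>p w. a (fst p) (fst (snd p) + cc (fst p) *\<^sub>R w))"
  proof (rule Sy_mono[where D = 1 and D' = 1])
    fix p and w :: 'a assume "p \<in> Par1"
    then have q: "fst p \<in> Q" by (auto simp: Par1_def)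
    show "0 \<le> \<bar>cc (fst p)\<bar> * 1 \<and> \<bar>cc (fst p)\<bar> * 1 \<le> 1 * J w" using cc(1,2)[OF q] J_ge1[of w] by simp
  qed auto
  show ?thesis
    by (rule Sy_cong'[OF Sy_mult[OF open_UNIV A Sy_mult[OF open_UNIV B Sy_mult[OF open_UNIV C Sy_exp_pha]]]])
       (auto simp: hfun_def case_prod_beta)
qed

abbreviation "\<rho>t q \<equiv> (\<lambda>\<eta>. \<rho> (tt q *\<^sub>R \<eta>))"

lemma smo_\<rho>: "smo \<rho>" using Sy_smo[OF \<rho>, of "()"] by simp

lemma tempered_\<rho>t: assumes q: "q \<in> Q" shows "tempered 0 (\<rho>t q)"
proof -
  have "Sy {()} UNIV (\<lambda>_ _ x. \<bar>tt q\<bar> * (1 / sqrt (J (tt q *\<^sub>R x)))) (\<lambda>_ _. 1) (\<lambda>_. \<rho>t q)"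
    by (rule Sy_pullback[OF \<rho>, where \<pi> = "\<lambda>_. ()" and A = "\<lambda>p w. tt q *\<^sub>R w" and \<tau> = "\<lambda>b. b" and c = "\<lambda>p. tt q"])
       (auto simp: algebra_simps intro!: derivative_intros)
  then show ?thesis
  proof (rule Sy_mono[where D = 1 and D' = 1])
    fix x :: 'a
    have "1 \<le> sqrt (J (tt q *\<^sub>R x))" using J_ge1 by simp
    then have "1 / sqrt (J (tt q *\<^sub>R x)) \<le> 1" by (simp add: divide_le_eq)
    then have "\<bar>tt q\<bar> * (1 / sqrt (J (tt q *\<^sub>R x))) \<le> 1 * 1" using tt[OF q] J_pos[of "tt q *\<^sub>R x"] by (intro mult_mono) auto
    then show "0 \<le> \<bar>tt q\<bar> * (1 / sqrt (J (tt q *\<^sub>R x))) \<and> \<bar>tt q\<bar> * (1 / sqrt (J (tt q *\<^sub>R x))) \<le> 1 * 1"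
      using J_pos[of "tt q *\<^sub>R x"] by simp
  qed auto
qed

lemma smo_\<rho>t: "q \<in> Q \<Longrightarrow> smo (\<rho>t q)" using Sy_smo[OF tempered_\<rho>t, of q "()"] by simp

lemma tempered_rem: assumes q: "q \<in> Q" shows "tempered N (rem N (\<rho>t q) \<zeta>)"
proof -
  have "tempered N (\<lambda>\<eta>. \<Sum>k<N. (1 / fact k) * tay k (\<rho>t q) \<zeta> (\<eta> - \<zeta>))"
    by (rule Sy_sum) (auto simp: less_imp_le[OF J_pos] simp del: times_divide_eq_left mult_1 intro!: Sy_cmult tempered_tay)
  from Sy_diff[OF open_UNIV tempered_mono[OF tempered_\<rho>t[OF q], of N] this] show ?thesis
    by (simp add: rem_def[abs_def])
qed

definition KK :: real where "KK = max (2 / min 1 (C1/2)) (8 / C1\<^sup>2)"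

lemma KK: "0 \<le> KK" using C1 by (simp add: KK_def le_max_iff_disj)

text \<open>The chain rule gives a factor \<open>tt q\<close> per derivative and the rescaling one
  of \<open>sqrt (lam q)\<close>; with the symbol estimate for \<rho>, \<open>elliptic_ineq\<close>
  turns this into \<open>mu q * J v\<close>. One constant serves the finitely many lists of length
  \<open>l\<close>.\<close>

lemma \<rho>_bound: "\<exists>C\<ge>0. \<forall>L. L \<in> lists Basis \<and> length L = l \<longrightarrow> (\<forall>q\<in>Q. \<forall>y v.
    sqrt (lam q) ^ l * norm (PD L (\<rho>t q) (gr q y + sqrt (lam q) *\<^sub>R v)) \<le> C * (mu q * J v) ^ l)"
proof -
  have "\<exists>C\<ge>0. \<forall>q\<in>Q. \<forall>y v. sqrt (lam q) ^ l * norm (PD L (\<rho>t q) (gr q y + sqrt (lam q) *\<^sub>R v)) \<le> C * (mu q * J v) ^ l"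
    if L: "L \<in> lists Basis" "length L = l" for L
  proof -
    have pl: "(\<Prod>b\<leftarrow>L. 1 / sqrt (J x)) = (1 / sqrt (J x)) ^ l" for x :: 'a using L(2) by (induction L arbitrary: l) auto
    obtain C where C: "C \<ge> 0" "\<And>x. norm (PD L \<rho> x) \<le> C * (1 / sqrt (J x)) ^ l"
      using Sy_D(2)[OF \<rho> L(1)] pl by auto
    show ?thesis
    proof (intro exI[of _ "C * KK ^ l"] conjI ballI allI)
      fix q y v assume q: "q \<in> Q"
      let ?\<eta> = "gr q y + sqrt (lam q) *\<^sub>R v"
      have l1: "1 \<le> sqrt (lam q)" using lam[OF q] by simp
      have "PD L (\<rho>t q) ?\<eta> = of_real (tt q) ^ l * PD L \<rho> (tt q *\<^sub>R ?\<eta>)"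
        using PD_affine[OF smo_\<rho> L(1), of 0 "tt q"] L(2) by simp
      then have "sqrt (lam q) ^ l * norm (PD L (\<rho>t q) ?\<eta>) = (tt q * sqrt (lam q)) ^ l * norm (PD L \<rho> (tt q *\<^sub>R ?\<eta>))"
        using tt[OF q] by (simp add: norm_mult norm_power power_mult_distrib)
      also have "\<dots> \<le> (tt q * sqrt (lam q)) ^ l * (C * (1 / sqrt (J (tt q *\<^sub>R ?\<eta>))) ^ l)"
        using tt[OF q] l1 by (intro mult_left_mono C) auto
      also have "\<dots> = C * (tt q * sqrt (lam q) / sqrt (J (tt q *\<^sub>R ?\<eta>))) ^ l"
        by (simp add: power_divide power_mult_distrib)
      also have "\<dots> \<le> C * (KK * (mu q * J v)) ^ l"
      proof (intro mult_left_mono power_mono)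
        show "tt q * sqrt (lam q) / sqrt (J (tt q *\<^sub>R ?\<eta>)) \<le> KK * (mu q * J v)"
          unfolding KK_def mu_def by (rule elliptic_ineq[OF lam[OF q] tt(1)[OF q] tt(2)[OF q] C1 gr_lower[OF q]])
        show "0 \<le> tt q * sqrt (lam q) / sqrt (J (tt q *\<^sub>R ?\<eta>))" using tt[OF q] l1 J_pos[of "tt q *\<^sub>R ?\<eta>"] by simp
      qed (use C in auto)
      finally show "sqrt (lam q) ^ l * norm (PD L (\<rho>t q) ?\<eta>) \<le> C * KK ^ l * (mu q * J v) ^ l"
        by (simp add: power_mult_distrib mult_ac)
    qed (use C KK in simp)
  qed
  then obtain C where C: "\<And>L. L \<in> lists Basis \<Longrightarrow> length L = l \<Longrightarrow> 0 \<le> C L"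
    "\<And>L q y v. L \<in> lists Basis \<Longrightarrow> length L = l \<Longrightarrow> q \<in> Q \<Longrightarrow> sqrt (lam q) ^ l * norm (PD L (\<rho>t q) (gr q y + sqrt (lam q) *\<^sub>R v)) \<le> C L * (mu q * J v) ^ l"
    by metis
  let ?S = "{L. L \<in> lists (Basis::'a set) \<and> length L = l}"
  show ?thesis
  proof (intro exI[of _ "\<Sum>L\<in>?S. C L"] conjI allI impI ballI)
    show "0 \<le> (\<Sum>L\<in>?S. C L)" using C(1) by (intro sum_nonneg) auto
    fix L :: "'a list" and q and y v :: 'a assume L: "L \<in> lists Basis \<and> length L = l" and q: "q \<in> Q"
    have "C L \<le> (\<Sum>L\<in>?S. C L)" using L C(1) by (intro member_le_sum finite_lists_Basis) auto
    then have "C L * (mu q * J v) ^ l \<le> (\<Sum>L\<in>?S. C L) * (mu q * J v) ^ l"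
      using mu(1)[OF q] J_pos[of v] by (intro mult_right_mono) auto
    with C(2)[of L q y v] L q show "sqrt (lam q) ^ l * norm (PD L (\<rho>t q) (gr q y + sqrt (lam q) *\<^sub>R v)) \<le> (\<Sum>L\<in>?S. C L) * (mu q * J v) ^ l"
      by auto
  qed
qed

text \<open>The condition \<open>e * lam q \<le> 1\<close> keeps derivatives of the regularising
  Gaussian bounded after dilation by \<open>sqrt (lam q)\<close>. For fixed \<open>q\<close> it
  holds for all small \<open>e\<close>, which is enough for the limit.\<close>

definition Par2 :: "('q \<times> 'a \<times> 'a \<times> real) set" where
  "Par2 = {(q, y0, x, e). q \<in> Q \<and> 0 < e \<and> e < 1 \<and> e * lam q \<le> 1}"

text \<open>Fewer than \<open>N\<close> derivatives leave a Taylor remainder of lower order; from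
  \<open>N\<close> on, nothing is subtracted any more. In the first case the distance to the
  expansion point, in units of \<open>sqrt (lam q)\<close>, consists of \<open>v\<close> and of the
  increment of the gradient between \<open>x\<close> and \<open>y0\<close>, which is of order
  \<open>sqrt (lam q) * norm (x - y0)\<close>; hence the two weights.\<close>

lemma Sy_rem:
  "Sy Par2 UNIV (\<lambda>_ _ v. J v) (\<lambda>(q, y0, x, e) v. mu q ^ N * J (sqrt (lam q) *\<^sub>R (x - y0)) ^ (2 * N) * J v ^ (2 * N))
     (\<lambda>(q, y0, x, e) v. rem N (\<rho>t q) (gr q x) (gr q y0 + sqrt (lam q) *\<^sub>R v))"
proof (rule Sy_I)
  fix L :: "'a list" assume L: "L \<in> lists Basis"
  let ?l = "length L"
  let ?F = "\<lambda>(q, y0, x, e::real) v. rem N (\<rho>t q) (gr q x) (gr q y0 + sqrt (lam q) *\<^sub>R v)"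
  have smo_rem: "smo (rem N (\<rho>t q) \<zeta>)" if "q \<in> Q" for q \<zeta> using Sy_smo[OF tempered_rem[OF that], of "()"] by simp
  have PDF: "PD L (?F (q, y0, x, e)) = (\<lambda>v. of_real (sqrt (lam q)) ^ ?l * rem (N - ?l) (PD L (\<rho>t q)) (gr q x) (gr q y0 + sqrt (lam q) *\<^sub>R v))"
    if "q \<in> Q" for q y0 x e
    using PD_affine[OF smo_rem[OF that] L, of "gr q x" "gr q y0" "sqrt (lam q)"] PD_rem[OF smo_\<rho>t[OF that] L] by simp
  show "PD L (?F p) differentiable (at v)" if P: "p \<in> Par2" for p v
  proof -
    obtain q y0 x e where p: "p = (q, y0, x, e)" "q \<in> Q" using P by (auto simp: Par2_def)
    have "(\<lambda>v. rem (N - ?l) (PD L (\<rho>t q)) (gr q x) (gr q y0 + sqrt (lam q) *\<^sub>R v)) differentiable (at v)"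
      using differentiable_chain_at[of "\<lambda>v. gr q y0 + sqrt (lam q) *\<^sub>R v" v "rem (N - ?l) (PD L (\<rho>t q)) (gr q x)"]
        rem_differentiable[OF smo_PD[OF smo_\<rho>t[OF p(2)] L]] by (auto simp: o_def intro!: derivative_intros)
    then show ?thesis unfolding p(1) PDF[OF p(2)] by (intro differentiable_mult) auto
  qed
  have pl: "(\<Prod>b\<leftarrow>L. J v) = J v ^ ?l" for v :: 'a by (induction L) auto
  show "\<exists>C\<ge>0. \<forall>p\<in>Par2. \<forall>v\<in>UNIV. norm (PD L (?F p) v) \<le> C * ((case p of (q, y0, x, e) \<Rightarrow> \<lambda>v. mu q ^ N * J (sqrt (lam q) *\<^sub>R (x - y0)) ^ (2 * N) * J v ^ (2 * N)) v * (\<Prod>b\<leftarrow>L. J v))"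
  proof (cases "N \<le> ?l")
    case True
    obtain C where C: "C \<ge> 0" "\<And>q y v. q \<in> Q \<Longrightarrow> sqrt (lam q) ^ ?l * norm (PD L (\<rho>t q) (gr q y + sqrt (lam q) *\<^sub>R v)) \<le> C * (mu q * J v) ^ ?l"
      using \<rho>_bound[of ?l] L by blast
    show ?thesis
    proof (intro exI[of _ C] conjI ballI)
      fix p and v :: 'a assume "p \<in> Par2"
      then obtain q y0 x e where p: "p = (q, y0, x, e)" "q \<in> Q" by (auto simp: Par2_def)
      have l1: "1 \<le> sqrt (lam q)" using lam[OF p(2)] by simp
      let ?w = "J (sqrt (lam q) *\<^sub>R (x - y0)) ^ (2 * N) * J v ^ (2 * N)"
      have w: "1 \<le> ?w" using mult_mono[OF J_power_ge1[of "sqrt (lam q) *\<^sub>R (x - y0)" "2 * N"] J_power_ge1[of v "2 * N"]] by (simp add: less_imp_le[OF J_pos])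
      have "norm (PD L (?F p) v) = sqrt (lam q) ^ ?l * norm (PD L (\<rho>t q) (gr q y0 + sqrt (lam q) *\<^sub>R v))"
        unfolding p(1) PDF[OF p(2)] using True l1 by (simp add: norm_mult norm_power)
      also have "\<dots> \<le> C * (mu q * J v) ^ ?l" by (rule C(2)[OF p(2)])
      also have "\<dots> = C * (mu q ^ ?l * J v ^ ?l)" by (simp add: power_mult_distrib)
      \<comment> \<open>\<open>mu q \<le> 1\<close>, so the gain from derivatives beyond the order
        \<open>N\<close> is dropped.\<close>
      also have "\<dots> \<le> C * (mu q ^ N * J v ^ ?l)"
        using C(1) J_pos[of v] mu[OF p(2)] True by (intro mult_left_mono mult_right_mono power_decreasing) auto
      also have "\<dots> \<le> C * (mu q ^ N * J v ^ ?l) * ?w"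
        using mult_left_mono[OF w, of "C * (mu q ^ N * J v ^ ?l)"] C(1) J_pos[of v] mu(1)[OF p(2)] by simp
      finally show "norm (PD L (?F p) v) \<le> C * ((case p of (q, y0, x, e) \<Rightarrow> \<lambda>v. mu q ^ N * J (sqrt (lam q) *\<^sub>R (x - y0)) ^ (2 * N) * J v ^ (2 * N)) v * (\<Prod>b\<leftarrow>L. J v))"
        by (simp add: p(1) pl mult_ac)
    qed (rule C)
  next
    case False
    define M where "M = N - ?l"
    have M: "M + ?l = N" "M \<le> N" using False by (auto simp: M_def)
    obtain C where C: "C \<ge> 0" "\<And>L q y v. L \<in> lists Basis \<Longrightarrow> length L = N \<Longrightarrow> q \<in> Q \<Longrightarrow> sqrt (lam q) ^ N * norm (PD L (\<rho>t q) (gr q y + sqrt (lam q) *\<^sub>R v)) \<le> C * (mu q * J v) ^ N"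
      using \<rho>_bound[of N] by blast
    obtain G where G: "G \<ge> 0" "\<And>q x y. q \<in> Q \<Longrightarrow> norm (gr q y - gr q x) \<le> G * lam q * norm (y - x)"
      using gr_lipschitz by blast
    \<comment> \<open>\<open>2\<close> comes from Peetre's inequality and
      \<open>max 1 (G\<^sup>2)\<close> from dilating \<open>J\<close> by the Lipschitz constant. In
      the power \<open>2 * N\<close>, one \<open>N\<close> stems from \<open>\<rho>_bound\<close>
      and the other from \<open>norm V ^ M\<close>.\<close>
    let ?C = "real DIM('a) ^ M * C * (2 * max 1 (G\<^sup>2)) ^ (2 * N)"
    show ?thesis
    proof (intro exI[of _ ?C] conjI ballI)
      fix p and v :: 'a assume "p \<in> Par2"
      then obtain q y0 x e where p: "p = (q, y0, x, e)" "q \<in> Q" by (auto simp: Par2_def)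
      define sl where "sl = sqrt (lam q)"
      have sl: "1 \<le> sl" "sl * sl = lam q" using lam[OF p(2)] by (auto simp: sl_def)
      define V where "V = (1 / sl) *\<^sub>R (gr q y0 + sl *\<^sub>R v - gr q x)"
      have V: "gr q y0 + sl *\<^sub>R v = gr q x + 1 *\<^sub>R (sl *\<^sub>R V)" using sl by (simp add: V_def)
      let ?A = "C * (mu q * J V) ^ N / sl ^ N"
      have A0: "0 \<le> ?A" using C(1) mu(1)[OF p(2)] J_pos[of V] sl by simp
      have "norm (rem M (PD L (\<rho>t q)) (gr q x) (gr q x + 1 *\<^sub>R (sl *\<^sub>R V))) \<le> (real DIM('a) * norm (sl *\<^sub>R V)) ^ M * ?A"
      proof (rule rem_bound[OF smo_PD[OF smo_\<rho>t[OF p(2)] L]])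
        fix L' :: "'a list" and s :: real assume L': "L' \<in> lists Basis" "length L' = M" and s: "0 \<le> s" "s \<le> 1"
        have "sl ^ N * norm (PD (L' @ L) (\<rho>t q) (gr q x + sl *\<^sub>R (s *\<^sub>R V))) \<le> C * (mu q * J (s *\<^sub>R V)) ^ N"
          unfolding sl_def by (rule C(2)) (use L L' M p in auto)
        also have "\<dots> \<le> C * (mu q * J V) ^ N"
        proof (intro mult_left_mono power_mono C(1))
          have "norm (s *\<^sub>R V) \<le> 1 * norm V" using mult_right_mono[of s 1 "norm V"] s by simp
          then show "J (s *\<^sub>R V) \<le> J V" by (intro J_mono) simp
        qed (use mu(1)[OF p(2)] J_pos[of "s *\<^sub>R V"] in auto)
        finally show "norm (PD L' (PD L (\<rho>t q)) (gr q x + s *\<^sub>R (sl *\<^sub>R V))) \<le> ?A"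
          using sl by (simp add: PD_append field_simps)
      qed (use A0 in auto)
      then have "sl ^ ?l * norm (rem M (PD L (\<rho>t q)) (gr q x) (gr q y0 + sl *\<^sub>R v)) \<le> sl ^ ?l * ((real DIM('a) * (sl * norm V)) ^ M * ?A)"
        unfolding V using sl by (intro mult_left_mono) auto
      also have "\<dots> = real DIM('a) ^ M * C * mu q ^ N * (norm V ^ M * J V ^ N) * ((sl ^ ?l * sl ^ M) / sl ^ N)"
        by (simp add: power_mult_distrib)
      also have "(sl ^ ?l * sl ^ M) / sl ^ N = 1" using sl M(1) by (simp add: power_add[symmetric] add.commute)
      also have "real DIM('a) ^ M * C * mu q ^ N * (norm V ^ M * J V ^ N) * 1 \<le> real DIM('a) ^ M * C * mu q ^ N * (J V ^ N * J V ^ N) * 1"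
      proof -
        have "norm V ^ M \<le> J V ^ M" by (intro power_mono norm_le_J) auto
        also have "\<dots> \<le> J V ^ N" by (rule J_power_mono[OF M(2)])
        finally show ?thesis using C(1) mu(1)[OF p(2)] J_pos[of V] by (intro mult_right_mono mult_left_mono) auto
      qed
      also have "\<dots> = real DIM('a) ^ M * C * mu q ^ N * J V ^ (2 * N)" by (simp add: mult_2 power_add)
      also have "\<dots> \<le> real DIM('a) ^ M * C * mu q ^ N * (2 * max 1 (G\<^sup>2) * J (sl *\<^sub>R (x - y0)) * J v) ^ (2 * N)"
      proof (intro mult_left_mono power_mono)
        have "V = (1 / sl) *\<^sub>R (gr q y0 - gr q x) + v" using sl by (simp add: V_def algebra_simps)
        then have "J V \<le> 2 * (J ((1 / sl) *\<^sub>R (gr q y0 - gr q x)) * J v)" using J_peetre by metis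
        also have "J ((1 / sl) *\<^sub>R (gr q y0 - gr q x)) \<le> J (G *\<^sub>R (sl *\<^sub>R (x - y0)))"
        proof (rule J_mono)
          have "norm ((1 / sl) *\<^sub>R (gr q y0 - gr q x)) \<le> (1 / sl) * (G * lam q * norm (y0 - x))"
            using G(2)[OF p(2), of y0 x] sl by (simp add: divide_right_mono)
          also have "\<dots> = G * (sl * norm (x - y0))"
            using sl(1) unfolding sl(2)[symmetric] by (simp add: norm_minus_commute)
          also have "\<dots> = norm (G *\<^sub>R (sl *\<^sub>R (x - y0)))"
            using sl(1) G(1) by (simp only: norm_scaleR)
          finally show "norm ((1 / sl) *\<^sub>R (gr q y0 - gr q x)) \<le> norm (G *\<^sub>R (sl *\<^sub>R (x - y0)))" .
        qed
        also have "\<dots> \<le> max 1 (G\<^sup>2) * J (sl *\<^sub>R (x - y0))" by (rule J_scale_le)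
        finally show "J V \<le> 2 * max 1 (G\<^sup>2) * J (sl *\<^sub>R (x - y0)) * J v" using J_pos[of v] by (simp add: mult_ac)
      qed (use C(1) mu(1)[OF p(2)] J_pos[of V] in auto)
      finally have fin: "sl ^ ?l * norm (rem M (PD L (\<rho>t q)) (gr q x) (gr q y0 + sl *\<^sub>R v))
        \<le> ?C * (mu q ^ N * J (sl *\<^sub>R (x - y0)) ^ (2 * N) * J v ^ (2 * N))"
        by (simp add: power_mult_distrib mult_ac)
      have "norm (PD L (?F p) v) = sl ^ ?l * norm (rem M (PD L (\<rho>t q)) (gr q x) (gr q y0 + sl *\<^sub>R v))"
        unfolding p(1) PDF[OF p(2)] using sl by (simp add: norm_mult norm_power sl_def M_def)
      also note fin
      also have "?C * (mu q ^ N * J (sl *\<^sub>R (x - y0)) ^ (2 * N) * J v ^ (2 * N)) \<le> ?C * (mu q ^ N * J (sl *\<^sub>R (x - y0)) ^ (2 * N) * J v ^ (2 * N)) * J v ^ ?l"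
        using mult_left_mono[OF J_power_ge1[of v ?l], of "?C * (mu q ^ N * J (sl *\<^sub>R (x - y0)) ^ (2 * N) * J v ^ (2 * N))"]
          C(1) mu(1)[OF p(2)] J_pos[of v] J_pos[of "sl *\<^sub>R (x - y0)"] by simp
      finally show "norm (PD L (?F p) v) \<le> ?C * ((case p of (q, y0, x, e) \<Rightarrow> \<lambda>v. mu q ^ N * J (sqrt (lam q) *\<^sub>R (x - y0)) ^ (2 * N) * J v ^ (2 * N)) v * (\<Prod>b\<leftarrow>L. J v))"
        by (simp add: p(1) pl sl_def mult.assoc)
    qed (use C(1) in simp)
  qed
qed

definition Pfun :: "nat \<Rightarrow> 'q \<times> 'a \<times> 'a \<times> real \<Rightarrow> 'a \<Rightarrow> complex" where
  "Pfun N = (\<lambda>(q, y0, x, e) v. gauss e (gr q y0 + sqrt (lam q) *\<^sub>R v) * rem N (\<rho>t q) (gr q x) (gr q y0 + sqrt (lam q) *\<^sub>R v))"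

lemma Sy_Pfun:
  "Sy Par2 UNIV (\<lambda>_ _ v. J v) (\<lambda>p v. (case p of (q, y0, x, e) \<Rightarrow> mu q ^ N * J (sqrt (lam q) *\<^sub>R (x - y0)) ^ (2 * N)) * J v ^ (2 * N)) (Pfun N)"
proof -
  let ?A = "\<lambda>p v. gr (fst p) (fst (snd p)) + sqrt (lam (fst p)) *\<^sub>R v"
  have "Sy Par2 UNIV (\<lambda>p _ _. sqrt (snd (snd (snd p)))) (\<lambda>_ _. 1) (\<lambda>p. gauss (snd (snd (snd p))) :: 'a \<Rightarrow> complex)"
    by (rule Sy_gauss) (auto simp: Par2_def)
  then have "Sy Par2 UNIV (\<lambda>p _ _. \<bar>sqrt (lam (fst p))\<bar> * sqrt (snd (snd (snd p)))) (\<lambda>_ _. 1) (\<lambda>p v. gauss (snd (snd (snd p))) (?A p v))"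
    by (rule Sy_pullback[where \<pi> = "\<lambda>p. p" and A = ?A and \<tau> = "\<lambda>b. b" and c = "\<lambda>p. sqrt (lam (fst p))"])
       (auto simp: algebra_simps intro!: derivative_intros)
  then have "Sy Par2 UNIV (\<lambda>_ _ v. J v) (\<lambda>_ _. 1) (\<lambda>p v. gauss (snd (snd (snd p))) (?A p v))"
  proof (rule Sy_mono[where D = 1 and D' = 1])
    fix p and v :: 'a assume "p \<in> Par2"
    then have q: "fst p \<in> Q" "0 < snd (snd (snd p))" "snd (snd (snd p)) * lam (fst p) \<le> 1" by (auto simp: Par2_def)
    have "sqrt (lam (fst p)) * sqrt (snd (snd (snd p))) = sqrt (snd (snd (snd p)) * lam (fst p))" by (simp add: real_sqrt_mult)
    also have "\<dots> \<le> 1" using q by simp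
    finally show "0 \<le> \<bar>sqrt (lam (fst p))\<bar> * sqrt (snd (snd (snd p))) \<and> \<bar>sqrt (lam (fst p))\<bar> * sqrt (snd (snd (snd p))) \<le> 1 * J v"
      using lam[OF q(1)] q J_ge1[of v] by auto
  qed auto
  from Sy_mult[OF open_UNIV this Sy_rem[of N]] show ?thesis
    by (rule Sy_cong') (auto simp: Pfun_def case_prod_beta)
qed

text \<open>After rescaling, each windowed integral has the form treated by
  \<open>oscillatory_bound\<close>, with the Jacobians in space and in frequency cancelling. The
  estimate loses no power of \<open>lam q\<close>, because windows far from \<open>x\<close> are
  suppressed on the scale \<open>1 / sqrt (lam q)\<close> of the windows themselves.\<close>

theorem osc_rem_bound:
  "\<exists>C\<ge>0. \<forall>q\<in>Q. \<forall>x e. 0 < e \<and> e < 1 \<and> e * lam q \<le> 1 \<longrightarrow>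
     norm (osc (\<lambda>y. a q y * cis (\<phi> q y)) (rem N (\<rho>t q) (gr q x)) x e) \<le> C * mu q ^ N"
proof -
  let ?n = "DIM('a)"
  let ?B = "\<lambda>p. case p of (q, y0, x, e::real) \<Rightarrow> mu q ^ N * J (sqrt (lam q) *\<^sub>R (x - y0)) ^ (2 * N)"
  have h: "Sy Par2 UNIV (\<lambda>_ _ w. J w) (\<lambda>_ w. 1 / J w ^ K) (\<lambda>p. hfun (fst p, fst (snd p), snd (snd (snd p))))" for K
    using Sy_reindex[OF Sy_hfun[of K] open_UNIV, of Par2 "\<lambda>p. (fst p, fst (snd p), snd (snd (snd p)))"]
    by (auto simp: Par1_def Par2_def)
  have Sp: "Sch (\<lambda>\<eta>. gauss e \<eta> * rem N (\<rho>t q) \<zeta> \<eta>)" if "q \<in> Q" "0 < e" for q e \<zeta>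
    by (rule Sch_mult(1)[OF Sch_gauss[OF that(2)] tempered_rem[OF that(1)]])
  have SP: "Sch (Pfun N p)" if "p \<in> Par2" for p
  proof -
    obtain q y0 x e where "p = (q, y0, x, e)" by (metis prod.exhaust)
    with that have p: "p = (q, y0, x, e)" "q \<in> Q" "0 < e" by (auto simp: Par2_def)
    have "sqrt (lam q) \<noteq> 0" using lam[OF p(2)] by simp
    from Sch_affine[OF Sp[OF p(2,3), of "gr q x"] this, of "gr q y0"] show ?thesis by (simp add: Pfun_def p(1))
  qed
  have B: "0 \<le> ?B p" if "p \<in> Par2" for p
    using that mu(1) by (auto simp: Par2_def less_imp_le[OF J_pos])
  \<comment> \<open>Of the decay of order \<open>2 * N + ?n\<close>, the part \<open>2 * N\<close>
    cancels the growth of \<open>?B\<close> in \<open>x - y0\<close>, and \<open>?n\<close> makes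
    the integral over the centres \<open>y0\<close> converge.\<close>
  obtain C where C: "C \<ge> 0" "\<And>p w1. p \<in> Par2 \<Longrightarrow> norm (LINT w|lborel. hfun (fst p, fst (snd p), snd (snd (snd p))) w * FT (Pfun N p) (w - w1)) \<le> C * ?B p / J w1 ^ (2 * N + ?n)"
    using oscillatory_bound[OF h Sy_Pfun[of N] B SP, of "2 * N + ?n"] by blast
  define I0 where "I0 = (LINT v|lborel. 1 / J (v::'a) ^ ?n)"
  have I0: "I0 \<ge> 0" unfolding I0_def by (rule integral_nonneg_AE) (auto simp: less_imp_le[OF J_pos])
  show ?thesis
  proof (intro exI[of _ "C * I0 / sqrt pi ^ ?n"] conjI ballI allI impI)
    fix q x e assume q: "q \<in> Q" and e: "0 < e \<and> e < 1 \<and> e * lam q \<le> 1"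
    define sl where "sl = sqrt (lam q)"
    have sl: "1 \<le> sl" "cc q * sl = 1" "cc q = 1 / sl" using lam[OF q] cc(4)[OF q] by (auto simp: sl_def cc_def)
    define p where "p = rem N (\<rho>t q) (gr q x)"
    define u where "u = (\<lambda>y. a q y * cis (\<phi> q y))"
    define G where "G = (\<lambda>y. gauss e y * u y * FT (\<lambda>\<eta>. gauss e \<eta> * p \<eta>) (y - x))"
    have Sgp: "Sch (\<lambda>\<eta>. gauss e \<eta> * p \<eta>)" unfolding p_def using Sp q e by simp
    note [measurable] = integrable_Sch(3)[OF Sgp] FT_measurable[OF integrable_Sch(3)[OF Sgp]]
    have ub: "\<exists>Cu\<ge>0. \<forall>y. norm (u y) \<le> Cu" using Sy_bound0[OF a] q unfolding u_def by (auto simp: norm_mult)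
    have um [measurable]: "u \<in> borel_measurable borel"
    proof -
      have [measurable]: "a q \<in> borel_measurable borel" using Sy_diff0[OF a q] by (intro differentiable_imp_measurable) auto
      have [measurable]: "\<Phi> q \<in> borel_measurable borel" by (rule differentiable_imp_measurable(2)[OF \<phi>_diff[OF q]])
      have "(\<lambda>y. Re (\<Phi> q y)) \<in> borel_measurable borel" by measurable
      then have [measurable]: "\<phi> q \<in> borel_measurable borel" by simp
      show ?thesis unfolding u_def by measurable
    qed
    have Gi: "integrable lborel G"
    proof -
      obtain Cu where Cu: "Cu \<ge> 0" "\<And>y. norm (u y) \<le> Cu" using ub by blast
      have ge: "integrable lborel (\<lambda>y::'a. norm (gauss e y) * (Cu * (LINT y|lborel. norm (gauss e y * p y))))"
        using e by (intro integrable_mult_left integrable_norm integrable_Sch(1) Sch_gauss) auto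
      have [measurable]: "gauss e \<in> borel_measurable (borel :: 'a measure)" using e by (intro integrable_Sch(3) Sch_gauss) auto
      show ?thesis
      proof (rule Bochner_Integration.integrable_bound[OF ge])
        show "G \<in> borel_measurable lborel" unfolding G_def by measurable
        show "AE y in lborel. norm (G y) \<le> norm (norm (gauss e y) * (Cu * (LINT y|lborel. norm (gauss e y * p y))))"
        proof (intro always_eventually allI)
          fix y
          have I: "0 \<le> (LINT y|lborel. norm (gauss e y * p y))" by (rule integral_nonneg_AE) auto
          have "norm (u y) * norm (FT (\<lambda>\<eta>. gauss e \<eta> * p \<eta>) (y - x)) \<le> Cu * (LINT y|lborel. norm (gauss e y * p y))"
            using Cu FT_bound[OF integrable_Sch(1)[OF Sgp]] by (intro mult_mono) auto
          then have "norm (G y) \<le> norm (gauss e y) * (Cu * (LINT y|lborel. norm (gauss e y * p y)))"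
            unfolding G_def norm_mult mult.assoc by (rule mult_left_mono) simp
          then show "norm (G y) \<le> norm (norm (gauss e y) * (Cu * (LINT y|lborel. norm (gauss e y * p y))))"
            by (rule order_trans) (simp only: real_norm_def abs_ge_self)
        qed
      qed
    qed
    have Kb: "norm (LINT y|lborel. gauss 1 ((1 / cc q) *\<^sub>R (y - y0)) * G y) \<le> C * mu q ^ N * (1 / J (sl *\<^sub>R x + (- sl) *\<^sub>R y0) ^ ?n)" for y0
    proof -
      let ?P = "(q, y0, x, e)" and ?w1 = "sl *\<^sub>R (x - y0)"
      have P: "?P \<in> Par2" using q e by (simp add: Par2_def)
      have FTz: "FT (\<lambda>\<eta>. gauss e \<eta> * p \<eta>) z = of_real (sl ^ ?n) * (cis (- (gr q y0 \<bullet> z)) * FT (Pfun N ?P) (sl *\<^sub>R z))" for z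
      proof -
        have "FT (\<lambda>\<eta>. gauss e \<eta> * p \<eta>) z = \<bar>sl\<bar> ^ ?n *\<^sub>R (LINT v|lborel. gauss e (gr q y0 + sl *\<^sub>R v) * p (gr q y0 + sl *\<^sub>R v) * cis (- ((gr q y0 + sl *\<^sub>R v) \<bullet> z)))"
          unfolding FT_def by (rule integral_lborel_affine(1)) (use sl in auto)
        also have "(LINT v|lborel. gauss e (gr q y0 + sl *\<^sub>R v) * p (gr q y0 + sl *\<^sub>R v) * cis (- ((gr q y0 + sl *\<^sub>R v) \<bullet> z)))
          = (LINT v|lborel. cis (- (gr q y0 \<bullet> z)) * (Pfun N ?P v * cis (- (v \<bullet> (sl *\<^sub>R z)))))"
          by (rule Bochner_Integration.integral_cong[OF refl])
             (simp add: Pfun_def p_def sl_def inner_add_left cis_mult)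
        also have "\<dots> = cis (- (gr q y0 \<bullet> z)) * FT (Pfun N ?P) (sl *\<^sub>R z)" unfolding FT_def by (rule integral_mult_right_zero)
        finally show ?thesis using sl by (simp add: scaleR_conv_of_real)
      qed
      have [measurable]: "gauss 1 \<in> borel_measurable (borel :: 'a measure)" by (rule integrable_Sch(3)[OF Sch_gauss1])
      have [measurable]: "G \<in> borel_measurable borel" using Gi by auto
      have "(LINT y|lborel. gauss 1 ((1 / cc q) *\<^sub>R (y - y0)) * G y)
        = \<bar>cc q\<bar> ^ ?n *\<^sub>R (LINT w|lborel. gauss 1 ((1 / cc q) *\<^sub>R ((y0 + cc q *\<^sub>R w) - y0)) * G (y0 + cc q *\<^sub>R w))"
        by (rule integral_lborel_affine(1)) (use cc(1)[OF q] in auto)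
      also have "(LINT w|lborel. gauss 1 ((1 / cc q) *\<^sub>R ((y0 + cc q *\<^sub>R w) - y0)) * G (y0 + cc q *\<^sub>R w))
        = (LINT w|lborel. (of_real (sl ^ ?n) * cis (- (gr q y0 \<bullet> (y0 - x)))) * (hfun (q, y0, e) w * FT (Pfun N ?P) (w - ?w1)))"
      proof (rule Bochner_Integration.integral_cong[OF refl])
        fix w
        have z: "sl *\<^sub>R (y0 + cc q *\<^sub>R w - x) = w - ?w1" using sl(1) by (simp add: algebra_simps sl(3))
        have c1: "cis (- (gr q y0 \<bullet> (y0 + cc q *\<^sub>R w - x))) = cis (- (gr q y0 \<bullet> (y0 - x))) * cis (- (cc q * (w \<bullet> gr q y0)))"
          by (simp add: cis_mult inner_diff_right inner_add_right inner_commute inner_diff_left diff_diff_eq)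
        have c2: "exp (pha (q, y0, e) w) = cis (\<phi> q (y0 + cc q *\<^sub>R w)) * cis (- (cc q * (w \<bullet> gr q y0)))"
          by (simp add: pha_def cis_mult cis_conv_exp exp_add[symmetric] algebra_simps)
        have w: "(1 / cc q) *\<^sub>R ((y0 + cc q *\<^sub>R w) - y0) = w" using cc(1)[OF q] by simp
        show "gauss 1 ((1 / cc q) *\<^sub>R ((y0 + cc q *\<^sub>R w) - y0)) * G (y0 + cc q *\<^sub>R w)
          = (of_real (sl ^ ?n) * cis (- (gr q y0 \<bullet> (y0 - x)))) * (hfun (q, y0, e) w * FT (Pfun N ?P) (w - ?w1))"
          unfolding w G_def u_def FTz z c1 hfun_def prod.case c2 by (simp only: mult_ac)
      qed
      also have "\<dots> = (of_real (sl ^ ?n) * cis (- (gr q y0 \<bullet> (y0 - x)))) * (LINT w|lborel. hfun (q, y0, e) w * FT (Pfun N ?P) (w - ?w1))"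
        by (rule integral_mult_right_zero)
      finally have "norm (LINT y|lborel. gauss 1 ((1 / cc q) *\<^sub>R (y - y0)) * G y) = (cc q ^ ?n * sl ^ ?n) * norm (LINT w|lborel. hfun (q, y0, e) w * FT (Pfun N ?P) (w - ?w1))"
        using cc(1)[OF q] sl(1) by (simp add: norm_mult norm_power)
      also have "cc q ^ ?n * sl ^ ?n = 1" using sl(2) by (simp flip: power_mult_distrib)
      also have "1 * norm (LINT w|lborel. hfun (q, y0, e) w * FT (Pfun N ?P) (w - ?w1)) \<le> C * ?B ?P / J ?w1 ^ (2 * N + ?n)"
        using C(2)[OF P, of ?w1] by simp
      also have "\<dots> = C * mu q ^ N * (1 / J ?w1 ^ ?n)" by (simp add: sl_def power_add)
      finally show ?thesis by (simp add: scaleR_diff_right)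
    qed
    let ?k = "\<lambda>y0. C * mu q ^ N * (1 / J (sl *\<^sub>R x + (- sl) *\<^sub>R y0) ^ ?n)"
    have Ji: "integrable lborel (\<lambda>y0. 1 / J (sl *\<^sub>R x + (- sl) *\<^sub>R y0) ^ ?n)"
      using integral_lborel_affine(2)[of "- sl" "\<lambda>v::'a. 1 / J v ^ ?n" "sl *\<^sub>R x"] integrable_J sl(1) by simp
    \<comment> \<open>Integration over the centres yields \<open>cc q ^ ?n\<close>, the same power
      as in the window normalisation, so the final constant is free of \<open>q\<close>.\<close>
    have Jc: "(LINT y0|lborel. 1 / J (sl *\<^sub>R x + (- sl) *\<^sub>R y0) ^ ?n) = cc q ^ ?n * I0"
    proof -
      have "I0 = \<bar>- sl\<bar> ^ ?n *\<^sub>R (LINT y0|lborel. 1 / J (sl *\<^sub>R x + (- sl) *\<^sub>R y0) ^ ?n)"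
        unfolding I0_def by (rule integral_lborel_affine(1)) (use sl in auto)
      then show ?thesis using sl(1) by (simp add: sl(3) power_divide)
    qed
    have "(cc q * sqrt pi) ^ ?n * norm (LINT y|lborel. G y) \<le> (LINT y0|lborel. ?k y0)"
      by (rule window_bound[OF Gi cc(1)[OF q] integrable_mult_right[OF Ji] Kb])
    also have "\<dots> = C * mu q ^ N * (cc q ^ ?n * I0)" unfolding integral_mult_right_zero Jc ..
    finally have "cc q ^ ?n * (sqrt pi ^ ?n * norm (LINT y|lborel. G y)) \<le> cc q ^ ?n * (C * mu q ^ N * I0)"
      by (simp add: power_mult_distrib mult_ac)
    then have "sqrt pi ^ ?n * norm (LINT y|lborel. G y) \<le> C * mu q ^ N * I0"
      using cc(1)[OF q] by (simp add: mult_le_cancel_left_pos)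
    then show "norm (osc (\<lambda>y. a q y * cis (\<phi> q y)) (rem N (\<rho>t q) (gr q x)) x e) \<le> C * I0 / sqrt pi ^ ?n * mu q ^ N"
      unfolding osc_def G_def u_def p_def by (simp add: pos_le_divide_eq mult_ac)
  qed (use C I0 in simp)
qed

end

section \<open>The phase and the terms of the expansion\<close>

lemma jbr_eq: "jbr \<xi> = sqrt (J \<xi>)" by (simp add: jbr_def J_norm)
lemma jbr_ge1: "1 \<le> jbr \<xi>" by (simp add: jbr_def)
lemma jbr_pos: "0 < jbr \<xi>" using jbr_ge1[of \<xi>] by linarith
lemma jbr_le_norm: "1 < norm \<xi> \<Longrightarrow> jbr \<xi> \<le> 2 * norm \<xi>"
proof -
  assume n: "1 < norm \<xi>"
  have "1 * 1 \<le> norm \<xi> * norm \<xi>" using n by (intro mult_mono) auto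
  then have "1 + (norm \<xi>)\<^sup>2 \<le> (2 * norm \<xi>)\<^sup>2" by (simp add: power2_eq_square)
  then show ?thesis unfolding jbr_def by (intro real_le_lsqrt) (use n in auto)
qed
abbreviation Om :: "((real^'n) \<times> (real^'n)) set" where "Om \<equiv> {p. norm (snd p) > 1}"

lemma open_Om [simp]: "open Om"
  by (intro open_Collect_less continuous_intros)

abbreviation T01 :: "real set" where "T01 \<equiv> {0<..<1}"

text \<open>Derivative weights of the symbol classes of type (1,0): a frequency direction,
  recognised by its vanishing space component, gains one power of the bracket.\<close>

definition om :: "(real^'n) \<times> (real^'n) \<Rightarrow> (real^'n) \<times> (real^'n) \<Rightarrow> real" where
  "om b p = (if fst b = 0 then 1 / jbr (snd p) else 1)"

lemma om: "0 \<le> om b p" "om b p \<le> 1"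
  using jbr_ge1[of "snd p"] by (auto simp: om_def)

definition bx :: "real^'n \<Rightarrow> (real^'n) \<times> (real^'n)" where "bx b = (b, 0)"

lemma bx_Basis: "b \<in> Basis \<Longrightarrow> bx b \<in> Basis"
  by (auto simp: bx_def Basis_prod_def)

lemma map_bx_Basis: "L \<in> lists Basis \<Longrightarrow> map bx L \<in> lists Basis"
  unfolding in_lists_conv_set set_map using bx_Basis by blast

lemma om_bx: "b \<in> Basis \<Longrightarrow> om (bx b) p = 1"
  using nonzero_Basis by (auto simp: om_def bx_def)

lemma om_edir: "om (edir d) p = (case d of Inl i \<Rightarrow> 1 | Inr i \<Rightarrow> 1 / jbr (snd p))"
  by (cases d) (auto simp: om_def edir_def)

lemma edir_sort: "\<exists>G B. mset L = mset (map Inr G @ map Inl B)" for L :: "('n + 'n) list"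
proof (induction L)
  case Nil
  show ?case by (intro exI[of _ "[]"]) simp
next
  case (Cons d L)
  then obtain G B where GB: "mset L = mset (map Inr G @ map Inl B)" by blast
  show ?case
  proof (cases d)
    case (Inl i)
    then show ?thesis using GB by (intro exI[of _ G] exI[of _ "i # B"]) simp
  next
    case (Inr i)
    then show ?thesis using GB by (intro exI[of _ "i # G"] exI[of _ B]) simp
  qed
qed

lemma prod_om_sort:
  assumes "mset L = mset (map Inr G @ map Inl B)"
  shows "(\<Prod>b\<leftarrow>map edir L. om b p) = (1 / jbr (snd p)) ^ length G"
proof -
  have "(\<Prod>b\<leftarrow>map edir L. om b p) = prod_mset (image_mset (\<lambda>d. om (edir d) p) (mset L))"
    by (simp add: o_def flip: prod_mset_prod_list mset_map)
  also have "\<dots> = (\<Prod>d\<leftarrow>map Inr G @ map Inl B. om (edir d) p)"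
    unfolding assms by (simp flip: prod_mset_prod_list mset_map)
  also have "\<dots> = (1 / jbr (snd p)) ^ length G"
  proof -
    have "(\<Prod>d\<leftarrow>map Inl B. om (edir d) p) = 1" by (induction B) (auto simp: om_edir)
    moreover have "(\<Prod>d\<leftarrow>map Inr G. om (edir d) p) = (1 / jbr (snd p)) ^ length G" by (induction G) (auto simp: om_edir)
    ultimately show ?thesis by simp
  qed
  finally show ?thesis .
qed

lemma PD_unsorted_eq_dd:
  fixes F :: "real^'n \<Rightarrow> real^'n \<Rightarrow> 'b::real_normed_vector"
  assumes S: "open S" and sm: "smooth_on S F"
    and m: "mset L = mset (map Inr G @ map Inl B)" and p: "p \<in> S"
  shows "PD (map edir L) (\<lambda>p. F (fst p) (snd p)) p = dd G B F (fst p) (snd p)"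
proof -
  have "PD (map edir L) (\<lambda>p. F (fst p) (snd p)) p = PD (map edir (map Inr G @ map Inl B)) (\<lambda>p. F (fst p) (snd p)) p"
  proof (rule PD_perm[OF S smooth_on_imp_PD_differentiable[OF S sm] _ _ p])
    show "map edir L \<in> lists Basis" using lists_Basis_edir by blast
    show "mset (map edir L) = mset (map edir (map Inr G @ map Inl B))" using m by (simp only: mset_map)
  qed
  then show ?thesis by (simp add: dd_def Dl_eq_PD)
qed

text \<open>The exponent \<epsilon> and the order of the expansion are left out, since the analysis
  up to the bounds in powers of \<open>mup\<close> and the crude bounds is independent of the former
  and valid for every order.\<close>

locale symbol_setting =
  fixes a :: "real \<Rightarrow> real^'n::finite \<Rightarrow> real^'n \<Rightarrow> complex"
    and \<rho> :: "real^'n \<Rightarrow> complex" and \<phi> :: "real^'n \<Rightarrow> real^'n \<Rightarrow> real" and m :: real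
  assumes m: "m \<le> 0"
    and a_smooth: "\<forall>t\<in>{0<..<1}. smooth_on UNIV (a t)"
    and a_symb: "\<forall>G B. \<exists>C. \<forall>t\<in>{0<..<1}. \<forall>x \<xi>.
                   norm (dd G B (a t) x \<xi>) \<le> C * jbr \<xi> powr (m - real (length G))"
    and a_supp: "\<forall>t\<in>{0<..<1}. closure {p. a t (fst p) (snd p) \<noteq> 0} \<subseteq> Om"
    and rho: "S10 0 (\<lambda>x \<xi>. \<rho> \<xi>)"
    and phi_smooth: "smooth_on Om \<phi>"
    and phi_i: "\<exists>C1 C2. C1 > 0 \<and> C2 > 0 \<and> (\<forall>(x,\<xi>)\<in>Om.
                   C1 * norm \<xi> \<le> norm (grad_x \<phi> x \<xi>) \<and> norm (grad_x \<phi> x \<xi>) \<le> C2 * norm \<xi>)"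
    and phi_ii_x: "\<forall>B. length B \<ge> 1 \<longrightarrow> (\<exists>C. \<forall>(x,\<xi>)\<in>Om. norm (dd [] B \<phi> x \<xi>) \<le> C * jbr \<xi>)"
    and phi_ii_mixed: "\<forall>G B. length G \<ge> 1 \<longrightarrow> length B \<ge> 1 \<longrightarrow>
               (\<exists>C. \<forall>(x,\<xi>)\<in>Om. norm (dd G B \<phi> x \<xi>) \<le> C * norm \<xi> powr (1 - real (length G)))"
begin

abbreviation jb :: "(real^'n) \<times> (real^'n) \<Rightarrow> real" where "jb p \<equiv> jbr (snd p)"

section \<open>The hypotheses expressed in the weight calculus\<close>

definition ac :: "real \<Rightarrow> (real^'n) \<times> (real^'n) \<Rightarrow> complex" where "ac t p = a t (fst p) (snd p)"

definition phc :: "(real^'n) \<times> (real^'n) \<Rightarrow> complex" where "phc p = of_real (\<phi> (fst p) (snd p))"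

definition ze :: "(real^'n) \<times> (real^'n) \<Rightarrow> real^'n" where "ze p = grad_x \<phi> (fst p) (snd p)"

lemma Sy_ac: "Sy T01 UNIV (\<lambda>_. om) (\<lambda>_ p. jb p powr m) ac"
proof (rule Sy_I)
  fix L :: "((real^'n) \<times> (real^'n)) list" assume L: "L \<in> lists Basis"
  show "PD L (ac t) differentiable (at p)" if "t \<in> T01" for t p
    unfolding ac_def by (rule smooth_on_imp_PD_differentiable[OF open_UNIV _ L]) (use a_smooth that in auto)
  obtain L' where L': "L = map edir L'" using L lists_Basis_edir by blast
  obtain G B where GB: "mset L' = mset (map Inr G @ map Inl B)" using edir_sort by blast
  obtain C where C: "\<And>t x \<xi>. t \<in> T01 \<Longrightarrow> norm (dd G B (a t) x \<xi>) \<le> C * jbr \<xi> powr (m - real (length G))"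
    using a_symb by blast
  show "\<exists>C\<ge>0. \<forall>t\<in>T01. \<forall>p\<in>UNIV. norm (PD L (ac t) p) \<le> C * (jb p powr m * (\<Prod>b\<leftarrow>L. om b p))"
  proof (intro exI[of _ "\<bar>C\<bar>"] conjI ballI)
    fix t :: real and p :: "(real^'n) \<times> (real^'n)" assume t: "t \<in> T01"
    have "PD L (ac t) p = dd G B (a t) (fst p) (snd p)"
      unfolding ac_def L' by (rule PD_unsorted_eq_dd[OF open_UNIV _ GB]) (use a_smooth t in auto)
    then have "norm (PD L (ac t) p) \<le> C * jb p powr (m - real (length G))" using C[OF t] by simp
    also have "\<dots> \<le> \<bar>C\<bar> * jb p powr (m - real (length G))" by (intro mult_right_mono) auto
    also have "jb p powr (m - real (length G)) = jb p powr m * (\<Prod>b\<leftarrow>L. om b p)"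
      unfolding L' prod_om_sort[OF GB] using jbr_pos[of "snd p"] by (simp add: powr_diff powr_realpow power_divide)
    finally show "norm (PD L (ac t) p) \<le> \<bar>C\<bar> * (jb p powr m * (\<Prod>b\<leftarrow>L. om b p))" .
  qed auto
qed

lemma ac_zero: 
  assumes "t \<in> T01" "p \<notin> Om" shows "\<exists>U. open U \<and> p \<in> U \<and> (\<forall>q\<in>U. ac t q = 0)"
proof (intro exI[of _ "- closure {p. a t (fst p) (snd p) \<noteq> 0}"] conjI ballI)
  show "p \<in> - closure {p. a t (fst p) (snd p) \<noteq> 0}" using a_supp assms by auto
  fix q assume "q \<in> - closure {p. a t (fst p) (snd p) \<noteq> 0}"
  then show "ac t q = 0" using subsetD[OF closure_subset, of q "{p. a t (fst p) (snd p) \<noteq> 0}"] by (auto simp: ac_def)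
qed (rule open_Compl[OF closed_closure])

lemma phc_PD:
  assumes L: "L \<in> lists Basis" and p: "p \<in> Om"
  shows "PD L phc differentiable (at p)" "PD L phc p = of_real (PD L (\<lambda>p. \<phi> (fst p) (snd p)) p)"
  using PD_of_real[OF open_Om smooth_on_imp_PD_differentiable[OF open_Om phi_smooth] L p] unfolding phc_def[abs_def] by auto

text \<open>With \<open>bx b\<close> as the innermost derivative, every further derivative still
  contains a space direction, and such derivatives of the phase are exactly those that the
  hypotheses control.\<close>

lemma Sy_phc: assumes b: "b \<in> Basis" shows "Sy {()} Om (\<lambda>_. om) (\<lambda>_ p. jb p) (\<lambda>_. pd (bx b) phc)"
proof (rule Sy_I)
  fix L :: "((real^'n) \<times> (real^'n)) list" assume L: "L \<in> lists Basis"
  have PDe: "PD L (pd (bx b) phc) = PD (L @ [bx b]) phc" by (simp add: PD_append)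
  have Lb: "L @ [bx b] \<in> lists Basis" using L bx_Basis[OF b] by simp
  show "PD L (pd (bx b) phc) differentiable (at p)" if "p \<in> Om" for p
    unfolding PDe by (rule phc_PD(1)[OF Lb that])
  obtain i where i: "b = axis i 1" using b unfolding Basis_vec_axis by auto
  then have bi: "bx b = edir (Inl i)" by (simp add: bx_def edir_def)
  obtain L' where L': "L = map edir L'" using L lists_Basis_edir by blast
  obtain G B where GB: "mset L' = mset (map Inr G @ map Inl B)" using edir_sort by blast
  have GB': "mset (L' @ [Inl i]) = mset (map Inr G @ map Inl (B @ [i]))" using GB by simp
  have "\<exists>C\<ge>0. \<forall>p\<in>Om. norm (dd G (B @ [i]) \<phi> (fst p) (snd p)) \<le> C * (jb p * (1 / jb p) ^ length G)"
  proof (cases "G = []")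
    case True
    obtain C where C: "\<forall>(x,\<xi>)\<in>Om. norm (dd [] (B @ [i]) \<phi> x \<xi>) \<le> C * jbr \<xi>" using phi_ii_x by force
    have "norm (dd G (B @ [i]) \<phi> (fst p) (snd p)) \<le> \<bar>C\<bar> * (jb p * (1 / jb p) ^ length G)" if "p \<in> Om" for p
    proof -
      have "norm (dd [] (B @ [i]) \<phi> (fst p) (snd p)) \<le> C * jb p" using C that by (cases p) auto
      also have "\<dots> \<le> \<bar>C\<bar> * jb p" using jbr_pos[of "snd p"] by (intro mult_right_mono) auto
      finally show ?thesis using True by simp
    qed
    then show ?thesis by (intro exI[of _ "\<bar>C\<bar>"]) auto
  next
    case False
    then have "length G \<ge> 1" by (cases G) auto
    then obtain C where C: "\<forall>(x,\<xi>)\<in>Om. norm (dd G (B @ [i]) \<phi> x \<xi>) \<le> C * norm \<xi> powr (1 - real (length G))"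
      using phi_ii_mixed by force
    let ?g = "length G"
    \<comment> \<open>The exponent \<open>1 - real ?g\<close> is at most 0, so powers of the
      frequency and of its bracket are compared through \<open>jb p / 2 \<le> norm (snd p)\<close>,
      at the cost of \<open>2 powr (real ?g - 1)\<close>.\<close>
    have "norm (dd G (B @ [i]) \<phi> (fst p) (snd p)) \<le> (\<bar>C\<bar> * 2 powr (real ?g - 1)) * (jb p * (1 / jb p) ^ ?g)" if p: "p \<in> Om" for p
    proof -
      have n: "0 < jb p / 2" "jb p / 2 \<le> norm (snd p)" using jbr_le_norm[of "snd p"] jbr_pos[of "snd p"] p by auto
      have "norm (dd G (B @ [i]) \<phi> (fst p) (snd p)) \<le> C * norm (snd p) powr (1 - real ?g)" using C p by (cases p) auto
      also have "\<dots> \<le> \<bar>C\<bar> * norm (snd p) powr (1 - real ?g)" by (intro mult_right_mono) auto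
      also have "\<dots> \<le> \<bar>C\<bar> * (jb p / 2) powr (1 - real ?g)"
        using n \<open>length G \<ge> 1\<close> by (intro mult_left_mono powr_mono2') auto
      also have "(jb p / 2) powr (1 - real ?g) = 2 powr (real ?g - 1) * (jb p * (1 / jb p) ^ ?g)"
        using jbr_pos[of "snd p"] by (simp add: powr_divide powr_diff powr_realpow power_divide)
      finally show ?thesis by (simp add: mult.assoc)
    qed
    then show ?thesis by (intro exI[of _ "\<bar>C\<bar> * 2 powr (real ?g - 1)"]) auto
  qed
  then obtain C where C: "C \<ge> 0" "\<And>p. p \<in> Om \<Longrightarrow> norm (dd G (B @ [i]) \<phi> (fst p) (snd p)) \<le> C * (jb p * (1 / jb p) ^ length G)" by blast
  show "\<exists>C\<ge>0. \<forall>_\<in>{()}. \<forall>p\<in>Om. norm (PD L (pd (bx b) phc) p) \<le> C * (jb p * (\<Prod>b\<leftarrow>L. om b p))"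
  proof (intro exI[of _ C] conjI ballI)
    fix p :: "(real^'n) \<times> (real^'n)" assume p: "p \<in> Om"
    have Leq: "L @ [bx b] = map edir (L' @ [Inl i])" by (simp add: L' bi)
    have "norm (PD L (pd (bx b) phc) p) = norm (PD (L @ [bx b]) (\<lambda>p. \<phi> (fst p) (snd p)) p)"
      by (simp only: PDe phc_PD(2)[OF Lb p] norm_of_real real_norm_def)
    also have "\<dots> = norm (dd G (B @ [i]) \<phi> (fst p) (snd p))"
      by (simp only: Leq PD_unsorted_eq_dd[OF open_Om phi_smooth GB' p])
    also have "\<dots> \<le> C * (jb p * (1 / jb p) ^ length G)" by (rule C(2)[OF p])
    also have "(1 / jb p) ^ length G = (\<Prod>b\<leftarrow>L. om b p)" unfolding L' prod_om_sort[OF GB] ..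
    finally show "norm (PD L (pd (bx b) phc) p) \<le> C * (jb p * (\<Prod>b\<leftarrow>L. om b p))" .
  qed (rule C(1))
qed

lemma ze_inner:
  assumes b: "b \<in> Basis" and p: "p \<in> Om"
  shows "pd (bx b) phc p = of_real (ze p \<bullet> b)"
proof -
  obtain i where i: "b = axis i 1" using b unfolding Basis_vec_axis by auto
  have "pd (bx b) phc p = PD [bx b] phc p" by simp
  also have "\<dots> = of_real (PD [bx b] (\<lambda>p. \<phi> (fst p) (snd p)) p)" by (rule phc_PD(2)) (use bx_Basis[OF b] p in auto)
  also have "PD [bx b] (\<lambda>p. \<phi> (fst p) (snd p)) p = pdir (Inl i) \<phi> (fst p) (snd p)"
    using Dl_eq_PD[of "[Inl i]" \<phi> "fst p" "snd p"] by (simp add: i bx_def edir_def)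
  also have "\<dots> = ze p \<bullet> b" by (simp add: ze_def grad_x_def i inner_axis)
  finally show ?thesis .
qed

definition C1 :: real where "C1 = (SOME c. c > 0 \<and> (\<forall>p\<in>Om. c * jb p \<le> norm (ze p)))"

lemma C1: "C1 > 0" "p \<in> Om \<Longrightarrow> C1 * jb p \<le> norm (ze p)"
proof -
  obtain c1 where c: "c1 > 0" "\<forall>(x,\<xi>)\<in>Om. c1 * norm \<xi> \<le> norm (grad_x \<phi> x \<xi>)" using phi_i by blast
  \<comment> \<open>Halving the constant passes from the norm of the frequency to its bracket, which
    is at most twice as large on \<open>Om\<close>.\<close>
  have "(c1/2) * jb p \<le> norm (ze p)" if p: "p \<in> Om" for p
  proof -
    have "(c1/2) * jb p \<le> (c1/2) * (2 * norm (snd p))" using c(1) p by (intro mult_left_mono jbr_le_norm) auto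
    also have "\<dots> \<le> norm (ze p)" using c(2) p by (cases p) (auto simp: ze_def)
    finally show ?thesis .
  qed
  then have "\<exists>c. c > 0 \<and> (\<forall>p\<in>Om. c * jb p \<le> norm (ze p))" using c(1) by (intro exI[of _ "c1/2"]) auto
  from someI_ex[OF this] show "C1 > 0" "p \<in> Om \<Longrightarrow> C1 * jb p \<le> norm (ze p)" unfolding C1_def by blast+
qed

lemma PD_slice: "PD L (\<lambda>y. F (y, \<xi>)) y = PD (map bx L) F (y, \<xi>)"
proof (induction L arbitrary: y)
  case (Cons b L)
  show ?case by (simp add: pd_def bx_def Cons.IH[unfolded bx_def])
qed simp

lemma Dl_rho: "Dl (map Inr G) (\<lambda>x \<xi>. \<rho> \<xi>) x \<xi> = PD (map (\<lambda>i. axis i 1) G) \<rho> \<xi>"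
proof (induction G arbitrary: x \<xi>)
  case (Cons i G)
  show ?case by (simp add: pdir_def dline_def pd_def Cons.IH)
qed simp

lemma Sy_rho: "Sy {()} UNIV (\<lambda>_ _ x. 1 / sqrt (J x)) (\<lambda>_ _. 1) (\<lambda>_. \<rho>)"
proof (rule Sy_I)
  fix L :: "(real^'n) list" assume L: "L \<in> lists Basis"
  obtain G where G: "L = map (\<lambda>i. axis i 1) G" using L unfolding Basis_vec_axis lists_image by auto
  have sm: "smooth_on UNIV (\<lambda>x \<xi>. \<rho> \<xi>)" using rho unfolding S10_def by blast
  show "PD L \<rho> differentiable (at \<xi>)" for \<xi>
  proof -
    have "map edir (map Inr G) \<in> lists Basis" using lists_Basis_edir by blast
    then have "PD (map edir (map Inr G)) (\<lambda>p. \<rho> (snd p)) differentiable (at (0, \<xi>))"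
      using smooth_on_imp_PD_differentiable[OF open_UNIV sm] by blast
    then have "(\<lambda>\<xi>. PD (map edir (map Inr G)) (\<lambda>p. \<rho> (snd p)) (0, \<xi>)) differentiable (at \<xi>)"
      using differentiable_chain_at[of "\<lambda>\<xi>. (0, \<xi>)" \<xi> "PD (map edir (map Inr G)) (\<lambda>p. \<rho> (snd p))"]
        differentiableI[OF has_derivative_Pair[OF has_derivative_const[of "0::real^'n"] has_derivative_ident]]
      by (simp add: o_def)
    moreover have "PD (map edir (map Inr G)) (\<lambda>p. \<rho> (snd p)) (0, \<xi>) = PD L \<rho> \<xi>" for \<xi>
      using Dl_eq_PD[of "map Inr G" "\<lambda>x \<xi>. \<rho> \<xi>" 0 \<xi>] Dl_rho[of G 0 \<xi>] G by simp
    ultimately show ?thesis by simp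
  qed
  obtain C where C: "\<And>x \<xi>. norm (dd G [] (\<lambda>x \<xi>. \<rho> \<xi>) x \<xi>) \<le> C * jbr \<xi> powr (0 - real (length G))"
    using rho unfolding S10_def by blast
  have pl: "(\<Prod>b\<leftarrow>L. 1 / sqrt (J \<xi>)) = (1 / sqrt (J \<xi>)) ^ length G" for \<xi> :: "real^'n" unfolding G by (induction G) auto
  show "\<exists>C\<ge>0. \<forall>_\<in>{()}. \<forall>\<xi>\<in>UNIV. norm (PD L \<rho> \<xi>) \<le> C * (1 * (\<Prod>b\<leftarrow>L. 1 / sqrt (J \<xi>)))"
  proof (intro exI[of _ "\<bar>C\<bar>"] conjI ballI)
    fix \<xi> :: "real^'n"
    have "norm (PD L \<rho> \<xi>) = norm (dd G [] (\<lambda>x \<xi>. \<rho> \<xi>) 0 \<xi>)" by (simp add: dd_def Dl_rho G)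
    also have "\<dots> \<le> C * jbr \<xi> powr (0 - real (length G))" by (rule C)
    also have "\<dots> \<le> \<bar>C\<bar> * jbr \<xi> powr (0 - real (length G))" by (intro mult_right_mono) auto
    also have "jbr \<xi> powr (0 - real (length G)) = (1 / sqrt (J \<xi>)) ^ length G"
      using jbr_pos[of \<xi>] by (simp add: powr_minus powr_realpow jbr_eq[symmetric] power_divide divide_inverse power_inverse)
    finally show "norm (PD L \<rho> \<xi>) \<le> \<bar>C\<bar> * (1 * (\<Prod>b\<leftarrow>L. 1 / sqrt (J \<xi>)))" by (simp add: pl)
  qed auto
qed

section \<open>Derivatives of the multiplier along the phase gradient\<close>

definition RL :: "(real^'n) list \<Rightarrow> real \<Rightarrow> (real^'n) \<times> (real^'n) \<Rightarrow> complex" where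
  "RL L t p = PD L \<rho> (t *\<^sub>R ze p)"

lemma ze_has_derivative:
  assumes p: "p \<in> Om"
  shows "\<exists>z'. (ze has_derivative z') (at p) \<and> (\<forall>b c. b \<in> Basis \<longrightarrow> c \<in> Basis \<longrightarrow> complex_of_real (z' b \<bullet> c) = pd b (pd (bx c) phc) p)"
proof -
  define zc where "zc = (\<lambda>c p. Re (pd (bx c) phc p))"
  have zc: "(zc c has_derivative (\<lambda>h. Re (\<Sum>b\<in>Basis. (h \<bullet> b) *\<^sub>R pd b (pd (bx c) phc) p))) (at p)" if c: "c \<in> Basis" for c
    unfolding zc_def by (intro has_derivative_Re has_derivative_pd Sy_diff0[OF Sy_phc[OF c]]) (use p in auto)
  define z' where "z' = (\<lambda>h. \<Sum>c\<in>Basis. Re (\<Sum>b\<in>Basis. (h \<bullet> b) *\<^sub>R pd b (pd (bx c) phc) p) *\<^sub>R c)"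
  have "((\<lambda>p. \<Sum>c\<in>Basis. zc c p *\<^sub>R c) has_derivative z') (at p)"
    unfolding z'_def by (intro has_derivative_sum has_derivative_scaleR_left zc)
  then have d: "(ze has_derivative z') (at p)"
  proof (rule has_derivative_transform_within_open[OF _ open_Om p])
    fix q :: "(real^'n) \<times> (real^'n)" assume q: "q \<in> Om"
    have "(\<Sum>c\<in>Basis. zc c q *\<^sub>R c) = (\<Sum>c\<in>Basis. (ze q \<bullet> c) *\<^sub>R c)"
      by (rule sum.cong) (auto simp: zc_def ze_inner[OF _ q])
    then show "(\<Sum>c\<in>Basis. zc c q *\<^sub>R c) = ze q" by (simp add: euclidean_representation)
  qed
  moreover have "complex_of_real (z' b \<bullet> c) = pd b (pd (bx c) phc) p" if b: "b \<in> Basis" and c: "c \<in> Basis" for b c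
  proof -
    have dc: "pd (bx c) phc differentiable (at p)" by (rule Sy_diff0[OF Sy_phc[OF c]]) (use p in auto)
    have "z' b \<bullet> c = Re (\<Sum>b'\<in>Basis. (b \<bullet> b') *\<^sub>R pd b' (pd (bx c) phc) p)"
      unfolding z'_def using c by (simp add: inner_sum_left_Basis)
    also have "(\<Sum>b'\<in>Basis. (b \<bullet> b') *\<^sub>R pd b' (pd (bx c) phc) p) = pd b (pd (bx c) phc) p"
      by (rule pd_has_derivative[OF has_derivative_pd[OF dc], symmetric])
    finally have "z' b \<bullet> c = Re (pd b (pd (bx c) phc) p)" .
    moreover have "pd b (pd (bx c) phc) p = of_real (PD [b, bx c] (\<lambda>p. \<phi> (fst p) (snd p)) p)"
      using phc_PD(2)[of "[b, bx c]" p] b bx_Basis[OF c] p by simp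
    ultimately show ?thesis by simp
  qed
  ultimately show ?thesis by blast
qed

lemma pd_RL:
  assumes p: "p \<in> Om" and L: "L \<in> lists Basis" and b: "b \<in> Basis"
  shows "RL L t differentiable (at p)"
    and "pd b (RL L t) p = (\<Sum>c\<in>Basis. of_real t * (pd b (pd (bx c) phc) p * RL (c # L) t p))"
proof -
  obtain z' where z': "(ze has_derivative z') (at p)" "\<And>b c. b \<in> Basis \<Longrightarrow> c \<in> Basis \<Longrightarrow> complex_of_real (z' b \<bullet> c) = pd b (pd (bx c) phc) p"
    using ze_has_derivative[OF p] by blast
  have d: "PD L \<rho> differentiable (at y)" for y using Sy_D(1)[OF Sy_rho L] by simp
  have *: "(RL L t has_derivative (\<lambda>h. \<Sum>c\<in>Basis. ((t *\<^sub>R z' h) \<bullet> c) *\<^sub>R pd c (PD L \<rho>) (t *\<^sub>R ze p))) (at p)"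
    unfolding RL_def[abs_def]
    by (rule has_derivative_compose[OF has_derivative_scaleR_right[OF z'(1)] has_derivative_pd[OF d]])
  then show "RL L t differentiable (at p)" by (rule differentiableI)
  have "pd b (RL L t) p = (\<Sum>c\<in>Basis. ((t *\<^sub>R z' b) \<bullet> c) *\<^sub>R pd c (PD L \<rho>) (t *\<^sub>R ze p))" by (rule pd_has_derivative[OF *])
  also have "\<dots> = (\<Sum>c\<in>Basis. of_real t * (pd b (pd (bx c) phc) p * RL (c # L) t p))"
    by (rule sum.cong) (auto simp: scaleR_conv_of_real[where 'a = complex] z'(2)[OF b, symmetric] RL_def mult.assoc)
  finally show "pd b (RL L t) p = (\<Sum>c\<in>Basis. of_real t * (pd b (pd (bx c) phc) p * RL (c # L) t p))" .
qed

text \<open>A derivative brings out \<open>t\<close>, a derivative of the phase gradient of size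
  \<open>jb p * om b p\<close>, and one more derivative of \<rho>. Since
  \<open>t * jb p / (1 + t * jb p) \<le> 1\<close>, the additional decay of \<rho> pays for the
  factor \<open>t * jb p\<close>, and composition with the phase gradient keeps weights that are
  uniform in \<open>t\<close>.\<close>

lemma Sy_RL:
  assumes "L \<in> lists Basis"
  shows "Sy T01 Om (\<lambda>_. om) (\<lambda>t p. 1 / (1 + t * jb p) ^ length L) (RL L)"
proof -
  have D: "1 \<le> 1 + t * jb p" if "t \<in> T01" for t p using that jbr_pos[of "snd p"] by simp
  have "Syk k T01 Om (\<lambda>_. om) (\<lambda>t p. 1 / (1 + t * jb p) ^ length L) (RL L)" for k
    using assms
  proof (induction k arbitrary: L)
    case (Suc k)
    have "\<exists>C\<ge>0. \<forall>t\<in>T01. \<forall>p\<in>Om. norm (RL L t p) \<le> C * (1 / (1 + t * jb p) ^ length L)"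
    proof -
      have pl: "(\<Prod>b\<leftarrow>L. 1 / sqrt (J x)) = (1 / sqrt (J x)) ^ length L" for x :: "real^'n" by (induction L) auto
      obtain C where C: "C \<ge> 0" "\<And>x. norm (PD L \<rho> x) \<le> C * (1 / sqrt (J x)) ^ length L"
        using Sy_D(2)[OF Sy_rho Suc.prems] pl by auto
      define d where "d = min 1 C1 / 2"
      have d: "0 < d" using C1(1) by (simp add: d_def)
      have "norm (RL L t p) \<le> C * (1 / d) ^ length L * (1 / (1 + t * jb p) ^ length L)" if t: "t \<in> T01" and p: "p \<in> Om" for t p
      proof -
        have "d * (1 + t * jb p) \<le> sqrt (J (t *\<^sub>R ze p))"
        proof -
          have "min 1 C1 * (t * jb p) \<le> C1 * (t * jb p)" using t jbr_pos[of "snd p"] by (intro mult_right_mono) auto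
          also have "\<dots> \<le> t * norm (ze p)" using mult_left_mono[OF C1(2)[OF p], of t] t by (simp add: mult_ac)
          finally have "min 1 C1 * (1 + t * jb p) \<le> 1 + t * norm (ze p)" unfolding distrib_left by simp
          moreover have "(1 + t * norm (ze p)) \<le> 2 * sqrt (J (t *\<^sub>R ze p))"
          proof -
            have "t * norm (ze p) \<le> sqrt (J (t *\<^sub>R ze p))" using t by (intro real_le_rsqrt) (simp add: J_norm power_mult_distrib)
            moreover have "1 \<le> sqrt (J (t *\<^sub>R ze p))" using J_ge1 by simp
            ultimately show ?thesis by linarith
          qed
          ultimately show ?thesis unfolding d_def by simp
        qed
        then have "1 / sqrt (J (t *\<^sub>R ze p)) \<le> 1 / (d * (1 + t * jb p))"
          using d D[OF t, of p] J_pos[of "t *\<^sub>R ze p"] by (intro divide_left_mono mult_pos_pos) auto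
        then have "(1 / sqrt (J (t *\<^sub>R ze p))) ^ length L \<le> (1 / (d * (1 + t * jb p))) ^ length L"
          using J_pos[of "t *\<^sub>R ze p"] by (intro power_mono) auto
        from mult_left_mono[OF this C(1)] C(2)[of "t *\<^sub>R ze p"] show ?thesis
          unfolding RL_def by (simp add: power_mult_distrib power_divide)
      qed
      then show ?thesis using C(1) d by (intro exI[of _ "C * (1 / d) ^ length L"]) auto
    qed
    moreover have "Syk k T01 Om (\<lambda>_. om) (\<lambda>t p. 1 / (1 + t * jb p) ^ length L * om b p) (\<lambda>t. pd b (RL L t))" if b: "b \<in> Basis" for b
    proof -
      have "Syk k T01 Om (\<lambda>_. om) (\<lambda>t p. 1 / (1 + t * jb p) ^ length L * om b p) (\<lambda>t p. of_real t * (pd b (pd (bx c) phc) p * RL (c # L) t p))" if c: "c \<in> Basis" for c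
      proof -
        have "Sy T01 Om (\<lambda>_. om) (\<lambda>_ p. jb p * om b p) (\<lambda>_. pd b (pd (bx c) phc))"
          using Sy_reindex[OF Sy_pd[OF Sy_phc[OF c] b] open_Om, of T01 "\<lambda>_. ()"] by simp
        then have 1: "Syk k T01 Om (\<lambda>_. om) (\<lambda>_ p. jb p * om b p) (\<lambda>_. pd b (pd (bx c) phc))" by (simp add: Sy_def)
        have 2: "Syk k T01 Om (\<lambda>_. om) (\<lambda>t p. 1 / (1 + t * jb p) ^ length (c # L)) (RL (c # L))"
          by (rule Suc.IH) (use Suc.prems c in simp)
        show ?thesis
        proof (rule Syk_mono[OF open_Om Syk_scale[OF open_Om Syk_mult[OF open_Om 1 2], of "\<lambda>t. of_real t"], where D = 1 and D' = 1])
          fix t p assume t: "t \<in> T01" and p: "p \<in> (Om :: ((real^'n) \<times> (real^'n)) set)"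
          have D': "0 < 1 + t * jb p" using D[OF t, of p] by linarith
          have "t * jb p / (1 + t * jb p) \<le> 1" using D' by (simp add: divide_le_eq)
          then have "om b p * (1 / (1 + t * jb p) ^ length L) * (t * jb p / (1 + t * jb p)) \<le> om b p * (1 / (1 + t * jb p) ^ length L) * 1"
            using om(1)[of b p] D' by (intro mult_left_mono) auto
          then show "0 \<le> jb p * om b p * (1 / (1 + t * jb p) ^ length (c # L)) * norm (complex_of_real t) \<and>
             jb p * om b p * (1 / (1 + t * jb p) ^ length (c # L)) * norm (complex_of_real t) \<le> 1 * (1 / (1 + t * jb p) ^ length L * om b p)"
            using t om(1)[of b p] D' jbr_pos[of "snd p"] by (simp add: mult_ac)
        qed (use om in auto)
      qed
      then have "Syk k T01 Om (\<lambda>_. om) (\<lambda>t p. 1 / (1 + t * jb p) ^ length L * om b p) (\<lambda>t p. \<Sum>c\<in>Basis. of_real t * (pd b (pd (bx c) phc) p * RL (c # L) t p))"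
      proof -
        assume *: "\<And>c. c \<in> Basis \<Longrightarrow> Syk k T01 Om (\<lambda>_. om) (\<lambda>t p. 1 / (1 + t * jb p) ^ length L * om b p) (\<lambda>t p. of_real t * (pd b (pd (bx c) phc) p * RL (c # L) t p))"
        have "Syk k T01 Om (\<lambda>_. om) (\<lambda>t p. 1 / (1 + t * jb p) ^ length L * om b p) (\<lambda>t p. \<Sum>c\<in>I. of_real t * (pd b (pd (bx c) phc) p * RL (c # L) t p))"
          if "finite I" "I \<subseteq> Basis" for I
          using that
        proof (induction I rule: finite_induct)
          case empty
          show ?case unfolding sum.empty
          proof (rule Syk_zero)
            fix t p assume "t \<in> T01"
            from D[OF this, of p] show "0 \<le> 1 / (1 + t * jb p) ^ length L * om b p"
              by (intro mult_nonneg_nonneg om) (simp add: order_trans[OF zero_le_one])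
          qed (rule om)
        next
          case (insert c I)
          then show ?case using Syk_add[OF open_Om *[of c] insert.IH] by simp
        qed
        then show ?thesis by simp
      qed
      then show ?thesis
        by (rule Syk_cong[OF open_Om, rotated 2]) (use pd_RL(2)[OF _ Suc.prems b] in auto)
    qed
    \<comment> \<open>Some basis direction is needed to invoke the differentiability part of
      \<open>pd_RL\<close>.\<close>
    moreover obtain b0 :: "(real^'n) \<times> (real^'n)" where "b0 \<in> Basis" using nonempty_Basis by blast
    ultimately show ?case using pd_RL(1)[OF _ Suc.prems] by auto
  qed simp
  then show ?thesis by (simp add: Sy_def)
qed

end

lemma PD_zero: "PD L (\<lambda>_::'a::real_normed_vector. 0::'b::real_normed_vector) = (\<lambda>_. 0)"
proof (induction L)
  case (Cons b L)
  have "PD (b # L) (\<lambda>_::'a. 0::'b) = pd b (\<lambda>_. 0)" using Cons by simp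
  then show ?case by (simp add: fun_eq_iff)
qed simp

lemma Sy_sum_list:
  assumes "open S" "\<And>i. i \<in> set I \<Longrightarrow> Sy P S w W (F i)"
    "\<And>p x. p \<in> P \<Longrightarrow> x \<in> S \<Longrightarrow> 0 \<le> W p x" "\<And>p b x. p \<in> P \<Longrightarrow> b \<in> Basis \<Longrightarrow> x \<in> S \<Longrightarrow> 0 \<le> w p b x"
  shows "Sy P S w W (\<lambda>p x. \<Sum>i\<leftarrow>I. F i p x)"
  using assms(2)
proof (induction I)
  case Nil
  show ?case unfolding list.map sum_list.Nil by (rule Sy_zero) (use assms in auto)
next
  case (Cons i I)
  have "Sy P S w W (\<lambda>p x. F i p x + (\<Sum>i\<leftarrow>I. F i p x))"
    by (rule Sy_add[OF assms(1)]) (use Cons in auto)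
  then show ?case by simp
qed

lemma PD_cmult:
  assumes "smo h" "L \<in> lists Basis"
  shows "PD L (\<lambda>y. k * h y) = (\<lambda>y. k * PD L h y)"
  using assms(2)
proof (induction L rule: list.induct)
  case (Cons b L)
  then have "PD L h differentiable (at y)" for y using assms(1) by (simp add: smo_def)
  then have "pd b (\<lambda>y. k * PD L h y) = (\<lambda>y. k * pd b (PD L h) y)" by (simp add: fun_eq_iff pd_cmult)
  then show ?case using Cons by simp
qed simp

lemma PD_affine_range:
  assumes h: "smo h" and L: "L \<in> lists Basis" "L \<noteq> []"
  shows "PD L (\<lambda>y. k * (h y - c)) = (\<lambda>y. k * PD L h y)"
proof -
  obtain L' b where Lb: "L = L' @ [b]" using L(2) by (cases L rule: rev_cases) auto
  have b: "b \<in> Basis" "L' \<in> lists Basis" using L Lb by auto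
  have d: "h differentiable (at y)" for y by (rule smo_D[OF h])
  have *: "pd b (\<lambda>y. k * (h y - c)) y = k * pd b h y" for y
  proof -
    have "pd b (\<lambda>y. k * h y + (- (k * c))) y = pd b (\<lambda>y. k * h y) y + pd b (\<lambda>y. - (k * c)) y"
      by (rule pd_add) (use d in auto)
    then show ?thesis by (simp add: pd_cmult[OF d] algebra_simps)
  qed
  then have "PD L (\<lambda>y. k * (h y - c)) = PD L' (\<lambda>y. k * pd b h y)" by (simp add: Lb PD_append ext[OF *])
  also have "\<dots> = (\<lambda>y. k * PD L' (pd b h) y)" by (rule PD_cmult[OF smo_pd[OF h b(1)] b(2)])
  finally show ?thesis by (simp add: Lb PD_append)
qed

lemma jbr_nonneg [simp]: "0 \<le> jbr \<xi>" by (simp add: jbr_def)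

context symbol_setting
begin

abbreviation "Xi \<equiv> {\<xi>::real^'n. 1 < norm \<xi>}"
abbreviation "QQ \<equiv> T01 \<times> Xi"

text \<open>The frequency moves from the variables to the parameters; only the space directions
  remain, and they have weight 1.\<close>

lemma Sy_slice:
  assumes F: "Sy P Om (\<lambda>_. om) W F" and W: "\<And>t p. t \<in> P \<Longrightarrow> p \<in> Om \<Longrightarrow> 0 \<le> W t p"
  shows "Sy (P \<times> Xi) UNIV (\<lambda>_ _ _. 1) (\<lambda>q y. W (fst q) (y, snd q)) (\<lambda>q y. F (fst q) (y, snd q))"
proof -
  have "Sy (P \<times> Xi) UNIV (\<lambda>q b y. \<bar>1\<bar> * om (bx b) (y, snd q)) (\<lambda>q y. W (fst q) (y, snd q)) (\<lambda>q y. F (fst q) (y, snd q))"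
  proof (rule Sy_pullback[where P=P and S=Om and \<pi>=fst and A = "\<lambda>q y. (y, snd q)" and c="\<lambda>_. 1" and \<tau>=bx and w="\<lambda>_. om", OF F])
    show "(\<lambda>y. (y, snd q)) differentiable (at x)" for q :: "'a \<times> (real^'n)" and x :: "real^'n"
      by (rule differentiableI[OF has_derivative_Pair[OF has_derivative_ident has_derivative_const]])
  qed (auto simp: bx_def[abs_def] Basis_prod_def)
  then show ?thesis by (rule Sy_mono[where D=1 and D'=1]) (use W in \<open>auto simp: om_bx\<close>)
qed

lemma Sy_phc_T: "b \<in> Basis \<Longrightarrow> Sy T01 Om (\<lambda>_. om) (\<lambda>_ p. jb p) (\<lambda>_. pd (bx b) phc)"
  using Sy_reindex[OF Sy_phc open_Om, where Q = T01 and \<pi> = "\<lambda>_. ()"] by auto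

lemma phc_slice_diff: "\<xi> \<in> Xi \<Longrightarrow> (\<lambda>y. phc (y, \<xi>)) differentiable (at y)"
  using differentiable_chain_at[of "\<lambda>y. (y, \<xi>)" y phc] phc_PD(1)[of "[]" "(y, \<xi>)"]
    differentiableI[OF has_derivative_Pair[OF has_derivative_ident has_derivative_const]]
  by (simp add: o_def)

lemma pd_slice: "pd b (\<lambda>y. F (y, \<xi>)) = (\<lambda>y. pd (bx b) F (y, \<xi>))"
  using PD_slice[of "[b]" F \<xi>] by (simp add: fun_eq_iff)

lemma Sy_phc_slice:
  assumes "b \<in> Basis"
  shows "Sy QQ UNIV (\<lambda>_ _ _. 1) (\<lambda>q _. jbr (snd q)) (\<lambda>q. pd b (\<lambda>y. phc (y, snd q)))"
  unfolding pd_slice using Sy_slice[OF Sy_phc_T[OF assms]] by (simp add: less_imp_le[OF jbr_pos])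

section \<open>The exponential of the phase minus its linearisation\<close>

definition Eph :: "(real^'n) \<times> (real^'n) \<Rightarrow> real^'n \<Rightarrow> complex" where
  "Eph p y = exp (\<i> * (phc (y, snd p) - phc p - of_real ((y - fst p) \<bullet> ze p)))"

definition EL :: "(real^'n) list \<Rightarrow> (real^'n) \<times> (real^'n) \<Rightarrow> complex" where "EL L p = PD L (Eph p) (fst p)"

lemma pd_Eph:
  assumes p: "p \<in> Om"
  shows "(\<lambda>y. \<i> * (phc (y, snd p) - phc p - of_real ((y - fst p) \<bullet> ze p))) differentiable (at y)"
    and "pd b (\<lambda>y. \<i> * (phc (y, snd p) - phc p - of_real ((y - fst p) \<bullet> ze p))) y = \<i> * (pd b (\<lambda>y. phc (y, snd p)) y - of_real (b \<bullet> ze p))"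
proof -
  have d: "(\<lambda>y. phc (y, snd p)) differentiable (at y)" for y by (rule phc_slice_diff) (use p in simp)
  have c: "(\<lambda>y. complex_of_real (y \<bullet> ze p)) differentiable (at y)" for y by (rule pd_inner)
  have eq: "(\<lambda>y. \<i> * (phc (y, snd p) - phc p - of_real ((y - fst p) \<bullet> ze p)))
     = (\<lambda>y. \<i> * phc (y, snd p) + ((- \<i>) * complex_of_real (y \<bullet> ze p) + \<i> * (of_real (fst p \<bullet> ze p) - phc p)))"
    by (simp add: fun_eq_iff inner_diff_left algebra_simps)
  have d1: "(\<lambda>y. \<i> * phc (y, snd p)) differentiable (at y)" "(\<lambda>y. (- \<i>) * complex_of_real (y \<bullet> ze p)) differentiable (at y)" for y
    using d c by auto
  have d2: "(\<lambda>y. (- \<i>) * complex_of_real (y \<bullet> ze p) + \<i> * (of_real (fst p \<bullet> ze p) - phc p)) differentiable (at y)" for y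
    by (intro differentiable_add d1) auto
  show "(\<lambda>y. \<i> * (phc (y, snd p) - phc p - of_real ((y - fst p) \<bullet> ze p))) differentiable (at y)"
    unfolding eq by (rule differentiable_add[OF d1(1) d2])
  show "pd b (\<lambda>y. \<i> * (phc (y, snd p) - phc p - of_real ((y - fst p) \<bullet> ze p))) y = \<i> * (pd b (\<lambda>y. phc (y, snd p)) y - of_real (b \<bullet> ze p))"
    unfolding eq pd_add[OF d1(1) d2] pd_add[OF d1(2) differentiable_const] pd_cmult[OF d] pd_cmult[OF c] pd_inner(2)
    by (simp add: algebra_simps)
qed

lemma Sy_const_slice:
  assumes p: "p \<in> Om" and b: "b \<in> Basis"
  shows "Sy {()} UNIV (\<lambda>_ _ _. jb p) (\<lambda>_ _. jb p) (\<lambda>_. pd b (\<lambda>y. phc (y, snd p)))"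
proof -
  have "Sy {()} UNIV (\<lambda>_ _ _. 1) (\<lambda>_ _. jb p) (\<lambda>_. pd b (\<lambda>y. phc (y, snd p)))"
    using Sy_reindex[OF Sy_phc_slice[OF b] open_UNIV subset_UNIV, where Q = "{()}" and \<pi> = "\<lambda>_. (1/2, snd p)"] p by auto
  then show ?thesis by (rule Sy_mono[where D=1 and D'=1]) (use jbr_ge1[of "snd p"] in auto)
qed

lemma smo_Eph:
  assumes p: "p \<in> Om" shows "smo (Eph p)"
proof -
  have "Sy {()} UNIV (\<lambda>_ _ _. jb p) (\<lambda>_ _. 1) (\<lambda>_ y. exp (\<i> * (phc (y, snd p) - phc p - of_real ((y - fst p) \<bullet> ze p))))"
  proof (rule Sy_exp[OF open_UNIV])
    show "Re (\<i> * (phc (y, snd p) - phc p - of_real ((y - fst p) \<bullet> ze p))) \<le> 0" for y by (simp add: phc_def)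
    fix b :: "real^'n" assume b: "b \<in> Basis"
    have "Sy {()} UNIV (\<lambda>_ _ _. jb p) (\<lambda>_ _. jb p) (\<lambda>_ y. \<i> * (pd b (\<lambda>y. phc (y, snd p)) y - of_real (b \<bullet> ze p)))"
    proof (intro Sy_cmult Sy_diff open_UNIV Sy_const_slice[OF p b] Sy_const[where C = "norm (b \<bullet> ze p)"])
      show "norm (complex_of_real (b \<bullet> ze p)) \<le> norm (b \<bullet> ze p) * jb p"
        using jbr_ge1[of "snd p"] by (simp add: mult_le_cancel_left1)
    qed (use jbr_pos[of "snd p"] in auto)
    then show "Sy {()} UNIV (\<lambda>_ _ _. jb p) (\<lambda>_ _. jb p) (\<lambda>_. pd b (\<lambda>y. \<i> * (phc (y, snd p) - phc p - of_real ((y - fst p) \<bullet> ze p))))"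
      unfolding ext[OF pd_Eph(2)[OF p]] .
  qed (rule pd_Eph(1)[OF p])
  from Sy_smo[OF this, of "()"] show ?thesis by (simp add: Eph_def[abs_def])
qed

lemma EL_Nil: "EL [] p = 1" by (simp add: EL_def Eph_def)

text \<open>The phase of \<^const>\<open>Eph\<close> vanishes to second order at the base point, so each factor
  \<open>jb\<close> uses up at least two derivatives.\<close>
lemma EL_snoc:
  assumes p: "p \<in> Om" and L: "L \<in> lists Basis" and b: "b \<in> Basis"
  shows "EL (L @ [b]) p = (\<Sum>(A, B)\<leftarrow>splits L. (if A = [] then 0 else \<i> * PD (map bx (A @ [b])) phc p) * EL B p)"
proof -
  define h where "h = pd b (\<lambda>y. phc (y, snd p))"
  define g where "g = (\<lambda>y. \<i> * (h y - of_real (b \<bullet> ze p)))"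
  have h: "smo h" using Sy_smo[OF Sy_const_slice[OF p b], of "()"] by (simp add: h_def)
  have g: "smo g"
  proof -
    have "PD L g = (if L = [] then g else (\<lambda>y. \<i> * PD L h y))" if "L \<in> lists Basis" for L
      using PD_affine_range[OF h that] by (auto simp: g_def)
    moreover have "(\<lambda>y. \<i> * PD L h y) differentiable (at x)" if "L \<in> lists Basis" for L x
      using h that by (auto simp: smo_def)
    moreover have "g differentiable (at x)" for x unfolding g_def using smo_D[OF h] by auto
    ultimately show ?thesis unfolding smo_def by auto
  qed
  have "pd b (Eph p) y = g y * Eph p y" for y
    unfolding Eph_def[abs_def] pd_exp(2)[OF pd_Eph(1)[OF p]] pd_Eph(2)[OF p] by (simp add: g_def h_def)
  then have "pd b (Eph p) = (\<lambda>y. g y * Eph p y)" by (simp add: fun_eq_iff)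
  then have "EL (L @ [b]) p = PD L (\<lambda>y. g y * Eph p y) (fst p)" by (simp add: EL_def PD_append)
  also have "\<dots> = (\<Sum>(A, B)\<leftarrow>splits L. PD A g (fst p) * PD B (Eph p) (fst p))"
    by (rule PD_leibniz[OF open_UNIV]) (use g smo_Eph[OF p] L in \<open>auto simp: smo_def\<close>)
  also have "\<dots> = (\<Sum>(A, B)\<leftarrow>splits L. (if A = [] then 0 else \<i> * PD (map bx (A @ [b])) phc p) * EL B p)"
  proof (rule arg_cong[of _ _ sum_list], rule map_cong[OF refl], safe)
    fix A B assume AB: "(A, B) \<in> set (splits L)"
    have A: "A \<in> lists Basis" using splits_props(2)[OF AB] L by (auto simp: in_lists_conv_set)
    have "PD A g (fst p) = (if A = [] then 0 else \<i> * PD (map bx (A @ [b])) phc p)"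
    proof (cases "A = []")
      case True
      have "h (fst p) = of_real (b \<bullet> ze p)" by (simp add: h_def pd_slice ze_inner[OF b p] inner_commute)
      then show ?thesis by (simp add: True g_def)
    next
      case False
      have "PD A h (fst p) = PD (A @ [b]) (\<lambda>y. phc (y, snd p)) (fst p)" by (simp add: h_def PD_append)
      also have "\<dots> = PD (map bx (A @ [b])) phc p" by (simp only: PD_slice prod.collapse)
      finally show ?thesis using False PD_affine_range[OF h A False] by (simp add: g_def)
    qed
    then show "PD A g (fst p) * PD B (Eph p) (fst p) = (if A = [] then 0 else \<i> * PD (map bx (A @ [b])) phc p) * EL B p"
      by (simp add: EL_def)
  qed
  finally show ?thesis .
qed

lemma prod_om_bx: "L \<in> lists Basis \<Longrightarrow> (\<Prod>b\<leftarrow>map bx L. om b p) = 1"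
proof (induction L rule: list.induct)
  case (Cons b L)
  then have "om (bx b) p = 1" "L \<in> lists Basis" by (auto intro: om_bx)
  then show ?case using Cons by simp
qed simp

lemma Sy_PD_x:
  assumes F: "Sy P S (\<lambda>_. om) W F" and L: "L \<in> lists Basis"
  shows "Sy P S (\<lambda>_. om) W (\<lambda>t. PD (map bx L) (F t))"
  using Sy_PD[OF F map_bx_Basis[OF L]] unfolding prod_om_bx[OF L] by simp

lemma sqrt_jb: "1 \<le> sqrt (jb p)" "sqrt (jb p) * sqrt (jb p) = jb p"
  using jbr_ge1[of "snd p"] by auto

text \<open>Strong induction on the length, as the nonzero terms of \<open>EL_snoc\<close> refer to
  lists shorter by at least two. The value at the base point is estimated as a function of the pair
  of variables, so that its frequency derivatives are covered as well.\<close>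

lemma Sy_EL: "L \<in> lists Basis \<Longrightarrow> Sy {()} Om (\<lambda>_. om) (\<lambda>_ p. sqrt (jb p) ^ length L) (\<lambda>_. EL L)"
proof (induction L rule: measure_induct_rule[of length])
  case (less L)
  show ?case
  proof (cases L rule: rev_cases)
    case Nil
    have "Sy {()} (Om :: ((real^'n) \<times> (real^'n)) set) (\<lambda>_. om) (\<lambda>_ _. 1) (\<lambda>_ _. 1)" by (rule Sy_const[where C = 1]) (auto simp: om)
    then show ?thesis by (simp add: Nil EL_Nil[abs_def])
  next
    case (snoc L' b)
    have L': "L' \<in> lists Basis" "b \<in> Basis" using less.prems snoc by auto
    have "Sy {()} Om (\<lambda>_. om) (\<lambda>_ p. sqrt (jb p) ^ length L)
        (\<lambda>_ p. \<Sum>i\<leftarrow>splits L'. (if fst i = [] then 0 else \<i> * PD (map bx (fst i @ [b])) phc p) * EL (snd i) p)"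
    proof (rule Sy_sum_list[OF open_Om])
      fix i assume i: "i \<in> set (splits L')"
      obtain A B where AB: "i = (A, B)" by (cases i)
      note sp = splits_props[OF i[unfolded AB]]
      show "Sy {()} Om (\<lambda>_. om) (\<lambda>_ p. sqrt (jb p) ^ length L) (\<lambda>_ p. (if fst i = [] then 0 else \<i> * PD (map bx (fst i @ [b])) phc p) * EL (snd i) p)"
      proof (cases "A = []")
        case True
        show ?thesis unfolding AB fst_conv snd_conv True simp_thms if_True mult_zero_left by (rule Sy_zero) (use sqrt_jb in \<open>auto simp: om\<close>)
      next
        case False
        have A: "A \<in> lists Basis" "B \<in> lists Basis" using sp(2,3) L' by (auto simp: in_lists_conv_set)
        have 1: "Sy {()} Om (\<lambda>_. om) (\<lambda>_ p. jb p) (\<lambda>_ p. \<i> * PD (map bx (A @ [b])) phc p)"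
          using Sy_cmult[OF open_Om Sy_PD_x[OF Sy_phc[OF L'(2)] A(1)], where c = "\<i>"] by (simp add: PD_append)
        have 2: "Sy {()} Om (\<lambda>_. om) (\<lambda>_ p. sqrt (jb p) ^ length B) (\<lambda>_. EL B)"
          by (rule less.IH) (use A sp(1) snoc in auto)
        have "Sy {()} Om (\<lambda>_. om) (\<lambda>_ p. sqrt (jb p) ^ length L) (\<lambda>_ p. \<i> * PD (map bx (A @ [b])) phc p * EL B p)"
        proof (rule Sy_mono[OF Sy_mult[OF open_Om 1 2] open_Om, where D = 1 and D' = 1])
          fix p :: "(real^'n) \<times> (real^'n)"
          have "length A \<ge> 1" using False by (cases A) auto
          then have "length B + 2 \<le> length L" using sp(1) snoc by simp
          then have "sqrt (jb p) ^ (length B + 2) \<le> sqrt (jb p) ^ length L" by (rule power_increasing[OF _ sqrt_jb(1)])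
          moreover have "sqrt (jb p) ^ (length B + 2) = jb p * sqrt (jb p) ^ length B"
            unfolding power_add power2_eq_square sqrt_jb(2) by simp
          ultimately have "jb p * sqrt (jb p) ^ length B \<le> sqrt (jb p) ^ length L" by metis
          then show "0 \<le> jb p * sqrt (jb p) ^ length B \<and> jb p * sqrt (jb p) ^ length B \<le> 1 * sqrt (jb p) ^ length L"
            using jbr_pos[of "snd p"] by simp
        qed (auto simp: om)
        then show ?thesis using False by (simp add: AB)
      qed
    qed (use jbr_pos in \<open>auto simp: om less_imp_le\<close>)
    then show ?thesis
      by (rule Sy_cong'[OF _ open_Om refl]) (simp add: snoc EL_snoc[OF _ L'] case_prod_unfold)
  qed
qed

text \<open>The gain per order of the expansion: \<open>t\<close> from the chain rule and
  \<open>1 / (1 + t * jb p)\<close> from a derivative of \<rho>, against \<open>sqrt (jb p)\<close>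
  lost in a derivative of \<open>Eph\<close>. It coincides with \<open>mu\<close> of
  \<open>osc_family\<close>.\<close>

definition mup :: "real \<Rightarrow> (real^'n) \<times> (real^'n) \<Rightarrow> real" where
  "mup t p = t * sqrt (jb p) / (1 + t * jb p)"

lemma mup_nonneg: "t \<in> T01 \<Longrightarrow> 0 \<le> mup t p"
  using jbr_pos[of "snd p"] by (auto simp: mup_def)

text \<open>By the Leibniz rule this is the derivative \<open>PD L\<close> of \<open>\<lambda>y. ac t (y, \<xi>) * Eph (x, \<xi>) y\<close> at \<open>x\<close>.\<close>
definition AL :: "(real^'n) list \<Rightarrow> real \<Rightarrow> (real^'n) \<times> (real^'n) \<Rightarrow> complex" where
  "AL L t p = (\<Sum>i\<leftarrow>splits L. PD (map bx (fst i)) (ac t) p * EL (snd i) p)"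

text \<open>The contribution of one ordered list of directions to the expansion, still to be divided by \<open>fact (length L)\<close>.\<close>
definition XL :: "(real^'n) list \<Rightarrow> real \<Rightarrow> (real^'n) \<times> (real^'n) \<Rightarrow> complex" where
  "XL L t p = (- \<i> * of_real t) ^ length L * (RL L t p * AL L t p)"

lemma XL_zero:
  assumes "t \<in> T01" "p \<notin> Om" shows "\<exists>U. open U \<and> p \<in> U \<and> (\<forall>q\<in>U. XL L t q = 0)"
proof -
  obtain U where U: "open U" "p \<in> U" "\<forall>q\<in>U. ac t q = 0" using ac_zero[OF assms] by blast
  have "PD A (ac t) q = 0" if "q \<in> U" for A q
    using PD_cong[OF U(1), of "ac t" "\<lambda>_. 0" q A] U(3) that by (simp add: PD_zero)
  then have "XL L t q = 0" if "q \<in> U" for q using that by (simp add: XL_def AL_def)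
  then show ?thesis using U by blast
qed

text \<open>The estimate is made on \<open>Om\<close>, where the phase lives, and extended by zero:
  near the complement the factor \<open>AL\<close> vanishes together with the amplitude.\<close>

lemma Sy_XL:
  assumes L: "L \<in> lists Basis"
  shows "Sy T01 UNIV (\<lambda>_. om) (\<lambda>t p. mup t p ^ length L * jb p powr m) (XL L)"
proof (rule Sy_ext_zero[OF open_Om _ XL_zero])
  have A: "Sy T01 Om (\<lambda>_. om) (\<lambda>_ p. jb p powr m * sqrt (jb p) ^ length L) (AL L)"
    unfolding AL_def[abs_def]
  proof (rule Sy_sum_list[OF open_Om])
    fix i assume i: "i \<in> set (splits L)"
    obtain A B where AB: "i = (A, B)" by (cases i)
    note sp = splits_props[OF i[unfolded AB]]
    have A: "A \<in> lists Basis" "B \<in> lists Basis" using sp(2,3) L by (auto simp: in_lists_conv_set)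
    have 1: "Sy T01 Om (\<lambda>_. om) (\<lambda>_ p. jb p powr m) (\<lambda>t. PD (map bx A) (ac t))"
      using Sy_PD_x[OF Sy_reindex[OF Sy_ac open_Om, where Q = T01 and \<pi> = "\<lambda>t. t"] A(1)] by simp
    have 2: "Sy T01 Om (\<lambda>_. om) (\<lambda>_ p. sqrt (jb p) ^ length B) (\<lambda>_. EL B)"
      using Sy_reindex[OF Sy_EL[OF A(2)] open_Om, where Q = T01 and \<pi> = "\<lambda>_. ()"] by simp
    show "Sy T01 Om (\<lambda>_. om) (\<lambda>_ p. jb p powr m * sqrt (jb p) ^ length L) (\<lambda>t p. PD (map bx (fst i)) (ac t) p * EL (snd i) p)"
      unfolding AB fst_conv snd_conv
    proof (rule Sy_mono[OF Sy_mult[OF open_Om 1 2] open_Om, where D = 1 and D' = 1])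
      fix p :: "(real^'n) \<times> (real^'n)"
      have "sqrt (jb p) ^ length B \<le> sqrt (jb p) ^ length L" by (rule power_increasing[OF _ sqrt_jb(1)]) (use sp(1) in simp)
      then show "0 \<le> jb p powr m * sqrt (jb p) ^ length B \<and> jb p powr m * sqrt (jb p) ^ length B \<le> 1 * (jb p powr m * sqrt (jb p) ^ length L)"
        using jbr_pos[of "snd p"] by (simp add: mult_left_mono)
    qed (auto simp: om)
  qed (use jbr_pos in \<open>auto simp: om less_imp_le intro!: mult_nonneg_nonneg\<close>)
  show "Sy T01 Om (\<lambda>_. om) (\<lambda>t p. mup t p ^ length L * jb p powr m) (XL L)"
  proof (rule Sy_cong'[OF Sy_scale[OF open_Om Sy_mult[OF open_Om Sy_RL[OF L] A], where d = "\<lambda>t. (- \<i> * of_real t) ^ length L"] open_Om])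
    fix t p assume "t \<in> T01"
    then show "1 / (1 + t * jb p) ^ length L * (jb p powr m * sqrt (jb p) ^ length L) * norm ((- \<i> * complex_of_real t) ^ length L)
       = mup t p ^ length L * jb p powr m"
      by (simp add: mup_def norm_power norm_mult power_mult_distrib power_divide)
  qed (simp add: XL_def)
qed (use mup_nonneg in \<open>auto simp: om\<close>)

section \<open>The amplitude and its Taylor expansion\<close>

definition sg :: "real \<Rightarrow> (real^'n) \<times> (real^'n) \<Rightarrow> complex" where
  "sg t p = sigma_amp (a t) \<rho> \<phi> t (fst p) (snd p)"

definition u0 :: "real \<Rightarrow> real^'n \<Rightarrow> real^'n \<Rightarrow> complex" where
  "u0 t \<xi> y = a t y \<xi> * cis (\<phi> y \<xi>)"

lemma u0_eq: "u0 t \<xi> y = ac t (y, \<xi>) * exp (\<i> * phc (y, \<xi>))"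
  by (simp add: u0_def ac_def phc_def cis_conv_exp)

text \<open>By \<open>m \<le> 0\<close> the factor \<open>jbr (snd q) powr m\<close> is given up
  here; \<open>Sy_RN\<close> recovers it, since there a large order outweighs any power of the
  bracket.\<close>

lemma Sy_ac_slice: "Sy QQ UNIV (\<lambda>_ _ _. 1) (\<lambda>_ _. 1) (\<lambda>q y. ac (fst q) (y, snd q))"
proof -
  have "Sy T01 Om (\<lambda>_. om) (\<lambda>_ p. jb p powr m) ac"
    using Sy_reindex[OF Sy_ac open_Om, where Q = T01 and \<pi> = "\<lambda>t. t"] by simp
  from Sy_slice[OF this] have "Sy QQ UNIV (\<lambda>_ _ _. 1) (\<lambda>q y. jbr (snd q) powr m) (\<lambda>q y. ac (fst q) (y, snd q))" by simp
  then show ?thesis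
  proof (rule Sy_mono[OF _ open_UNIV, where D = 1 and D' = 1])
    fix q :: "real \<times> (real^'n)"
    have "jbr (snd q) powr m \<le> jbr (snd q) powr 0" by (rule powr_mono[OF m jbr_ge1])
    then show "0 \<le> jbr (snd q) powr m \<and> jbr (snd q) powr m \<le> 1 * 1" using jbr_pos[of "snd q"] by simp
  qed auto
qed

lemma tempered_u0:
  assumes q: "t \<in> T01" "\<xi> \<in> Xi" shows "tempered 0 (u0 t \<xi>)"
proof -
  have "Sy {()} UNIV (\<lambda>_ _ _. jbr \<xi>) (\<lambda>_ _. 1) (\<lambda>_ y. exp (\<i> * phc (y, \<xi>)))"
  proof (rule Sy_exp[OF open_UNIV])
    show "(\<lambda>y. \<i> * phc (y, \<xi>)) differentiable (at y)" for y using phc_slice_diff[OF q(2)] by auto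
    show "Re (\<i> * phc (y, \<xi>)) \<le> 0" for y by (simp add: phc_def)
    fix b :: "real^'n" assume b: "b \<in> Basis"
    show "Sy {()} UNIV (\<lambda>_ _ _. jbr \<xi>) (\<lambda>_ _. jbr \<xi>) (\<lambda>_. pd b (\<lambda>y. \<i> * phc (y, \<xi>)))"
      using Sy_cmult[OF open_UNIV Sy_const_slice[OF _ b, of "(0, \<xi>)"], where c = "\<i>"] q(2)
      by (simp add: pd_cmult[OF phc_slice_diff[OF q(2)], abs_def])
  qed
  then have 1: "tempered 0 (\<lambda>y. exp (\<i> * phc (y, \<xi>)))"
    by (rule Sy_mono[OF _ open_UNIV, where D = 1 and D' = "jbr \<xi>"]) (use jbr_pos[of \<xi>] in auto)
  have 2: "tempered 0 (\<lambda>y. ac t (y, \<xi>))"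
    using Sy_reindex[OF Sy_ac_slice open_UNIV subset_UNIV, where Q = "{()}" and \<pi> = "\<lambda>_. (t, \<xi>)"] q by simp
  from Sy_mult[OF open_UNIV 2 1] show ?thesis by (simp add: u0_eq[abs_def])
qed

lemma osc_fam: "osc_family QQ (\<lambda>q. jbr (snd q)) fst (\<lambda>q y. a (fst q) y (snd q)) (\<lambda>q y. \<phi> y (snd q)) (\<lambda>q y. ze (y, snd q)) \<rho> C1"
proof
  show "Sy QQ UNIV (\<lambda>_ _ _. 1) (\<lambda>_ _. 1) (\<lambda>q y. a (fst q) y (snd q))" using Sy_ac_slice by (simp add: ac_def)
  have phc: "(\<lambda>y. complex_of_real (\<phi> y \<xi>)) = (\<lambda>y. phc (y, \<xi>))" for \<xi> by (simp add: phc_def)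
  show "(\<lambda>y. complex_of_real (\<phi> y (snd q))) differentiable (at y)" if "q \<in> QQ" for q y
    unfolding phc by (rule phc_slice_diff) (use that in auto)
  show "Sy QQ UNIV (\<lambda>_ _ _. 1) (\<lambda>q _. jbr (snd q)) (\<lambda>q. pd b (\<lambda>y. complex_of_real (\<phi> y (snd q))))" if "b \<in> Basis" for b
    unfolding phc by (rule Sy_phc_slice[OF that])
  show "pd b (\<lambda>y. complex_of_real (\<phi> y (snd q))) y = of_real (ze (y, snd q) \<bullet> b)" if "q \<in> QQ" "b \<in> Basis" for q b y
    unfolding phc pd_slice by (rule ze_inner) (use that in auto)
  show "C1 > 0" by (rule C1)
  show "C1 * jbr (snd q) \<le> norm (ze (y, snd q))" if "q \<in> QQ" for q y using C1(2)[of "(y, snd q)"] that by auto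
qed (auto simp: jbr_ge1 Sy_rho)

lemma sg_zero: "t \<in> T01 \<Longrightarrow> p \<notin> Om \<Longrightarrow> sg t p = 0"
proof -
  assume t: "t \<in> T01" and p: "p \<notin> Om"
  have "a t y (snd p) = 0" for y using ac_zero[OF t, of "(y, snd p)"] p by (auto simp: ac_def)
  then show ?thesis unfolding sg_def sigma_amp_def by (simp add: tendsto_Lim)
qed

text \<open>The inner integral over \<eta> is a Fourier transform at \<open>y - x\<close>, and the
  factor depending on \<open>x\<close> alone comes out. \<open>Lim\<close> is determined once
  convergence is known.\<close>

lemma sg_eq_limit:
  assumes l: "(osc (u0 t \<xi>) (\<lambda>\<eta>. \<rho> (t *\<^sub>R \<eta>)) x \<longlongrightarrow> l) (at_right 0)"
  shows "sg t (x, \<xi>) = cis (- \<phi> x \<xi>) * l / of_real ((2 * pi) ^ CARD('n))"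
proof -
  have "(LINT \<eta>|lborel. of_real (exp (- e * ((norm y)\<^sup>2 + (norm \<eta>)\<^sup>2))) * a t y \<xi> * \<rho> (t *\<^sub>R \<eta>) * cis ((x - y) \<bullet> \<eta> + \<phi> y \<xi> - \<phi> x \<xi>))
    = cis (- \<phi> x \<xi>) * (gauss e y * u0 t \<xi> y * FT (\<lambda>\<eta>. gauss e \<eta> * \<rho> (t *\<^sub>R \<eta>)) (y - x))" for e y
  proof -
    have "of_real (exp (- e * ((norm y)\<^sup>2 + (norm \<eta>)\<^sup>2))) * a t y \<xi> * \<rho> (t *\<^sub>R \<eta>) * cis ((x - y) \<bullet> \<eta> + \<phi> y \<xi> - \<phi> x \<xi>)
      = (cis (- \<phi> x \<xi>) * (gauss e y * u0 t \<xi> y)) * (gauss e \<eta> * \<rho> (t *\<^sub>R \<eta>) * cis (- (\<eta> \<bullet> (y - x))))" for \<eta>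
    proof -
      have c: "cis ((x - y) \<bullet> \<eta> + \<phi> y \<xi> - \<phi> x \<xi>) = cis (- \<phi> x \<xi>) * cis (\<phi> y \<xi>) * cis (- (\<eta> \<bullet> (y - x)))"
        by (simp add: cis_mult inner_diff_left inner_diff_right inner_commute algebra_simps)
      have g: "complex_of_real (exp (- e * ((norm y)\<^sup>2 + (norm \<eta>)\<^sup>2))) = gauss e y * gauss e \<eta>"
        by (simp add: gauss_def power2_norm_eq_inner algebra_simps flip: of_real_mult exp_add)
      show ?thesis unfolding c g u0_def by (simp only: mult_ac)
    qed
    then show ?thesis by (simp only: FT_def integral_mult_right_zero mult.assoc)
  qed
  then have "(\<lambda>e. (LINT y|lborel. LINT \<eta>|lborel. of_real (exp (- e * ((norm y)\<^sup>2 + (norm \<eta>)\<^sup>2))) * a t y \<xi> * \<rho> (t *\<^sub>R \<eta>) * cis ((x - y) \<bullet> \<eta> + \<phi> y \<xi> - \<phi> x \<xi>))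
       / of_real ((2 * pi) ^ CARD('n))) = (\<lambda>e. cis (- \<phi> x \<xi>) * osc (u0 t \<xi>) (\<lambda>\<eta>. \<rho> (t *\<^sub>R \<eta>)) x e / of_real ((2 * pi) ^ CARD('n)))"
    by (simp add: osc_def)
  moreover have "((\<lambda>e. cis (- \<phi> x \<xi>) * osc (u0 t \<xi>) (\<lambda>\<eta>. \<rho> (t *\<^sub>R \<eta>)) x e / of_real ((2 * pi) ^ CARD('n)))
      \<longlongrightarrow> cis (- \<phi> x \<xi>) * l / of_real ((2 * pi) ^ CARD('n))) (at_right 0)"
    by (intro tendsto_intros l) simp
  ultimately show ?thesis unfolding sg_def sigma_amp_def by (simp add: tendsto_Lim)
qed

lemma smo_ac_slice: "t \<in> T01 \<Longrightarrow> \<xi> \<in> Xi \<Longrightarrow> smo (\<lambda>y. ac t (y, \<xi>))"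
  using Sy_smo[OF Sy_ac_slice, of "(t, \<xi>)"] by simp

text \<open>Modulating by the linear part of the phase and factoring out
  \<open>cis (\<phi> x \<xi>)\<close> turns the exponential into \<open>Eph\<close>, after which the
  Leibniz rule gives \<open>AL\<close>.\<close>

lemma PD_u0:
  assumes t: "t \<in> T01" and p: "(x, \<xi>) \<in> Om" and L: "L \<in> lists Basis"
  shows "PD L (\<lambda>y. u0 t \<xi> y * cis (- ((y - x) \<bullet> ze (x, \<xi>)))) x = cis (\<phi> x \<xi>) * AL L t (x, \<xi>)"
proof -
  have sa: "smo (\<lambda>y. ac t (y, \<xi>))" using smo_ac_slice t p by simp
  have eq: "u0 t \<xi> y * cis (- ((y - x) \<bullet> ze (x, \<xi>))) = (cis (\<phi> x \<xi>) * ac t (y, \<xi>)) * Eph (x, \<xi>) y" for y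
    by (simp add: u0_eq Eph_def phc_def cis_conv_exp algebra_simps flip: exp_add)
  have sc: "PD A (\<lambda>y. cis (\<phi> x \<xi>) * ac t (y, \<xi>)) = (\<lambda>y. cis (\<phi> x \<xi>) * PD A (\<lambda>y. ac t (y, \<xi>)) y)" if "A \<in> lists Basis" for A
    by (rule PD_cmult[OF sa that])
  have "PD L (\<lambda>y. (cis (\<phi> x \<xi>) * ac t (y, \<xi>)) * Eph (x, \<xi>) y) x
      = (\<Sum>(A, B)\<leftarrow>splits L. PD A (\<lambda>y. cis (\<phi> x \<xi>) * ac t (y, \<xi>)) x * PD B (Eph (x, \<xi>)) x)"
    by (rule PD_leibniz[OF open_UNIV _ _ L]) (use sc sa smo_Eph[OF p] in \<open>auto simp: smo_def\<close>)
  also have "\<dots> = (\<Sum>i\<leftarrow>splits L. cis (\<phi> x \<xi>) * (PD (map bx (fst i)) (ac t) (x, \<xi>) * EL (snd i) (x, \<xi>)))"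
  proof (rule arg_cong[of _ _ sum_list], rule map_cong[OF refl], safe)
    fix A B assume "(A, B) \<in> set (splits L)"
    then have A: "A \<in> lists Basis" using splits_props(2) L by (fastforce simp: in_lists_conv_set)
    show "PD A (\<lambda>y. cis (\<phi> x \<xi>) * ac t (y, \<xi>)) x * PD B (Eph (x, \<xi>)) x
       = cis (\<phi> x \<xi>) * (PD (map bx (fst (A, B))) (ac t) (x, \<xi>) * EL (snd (A, B)) (x, \<xi>))"
      by (simp add: sc[OF A] PD_slice[of A "ac t"] EL_def)
  qed
  finally show ?thesis by (simp add: eq AL_def sum_list_const_mult)
qed

definition TN :: "nat \<Rightarrow> real \<Rightarrow> (real^'n) \<times> (real^'n) \<Rightarrow> complex" where
  "TN k t p = (\<Sum>L | L \<in> lists Basis \<and> length L = k. XL L t p) / fact k"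

text \<open>Only the value of the remainder is bounded, not its derivatives. Up to a unimodular and
  a constant factor it is the limit of \<open>osc\<close> applied to the Taylor remainder of the
  multiplier, and it inherits the bound that holds uniformly for small \<open>e\<close>.\<close>

lemma sg_expansion:
  "\<exists>C\<ge>0. \<forall>t\<in>T01. \<forall>p. norm (sg t p - (\<Sum>k<N. TN k t p)) \<le> C * mup t p ^ N"
proof -
  obtain C where C: "C \<ge> 0" "\<And>q x e. q \<in> QQ \<Longrightarrow> 0 < e \<and> e < 1 \<and> e * jbr (snd q) \<le> 1 \<Longrightarrow>
     norm (osc (\<lambda>y. a (fst q) y (snd q) * cis (\<phi> y (snd q))) (rem N (\<lambda>\<eta>. \<rho> (fst q *\<^sub>R \<eta>)) (ze (x, snd q))) x e)
       \<le> C * osc_family.mu (\<lambda>q. jbr (snd q)) fst q ^ N"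
    using osc_family.osc_rem_bound[OF osc_fam, of N] by blast
  define c where "c = (2 * pi) ^ CARD('n)"
  have c: "0 < c" by (simp add: c_def)
  show ?thesis
  proof (intro exI[of _ "C / c"] conjI ballI allI)
    fix t and p :: "(real^'n) \<times> (real^'n)" assume t: "t \<in> T01"
    show "norm (sg t p - (\<Sum>k<N. TN k t p)) \<le> C / c * mup t p ^ N"
    proof (cases "p \<in> Om")
      case False
      have "XL L t p = 0" for L using XL_zero[OF t False, of L] by blast
      then show ?thesis using sg_zero[OF t False] C(1) c mup_nonneg[OF t, of p] by (simp add: TN_def)
    next
      case True
      obtain x \<xi> where p: "p = (x, \<xi>)" by (cases p)
      have xi: "\<xi> \<in> Xi" using True p by simp
      have q: "(t, \<xi>) \<in> QQ" using t xi by simp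
      let ?r = "\<lambda>\<eta>. \<rho> (t *\<^sub>R \<eta>)"
      have tr: "tempered 0 ?r" using osc_family.tempered_\<rho>t[OF osc_fam q] by simp
      have tu: "tempered 0 (u0 t \<xi>)" by (rule tempered_u0[OF t xi])
      obtain l where l: "(osc (u0 t \<xi>) ?r x \<longlongrightarrow> l) (at_right 0)" using osc_limit[OF tu tr] by blast
      define D where "D = l - (\<Sum>k<N. (\<Sum>L | L \<in> lists Basis \<and> length L = k. PD L ?r (ze p) *
        (of_real ((2 * pi) ^ DIM(real^'n)) * (- \<i>) ^ length L * PD L (\<lambda>y. u0 t \<xi> y * cis (- ((y - x) \<bullet> ze p))) x)) / fact k)"
      have lim: "(osc (u0 t \<xi>) (rem N ?r (ze p)) x \<longlongrightarrow> D) (at_right 0)"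
        unfolding D_def by (rule osc_rem_limit[OF tu tr l])
      have "\<forall>\<^sub>F e in at_right 0. norm (osc (u0 t \<xi>) (rem N ?r (ze p)) x e) \<le> C * mup t p ^ N"
      proof -
        have "\<forall>\<^sub>F e in at_right (0::real). e < 1 / jbr \<xi>" using eventually_at_right_real[of 0 "1 / jbr \<xi>"] jbr_pos[of \<xi>] by (auto elim: eventually_mono)
        then show ?thesis using eventually_at_right_01
        proof eventually_elim
          case (elim e)
          have "e * jbr \<xi> \<le> 1" using elim(1) jbr_pos[of \<xi>] by (simp add: pos_less_divide_eq)
          then show ?case using C(2)[OF q, of e x] elim(2)
            by (simp add: p u0_def[abs_def] mup_def osc_family.mu_def[OF osc_fam])
        qed
      qed
      then have bd: "norm D \<le> C * mup t p ^ N" using lim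
        by (intro tendsto_upperbound[OF tendsto_norm[OF lim]]) auto
      have PDr: "PD L ?r (ze p) = of_real t ^ length L * RL L t p" if "L \<in> lists Basis" for L
        using PD_affine[OF osc_family.smo_\<rho>[OF osc_fam] that, of 0 t] by (simp add: RL_def)
      have trm: "PD L ?r (ze p) * (of_real ((2 * pi) ^ DIM(real^'n)) * (- \<i>) ^ length L * PD L (\<lambda>y. u0 t \<xi> y * cis (- ((y - x) \<bullet> ze p))) x)
         = of_real c * cis (\<phi> x \<xi>) * XL L t p" if "L \<in> lists Basis" for L
      proof -
        have cn: "(2 * pi) ^ DIM(real^'n) = c" by (simp add: c_def)
        have pw: "(- \<i> * complex_of_real t) ^ length L = (- \<i>) ^ length L * of_real t ^ length L" by (rule power_mult_distrib)
        show ?thesis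
          unfolding PDr[OF that] XL_def pw cn PD_u0[OF t True[unfolded p] that, folded p] by (simp only: mult_ac)
      qed
      have S: "(\<Sum>L | L \<in> lists Basis \<and> length L = k. PD L ?r (ze p) *
        (of_real ((2 * pi) ^ DIM(real^'n)) * (- \<i>) ^ length L * PD L (\<lambda>y. u0 t \<xi> y * cis (- ((y - x) \<bullet> ze p))) x))
        = of_real c * cis (\<phi> x \<xi>) * (\<Sum>L | L \<in> lists Basis \<and> length L = k. XL L t p)" for k
        unfolding sum_distrib_left by (rule sum.cong[OF refl], rule trm, simp)
      have "D = l - (\<Sum>k<N. of_real c * cis (\<phi> x \<xi>) * TN k t p)"
        unfolding D_def TN_def S by simp
      also have "l = of_real c * cis (\<phi> x \<xi>) * sg t p"
        unfolding p sg_eq_limit[OF l] using c by (simp add: c_def cis_mult mult.assoc[symmetric])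
      finally have "D = of_real c * cis (\<phi> x \<xi>) * (sg t p - (\<Sum>k<N. TN k t p))"
        by (simp add: right_diff_distrib sum_distrib_left)
      then have "norm D = c * norm (sg t p - (\<Sum>k<N. TN k t p))" using c by (simp add: norm_mult)
      then show ?thesis using bd c by (simp add: pos_le_divide_eq mult.commute)
    qed
  qed (use C(1) c in simp)
qed

end

section \<open>Crude bounds for the amplitude\<close>

text \<open>The functions decay like \<open>1 / J x ^ DIM('a)\<close> and need not be in
  \<open>Sch\<close>. Gaussian factors bring them there with uniform bounds, and the estimate
  survives the limit. Decay of every order \<open>j\<close> results because derivatives of every
  order are integrable.\<close>

lemma FT_uniform_decay:
  fixes g :: "'p \<Rightarrow> 'a::euclidean_space \<Rightarrow> complex"
  assumes g: "Sy P UNIV (\<lambda>_ _ _. 1) (\<lambda>_ x. 1 / J x ^ DIM('a)) g"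
  shows "\<exists>C\<ge>0. \<forall>p\<in>P. \<forall>v. norm (FT (g p) v) \<le> C / J v ^ j"
proof -
  let ?Pe = "P \<times> {0<..<1::real}"
  let ?G = "\<lambda>q x. gauss (snd q) x * g (fst q) x"
  have g1: "Sy ?Pe UNIV (\<lambda>_ _ _. 1) (\<lambda>_ _. 1) (\<lambda>q. gauss (snd q) :: 'a \<Rightarrow> complex)"
    by (rule Sy_mono[OF Sy_gauss[where e = snd] open_UNIV, where D = 1 and D' = 1]) auto
  have g2: "Sy ?Pe UNIV (\<lambda>_ _ _. 1) (\<lambda>_ x. 1 / J x ^ DIM('a)) (\<lambda>q. g (fst q))"
    using Sy_reindex[OF g open_UNIV subset_UNIV, where Q = ?Pe and \<pi> = fst] by auto
  have G: "Sy ?Pe UNIV (\<lambda>_ _ _. 1) (\<lambda>_ x. 1 / J x ^ DIM('a)) ?G"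
    using Sy_mult[OF open_UNIV g1 g2] by simp
  have SG: "Sch (\<lambda>x. gauss e x * g p x)" if "p \<in> P" "0 < e" for p e
  proof (rule Sch_mult(1)[OF Sch_gauss[OF that(2)]])
    have "Sy {()} UNIV (\<lambda>_ _ _. 1) (\<lambda>_ x. 1 / J x ^ DIM('a)) (\<lambda>_. g p)"
      using Sy_reindex[OF g open_UNIV subset_UNIV, where Q = "{()}" and \<pi> = "\<lambda>_. p"] that by auto
    then show "tempered 0 (g p)" by (rule Sy_mono[where D = 1 and D' = 1]) (auto simp: J_inv_le1 less_imp_le[OF J_pos])
  qed
  obtain C where C: "C \<ge> 0" "\<And>q x. q \<in> ?Pe \<Longrightarrow> norm ((lap ^^ j) (?G q) x) \<le> C * (1 / J x ^ DIM('a))"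
    using Sy_bound0[OF Sy_lap_power[OF G, where k = j]] by (auto simp: less_imp_le[OF J_pos])
  obtain C' where C': "C' \<ge> 0" "\<And>p x. p \<in> P \<Longrightarrow> norm (g p x) \<le> C' * (1 / J x ^ DIM('a))"
    using Sy_bound0[OF g] by auto
  define I where "I = (LINT x|(lborel :: 'a measure). 1 / J x ^ DIM('a))"
  have I: "0 \<le> I" unfolding I_def by (rule integral_nonneg_AE) (auto simp: less_imp_le[OF J_pos])
  have e: "norm (FT (\<lambda>x. gauss e x * g p x) v) \<le> C * I / J v ^ j" if p: "p \<in> P" and e: "0 < e" "e < 1" for p e v
  proof -
    have "norm (FT (\<lambda>x. gauss e x * g p x) v) \<le> (LINT y|lborel. norm ((lap ^^ j) (\<lambda>x. gauss e x * g p x) y)) / J v ^ j"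
      by (rule FT_decay[OF SG[OF p e(1)]])
    also have "(LINT y|lborel. norm ((lap ^^ j) (\<lambda>x. gauss e x * g p x) y)) \<le> (LINT y|(lborel :: 'a measure). C * (1 / J y ^ DIM('a)))"
    proof (rule integral_mono)
      show "integrable lborel (\<lambda>y. norm ((lap ^^ j) (\<lambda>x. gauss e x * g p x) y))"
        by (intro integrable_norm integrable_Sch(1) Sch_lap_power SG p e)
      show "integrable lborel (\<lambda>y::'a. C * (1 / J y ^ DIM('a)))" by (intro integrable_mult_right integrable_J)
      show "norm ((lap ^^ j) (\<lambda>x. gauss e x * g p x) y) \<le> C * (1 / J y ^ DIM('a))" for y
        using C(2)[of "(p, e)" y] p e by simp
    qed
    also have "\<dots> = C * I" unfolding I_def by (rule integral_mult_right_zero)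
    finally show ?thesis using J_pos[of v] by (simp add: divide_right_mono)
  qed
  show ?thesis
  proof (intro exI[of _ "C * I"] conjI ballI allI)
    fix p v assume p: "p \<in> P"
    have [measurable]: "g p \<in> borel_measurable borel"
      by (rule differentiable_imp_measurable(2)) (use Sy_diff0[OF g p] in auto)
    have "((\<lambda>e. LINT y|lborel. gauss e y * g p y * cis (- (y \<bullet> v))) \<longlongrightarrow> (LINT y|lborel. g p y * cis (- (y \<bullet> v)))) (at_right 0)"
    proof (rule dominated_convergence_at_right[where w = "\<lambda>x. C' / J x ^ DIM('a)"])
      show "(\<lambda>y. gauss e y * g p y * cis (- (y \<bullet> v))) \<in> borel_measurable lborel" for e unfolding gauss_def by measurable
      show "(\<lambda>y. g p y * cis (- (y \<bullet> v))) \<in> borel_measurable lborel" by measurable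
      show "integrable lborel (\<lambda>x::'a. C' / J x ^ DIM('a))" by (rule integrable_J')
      show "norm (gauss e y * g p y * cis (- (y \<bullet> v))) \<le> C' / J y ^ DIM('a)" if "0 < e" for e y
      proof -
        have "norm (gauss e y) \<le> 1" using that by (simp add: gauss_def)
        then have "norm (gauss e y) * norm (g p y) \<le> 1 * norm (g p y)" by (rule mult_right_mono) simp
        then show ?thesis using C'(2)[OF p, of y] by (simp add: norm_mult)
      qed
      show "((\<lambda>e. gauss e y * g p y * cis (- (y \<bullet> v))) \<longlongrightarrow> g p y * cis (- (y \<bullet> v))) (at_right 0)" for y
      proof -
        have "((\<lambda>e. gauss e y) \<longlongrightarrow> of_real (exp (- 0 * (y \<bullet> y)))) (at_right 0)" unfolding gauss_def by (intro tendsto_intros)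
        then have "((\<lambda>e. gauss e y) \<longlongrightarrow> 1) (at_right 0)" by simp
        then have "((\<lambda>e. gauss e y * g p y * cis (- (y \<bullet> v))) \<longlongrightarrow> 1 * g p y * cis (- (y \<bullet> v))) (at_right 0)" by (intro tendsto_mult tendsto_const)
        then show ?thesis by simp
      qed
    qed
    then have "((\<lambda>e. norm (FT (\<lambda>x. gauss e x * g p x) v)) \<longlongrightarrow> norm (FT (g p) v)) (at_right 0)"
      unfolding FT_def by (rule tendsto_norm)
    then show "norm (FT (g p) v) \<le> C * I / J v ^ j"
    proof (rule tendsto_upperbound)
      show "\<forall>\<^sub>F e in at_right 0. norm (FT (\<lambda>x. gauss e x * g p x) v) \<le> C * I / J v ^ j"
        using eventually_at_right_01 by eventually_elim (use e[OF p] in auto)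
    qed simp
  qed (use C I in simp)
qed

lemma integral_decay:
  fixes \<kappa> H :: "'a::euclidean_space \<Rightarrow> complex"
  assumes k: "\<And>z. norm (\<kappa> z) \<le> C / J z ^ (i + DIM('a))" and m: "\<kappa> \<in> borel_measurable borel" "H \<in> borel_measurable borel"
    and H: "\<And>z. norm (H z) \<le> B * J z ^ i"
  shows "integrable lborel (\<lambda>z. \<kappa> z * H z)"
    and "norm (LINT z|lborel. \<kappa> z * H z) \<le> C * (LINT x|(lborel :: 'a measure). 1 / J x ^ DIM('a)) * B"
proof -
  note [measurable] = m
  have b: "norm (\<kappa> z * H z) \<le> (C * B) / J z ^ DIM('a)" for z
  proof -
    have "norm (\<kappa> z * H z) \<le> (C / J z ^ (i + DIM('a))) * (B * J z ^ i)"
      unfolding norm_mult using k[of z] by (intro mult_mono H k order_trans[OF norm_ge_zero k]) auto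
    then show ?thesis using J_pos[of z] by (simp add: power_add)
  qed
  show int: "integrable lborel (\<lambda>z. \<kappa> z * H z)" by (rule integrable_J_bound[OF _ b]) measurable
  have "norm (LINT z|lborel. \<kappa> z * H z) \<le> (LINT z|(lborel :: 'a measure). (C * B) * (1 / J z ^ DIM('a)))"
    by (rule norm_LINT_le[OF int integrable_mult_right[OF integrable_J]]) (use b in auto)
  also have "\<dots> = C * (LINT x|(lborel :: 'a measure). 1 / J x ^ DIM('a)) * B"
    unfolding integral_mult_right_zero by simp
  finally show "norm (LINT z|lborel. \<kappa> z * H z) \<le> C * (LINT x|(lborel :: 'a measure). 1 / J x ^ DIM('a)) * B" .
qed

lemma has_derivative_quadratic:
  assumes l: "bounded_linear f'" and b: "\<And>h. norm h \<le> 1 \<Longrightarrow> norm (f (x + h) - f x - f' h) \<le> K * (norm h)\<^sup>2"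
  shows "(f has_derivative f') (at x)"
proof (rule has_derivativeI_sandwich[of 1, OF _ l])
  fix y assume y: "y \<noteq> x" "dist y x < 1"
  have "norm (f y - f x - f' (y - x)) \<le> K * (norm (y - x))\<^sup>2" using b[of "y - x"] y by (simp add: dist_norm)
  then show "norm (f y - f x - f' (y - x)) / norm (y - x) \<le> K * norm (y - x)"
    using y by (simp add: divide_le_eq power2_eq_square mult.assoc)
next
  have "((\<lambda>y. K * norm (y - x)) \<longlongrightarrow> K * norm (x - x)) (at x)" by (intro tendsto_intros)
  then show "((\<lambda>y. K * norm (y - x)) \<longlongrightarrow> 0) (at x)" by simp
qed simp

text \<open>Serves measurability: a derivative with respect to one variable depends measurably on
  the others, being a limit of a sequence of difference quotients.\<close>

lemma pd_sequential_limit: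
  fixes f :: "'a::real_normed_vector \<Rightarrow> complex"
  assumes "f differentiable (at x)"
  shows "(\<lambda>n. of_nat (Suc n) * (f (x + (1 / real (Suc n)) *\<^sub>R b) - f x)) \<longlonglongrightarrow> pd b f x"
proof -
  have "((\<lambda>s. f (x + s *\<^sub>R b)) has_vector_derivative pd b f x) (at 0)" using pd_line[of f x 0 b UNIV] assms by simp
  then have "((\<lambda>s. f (x + s *\<^sub>R b)) has_derivative (\<lambda>s. s *\<^sub>R pd b f x)) (at 0)" by (simp add: has_vector_derivative_def)
  then have l: "(\<lambda>s. norm (f (x + s *\<^sub>R b) - f x - s *\<^sub>R pd b f x) / norm s) \<midarrow>0\<rightarrow> 0"
    unfolding has_derivative_at by simp
  have "filterlim (\<lambda>n. 1 / real (Suc n)) (at 0) sequentially"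
    unfolding filterlim_at using LIMSEQ_inverse_real_of_nat by (auto simp: divide_inverse)
  from filterlim_compose[OF l this]
  have "(\<lambda>n. norm (of_nat (Suc n) * (f (x + (1 / real (Suc n)) *\<^sub>R b) - f x) - pd b f x)) \<longlonglongrightarrow> 0"
  proof (rule Lim_transform_eventually, intro always_eventually allI)
    fix n
    let ?s = "1 / real (Suc n)"
    have "of_nat (Suc n) * (f (x + ?s *\<^sub>R b) - f x) - pd b f x = of_nat (Suc n) * (f (x + ?s *\<^sub>R b) - f x - ?s *\<^sub>R pd b f x)"
      by (simp add: right_diff_distrib scaleR_conv_of_real del: of_nat_Suc)
    then have "norm (of_nat (Suc n) * (f (x + ?s *\<^sub>R b) - f x) - pd b f x) = real (Suc n) * norm (f (x + ?s *\<^sub>R b) - f x - ?s *\<^sub>R pd b f x)"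
      by (simp only: norm_mult norm_of_nat)
    then show "norm (f (x + ?s *\<^sub>R b) - f x - ?s *\<^sub>R pd b f x) / norm ?s = norm (of_nat (Suc n) * (f (x + ?s *\<^sub>R b) - f x) - pd b f x)"
      by (simp del: of_nat_Suc)
  qed
  then show ?thesis by (rule LIM_zero_cancel[OF tendsto_norm_zero_cancel])
qed

text \<open>Differentiation under the integral sign. Each derivative of \<open>G\<close> costs
  \<open>J z * w p\<close>; the rapidly decaying kernel absorbs the powers of \<open>J z\<close>,
  and \<open>w p\<close> remains. A second-order Taylor remainder provides the derivative with a
  quadratic error, for which \<open>w\<close> must not grow by more than a fixed factor over unit
  distances.\<close>

lemma Sy_integral:
  fixes G :: "'p \<times> 'c::euclidean_space \<Rightarrow> 'a::euclidean_space \<Rightarrow> complex" and \<kappa> :: "'p \<Rightarrow> 'c \<Rightarrow> complex" and w :: "'a \<Rightarrow> real"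
  assumes k: "\<And>j. \<exists>C\<ge>0. \<forall>t\<in>P. \<forall>z. norm (\<kappa> t z) \<le> C / J z ^ j"
    and km: "\<And>t. t \<in> P \<Longrightarrow> \<kappa> t \<in> borel_measurable borel"
    and w1: "\<And>p. 1 \<le> w p" and w2: "\<And>p h. norm h \<le> 1 \<Longrightarrow> w (p + h) \<le> 2 * w p"
    and G: "Sy (P \<times> UNIV) UNIV (\<lambda>q _ p. J (snd q) * w p) (\<lambda>q p. J (snd q) ^ i * w p ^ l) G"
    and Gm: "\<And>t p. t \<in> P \<Longrightarrow> (\<lambda>z. G (t, z) p) \<in> borel_measurable borel"
  shows "Sy P UNIV (\<lambda>_ _ p. w p) (\<lambda>_ p. w p ^ l) (\<lambda>t p. LINT z|lborel. \<kappa> t z * G (t, z) p)"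
proof -
  define I where "I = (LINT x|(lborel :: 'c measure). 1 / J x ^ DIM('c))"
  have I: "0 \<le> I" unfolding I_def by (rule integral_nonneg_AE) (auto simp: less_imp_le[OF J_pos])
  have w0: "0 \<le> w p" for p using w1[of p] by linarith
  have "Syk n P UNIV (\<lambda>_ _ p. w p) (\<lambda>_ p. w p ^ l) (\<lambda>t p. LINT z|lborel. \<kappa> t z * G (t, z) p)" for n
    using G Gm
  \<comment> \<open>The exponents are generalised because a derivative of \<open>G\<close> satisfies
    the same hypothesis with \<open>Suc i\<close> and \<open>Suc l\<close>.\<close>
  proof (induction n arbitrary: i l G)
    case (Suc n)
    note G = Suc.prems(1) and Gm = Suc.prems(2)
    have smo: "smo (G (t, z))" if "t \<in> P" for t z by (rule Sy_smo[OF G]) (use that in auto)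
    have m1: "(\<lambda>z. pd b (G (t, z)) p) \<in> borel_measurable borel" if t: "t \<in> P" for t b p
    proof (rule borel_measurable_LIMSEQ_metric)
      show "(\<lambda>z. of_nat (Suc n) * (G (t, z) (p + (1 / real (Suc n)) *\<^sub>R b) - G (t, z) p)) \<in> borel_measurable borel" for n
        using Gm[OF t] by measurable
      show "(\<lambda>n. of_nat (Suc n) * (G (t, z) (p + (1 / real (Suc n)) *\<^sub>R b) - G (t, z) p)) \<longlonglongrightarrow> pd b (G (t, z)) p" for z
        by (rule pd_sequential_limit[OF smo_D[OF smo[OF t]]])
    qed
    have G1: "Sy (P \<times> UNIV) UNIV (\<lambda>q _ p. J (snd q) * w p) (\<lambda>q p. J (snd q) ^ Suc i * w p ^ Suc l) (\<lambda>q. pd b (G q))" if "b \<in> Basis" for b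
      by (rule Sy_cong'[OF Sy_pd[OF G that] open_UNIV]) (auto simp: mult_ac)
    have deriv: "((\<lambda>p. LINT z|lborel. \<kappa> t z * G (t, z) p) has_derivative (\<lambda>h. \<Sum>b\<in>Basis. (h \<bullet> b) *\<^sub>R (LINT z|lborel. \<kappa> t z * pd b (G (t, z)) p))) (at p)"
      if t: "t \<in> P" for t p
    proof -
      have "\<exists>D\<ge>0. \<forall>q\<in>P\<times>UNIV. \<forall>p\<in>UNIV. norm (PD L (G q) p) \<le> D * (J (snd q) ^ i * w p ^ l * (\<Prod>b\<leftarrow>L. J (snd q) * w p))" if "L \<in> lists Basis" for L
        by (rule Sy_D(2)[OF G that])
      then obtain D where D: "\<And>L. L \<in> lists Basis \<Longrightarrow> 0 \<le> D L"
        "\<And>L z p. L \<in> lists Basis \<Longrightarrow> norm (PD L (G (t, z)) p) \<le> D L * (J z ^ i * w p ^ l * (\<Prod>b\<leftarrow>L. J z * w p))"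
        using t by (metis SigmaI UNIV_I snd_conv)
      define D2 where "D2 = (\<Sum>L | L \<in> lists Basis \<and> length L = 2. D L)"
      have D2: "0 \<le> D2" "\<And>L. L \<in> lists Basis \<Longrightarrow> length L = 2 \<Longrightarrow> D L \<le> D2"
        unfolding D2_def using D(1) by (auto intro!: sum_nonneg member_le_sum finite_lists_Basis)
      define A where "A = D2 * (2 * w p) ^ (l + 2)"
      have A0: "0 \<le> A" using D2(1) w0 by (simp add: A_def)
      have PDb: "norm (PD L (G (t, z)) (p + h)) \<le> A * J z ^ (i + 2)" if L: "L \<in> lists Basis" "length L = 2" and h: "norm h \<le> 1" for L z h
      proof -
        have "(\<Prod>b\<leftarrow>L. J z * w (p + h)) = (J z * w (p + h)) ^ 2" unfolding L(2)[symmetric] by (simp add: map_replicate_const)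
        then have "norm (PD L (G (t, z)) (p + h)) \<le> D L * (J z ^ (i + 2) * w (p + h) ^ (l + 2))"
          using D(2)[OF L(1), of z "p + h"] by (simp add: power_add power_mult_distrib power2_eq_square mult_ac)
        also have "\<dots> \<le> D2 * (J z ^ (i + 2) * (2 * w p) ^ (l + 2))"
        proof (rule mult_mono[OF D2(2)[OF L] mult_left_mono[OF power_mono[OF w2[OF h] w0]] D2(1)])
          show "0 \<le> J z ^ (i + 2)" using J_pos[of z] by simp
          then show "0 \<le> J z ^ (i + 2) * w (p + h) ^ (l + 2)" by (rule mult_nonneg_nonneg) (use w0 in simp)
        qed
        finally show ?thesis by (simp add: A_def mult_ac)
      qed
      define RR where "RR = (\<lambda>h z. G (t, z) (p + h) - G (t, z) p - (\<Sum>b\<in>Basis. of_real (h \<bullet> b) * pd b (G (t, z)) p))"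
      have RR: "norm (RR h z) \<le> ((real DIM('a) * norm h)\<^sup>2 * A) * J z ^ (i + 2)" if h: "norm h \<le> 1" for h z
      proof -
        have "norm (rem 2 (G (t, z)) p (p + 1 *\<^sub>R h)) \<le> (real DIM('a) * norm h) ^ 2 * (A * J z ^ (i + 2))"
        proof (rule rem_bound[OF smo[OF t]])
          fix L :: "'a list" and s :: real assume "L \<in> lists Basis" "length L = 2" "0 \<le> s" "s \<le> 1"
          moreover have "norm (s *\<^sub>R h) \<le> 1" using \<open>0 \<le> s\<close> \<open>s \<le> 1\<close> h by (simp add: mult_le_one)
          ultimately show "norm (PD L (G (t, z)) (p + s *\<^sub>R h)) \<le> A * J z ^ (i + 2)" by (intro PDb)
        qed (use A0 J_pos[of z] in auto)
        moreover have "rem 2 (G (t, z)) p (p + 1 *\<^sub>R h) = RR h z"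
          by (simp add: rem_def RR_def numeral_2_eq_2)
        ultimately show ?thesis by (simp add: mult_ac)
      qed
      have RRm: "RR h \<in> borel_measurable borel" for h unfolding RR_def using Gm[OF t] m1[OF t] by measurable
      obtain C where C: "C \<ge> 0" "\<And>z. norm (\<kappa> t z) \<le> C / J z ^ (i + 2 + DIM('c))" using k[of "i + 2 + DIM('c)"] t by blast
      obtain C0 where C0: "C0 \<ge> 0" "\<And>z. norm (\<kappa> t z) \<le> C0 / J z ^ (i + DIM('c))" using k[of "i + DIM('c)"] t by blast
      obtain C1 where C1: "C1 \<ge> 0" "\<And>z. norm (\<kappa> t z) \<le> C1 / J z ^ (Suc i + DIM('c))" using k[of "Suc i + DIM('c)"] t by blast
      have i0: "integrable lborel (\<lambda>z. \<kappa> t z * G (t, z) q)" for q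
      proof -
        have "norm (G (t, z) q) \<le> (D [] * w q ^ l) * J z ^ i" for z using D(2)[of "[]" z q] by (simp add: mult_ac)
        then show ?thesis by (rule integral_decay(1)[OF C0(2) km[OF t] Gm[OF t]])
      qed
      have i1: "integrable lborel (\<lambda>z. \<kappa> t z * pd b (G (t, z)) p)" if b: "b \<in> Basis" for b
      proof -
        have "norm (pd b (G (t, z)) p) \<le> (D [b] * w p ^ Suc l) * J z ^ Suc i" for z using D(2)[of "[b]" z p] b by (simp add: mult_ac)
        then show ?thesis by (rule integral_decay(1)[OF C1(2) km[OF t] m1[OF t]])
      qed
      show ?thesis
      proof (rule has_derivative_quadratic[where K = "C * I * ((real DIM('a))\<^sup>2 * A)"])
        show "bounded_linear (\<lambda>h. \<Sum>b\<in>Basis. (h \<bullet> b) *\<^sub>R (LINT z|lborel. \<kappa> t z * pd b (G (t, z)) p))"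
          by (intro bounded_linear_sum bounded_linear_compose[OF bounded_linear_scaleR_left bounded_linear_inner_left])
        fix h :: 'a assume h: "norm h \<le> 1"
        have "(LINT z|lborel. \<kappa> t z * RR h z) = (LINT z|lborel. \<kappa> t z * G (t, z) (p + h)) - (LINT z|lborel. \<kappa> t z * G (t, z) p)
           - (\<Sum>b\<in>Basis. (h \<bullet> b) *\<^sub>R (LINT z|lborel. \<kappa> t z * pd b (G (t, z)) p))"
        proof -
          have "(LINT z|lborel. \<kappa> t z * RR h z) = (LINT z|lborel. \<kappa> t z * G (t, z) (p + h) - \<kappa> t z * G (t, z) p
             - (\<Sum>b\<in>Basis. (h \<bullet> b) *\<^sub>R (\<kappa> t z * pd b (G (t, z)) p)))"
            by (rule Bochner_Integration.integral_cong) (auto simp: RR_def right_diff_distrib sum_distrib_left scaleR_conv_of_real mult_ac)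
          also have "\<dots> = (LINT z|lborel. \<kappa> t z * G (t, z) (p + h)) - (LINT z|lborel. \<kappa> t z * G (t, z) p)
             - (LINT z|lborel. (\<Sum>b\<in>Basis. (h \<bullet> b) *\<^sub>R (\<kappa> t z * pd b (G (t, z)) p)))"
            using i0 i1 by (subst Bochner_Integration.integral_diff, auto)+
          also have "(LINT z|lborel. (\<Sum>b\<in>Basis. (h \<bullet> b) *\<^sub>R (\<kappa> t z * pd b (G (t, z)) p)))
             = (\<Sum>b\<in>Basis. (h \<bullet> b) *\<^sub>R (LINT z|lborel. \<kappa> t z * pd b (G (t, z)) p))"
            using i1 by (subst Bochner_Integration.integral_sum) auto
          finally show ?thesis .
        qed
        moreover have "norm (LINT z|lborel. \<kappa> t z * RR h z) \<le> C * I * ((real DIM('a) * norm h)\<^sup>2 * A)"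
          unfolding I_def by (rule integral_decay(2)[OF C(2) km[OF t] RRm RR[OF h]])
        ultimately show "norm ((LINT z|lborel. \<kappa> t z * G (t, z) (p + h)) - (LINT z|lborel. \<kappa> t z * G (t, z) p)
           - (\<Sum>b\<in>Basis. (h \<bullet> b) *\<^sub>R (LINT z|lborel. \<kappa> t z * pd b (G (t, z)) p))) \<le> C * I * ((real DIM('a))\<^sup>2 * A) * (norm h)\<^sup>2"
          by (simp add: power_mult_distrib mult_ac)
      qed
    qed
    have pdI: "pd b (\<lambda>p. LINT z|lborel. \<kappa> t z * G (t, z) p) p = (LINT z|lborel. \<kappa> t z * pd b (G (t, z)) p)" if "t \<in> P" "b \<in> Basis" for t b p
      using pd_has_derivative[OF deriv[OF that(1)], of b p] that(2) by (simp add: inner_Basis if_distrib[of "\<lambda>r. r *\<^sub>R _"] cong: if_cong)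
    have bound: "\<exists>C\<ge>0. \<forall>t\<in>P. \<forall>p\<in>UNIV. norm (LINT z|lborel. \<kappa> t z * G (t, z) p) \<le> C * w p ^ l"
    proof -
      obtain C where C: "C \<ge> 0" "\<And>t z. t \<in> P \<Longrightarrow> norm (\<kappa> t z) \<le> C / J z ^ (i + DIM('c))" using k[of "i + DIM('c)"] by blast
      obtain D where D: "D \<ge> 0" "\<And>q p. q \<in> P \<times> UNIV \<Longrightarrow> norm (G q p) \<le> D * (J (snd q) ^ i * w p ^ l)" using Sy_bound0[OF G] by blast
      show ?thesis
      proof (intro exI[of _ "C * I * D"] conjI ballI)
        fix t p assume t: "t \<in> P"
        have "norm (G (t, z) p) \<le> (D * w p ^ l) * J z ^ i" for z using D(2)[of "(t, z)" p] t by (simp add: mult_ac)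
        from integral_decay(2)[OF C(2)[OF t] km[OF t] Gm[OF t] this]
        show "norm (LINT z|lborel. \<kappa> t z * G (t, z) p) \<le> C * I * D * w p ^ l" by (simp add: I_def mult_ac)
      qed (use C D I in auto)
    qed
    have "Syk n P UNIV (\<lambda>_ _ p. w p) (\<lambda>_ p. w p ^ l * w p) (\<lambda>t. pd b (\<lambda>p. LINT z|lborel. \<kappa> t z * G (t, z) p))" if b: "b \<in> Basis" for b
    proof -
      have "Syk n P UNIV (\<lambda>_ _ p. w p) (\<lambda>_ p. w p ^ Suc l) (\<lambda>t p. LINT z|lborel. \<kappa> t z * pd b (G (t, z)) p)"
        by (rule Suc.IH[OF G1[OF b] m1])
      then show ?thesis by (rule Syk_cong[OF open_UNIV, rotated 2]) (use pdI[OF _ b] in \<open>auto simp: mult.commute\<close>)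
    qed
    then show ?case using bound differentiableI[OF deriv] by auto
  qed simp
  then show ?thesis by (simp add: Sy_def)
qed

lemma prod_list_ge1: "(\<And>b. b \<in> set L \<Longrightarrow> 1 \<le> f b) \<Longrightarrow> 1 \<le> (\<Prod>b\<leftarrow>L. f b :: real)"
proof (induction L)
  case (Cons b L)
  then have "1 \<le> f b" "1 \<le> (\<Prod>b\<leftarrow>L. f b)" by auto
  then have "1 * 1 \<le> f b * (\<Prod>b\<leftarrow>L. f b)" by (intro mult_mono) auto
  then show ?case by simp
qed simp

lemma prod_list_le1: "(\<And>b. b \<in> set L \<Longrightarrow> 0 \<le> f b \<and> f b \<le> 1) \<Longrightarrow> 0 \<le> (\<Prod>b\<leftarrow>L. f b :: real) \<and> (\<Prod>b\<leftarrow>L. f b) \<le> 1"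
proof (induction L)
  case (Cons b L)
  then have "f b * (\<Prod>b\<leftarrow>L. f b) \<le> 1 * 1" by (intro mult_mono) auto
  then show ?case using Cons by simp
qed simp

lemma jbr_shift_le: "norm h \<le> 1 \<Longrightarrow> jbr (\<xi> + h) \<le> 2 * jbr \<xi>"
proof -
  assume h: "norm h \<le> 1"
  have "norm (\<xi> + h) \<le> norm \<xi> + 1" using norm_triangle_ineq[of \<xi> h] h by linarith
  then have "(norm (\<xi> + h))\<^sup>2 \<le> (norm \<xi> + 1)\<^sup>2" by (rule power_mono) simp
  moreover have "2 * norm \<xi> \<le> 1 + (norm \<xi>)\<^sup>2" using sum_squares_bound[of 1 "norm \<xi>"] by (simp add: power2_eq_square)
  ultimately have "1 + (norm (\<xi> + h))\<^sup>2 \<le> 4 + 4 * (norm \<xi>)\<^sup>2"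
    using zero_le_power2[of "norm \<xi>"] unfolding power2_sum one_power2 mult_1_right by linarith
  then have "1 + (norm (\<xi> + h))\<^sup>2 \<le> (2 * jbr \<xi>)\<^sup>2" by (simp add: jbr_def power_mult_distrib)
  then show ?thesis unfolding jbr_def[of "\<xi> + h"] by (rule real_le_lsqrt[rotated -1]) auto
qed

section \<open>The amplitude as an absolutely convergent integral\<close>

context symbol_setting
begin

text \<open>The derivative conjugated by \<open>exp (\<i> * phc p)\<close>.\<close>
definition Db :: "real^'n \<Rightarrow> ((real^'n) \<times> (real^'n) \<Rightarrow> complex) \<Rightarrow> (real^'n) \<times> (real^'n) \<Rightarrow> complex" where
  "Db b c p = pd (bx b) c p + \<i> * pd (bx b) phc p * c p"

text \<open>The coefficient of the exponential after \<open>k\<close> applications of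
  \<open>lap\<close> in the space variable; see \<open>lap_power_u0\<close>.\<close>

primrec cs :: "nat \<Rightarrow> real \<Rightarrow> (real^'n) \<times> (real^'n) \<Rightarrow> complex" where
  "cs 0 = ac"
| "cs (Suc k) = (\<lambda>t p. cs k t p - (\<Sum>b\<in>Basis. Db b (Db b (cs k t)) p))"

lemma Db_zero: "open U \<Longrightarrow> \<forall>q\<in>U. c q = 0 \<Longrightarrow> \<forall>q\<in>U. Db b c q = 0"
  using pd_cong[of U _ c "\<lambda>_. 0"] by (auto simp: Db_def)

text \<open>The phase is only defined on \<open>Om\<close>; products with an amplitude that vanishes near the complement extend by zero.\<close>
definition lz :: "(real \<Rightarrow> (real^'n) \<times> (real^'n) \<Rightarrow> complex) \<Rightarrow> bool" where
  "lz c \<longleftrightarrow> (\<forall>t\<in>T01. \<forall>p. p \<notin> Om \<longrightarrow> (\<exists>U. open U \<and> p \<in> U \<and> (\<forall>q\<in>U. c t q = 0)))"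

lemma lz_Db: "lz c \<Longrightarrow> lz (\<lambda>t. Db b (c t))"
  unfolding lz_def using Db_zero by meson

lemma Sy_Db:
  assumes c: "Sy T01 UNIV (\<lambda>_. om) (\<lambda>_ p. jb p ^ l) c" and z: "lz c" and b: "b \<in> Basis"
  shows "Sy T01 UNIV (\<lambda>_. om) (\<lambda>_ p. jb p ^ Suc l) (\<lambda>t. Db b (c t))"
proof (rule Sy_ext_zero[OF open_Om])
  have c': "Sy T01 Om (\<lambda>_. om) (\<lambda>_ p. jb p ^ l) c"
    using Sy_reindex[OF c open_Om, where Q = T01 and \<pi> = "\<lambda>t. t"] by simp
  have 1: "Sy T01 Om (\<lambda>_. om) (\<lambda>_ p. jb p ^ Suc l) (\<lambda>t. pd (bx b) (c t))"
  proof (rule Sy_mono[OF Sy_pd[OF c' bx_Basis[OF b]] open_Om, where D = 1 and D' = 1])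
    fix p :: "(real^'n) \<times> (real^'n)"
    have "jb p ^ l * 1 \<le> jb p ^ l * jb p" by (intro mult_left_mono jbr_ge1) simp
    then show "0 \<le> jb p ^ l * om (bx b) p \<and> jb p ^ l * om (bx b) p \<le> 1 * jb p ^ Suc l" by (simp add: om_bx[OF b] mult.commute)
  qed (auto simp: om)
  have 2: "Sy T01 Om (\<lambda>_. om) (\<lambda>_ p. jb p ^ Suc l) (\<lambda>t p. \<i> * pd (bx b) phc p * c t p)"
    using Sy_mult[OF open_Om Sy_cmult[OF open_Om Sy_phc_T[OF b], where c = "\<i>"] c'] by simp
  show "Sy T01 Om (\<lambda>_. om) (\<lambda>_ p. jb p ^ Suc l) (\<lambda>t. Db b (c t))"
    using Sy_add[OF open_Om 1 2] by (simp add: Db_def[abs_def])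
  show "\<exists>U. open U \<and> p \<in> U \<and> (\<forall>q\<in>U. Db b (c t) q = 0)" if "t \<in> T01" "p \<notin> Om" for t p
    using lz_Db[OF z, of b] that unfolding lz_def by blast
qed (auto simp: om)

lemma Sy_cs: "Sy T01 UNIV (\<lambda>_. om) (\<lambda>_ p. jb p ^ (2 * k)) (cs k) \<and> lz (cs k)"
proof (induction k)
  case 0
  have "Sy T01 UNIV (\<lambda>_. om) (\<lambda>_ _. 1) ac"
  proof (rule Sy_mono[OF Sy_ac open_UNIV, where D = 1 and D' = 1])
    fix p :: "(real^'n) \<times> (real^'n)"
    have "jb p powr m \<le> jb p powr 0" by (rule powr_mono[OF m jbr_ge1])
    then show "0 \<le> jb p powr m \<and> jb p powr m \<le> 1 * 1" using jbr_pos[of "snd p"] by simp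
  qed (auto simp: om)
  then show ?case using ac_zero by (auto simp: lz_def)
next
  case (Suc k)
  then have c: "Sy T01 UNIV (\<lambda>_. om) (\<lambda>_ p. jb p ^ (2 * k)) (cs k)" and z: "lz (cs k)" by auto
  have e: "jb p ^ (2 * Suc k) = jb p ^ Suc (Suc (2 * k))" for p by simp
  have "lz (cs (Suc k))" unfolding lz_def
  proof (intro ballI allI impI)
    fix t p assume "t \<in> T01" and "p \<notin> (Om :: ((real^'n) \<times> (real^'n)) set)"
    then obtain U where U: "open U" "p \<in> U" "\<forall>q\<in>U. cs k t q = 0" using z unfolding lz_def by blast
    have "\<forall>q\<in>U. Db b (Db b (cs k t)) q = 0" for b by (intro Db_zero U)
    then show "\<exists>U. open U \<and> p \<in> U \<and> (\<forall>q\<in>U. cs (Suc k) t q = 0)" using U by (intro exI[of _ U]) auto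
  qed
  moreover have "Sy T01 UNIV (\<lambda>_. om) (\<lambda>_ p. jb p ^ (2 * Suc k)) (\<lambda>t p. cs k t p - (\<Sum>b\<in>Basis. Db b (Db b (cs k t)) p))"
  proof (rule Sy_diff[OF open_UNIV])
    show "Sy T01 UNIV (\<lambda>_. om) (\<lambda>_ p. jb p ^ (2 * Suc k)) (cs k)"
    proof (rule Sy_mono[OF c open_UNIV, where D = 1 and D' = 1])
      fix p :: "(real^'n) \<times> (real^'n)"
      have "jb p ^ (2 * k) \<le> jb p ^ (2 * Suc k)" by (rule power_increasing[OF _ jbr_ge1]) simp
      then show "0 \<le> jb p ^ (2 * k) \<and> jb p ^ (2 * k) \<le> 1 * jb p ^ (2 * Suc k)" unfolding mult_1 by (intro conjI) auto
    qed (auto simp: om)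
    show "Sy T01 UNIV (\<lambda>_. om) (\<lambda>_ p. jb p ^ (2 * Suc k)) (\<lambda>t p. \<Sum>b\<in>Basis. Db b (Db b (cs k t)) p)"
      unfolding e by (rule Sy_sum[OF open_UNIV finite_Basis Sy_Db[OF Sy_Db[OF c z] lz_Db[OF z]]]) (auto simp: om)
  qed
  ultimately show ?case by simp
qed

lemma slice_diff: "c differentiable (at (y, \<xi>)) \<Longrightarrow> (\<lambda>y. c (y, \<xi>)) differentiable (at y)"
  using differentiable_chain_at[of "\<lambda>y. (y, \<xi>)" y c]
    differentiableI[OF has_derivative_Pair[OF has_derivative_ident has_derivative_const]]
  by (simp add: o_def)

lemma pd_Db:
  assumes xi: "\<xi> \<in> Xi" and c: "\<And>p. c differentiable (at p)"
  shows "pd b (\<lambda>y. c (y, \<xi>) * exp (\<i> * phc (y, \<xi>))) = (\<lambda>y. Db b c (y, \<xi>) * exp (\<i> * phc (y, \<xi>)))"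
proof
  fix y
  have d: "(\<lambda>y. c (y, \<xi>)) differentiable (at y)" "(\<lambda>y. \<i> * phc (y, \<xi>)) differentiable (at y)"
    using slice_diff[OF c] phc_slice_diff[OF xi] by auto
  show "pd b (\<lambda>y. c (y, \<xi>) * exp (\<i> * phc (y, \<xi>))) y = Db b c (y, \<xi>) * exp (\<i> * phc (y, \<xi>))"
    unfolding pd_mult[OF d(1) pd_exp(1)[OF d(2)]] pd_exp(2)[OF d(2)] pd_cmult[OF phc_slice_diff[OF xi]] pd_slice Db_def
    by (simp add: algebra_simps)
qed

lemma lap_power_u0:
  assumes t: "t \<in> T01" and xi: "\<xi> \<in> Xi"
  shows "(lap ^^ k) (u0 t \<xi>) = (\<lambda>y. cs k t (y, \<xi>) * exp (\<i> * phc (y, \<xi>)))"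
proof (induction k)
  case 0
  show ?case by (simp add: u0_eq fun_eq_iff)
next
  case (Suc k)
  have c: "Sy T01 UNIV (\<lambda>_. om) (\<lambda>_ p. jb p ^ (2 * k)) (cs k)" and z: "lz (cs k)" using Sy_cs by auto
  have d1: "cs k t differentiable (at p)" for p using Sy_diff0[OF c t] by simp
  have d2: "Db b (cs k t) differentiable (at p)" if "b \<in> Basis" for b p using Sy_diff0[OF Sy_Db[OF c z that] t] by simp
  have "pd b (pd b (\<lambda>y. cs k t (y, \<xi>) * exp (\<i> * phc (y, \<xi>)))) = (\<lambda>y. Db b (Db b (cs k t)) (y, \<xi>) * exp (\<i> * phc (y, \<xi>)))"
    if "b \<in> Basis" for b
    unfolding pd_Db[OF xi d1] by (rule pd_Db[OF xi d2[OF that]])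
  then have "lap (\<lambda>y. cs k t (y, \<xi>) * exp (\<i> * phc (y, \<xi>))) = (\<lambda>y. cs (Suc k) t (y, \<xi>) * exp (\<i> * phc (y, \<xi>)))"
    by (simp add: lap_def[abs_def] left_diff_distrib sum_distrib_right)
  then show ?case using Suc by simp
qed

text \<open>The kernel in the limit formula of \<open>osc_limit\<close>, that is, the transform of
  the multiplier divided by the power of \<open>J\<close> that makes it integrable.\<close>

definition kap :: "real \<Rightarrow> real^'n \<Rightarrow> complex" where
  "kap t = FT (\<lambda>\<eta>. \<rho> (t *\<^sub>R \<eta>) / of_real (J \<eta>) ^ CARD('n))"

text \<open>The other factor of that formula after the substitution \<open>y = x + z\<close> and
  multiplication by \<open>cis (- \<phi> x \<xi>)\<close>, so that the phase appears only as an
  increment in space.\<close>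

definition Gf :: "real \<times> (real^'n) \<Rightarrow> (real^'n) \<times> (real^'n) \<Rightarrow> complex" where
  "Gf q p = cs CARD('n) (fst q) (p + bx (snd q)) * exp (\<i> * (phc (p + bx (snd q)) - phc p))"

lemma Sy_rt: "Sy T01 UNIV (\<lambda>_ _ _. 1) (\<lambda>_ \<eta>. 1 / J \<eta> ^ CARD('n)) (\<lambda>t \<eta>. \<rho> (t *\<^sub>R \<eta>) / of_real (J \<eta>) ^ CARD('n))"
proof -
  have "Sy T01 UNIV (\<lambda>t b \<eta>. \<bar>t\<bar> * (1 / sqrt (J (t *\<^sub>R \<eta>)))) (\<lambda>_ _. 1) (\<lambda>t \<eta>. \<rho> (t *\<^sub>R \<eta>))"
    by (rule Sy_pullback[where \<pi> = "\<lambda>_. ()" and A = "\<lambda>t \<eta>. t *\<^sub>R \<eta>" and c = "\<lambda>t. t" and \<tau> = "\<lambda>b. b", OF Sy_rho open_UNIV])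
      (auto simp: algebra_simps)
  then have "Sy T01 UNIV (\<lambda>_ _ _. 1) (\<lambda>_ _. 1) (\<lambda>t \<eta>. \<rho> (t *\<^sub>R \<eta>))"
  proof (rule Sy_mono[OF _ open_UNIV, where D = 1 and D' = 1])
    fix t :: real and \<eta> :: "real^'n" assume t: "t \<in> T01"
    have "1 \<le> sqrt (J (t *\<^sub>R \<eta>))" using J_ge1 by simp
    then have "1 / sqrt (J (t *\<^sub>R \<eta>)) \<le> 1" by (simp add: divide_le_eq)
    then show "0 \<le> \<bar>t\<bar> * (1 / sqrt (J (t *\<^sub>R \<eta>))) \<and> \<bar>t\<bar> * (1 / sqrt (J (t *\<^sub>R \<eta>))) \<le> 1 * 1"
      using t J_pos[of "t *\<^sub>R \<eta>"] by (intro conjI mult_mono mult_nonneg_nonneg) auto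
  qed auto
  from Sy_mult[OF open_UNIV this Sy_J_inverse[where k = "CARD('n)"]] show ?thesis by simp
qed

lemma kap_measurable: "t \<in> T01 \<Longrightarrow> kap t \<in> borel_measurable borel"
  unfolding kap_def by (rule FT_measurable, rule differentiable_imp_measurable(2)) (use Sy_diff0[OF Sy_rt] in auto)

lemma kap_decay: "\<exists>C\<ge>0. \<forall>t\<in>T01. \<forall>z. norm (kap t z) \<le> C / J z ^ j"
  unfolding kap_def by (rule FT_uniform_decay) (use Sy_rt in simp)

text \<open>The explicit limit of \<open>osc_limit\<close> as an integral over the displacement
  \<open>z\<close>; in this form \<sigma> can be differentiated in all variables. Off
  \<open>Om\<close> both sides vanish.\<close>

lemma sg_eq_integral:
  assumes t: "t \<in> T01"
  shows "sg t p = 1 / of_real ((2 * pi) ^ CARD('n)) * (LINT z|lborel. kap t z * Gf (t, z) p)"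
proof (cases "p \<in> Om")
  case False
  have "Gf (t, z) p = 0" for z
  proof -
    have "p + bx z \<notin> Om" using False by (simp add: bx_def)
    then have "cs CARD('n) t (p + bx z) = 0" using Sy_cs t unfolding lz_def by blast
    then show ?thesis by (simp add: Gf_def)
  qed
  then show ?thesis using sg_zero[OF t False] by simp
next
  case True
  obtain x \<xi> where p: "p = (x, \<xi>)" by (cases p)
  have xi: "\<xi> \<in> Xi" using True p by simp
  have tr: "tempered 0 (\<lambda>\<eta>. \<rho> (t *\<^sub>R \<eta>))" using osc_family.tempered_\<rho>t[OF osc_fam, of "(t, \<xi>)"] t xi by simp
  define h where "h = (\<lambda>y. (lap ^^ CARD('n)) (u0 t \<xi>) y * kap t (y - x))"
  have "(osc (u0 t \<xi>) (\<lambda>\<eta>. \<rho> (t *\<^sub>R \<eta>)) x \<longlongrightarrow> (LINT y|lborel. h y)) (at_right 0)"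
    using osc_limit[OF tempered_u0[OF t xi] tr, of x] by (simp add: h_def kap_def)
  then have "sg t p = cis (- \<phi> x \<xi>) * (LINT y|lborel. h y) / of_real ((2 * pi) ^ CARD('n))"
    unfolding p by (rule sg_eq_limit)
  also have "(LINT y|lborel. h y) = (LINT z|lborel. h (x + z))" by (rule integral_lborel_shift(1)[symmetric])
  also have "cis (- \<phi> x \<xi>) * (LINT z|lborel. h (x + z)) = (LINT z|lborel. cis (- \<phi> x \<xi>) * h (x + z))" by simp
  also have "(\<lambda>z. cis (- \<phi> x \<xi>) * h (x + z)) = (\<lambda>z. kap t z * Gf (t, z) p)"
  proof
    fix z
    have "cis (- \<phi> x \<xi>) = exp (- (\<i> * phc p))" by (simp add: cis_conv_exp phc_def p)
    then show "cis (- \<phi> x \<xi>) * h (x + z) = kap t z * Gf (t, z) p"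
      by (simp add: h_def lap_power_u0[OF t xi] Gf_def p bx_def right_diff_distrib exp_diff exp_minus field_simps)
  qed
  finally show ?thesis by simp
qed

lemma PD_phc_diff:
  assumes G: "G \<in> lists Basis" and p: "p \<in> Om" and v: "snd v = 0"
  shows "PD G (\<lambda>p. \<i> * (phc (p + v) - phc p)) p = \<i> * (PD G phc (p + v) - PD G phc p)"
    and "PD G (\<lambda>p. \<i> * (phc (p + v) - phc p)) differentiable (at p)"
proof -
  have pv: "q \<in> Om \<Longrightarrow> q + v \<in> Om" for q using v by simp
  have d: "(\<lambda>p. \<i> * (PD G phc (p + v) - PD G phc p)) differentiable (at q)" if G: "G \<in> lists Basis" and q: "q \<in> Om" for G q
  proof -
    have "(\<lambda>q. PD G phc (q + v)) differentiable (at q)"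
      using differentiable_chain_at[of "\<lambda>q. q + v" q "PD G phc"] phc_PD(1)[OF G pv[OF q]] by (simp add: o_def)
    then show ?thesis using phc_PD(1)[OF G q] by auto
  qed
  have *: "\<forall>p\<in>Om. PD G (\<lambda>p. \<i> * (phc (p + v) - phc p)) p = \<i> * (PD G phc (p + v) - PD G phc p)"
    using G
  proof (induction G rule: list.induct)
    case (Cons b G)
    then have G: "G \<in> lists Basis" and IH: "\<And>p. p \<in> Om \<Longrightarrow> PD G (\<lambda>p. \<i> * (phc (p + v) - phc p)) p = \<i> * (PD G phc (p + v) - PD G phc p)" by auto
    show ?case
    proof
      fix q :: "(real^'n) \<times> (real^'n)" assume q: "q \<in> Om"
      have d1: "(\<lambda>q. PD G phc (q + v)) differentiable (at q)"
        using differentiable_chain_at[of "\<lambda>q. q + v" q "PD G phc"] phc_PD(1)[OF G pv[OF q]] by (simp add: o_def)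
      have d2: "PD G phc differentiable (at q)" by (rule phc_PD(1)[OF G q])
      have s: "pd b (\<lambda>q. PD G phc (q + v)) q = pd b (PD G phc) (q + v)" by (simp add: pd_def add_ac)
      have "pd b (PD G (\<lambda>p. \<i> * (phc (p + v) - phc p))) q = pd b (\<lambda>p. \<i> * PD G phc (p + v) + (- \<i>) * PD G phc p) q"
        by (rule pd_cong[OF open_Om q]) (simp only: IH, simp add: algebra_simps)
      also have "\<dots> = \<i> * pd b (PD G phc) (q + v) + (- \<i>) * pd b (PD G phc) q"
      proof -
        have "pd b (\<lambda>p. \<i> * PD G phc (p + v) + (- \<i>) * PD G phc p) q = pd b (\<lambda>p. \<i> * PD G phc (p + v)) q + pd b (\<lambda>p. (- \<i>) * PD G phc p) q"
          by (rule pd_add) (use d1 d2 in auto)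
        then show ?thesis by (simp only: pd_cmult[OF d1] pd_cmult[OF d2] s)
      qed
      finally show "PD (b # G) (\<lambda>p. \<i> * (phc (p + v) - phc p)) q = \<i> * (PD (b # G) phc (q + v) - PD (b # G) phc q)"
        by (simp add: algebra_simps)
    qed
  qed simp
  then show "PD G (\<lambda>p. \<i> * (phc (p + v) - phc p)) p = \<i> * (PD G phc (p + v) - PD G phc p)" using p by blast
  show "PD G (\<lambda>p. \<i> * (phc (p + v) - phc p)) differentiable (at p)"
    by (rule differentiable_cong_open[OF open_Om p _ d[OF G p]]) (use * in auto)
qed

text \<open>Only mixed derivatives of the phase are controlled, so a pure frequency derivative enters
  through its increment in the space variable.\<close>
lemma phc_increment:
  assumes G: "G \<in> lists Basis"
  shows "\<exists>C\<ge>0. \<forall>z. \<forall>p\<in>Om. norm (PD G phc (p + bx z) - PD G phc p) \<le> C * (J z * jb p)"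
proof -
  have "\<exists>C\<ge>0. \<forall>p\<in>Om. norm (PD (G @ [bx c]) phc p) \<le> C * jb p" if c: "c \<in> Basis" for c
  proof -
    obtain C where C: "C \<ge> 0" "\<forall>p\<in>Om. norm (PD G (pd (bx c) phc) p) \<le> C * (jb p * (\<Prod>b\<leftarrow>G. om b p))"
      using Sy_D(2)[OF Sy_phc[OF c] G] by auto
    have "norm (PD (G @ [bx c]) phc p) \<le> C * jb p" if p: "p \<in> Om" for p
    proof -
      have "C * (jb p * (\<Prod>b\<leftarrow>G. om b p)) \<le> C * (jb p * 1)"
      proof -
        have "(\<Prod>b\<leftarrow>G. om b p) \<le> 1" by (rule conjunct2[OF prod_list_le1]) (use om in blast)
        then show ?thesis using C(1) by (intro mult_left_mono) auto
      qed
      moreover have "norm (PD (G @ [bx c]) phc p) \<le> C * (jb p * (\<Prod>b\<leftarrow>G. om b p))"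
        using bspec[OF C(2) p] by (simp only: PD_append PD.simps)
      ultimately show ?thesis by simp
    qed
    then show ?thesis using C(1) by blast
  qed
  then obtain D where D: "\<And>c. c \<in> Basis \<Longrightarrow> 0 \<le> D c" "\<And>c p. c \<in> Basis \<Longrightarrow> p \<in> Om \<Longrightarrow> norm (PD (G @ [bx c]) phc p) \<le> D c * jb p"
    by metis
  define M where "M = (\<Sum>c\<in>Basis. D c)"
  have M: "D c \<le> M" if "c \<in> Basis" for c unfolding M_def using D(1) that by (intro member_le_sum) auto
  have M0: "0 \<le> M" unfolding M_def using D(1) by (intro sum_nonneg)
  show ?thesis
  proof (intro exI[of _ "real CARD('n) * M"] conjI allI ballI)
    fix z and p :: "(real^'n) \<times> (real^'n)" assume p: "p \<in> Om"
    obtain x \<xi> where pe: "p = (x, \<xi>)" by (cases p)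
    have "norm (PD G phc (x + z, \<xi>) - PD G phc (x, \<xi>)) \<le> real DIM(real^'n) * (M * jbr \<xi>) * norm ((x + z) - x)"
    proof (rule lipschitz_pd[where g = "\<lambda>y. PD G phc (y, \<xi>)"])
      show "(\<lambda>y. PD G phc (y, \<xi>)) differentiable (at y)" for y
        by (rule slice_diff, rule phc_PD(1)[OF G]) (use p pe in simp)
      fix c y :: "real^'n" assume c: "c \<in> Basis"
      have y: "(y, \<xi>) \<in> Om" using p pe by simp
      have "pd c (\<lambda>y. PD G phc (y, \<xi>)) y = PD (bx c # G) phc (y, \<xi>)" by (simp add: pd_slice)
      also have "\<dots> = PD (G @ [bx c]) phc (y, \<xi>)"
        by (rule PD_snoc_commute[OF open_Om _ G bx_Basis[OF c] y]) (rule phc_PD(1))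
      finally have "norm (pd c (\<lambda>y. PD G phc (y, \<xi>)) y) \<le> D c * jbr \<xi>" using D(2)[OF c y] by simp
      also have "\<dots> \<le> M * jbr \<xi>" using M[OF c] by (intro mult_right_mono) auto
      finally show "norm (pd c (\<lambda>y. PD G phc (y, \<xi>)) y) \<le> M * jbr \<xi>" .
    qed
    also have "\<dots> \<le> real DIM(real^'n) * (M * jbr \<xi>) * J z" using M0 norm_le_J[of z] by (intro mult_left_mono) auto
    finally show "norm (PD G phc (p + bx z) - PD G phc p) \<le> real CARD('n) * M * (J z * jb p)"
      by (simp add: pe bx_def mult_ac)
  qed (use M0 in simp)
qed

text \<open>By \<open>phc_increment\<close> the exponential contributes \<open>J z * jb p\<close>
  per derivative. The translated amplitude adds nothing worse, since translation in space leaves the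
  bracket of the frequency unchanged.\<close>

lemma Sy_Gf: "Sy (T01 \<times> UNIV) UNIV (\<lambda>q _ p. J (snd q) * jb p) (\<lambda>q p. J (snd q) ^ 0 * jb p ^ (2 * CARD('n))) Gf"
proof (rule Sy_ext_zero[OF open_Om])
  have Jj: "1 \<le> J z * jb p" for z :: "real^'n" and p using mult_mono[OF J_ge1[of z] jbr_ge1[of "snd p"]] by (simp add: less_imp_le[OF J_pos])
  have "Sy (T01 \<times> UNIV) Om (\<lambda>q b p. \<bar>1\<bar> * om b (p + bx (snd q))) (\<lambda>q p. jb (p + bx (snd q)) ^ (2 * CARD('n)))
     (\<lambda>q p. cs CARD('n) (fst q) (p + bx (snd q)))"
    by (rule Sy_pullback[where \<pi> = fst and A = "\<lambda>q p. p + bx (snd q)" and c = "\<lambda>_. 1" and \<tau> = "\<lambda>b. b" and S = UNIV and w = "\<lambda>_. om",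
         OF conjunct1[OF Sy_cs] open_Om]) auto
  then have 1: "Sy (T01 \<times> UNIV) Om (\<lambda>q _ p. J (snd q) * jb p) (\<lambda>q p. jb p ^ (2 * CARD('n))) (\<lambda>q p. cs CARD('n) (fst q) (p + bx (snd q)))"
  proof (rule Sy_mono[OF _ open_Om, where D = 1 and D' = 1])
    show "0 \<le> \<bar>1\<bar> * om b (p + bx (snd q)) \<and> \<bar>1\<bar> * om b (p + bx (snd q)) \<le> 1 * (J (snd q) * jb p)" for b p and q :: "real \<times> (real^'n)"
      using om[of b "p + bx (snd q)"] Jj[of "snd q" p] by auto
  qed (auto simp: bx_def)
  have 2: "Sy (T01 \<times> UNIV) Om (\<lambda>q _ p. J (snd q) * jb p) (\<lambda>_ _. 1) (\<lambda>q p. exp (\<i> * (phc (p + bx (snd q)) - phc p)))"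
  proof (rule Sy_exp[OF open_Om])
    show "(\<lambda>p. \<i> * (phc (p + bx (snd q)) - phc p)) differentiable (at p)" if "p \<in> Om" for q :: "real \<times> (real^'n)" and p
      using PD_phc_diff(2)[of "[]" p "bx (snd q)"] that by (simp add: bx_def)
    show "Re (\<i> * (phc (p + bx (snd q)) - phc p)) \<le> 0" for q :: "real \<times> (real^'n)" and p by (simp add: phc_def)
    fix b :: "(real^'n) \<times> (real^'n)" assume b: "b \<in> Basis"
    show "Sy (T01 \<times> UNIV) Om (\<lambda>q _ p. J (snd q) * jb p) (\<lambda>q p. J (snd q) * jb p) (\<lambda>q. pd b (\<lambda>p. \<i> * (phc (p + bx (snd q)) - phc p)))"
    proof (rule Sy_I)
      fix L :: "((real^'n) \<times> (real^'n)) list" assume L: "L \<in> lists Basis"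
      have Lb: "L @ [b] \<in> lists Basis" using L b by simp
      have e: "PD L (pd b (\<lambda>p. \<i> * (phc (p + v) - phc p))) = PD (L @ [b]) (\<lambda>p. \<i> * (phc (p + v) - phc p))" for v by (simp add: PD_append)
      show "PD L (pd b (\<lambda>p. \<i> * (phc (p + bx (snd q)) - phc p))) differentiable (at p)" if "p \<in> Om" for q :: "real \<times> (real^'n)" and p
        unfolding e by (rule PD_phc_diff(2)[OF Lb that]) (simp add: bx_def)
      obtain C where C: "C \<ge> 0" "\<And>z p. p \<in> Om \<Longrightarrow> norm (PD (L @ [b]) phc (p + bx z) - PD (L @ [b]) phc p) \<le> C * (J z * jb p)"
        using phc_increment[OF Lb] by blast
      show "\<exists>C\<ge>0. \<forall>q\<in>T01\<times>UNIV. \<forall>p\<in>Om. norm (PD L (pd b (\<lambda>p. \<i> * (phc (p + bx (snd q)) - phc p))) p) \<le> C * (J (snd q) * jb p * (\<Prod>b\<leftarrow>L. J (snd q) * jb p))"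
      proof (intro exI[of _ C] conjI ballI)
        fix q and p :: "(real^'n) \<times> (real^'n)" assume q: "q \<in> T01 \<times> (UNIV :: (real^'n) set)" and p: "p \<in> Om"
        have "norm (PD L (pd b (\<lambda>p. \<i> * (phc (p + bx (snd q)) - phc p))) p) = norm (PD (L @ [b]) phc (p + bx (snd q)) - PD (L @ [b]) phc p)"
          unfolding e PD_phc_diff(1)[OF Lb p, of "bx (snd q)", unfolded bx_def snd_conv, OF refl, folded bx_def] by (simp add: norm_mult)
        also have "\<dots> \<le> C * (J (snd q) * jb p)" by (rule C(2)[OF p])
        also have "\<dots> \<le> C * (J (snd q) * jb p * (\<Prod>b\<leftarrow>L. J (snd q) * jb p))"
        proof (rule mult_left_mono[OF _ C(1)])
          have "J (snd q) * jb p * 1 \<le> J (snd q) * jb p * (\<Prod>b\<leftarrow>L. J (snd q) * jb p)"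
            using Jj[of "snd q" p] by (intro mult_left_mono prod_list_ge1) auto
          then show "J (snd q) * jb p \<le> J (snd q) * jb p * (\<Prod>b\<leftarrow>L. J (snd q) * jb p)" by simp
        qed
        finally show "norm (PD L (pd b (\<lambda>p. \<i> * (phc (p + bx (snd q)) - phc p))) p) \<le> C * (J (snd q) * jb p * (\<Prod>b\<leftarrow>L. J (snd q) * jb p))" .
      qed (rule C(1))
    qed
  qed
  show "Sy (T01 \<times> UNIV) Om (\<lambda>q _ p. J (snd q) * jb p) (\<lambda>q p. J (snd q) ^ 0 * jb p ^ (2 * CARD('n))) Gf"
    using Sy_mult[OF open_Om 1 2] by (simp add: Gf_def[abs_def])
  show "\<exists>U. open U \<and> p \<in> U \<and> (\<forall>y\<in>U. Gf q y = 0)" if q: "q \<in> T01 \<times> UNIV" and p: "p \<notin> Om" for q p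
  proof -
    have "p + bx (snd q) \<notin> Om" using p by (simp add: bx_def)
    then obtain U where U: "open U" "p + bx (snd q) \<in> U" "\<forall>y\<in>U. cs CARD('n) (fst q) y = 0"
      using Sy_cs q unfolding lz_def by (metis mem_Times_iff)
    have "open ((\<lambda>y. y + bx (snd q)) -` U)" by (intro open_vimage U continuous_intros)
    then show ?thesis using U by (intro exI[of _ "(\<lambda>y. y + bx (snd q)) -` U"]) (auto simp: Gf_def)
  qed
qed (auto simp: less_imp_le[OF J_pos])

lemma Gf_measurable: assumes t: "t \<in> T01" shows "(\<lambda>z. Gf (t, z) p) \<in> borel_measurable borel"
proof (cases "p \<in> Om")
  case False
  have "Gf (t, z) p = 0" for z
  proof -
    have "p + bx z \<notin> Om" using False by (simp add: bx_def)
    then have "cs CARD('n) t (p + bx z) = 0" using Sy_cs t unfolding lz_def by blast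
    then show ?thesis by (simp add: Gf_def)
  qed
  then show ?thesis by simp
next
  case True
  have b: "(\<lambda>z. p + bx z) differentiable (at z)" for z :: "real^'n"
    unfolding bx_def by (intro differentiable_add differentiable_const differentiableI[OF has_derivative_Pair[OF has_derivative_ident has_derivative_const]])
  have 1: "(\<lambda>z. cs CARD('n) t (p + bx z)) differentiable (at z)" for z
    using differentiable_chain_at[OF b, where g = "cs CARD('n) t"] Sy_diff0[OF conjunct1[OF Sy_cs] t] by (simp add: o_def)
  have "phc differentiable (at (p + bx z))" for z using phc_PD(1)[of "[]" "p + bx z"] True by (simp add: bx_def)
  then have 2: "(\<lambda>z. phc (p + bx z)) differentiable (at z)" for z
    using differentiable_chain_at[OF b, where g = phc] by (simp add: o_def)
  have "(\<lambda>z. \<i> * (phc (p + bx z) - phc p)) differentiable (at z)" for z using 2 by auto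
  from pd_exp(1)[OF this] 1 have "(\<lambda>z. Gf (t, z) p) differentiable (at z)" for z
    unfolding Gf_def fst_conv snd_conv by (intro differentiable_mult)
  then show ?thesis by (rule differentiable_imp_measurable(2))
qed

text \<open>No gain in \<open>t\<close>, and every derivative, in frequency as well as in space,
  costs a full power of the bracket; the exponent \<open>2 * CARD('n)\<close> stems from
  \<open>lap ^^ CARD('n)\<close> acting on the oscillating factor.\<close>

lemma Sy_sg: "Sy T01 UNIV (\<lambda>_ _ p. jb p) (\<lambda>_ p. jb p ^ (2 * CARD('n))) sg"
proof -
  have "Sy T01 UNIV (\<lambda>_ _ p. jb p) (\<lambda>_ p. jb p ^ (2 * CARD('n))) (\<lambda>t p. LINT z|lborel. kap t z * Gf (t, z) p)"
  proof (rule Sy_integral[OF kap_decay kap_measurable _ _ Sy_Gf Gf_measurable])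
    fix p h :: "(real^'n) \<times> (real^'n)" assume h: "norm h \<le> 1"
    have "norm (snd h) \<le> 1" using norm_snd_le[of "snd h" "fst h"] h by simp
    then show "jb (p + h) \<le> 2 * jb p" unfolding snd_add by (rule jbr_shift_le)
  qed (auto simp: jbr_ge1)
  then have "Sy T01 UNIV (\<lambda>_ _ p. jb p) (\<lambda>_ p. jb p ^ (2 * CARD('n))) (\<lambda>t p. 1 / of_real ((2 * pi) ^ CARD('n)) * (LINT z|lborel. kap t z * Gf (t, z) p))"
    by (rule Sy_cmult[OF open_UNIV])
  then show ?thesis by (rule Sy_cong'[OF _ open_UNIV refl]) (use sg_eq_integral in auto)
qed

end

section \<open>Interpolation\<close>

text \<open>The Landau-Kolmogorov inequality, by comparing the increment of \<open>f\<close> over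
  the step \<open>s\<close> with \<open>s *\<^sub>R pd b f x\<close>. The step is left free so that
  the two terms can be balanced.\<close>

lemma pd_interpolate:
  fixes f :: "'a::real_normed_vector \<Rightarrow> complex"
  assumes d: "\<And>y. f differentiable (at y)" "\<And>y. pd b f differentiable (at y)" and s: "0 < s"
    and A: "norm (f x) \<le> A" "norm (f (x + s *\<^sub>R b)) \<le> A"
    and B: "\<And>r. 0 \<le> r \<Longrightarrow> r \<le> s \<Longrightarrow> norm (pd b (pd b f) (x + r *\<^sub>R b)) \<le> B"
  shows "norm (pd b f x) \<le> 2 * A / s + B * s"
proof -
  have B0: "0 \<le> B" using order_trans[OF norm_ge_zero B[of 0]] s by simp
  have seg: "closed_segment 0 r = {0..r}" if "0 \<le> r" for r :: real using that by (simp add: closed_segment_eq_real_ivl)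
  have 1: "norm (pd b f (x + r *\<^sub>R b) - pd b f x) \<le> B * s" if r: "0 \<le> r" "r \<le> s" for r
  proof -
    have "norm (pd b f (x + r *\<^sub>R b) - pd b f (x + 0 *\<^sub>R b)) \<le> B * \<bar>r\<bar>"
      by (rule line_bound[where f = "\<lambda>r. pd b f (x + r *\<^sub>R b)" and f' = "\<lambda>r. pd b (pd b f) (x + r *\<^sub>R b)", OF pd_line[OF d(2)]])
        (use B r seg in auto)
    also have "\<dots> \<le> B * s" using r B0 by (intro mult_left_mono) auto
    finally show ?thesis by simp
  qed
  have lin: "((\<lambda>r. r *\<^sub>R c) has_vector_derivative c) (at r within T)" for c :: complex and r T
    unfolding has_vector_derivative_def by (rule has_derivative_scaleR_left[OF has_derivative_ident])
  have "norm ((f (x + s *\<^sub>R b) - s *\<^sub>R pd b f x) - (f (x + 0 *\<^sub>R b) - 0 *\<^sub>R pd b f x)) \<le> (B * s) * \<bar>s\<bar>"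
  proof (rule line_bound[where f = "\<lambda>r. f (x + r *\<^sub>R b) - r *\<^sub>R pd b f x" and f' = "\<lambda>r. pd b f (x + r *\<^sub>R b) - pd b f x"])
    show "((\<lambda>r. f (x + r *\<^sub>R b) - r *\<^sub>R pd b f x) has_vector_derivative pd b f (x + r *\<^sub>R b) - pd b f x) (at r within closed_segment 0 s)" for r
      by (rule has_vector_derivative_diff[OF pd_line[OF d(1)] lin])
    show "norm (pd b f (x + r *\<^sub>R b) - pd b f x) \<le> B * s" if "r \<in> closed_segment 0 s" for r
      using 1[of r] that s seg[of s] by auto
  qed
  then have 2: "norm (f (x + s *\<^sub>R b) - s *\<^sub>R pd b f x - f x) \<le> B * s * s" using s by simp
  have "s * norm (pd b f x) = norm (s *\<^sub>R pd b f x)" using s by simp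
  also have "\<dots> = norm (f (x + s *\<^sub>R b) - f x - (f (x + s *\<^sub>R b) - s *\<^sub>R pd b f x - f x))" by simp
  also have "\<dots> \<le> (A + A) + B * s * s"
    by (rule order_trans[OF norm_triangle_ineq4]) (intro add_mono 2 order_trans[OF norm_triangle_ineq4] A)
  finally have "s * norm (pd b f x) \<le> s * (2 * A / s + B * s)" using s by (simp add: distrib_left mult_ac)
  then show ?thesis using s by simp
qed

lemma PD_add:
  assumes "smo f" "smo g" "L \<in> lists Basis"
  shows "PD L (\<lambda>y. f y + g y) = (\<lambda>y. PD L f y + PD L g y)"
  using assms(3)
proof (induction L rule: list.induct)
  case (Cons b L)
  then have "PD L f differentiable (at y)" "PD L g differentiable (at y)" for y using assms(1,2) by (auto simp: smo_def)
  then have "pd b (\<lambda>y. PD L f y + PD L g y) = (\<lambda>y. pd b (PD L f) y + pd b (PD L g) y)" by (simp add: fun_eq_iff pd_add)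
  then show ?case using Cons by simp
qed simp

section \<open>Multi-indices of ordered lists\<close>

definition cnt :: "(real^'n) list \<Rightarrow> 'n \<Rightarrow> nat" where "cnt L i = count_list L (axis i 1)"

lemma mabs_cnt:
  fixes L :: "(real^'n::finite) list"
  assumes "L \<in> lists Basis" shows "mabs (cnt L) = length L"
proof -
  have inj: "inj (\<lambda>i. axis i (1::real) :: real^'n)" by (auto simp: inj_on_def axis_eq_axis)
  have "mabs (cnt L) = sum (count_list L) (range (\<lambda>i. axis i 1))" by (simp add: mabs_def cnt_def sum.reindex[OF inj])
  also have "\<dots> = length L"
    by (rule sum_count_set) (use assms in \<open>auto simp: Basis_vec_axis[symmetric] in_lists_conv_set\<close>)
  finally show ?thesis .
qed

lemma finite_mabs: "finite {\<alpha> :: 'n::finite \<Rightarrow> nat. mabs \<alpha> < M}"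
proof (rule finite_subset)
  show "{\<alpha> :: 'n \<Rightarrow> nat. mabs \<alpha> < M} \<subseteq> PiE UNIV (\<lambda>_. {..<M})"
  proof
    fix \<alpha> :: "'n \<Rightarrow> nat" assume a: "\<alpha> \<in> {\<alpha>. mabs \<alpha> < M}"
    have "\<alpha> i \<le> mabs \<alpha>" for i unfolding mabs_def by (rule member_le_sum) auto
    then show "\<alpha> \<in> PiE UNIV (\<lambda>_. {..<M})" using a by (auto intro: le_less_trans)
  qed
qed (intro finite_PiE; simp)

context symbol_setting
begin

definition RN :: "nat \<Rightarrow> real \<Rightarrow> (real^'n) \<times> (real^'n) \<Rightarrow> complex" where
  "RN N t p = sg t p - (\<Sum>k<N. TN k t p)"

lemma mup_le1: "t \<in> T01 \<Longrightarrow> mup t p \<le> 1"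
proof -
  assume t: "t \<in> T01"
  have "sqrt (jb p) * 1 \<le> sqrt (jb p) * sqrt (jb p)" using sqrt_jb(1)[of p] by (intro mult_left_mono) auto
  then have "t * sqrt (jb p) \<le> t * jb p" using t by (intro mult_left_mono) auto
  moreover have "0 < 1 + t * jb p" using t by (intro add_pos_nonneg) auto
  ultimately show "mup t p \<le> 1" unfolding mup_def by (simp add: pos_divide_le_eq)
qed

lemma Sy_TN: "Sy T01 UNIV (\<lambda>_. om) (\<lambda>t p. mup t p ^ k * jb p powr m) (TN k)"
proof -
  have "Sy T01 UNIV (\<lambda>_. om) (\<lambda>t p. mup t p ^ k * jb p powr m) (\<lambda>t p. \<Sum>L | L \<in> lists Basis \<and> length L = k. XL L t p)"
    by (rule Sy_sum[OF open_UNIV finite_lists_Basis]) (use Sy_XL mup_nonneg in \<open>auto simp: om\<close>)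
  from Sy_cmult[OF open_UNIV this, of "1 / fact k"] show ?thesis by (simp add: TN_def[abs_def])
qed

text \<open>The exponent of \<open>jb p\<close> does not depend on \<open>N\<close>, so the order
  may be raised later without worsening the growth in frequency.\<close>

lemma Sy_RN_crude: "Sy T01 UNIV (\<lambda>_ _ p. jb p) (\<lambda>_ p. jb p ^ (2 * CARD('n))) (RN N)"
proof -
  have om_le: "om b p \<le> jb p" for b p using om(2)[of b p] jbr_ge1[of "snd p"] by linarith
  have "Sy T01 UNIV (\<lambda>_ _ p. jb p) (\<lambda>_ p. jb p ^ (2 * CARD('n))) (TN k)" for k
  proof (rule Sy_mono[OF Sy_TN open_UNIV, where D = 1 and D' = 1])
    fix t p assume t: "t \<in> T01"
    have "mup t p ^ k * jb p powr m \<le> 1 * jb p powr 0"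
      using mup_nonneg[OF t] mup_le1[OF t] m jbr_ge1 by (intro mult_mono power_le_one powr_mono) auto
    also have "\<dots> \<le> 1 * jb p ^ (2 * CARD('n))"
      using jbr_pos[of "snd p"] one_le_power[OF jbr_ge1[of "snd p"], of "2 * CARD('n)"] by simp
    finally show "0 \<le> mup t p ^ k * jb p powr m \<and> mup t p ^ k * jb p powr m \<le> 1 * jb p ^ (2 * CARD('n))"
      using mup_nonneg[OF t] by simp
  qed (auto simp: om om_le)
  then have "Sy T01 UNIV (\<lambda>_ _ p. jb p) (\<lambda>_ p. jb p ^ (2 * CARD('n))) (\<lambda>t p. \<Sum>k<N. TN k t p)"
    by (rule Sy_sum[OF open_UNIV finite_lessThan]) auto
  then show ?thesis unfolding RN_def[abs_def] by (rule Sy_diff[OF open_UNIV Sy_sg])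
qed

lemma Sy_imp_dd:
  assumes F: "Sy T01 UNIV (\<lambda>_. om) (\<lambda>t p. c t * jb p powr q) F"
  shows "\<forall>t\<in>T01. smooth_on UNIV (\<lambda>x \<xi>. F t (x, \<xi>))"
    and "\<exists>C. \<forall>t\<in>T01. \<forall>x \<xi>. norm (dd G B (\<lambda>x \<xi>. F t (x, \<xi>)) x \<xi>) \<le> C * c t * jbr \<xi> powr (q - real (length G))"
proof -
  show "\<forall>t\<in>T01. smooth_on UNIV (\<lambda>x \<xi>. F t (x, \<xi>))"
    by (intro ballI PD_differentiable_imp_smooth_on) (use Sy_D(1)[OF F] in auto)
  let ?L = "map Inr G @ map Inl B"
  have "map edir ?L \<in> lists Basis" using lists_Basis_edir by blast
  from Sy_D(2)[OF F this] obtain C where C: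
    "\<And>t p. t \<in> T01 \<Longrightarrow> norm (PD (map edir ?L) (F t) p) \<le> C * (c t * jb p powr q * (\<Prod>b\<leftarrow>map edir ?L. om b p))" by blast
  show "\<exists>C. \<forall>t\<in>T01. \<forall>x \<xi>. norm (dd G B (\<lambda>x \<xi>. F t (x, \<xi>)) x \<xi>) \<le> C * c t * jbr \<xi> powr (q - real (length G))"
  proof (intro exI[of _ C] ballI allI)
    fix t and x \<xi> :: "real^'n" assume t: "t \<in> T01"
    have "dd G B (\<lambda>x \<xi>. F t (x, \<xi>)) x \<xi> = PD (map edir ?L) (F t) (x, \<xi>)"
      unfolding dd_def Dl_eq_PD by simp
    then show "norm (dd G B (\<lambda>x \<xi>. F t (x, \<xi>)) x \<xi>) \<le> C * c t * jbr \<xi> powr (q - real (length G))"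
      using C[OF t, of "(x, \<xi>)"] jbr_pos[of \<xi>] unfolding prod_om_sort[OF refl]
      by (simp add: powr_diff powr_realpow power_divide mult.assoc)
  qed
qed

section \<open>Remainder estimates in powers of t and of the bracket\<close>

context
  fixes \<epsilon> :: real assumes eps: "0 < \<epsilon>" "\<epsilon> < 1/2"
begin

definition nu :: "real \<Rightarrow> (real^'n) \<times> (real^'n) \<Rightarrow> real" where
  "nu t p = t powr \<epsilon> * jb p powr (- (1/2 - \<epsilon>))"

lemma nu_pos: "t \<in> T01 \<Longrightarrow> 0 < nu t p" using jbr_pos[of "snd p"] by (simp add: nu_def)

lemma nu_le: "t \<in> T01 \<Longrightarrow> nu t p \<le> jb p powr (- (1/2 - \<epsilon>))" "t \<in> T01 \<Longrightarrow> nu t p \<le> 1"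
proof -
  assume t: "t \<in> T01"
  have "t powr \<epsilon> \<le> 1" using t eps by (simp add: powr_le1)
  then have "t powr \<epsilon> * jb p powr (- (1/2 - \<epsilon>)) \<le> 1 * jb p powr (- (1/2 - \<epsilon>))" by (rule mult_right_mono) simp
  then show 1: "nu t p \<le> jb p powr (- (1/2 - \<epsilon>))" by (simp add: nu_def)
  have "jb p powr (- (1/2 - \<epsilon>)) \<le> jb p powr 0" using eps by (intro powr_mono jbr_ge1) auto
  then show "nu t p \<le> 1" using 1 jbr_pos[of "snd p"] by simp
qed

text \<open>With \<open>X = t * jb p\<close>, the quotient of \<open>mup t p\<close> by
  \<open>nu t p\<close> is \<open>X powr (1 - \<epsilon>) / (1 + X)\<close>, which is at most 1 as
  the exponent lies between 0 and 1.\<close>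

lemma mup_le_nu: "t \<in> T01 \<Longrightarrow> mup t p \<le> nu t p"
proof -
  assume t: "t \<in> T01"
  define X where "X = t * jb p"
  have X: "0 < X" using t jbr_pos[of "snd p"] by (simp add: X_def)
  have "X powr (1 - \<epsilon>) \<le> 1 + X"
  proof (cases "X \<le> 1")
    case True
    then have "X powr (1 - \<epsilon>) \<le> 1" using X eps by (intro powr_le1) auto
    then show ?thesis using X by linarith
  next
    case False
    then have "X powr (1 - \<epsilon>) \<le> X powr 1" using eps by (intro powr_mono) auto
    then show ?thesis using X by simp
  qed
  then have *: "X powr (1 - \<epsilon>) * nu t p \<le> (1 + X) * nu t p" using nu_pos[OF t, of p] by (intro mult_right_mono) auto
  have "X powr (1 - \<epsilon>) * nu t p = (t powr (1 - \<epsilon>) * t powr \<epsilon>) * (jb p powr (1 - \<epsilon>) * jb p powr (- (1/2 - \<epsilon>)))"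
    unfolding X_def nu_def using t jbr_pos[of "snd p"] by (simp add: powr_mult)
  also have "\<dots> = t * sqrt (jb p)"
    using t jbr_pos[of "snd p"] by (simp add: powr_half_sqrt flip: powr_add)
  finally have "t * sqrt (jb p) \<le> (1 + X) * nu t p" using * by simp
  then show "mup t p \<le> nu t p" unfolding mup_def X_def[symmetric] using X by (simp add: pos_divide_le_eq mult.commute)
qed

lemma jb_shift: 
  assumes h: "norm (h :: (real^'n) \<times> (real^'n)) \<le> 1" shows "jb (p + h) \<le> 2 * jb p"
proof -
  have "norm (snd h) \<le> 1" using norm_snd_le[of "snd h" "fst h"] h by simp
  then show ?thesis unfolding snd_add by (rule jbr_shift_le)
qed

text \<open>Interpolation uses the bounds at a neighbouring point, so \<open>nu\<close> must vary
  slowly; the factor is \<open>2 powr (1/2 - \<epsilon>)\<close>, rounded up to 2.\<close>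

lemma nu_shift:
  assumes t: "t \<in> T01" and h: "norm (h :: (real^'n) \<times> (real^'n)) \<le> 1" shows "nu t (p + h) \<le> 2 * nu t p"
proof -
  have l: "jb p \<le> 2 * jb (p + h)" using jb_shift[of "- h" "p + h"] h by simp
  have "jb (p + h) powr (- (1/2 - \<epsilon>)) \<le> (jb p / 2) powr (- (1/2 - \<epsilon>))"
    by (rule powr_mono2') (use l eps jbr_pos[of "snd p"] in auto)
  also have "(jb p / 2) powr (- (1/2 - \<epsilon>)) = 2 powr (1/2 - \<epsilon>) * jb p powr (- (1/2 - \<epsilon>))"
  proof -
    have "(jb p / 2) powr (- d) = 2 powr d * jb p powr (- d)" for d
      using jbr_pos[of "snd p"] by (simp add: powr_divide powr_minus field_simps)
    then show ?thesis .
  qed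
  also have "\<dots> \<le> 2 powr 1 * jb p powr (- (1/2 - \<epsilon>))" using eps by (intro mult_right_mono powr_mono) auto
  finally have "t powr \<epsilon> * jb (p + h) powr (- (1/2 - \<epsilon>)) \<le> t powr \<epsilon> * (2 * jb p powr (- (1/2 - \<epsilon>)))"
    by (intro mult_left_mono) auto
  then show ?thesis by (simp add: nu_def)
qed

text \<open>Each derivative costs half of the exponent of \<^term>\<open>nu\<close>: the interpolation step balances the
  bound on the function against the crude bound on its second derivative.\<close>
lemma RN_interpolation:
  assumes "L \<in> lists Basis" "length L \<le> n"
  shows "\<exists>C\<ge>0. \<forall>t\<in>T01. \<forall>p. norm (PD L (RN (2 ^ n * j) t) p) \<le> C * (nu t p ^ (2 ^ (n - length L) * j) * jb p ^ (2 * CARD('n) + n + 1))"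
  using assms
proof (induction L rule: list.induct)
  case Nil
  obtain C where C: "C \<ge> 0" "\<And>t p. t \<in> T01 \<Longrightarrow> norm (RN (2 ^ n * j) t p) \<le> C * mup t p ^ (2 ^ n * j)"
    using sg_expansion[of "2 ^ n * j"] unfolding RN_def by blast
  show ?case
  proof (intro exI[of _ C] conjI ballI allI)
    fix t p assume t: "t \<in> T01"
    have "mup t p ^ (2 ^ n * j) * 1 \<le> nu t p ^ (2 ^ n * j) * jb p ^ (2 * CARD('n) + n + 1)"
      using mup_nonneg[OF t] mup_le_nu[OF t] jbr_ge1 nu_pos[OF t, of p] by (intro mult_mono power_mono one_le_power) auto
    then have "C * mup t p ^ (2 ^ n * j) \<le> C * (nu t p ^ (2 ^ n * j) * jb p ^ (2 * CARD('n) + n + 1))"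
      using C(1) by (intro mult_left_mono) auto
    then show "norm (PD [] (RN (2 ^ n * j) t) p) \<le> C * (nu t p ^ (2 ^ (n - length []) * j) * jb p ^ (2 * CARD('n) + n + 1))"
      using C(2)[OF t, of p] by simp
  qed (rule C(1))
next
  case (Cons b L)
  \<comment> \<open>The crude bound is applied to \<open>b # b # L\<close>, a list of length at most
    \<open>n + 1\<close>.\<close>
  define K where "K = 2 * CARD('n) + n + 1"
  define q where "q = 2 ^ (n - length (b # L)) * j"
  let ?f = "\<lambda>t. PD L (RN (2 ^ n * j) t)"
  have b: "b \<in> Basis" and L: "L \<in> lists Basis" using Cons.prems by auto
  have "n - length L = Suc (n - length (b # L))" using Cons.prems by simp
  then have q2: "2 ^ (n - length L) * j = q + q" by (simp add: q_def)
  obtain C where C: "C \<ge> 0" "\<And>t p. t \<in> T01 \<Longrightarrow> norm (?f t p) \<le> C * (nu t p ^ (q + q) * jb p ^ K)"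
    using Cons.IH L Cons.prems(2) unfolding q2 K_def by auto
  obtain D where D: "D \<ge> 0" "\<And>t p. t \<in> T01 \<Longrightarrow> norm (pd b (pd b (?f t)) p) \<le> D * jb p ^ K"
  proof -
    have bb: "b # b # L \<in> lists Basis" using b L by simp
    obtain D where D: "D \<ge> 0" "\<And>t p. t \<in> T01 \<Longrightarrow> norm (PD (b # b # L) (RN (2 ^ n * j) t) p) \<le> D * (jb p ^ (2 * CARD('n)) * (\<Prod>c\<leftarrow>b # b # L. jb p))"
      using Sy_D(2)[OF Sy_RN_crude bb] by blast
    have "D * (jb p ^ (2 * CARD('n)) * (\<Prod>c\<leftarrow>b # b # L. jb p)) \<le> D * jb p ^ K" for p
    proof (rule mult_left_mono[OF _ D(1)])
      have "jb p ^ (2 * CARD('n)) * (\<Prod>c\<leftarrow>b # b # L. jb p) = jb p ^ (2 * CARD('n) + length (b # b # L))"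
        by (simp only: map_replicate_const prod_list_replicate power_add)
      also have "\<dots> \<le> jb p ^ K" unfolding K_def using Cons.prems(2) by (intro power_increasing jbr_ge1) simp
      finally show "jb p ^ (2 * CARD('n)) * (\<Prod>c\<leftarrow>b # b # L. jb p) \<le> jb p ^ K" .
    qed
    then have "norm (pd b (pd b (?f t)) p) \<le> D * jb p ^ K" if "t \<in> T01" for t p
      using order_trans[OF D(2)[OF that, of p]] by simp
    then show ?thesis using D(1) that by blast
  qed
  show ?case
  proof (intro exI[of _ "2 * (C * (2 ^ (q + q) * 2 ^ K)) + D * 2 ^ K"] conjI ballI allI)
    fix t p assume t: "t \<in> T01"
    \<comment> \<open>With this step, \<open>nu t p ^ (q + q) / s\<close> and \<open>s\<close>
      coincide, which balances the two terms of \<open>pd_interpolate\<close>;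
      \<open>nu t p \<le> 1\<close> keeps the step within the unit distance on which the weights are
      comparable.\<close>
    define s where "s = nu t p ^ q"
    have s: "0 < s" "s \<le> 1" using nu_pos[OF t, of p] nu_le(2)[OF t, of p] by (auto simp: s_def power_le_one)
    have jK: "jb (p + h) ^ K \<le> (2 * jb p) ^ K" if "norm h \<le> 1" for h
      by (rule power_mono[OF jb_shift[OF that]]) simp
    have A: "norm (?f t (p + h)) \<le> C * ((2 * nu t p) ^ (q + q) * (2 * jb p) ^ K)" if h: "norm h \<le> 1" for h
    proof (rule order_trans[OF C(2)[OF t]], rule mult_left_mono[OF _ C(1)])
      show "nu t (p + h) ^ (q + q) * jb (p + h) ^ K \<le> (2 * nu t p) ^ (q + q) * (2 * jb p) ^ K"
        by (intro mult_mono power_mono nu_shift[OF t h] jK[OF h]) (use nu_pos[OF t] in \<open>auto simp: less_imp_le\<close>)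
    qed
    have hb: "norm (r *\<^sub>R b) \<le> 1" if "0 \<le> r" "r \<le> s" for r using that s b by simp
    have "norm (pd b (?f t) p) \<le> 2 * (C * ((2 * nu t p) ^ (q + q) * (2 * jb p) ^ K)) / s + (D * (2 * jb p) ^ K) * s"
    proof (rule pd_interpolate[OF _ _ s(1)])
      show "?f t differentiable (at y)" for y using Sy_D(1)[OF Sy_RN_crude L t] by simp
      show "pd b (?f t) differentiable (at y)" for y using Sy_D(1)[OF Sy_RN_crude, of "b # L"] b L t by simp
      show "norm (?f t p) \<le> C * ((2 * nu t p) ^ (q + q) * (2 * jb p) ^ K)" using A[of 0] by simp
      show "norm (?f t (p + s *\<^sub>R b)) \<le> C * ((2 * nu t p) ^ (q + q) * (2 * jb p) ^ K)" by (rule A[OF hb]) (use s in auto)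
      fix r assume r: "0 \<le> r" "r \<le> s"
      show "norm (pd b (pd b (?f t)) (p + r *\<^sub>R b)) \<le> D * (2 * jb p) ^ K"
        by (rule order_trans[OF D(2)[OF t] mult_left_mono[OF jK[OF hb[OF r]] D(1)]])
    qed
    also have "(2 * nu t p) ^ (q + q) = 2 ^ (q + q) * (s * s)" by (simp add: s_def power_mult_distrib power_add)
    also have "2 * (C * (2 ^ (q + q) * (s * s) * (2 * jb p) ^ K)) / s + (D * (2 * jb p) ^ K) * s
       = (2 * (C * (2 ^ (q + q) * 2 ^ K)) + D * 2 ^ K) * (s * jb p ^ K)"
      using s(1) by (simp add: power_mult_distrib field_simps)
    finally show "norm (PD (b # L) (RN (2 ^ n * j) t) p) \<le> (2 * (C * (2 ^ (q + q) * 2 ^ K)) + D * 2 ^ K) *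
        (nu t p ^ (2 ^ (n - length (b # L)) * j) * jb p ^ (2 * CARD('n) + n + 1))"
      by (simp add: s_def q_def K_def)
  qed (use C(1) D(1) in simp)
qed

text \<open>The order of the auxiliary remainder depends on the derivative \<open>L\<close>, because
  every derivative halves the exponent of \<open>nu\<close>; no single large order serves all
  derivatives.\<close>

lemma Sy_RN: "Sy T01 UNIV (\<lambda>_. om) (\<lambda>t p. nu t p ^ M * jb p powr m) (RN M)"
proof (rule Sy_I)
  fix L :: "((real^'n) \<times> (real^'n)) list" assume L: "L \<in> lists Basis"
  show "PD L (RN M t) differentiable (at p)" if "t \<in> T01" for t p using Sy_D(1)[OF Sy_RN_crude L that] by simp
  define n where "n = length L"
  define K where "K = 2 * CARD('n) + n + 1"
  \<comment> \<open>\<open>i\<close> factors \<open>nu\<close> have to supply the decay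
    \<open>jb p powr (m - real n - real K)\<close>: the order \<open>m\<close>, up to
    \<open>n\<close> frequency derivatives, and the crude loss \<open>K\<close>. The quotient makes
    sense because \<epsilon> < 1/2.\<close>
  obtain i :: nat where i: "(real K + real n - m) / (1/2 - \<epsilon>) \<le> real i" using real_arch_simple by blast
  define j where "j = M + i"
  have i': "real K + real n - m \<le> (1/2 - \<epsilon>) * real i" using i eps by (simp add: pos_divide_le_eq mult.commute)
  obtain C where C: "C \<ge> 0" "\<And>t p. t \<in> T01 \<Longrightarrow> norm (PD L (RN (2 ^ n * j) t) p) \<le> C * (nu t p ^ j * jb p ^ K)"
    using RN_interpolation[OF L, of n j] by (auto simp: n_def K_def)
  define S where "S = (\<lambda>t p. \<Sum>k\<in>{M..<2 ^ n * j}. TN k t p)"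
  have SyS: "Sy T01 UNIV (\<lambda>_. om) (\<lambda>t p. nu t p ^ M * jb p powr m) S"
    unfolding S_def
  proof (rule Sy_sum[OF open_UNIV])
    fix k assume k: "k \<in> {M..<2 ^ n * j}"
    show "Sy T01 UNIV (\<lambda>_. om) (\<lambda>t p. nu t p ^ M * jb p powr m) (TN k)"
    proof (rule Sy_mono[OF Sy_TN open_UNIV, where D = 1 and D' = 1])
      fix t p assume t: "t \<in> T01"
      have "mup t p ^ k \<le> nu t p ^ k" using mup_nonneg[OF t] mup_le_nu[OF t] by (intro power_mono)
      also have "\<dots> \<le> nu t p ^ M" using k nu_pos[OF t, of p] nu_le(2)[OF t, of p] by (intro power_decreasing) auto
      finally show "0 \<le> mup t p ^ k * jb p powr m \<and> mup t p ^ k * jb p powr m \<le> 1 * (nu t p ^ M * jb p powr m)"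
        using mup_nonneg[OF t, of p] by (simp add: mult_right_mono)
    qed (auto simp: om)
  qed (use nu_pos in \<open>auto simp: om less_imp_le\<close>)
  obtain D where D: "D \<ge> 0" "\<And>t p. t \<in> T01 \<Longrightarrow> norm (PD L (S t) p) \<le> D * (nu t p ^ M * jb p powr m * (\<Prod>b\<leftarrow>L. om b p))"
    using Sy_D(2)[OF SyS L] by blast
  have MN: "M \<le> 2 ^ n * j" unfolding j_def by (rule order_trans[of _ "1 * (M + i)"]) (auto intro!: mult_right_mono)
  have "(\<Sum>k<2 ^ n * j. TN k t p) = (\<Sum>k<M. TN k t p) + (\<Sum>k\<in>{M..<2 ^ n * j}. TN k t p)" for t p
    using sum.atLeastLessThan_concat[of 0 M "2 ^ n * j" "\<lambda>k. TN k t p"] MN by (simp add: atLeast0LessThan)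
  then have RNM: "RN M t = (\<lambda>p. RN (2 ^ n * j) t p + S t p)" for t by (simp add: RN_def S_def fun_eq_iff)
  have om_ge: "(1 / jb p) ^ n \<le> (\<Prod>b\<leftarrow>L. om b p)" for p
  proof -
    have "1 / jb p \<le> 1" using jbr_ge1[of "snd p"] by (simp add: divide_le_eq)
    then have "1 / jb p \<le> om b p" for b by (simp add: om_def)
    then have "(1 / jb p) ^ length L \<le> (\<Prod>b\<leftarrow>L. om b p)" for L
    proof (induction L)
      case (Cons b L)
      have "(1 / jb p) * (1 / jb p) ^ length L \<le> om b p * (\<Prod>b\<leftarrow>L. om b p)"
        by (intro mult_mono Cons) (auto simp: om)
      then show ?case by simp
    qed simp
    then show ?thesis unfolding n_def .
  qed
  show "\<exists>C\<ge>0. \<forall>t\<in>T01. \<forall>p\<in>UNIV. norm (PD L (RN M t) p) \<le> C * (nu t p ^ M * jb p powr m * (\<Prod>b\<leftarrow>L. om b p))"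
  proof (intro exI[of _ "C + D"] conjI ballI)
    fix t p assume t: "t \<in> T01"
    have "nu t p ^ j * jb p ^ K \<le> nu t p ^ M * jb p powr m * (\<Prod>b\<leftarrow>L. om b p)"
    proof -
      have "nu t p ^ i \<le> (jb p powr (- (1/2 - \<epsilon>))) ^ i" using nu_pos[OF t, of p] nu_le(1)[OF t] by (intro power_mono) auto
      also have "\<dots> = jb p powr (- ((1/2 - \<epsilon>) * real i))" using jbr_pos[of "snd p"] by (simp add: powr_power algebra_simps)
      also have "\<dots> \<le> jb p powr (m - real n - real K)" using i' by (intro powr_mono jbr_ge1) auto
      finally have "nu t p ^ i * jb p ^ K \<le> jb p powr (m - real n - real K) * jb p ^ K" by (rule mult_right_mono) simp
      also have "\<dots> = jb p powr m * (1 / jb p) ^ n"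
        using jbr_pos[of "snd p"] by (simp add: powr_diff powr_realpow power_divide)
      also have "\<dots> \<le> jb p powr m * (\<Prod>b\<leftarrow>L. om b p)" using om_ge by (intro mult_left_mono) auto
      finally have "nu t p ^ M * (nu t p ^ i * jb p ^ K) \<le> nu t p ^ M * (jb p powr m * (\<Prod>b\<leftarrow>L. om b p))"
        using nu_pos[OF t, of p] by (intro mult_left_mono) auto
      then show ?thesis by (simp add: j_def power_add mult.assoc)
    qed
    then have 1: "norm (PD L (RN (2 ^ n * j) t) p) \<le> C * (nu t p ^ M * jb p powr m * (\<Prod>b\<leftarrow>L. om b p))"
      using order_trans[OF C(2)[OF t] mult_left_mono[OF _ C(1)]] by blast
    have "PD L (RN M t) p = PD L (RN (2 ^ n * j) t) p + PD L (S t) p"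
      unfolding RNM by (subst PD_add[OF Sy_smo[OF Sy_RN_crude t] Sy_smo[OF SyS t] L]) simp
    then have "norm (PD L (RN M t) p) \<le> norm (PD L (RN (2 ^ n * j) t) p) + norm (PD L (S t) p)" by (simp add: norm_triangle_ineq)
    also have "\<dots> \<le> (C + D) * (nu t p ^ M * jb p powr m * (\<Prod>b\<leftarrow>L. om b p))"
      unfolding distrib_right by (rule add_mono[OF 1 D(2)[OF t]])
    finally show "norm (PD L (RN M t) p) \<le> (C + D) * (nu t p ^ M * jb p powr m * (\<Prod>b\<leftarrow>L. om b p))" .
  qed (use C(1) D(1) in simp)
qed

section \<open>The symbols of the expansion\<close>

lemma nu_power:
  assumes t: "t \<in> T01"
  shows "nu t p ^ k * jb p powr m = t powr (real k * \<epsilon>) * jb p powr (m - real k * (1/2 - \<epsilon>))"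
proof -
  have "nu t p ^ k = t powr (real k * \<epsilon>) * jb p powr (- (real k * (1/2 - \<epsilon>)))"
    unfolding nu_def using t jbr_pos[of "snd p"] by (simp add: power_mult_distrib powr_power algebra_simps)
  then show ?thesis by (simp add: mult.assoc flip: powr_add)
qed

definition rem_symbol :: "nat \<Rightarrow> real \<Rightarrow> (real^'n) \<times> (real^'n) \<Rightarrow> complex" where
  "rem_symbol M t p = of_real (t powr - (real M * \<epsilon>)) * RN M t p"

lemma Sy_rem_symbol: "Sy T01 UNIV (\<lambda>_. om) (\<lambda>_ p. 1 * jb p powr (m - real M * (1/2 - \<epsilon>))) (rem_symbol M)"
  unfolding rem_symbol_def[abs_def]
proof (rule Sy_cong'[OF Sy_scale[OF open_UNIV Sy_RN] open_UNIV])
  fix t p assume "t \<in> T01"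
  then show "nu t p ^ M * jb p powr m * norm (complex_of_real (t powr - (real M * \<epsilon>))) = 1 * jb p powr (m - real M * (1/2 - \<epsilon>))"
    unfolding norm_of_real by (simp add: nu_power powr_minus)
qed simp

text \<open>A multi-index \<open>\<alpha>\<close> corresponds to \<open>fact (mabs \<alpha>) / mfact \<alpha>\<close> ordered lists.\<close>
definition term_symbol :: "('n \<Rightarrow> nat) \<Rightarrow> real \<Rightarrow> (real^'n) \<times> (real^'n) \<Rightarrow> complex" where
  "term_symbol \<alpha> t p = (\<Sum>L | (L \<in> lists Basis \<and> length L = mabs \<alpha>) \<and> cnt L = \<alpha>.
     of_real (real (mfact \<alpha>) / (t ^ mabs \<alpha> * fact (mabs \<alpha>))) * XL L t p)"

text \<open>The division by \<open>t ^ mabs \<alpha>\<close> in the definition turns the gain with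
  exponent \<open>real (mabs \<alpha>) * \<epsilon>\<close> in \<open>t\<close> into the exponent
  \<open>real (mabs \<alpha>) * (\<epsilon> - 1)\<close>.\<close>

lemma Sy_term_symbol:
  "Sy T01 UNIV (\<lambda>_. om) (\<lambda>t p. t powr (real (mabs \<alpha>) * (\<epsilon> - 1)) * jb p powr (m - real (mabs \<alpha>) * (1/2 - \<epsilon>))) (term_symbol \<alpha>)"
  unfolding term_symbol_def[abs_def]
proof (rule Sy_sum[OF open_UNIV])
  let ?k = "mabs \<alpha>" and ?c = "real (mfact \<alpha>) / fact (mabs \<alpha>)"
  show "finite {L. (L \<in> lists (Basis :: (real^'n) set) \<and> length L = mabs \<alpha>) \<and> cnt L = \<alpha>}"
    by (rule finite_subset[OF _ finite_lists_Basis[of "mabs \<alpha>"]]) auto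
  fix L assume "L \<in> {L. (L \<in> lists (Basis :: (real^'n) set) \<and> length L = mabs \<alpha>) \<and> cnt L = \<alpha>}"
  then have L: "L \<in> lists Basis" "length L = ?k" by auto
  show "Sy T01 UNIV (\<lambda>_. om) (\<lambda>t p. t powr (real ?k * (\<epsilon> - 1)) * jb p powr (m - real ?k * (1/2 - \<epsilon>)))
     (\<lambda>t p. of_real (real (mfact \<alpha>) / (t ^ ?k * fact ?k)) * XL L t p)"
  proof (rule Sy_mono[OF Sy_scale[OF open_UNIV Sy_XL[OF L(1)]] open_UNIV, where D = ?c and D' = 1])
    fix t p assume t: "t \<in> T01"
    have "mup t p ^ ?k * jb p powr m \<le> nu t p ^ ?k * jb p powr m"
      using mup_nonneg[OF t] mup_le_nu[OF t] by (intro mult_right_mono power_mono) auto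
    also have "\<dots> = t powr (real ?k * \<epsilon>) * jb p powr (m - real ?k * (1/2 - \<epsilon>))" by (rule nu_power[OF t])
    also have "t powr (real ?k * \<epsilon>) = t ^ ?k * t powr (real ?k * (\<epsilon> - 1))"
      using t by (simp add: right_diff_distrib powr_diff powr_realpow)
    finally have "(mup t p ^ ?k * jb p powr m) * (?c / t ^ ?k) \<le> (t ^ ?k * t powr (real ?k * (\<epsilon> - 1)) * jb p powr (m - real ?k * (1/2 - \<epsilon>))) * (?c / t ^ ?k)"
      using t by (intro mult_right_mono) auto
    also have "\<dots> = ?c * (t powr (real ?k * (\<epsilon> - 1)) * jb p powr (m - real ?k * (1/2 - \<epsilon>)))"
      using t by simp
    finally have *: "(mup t p ^ ?k * jb p powr m) * (?c / t ^ ?k) \<le> ?c * (t powr (real ?k * (\<epsilon> - 1)) * jb p powr (m - real ?k * (1/2 - \<epsilon>)))" .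
    have "norm (complex_of_real (real (mfact \<alpha>) / (t ^ ?k * fact ?k))) = ?c / t ^ ?k"
      unfolding norm_of_real using t by (simp add: abs_mult)
    then show "0 \<le> mup t p ^ length L * jb p powr m * norm (complex_of_real (real (mfact \<alpha>) / (t ^ ?k * fact ?k))) \<and>
      mup t p ^ length L * jb p powr m * norm (complex_of_real (real (mfact \<alpha>) / (t ^ ?k * fact ?k)))
       \<le> ?c * (t powr (real ?k * (\<epsilon> - 1)) * jb p powr (m - real ?k * (1/2 - \<epsilon>)))"
      using * L(2) mup_nonneg[OF t, of p] t by simp
  qed (auto simp: om)
qed (auto simp: om)

text \<open>Lists are regrouped by their multi-index, and the factors \<open>mfact \<alpha>\<close>
  and \<open>t ^ mabs \<alpha>\<close> cancel against those in \<open>term_symbol\<close>. The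
  identity holds for every \<open>p\<close>: off \<open>Om\<close> the value \<open>ze p\<close>
  carries no information, but it is multiplied by a vanishing amplitude.\<close>

lemma expansion:
  assumes t: "t \<in> T01" and M: "1 \<le> M"
  shows "sg t p = \<rho> (t *\<^sub>R ze p) * ac t p
     + (\<Sum>\<alpha>\<in>{\<alpha>. 0 < mabs \<alpha> \<and> mabs \<alpha> < M}. of_real (t ^ mabs \<alpha> / real (mfact \<alpha>)) * term_symbol \<alpha> t p)
     + of_real (t powr (real M * \<epsilon>)) * rem_symbol M t p"
proof -
  define S where "S = {L. L \<in> lists (Basis :: (real^'n) set) \<and> 0 < length L \<and> length L < M}"
  define F where "F = (\<lambda>L. XL L t p / fact (length L))"
  define T where "T = {\<alpha> :: 'n \<Rightarrow> nat. 0 < mabs \<alpha> \<and> mabs \<alpha> < M}"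
  have finT: "finite T" unfolding T_def by (rule finite_subset[OF _ finite_mabs[of M]]) auto
  have "S \<subseteq> (\<Union>k<M. {L. L \<in> lists Basis \<and> length L = k})" by (auto simp: S_def)
  then have finS: "finite S" by (rule finite_subset) (use finite_lists_Basis in auto)
  have SL: "L \<in> lists Basis" "0 < length L" "length L < M" if "L \<in> S" for L using that by (auto simp: S_def)
  have mc: "mabs (cnt L) = length L" if "L \<in> S" for L by (rule mabs_cnt[OF SL(1)[OF that]])
  have mf: "0 < mfact \<alpha>" for \<alpha> :: "'n \<Rightarrow> nat" by (simp add: mfact_def)
  have "(\<Sum>\<alpha>\<in>T. of_real (t ^ mabs \<alpha> / real (mfact \<alpha>)) * term_symbol \<alpha> t p) = (\<Sum>\<alpha>\<in>T. \<Sum>L\<in>{L\<in>S. cnt L = \<alpha>}. F L)"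
  proof (rule sum.cong[OF refl])
    fix \<alpha> assume a: "\<alpha> \<in> T"
    have eq: "{L. (L \<in> lists (Basis :: (real^'n) set) \<and> length L = mabs \<alpha>) \<and> cnt L = \<alpha>} = {L\<in>S. cnt L = \<alpha>}"
    proof (rule set_eqI)
      fix L show "L \<in> {L. (L \<in> lists (Basis :: (real^'n) set) \<and> length L = mabs \<alpha>) \<and> cnt L = \<alpha>} \<longleftrightarrow> L \<in> {L\<in>S. cnt L = \<alpha>}"
      proof (cases "L \<in> lists Basis")
        case True
        then show ?thesis using a mabs_cnt[OF True] by (auto simp: S_def T_def)
      qed (auto simp: S_def)
    qed
    have "of_real (t ^ mabs \<alpha> / real (mfact \<alpha>)) * (of_real (real (mfact \<alpha>) / (t ^ mabs \<alpha> * fact (mabs \<alpha>))) * XL L t p) = F L"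
      if "L \<in> {L\<in>S. cnt L = \<alpha>}" for L
    proof -
      have "length L = mabs \<alpha>" using that mc by auto
      moreover have "t ^ mabs \<alpha> / real (mfact \<alpha>) * (real (mfact \<alpha>) / (t ^ mabs \<alpha> * fact (mabs \<alpha>))) = 1 / fact (mabs \<alpha>)"
        using t mf[of \<alpha>] by simp
      ultimately show ?thesis unfolding F_def mult.assoc[symmetric] of_real_mult[symmetric] by simp
    qed
    then show "of_real (t ^ mabs \<alpha> / real (mfact \<alpha>)) * term_symbol \<alpha> t p = (\<Sum>L\<in>{L\<in>S. cnt L = \<alpha>}. F L)"
      unfolding term_symbol_def eq sum_distrib_left by (rule sum.cong[OF refl])
  qed
  also have "\<dots> = sum F S"
    by (rule sum.group[OF finS finT]) (use mc SL in \<open>auto simp: T_def\<close>)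
  also have "sum F S = (\<Sum>k\<in>{0<..<M}. \<Sum>L\<in>{L\<in>S. length L = k}. F L)"
    by (rule sum.group[symmetric, OF finS]) (auto simp: S_def)
  also have "\<dots> = (\<Sum>k\<in>{0<..<M}. TN k t p)"
  proof (rule sum.cong[OF refl])
    fix k assume "k \<in> {0<..<M}"
    then have "{L\<in>S. length L = k} = {L. L \<in> lists Basis \<and> length L = k}" by (auto simp: S_def)
    then show "(\<Sum>L\<in>{L\<in>S. length L = k}. F L) = TN k t p" by (simp add: TN_def F_def sum_divide_distrib)
  qed
  finally have s: "(\<Sum>\<alpha>\<in>T. of_real (t ^ mabs \<alpha> / real (mfact \<alpha>)) * term_symbol \<alpha> t p) = (\<Sum>k\<in>{0<..<M}. TN k t p)" .
  have "{L. L \<in> lists (Basis :: (real^'n) set) \<and> length L = 0} = {[]}" by auto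
  then have T0: "TN 0 t p = \<rho> (t *\<^sub>R ze p) * ac t p" unfolding TN_def by (simp add: XL_def RL_def AL_def EL_Nil)
  have "{..<M} = insert 0 {0<..<M}" using M by auto
  then have sM: "(\<Sum>k<M. TN k t p) = TN 0 t p + (\<Sum>k\<in>{0<..<M}. TN k t p)" by simp
  have r: "of_real (t powr (real M * \<epsilon>)) * rem_symbol M t p = RN M t p"
  proof -
    have "t powr (real M * \<epsilon>) * t powr - (real M * \<epsilon>) = 1" using t by (simp flip: powr_add)
    then show ?thesis unfolding rem_symbol_def mult.assoc[symmetric] of_real_mult[symmetric] by simp
  qed
  show ?thesis unfolding T_def[symmetric] s r RN_def sM T0 by simp
qed

end

end

theorem theorem4p2:
  fixes a :: "real \<Rightarrow> real^'n::finite \<Rightarrow> real^'n \<Rightarrow> complex"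
    and \<rho> :: "real^'n \<Rightarrow> complex"
    and \<phi> :: "real^'n \<Rightarrow> real^'n \<Rightarrow> real"
    and m \<epsilon> :: real and M :: nat
  defines "\<Omega> \<equiv> {p :: (real^'n) \<times> (real^'n). norm (snd p) > 1}"
  assumes m: "m \<le> 0"
    and eps: "0 < \<epsilon>" "\<epsilon> < 1/2"
    and a_smooth: "\<forall>t\<in>{0<..<1}. smooth_on UNIV (a t)"
    and a_symb: "\<forall>G B. \<exists>C. \<forall>t\<in>{0<..<1}. \<forall>x \<xi>.
                   norm (dd G B (a t) x \<xi>) \<le> C * jbr \<xi> powr (m - real (length G))"
    and a_supp: "\<forall>t\<in>{0<..<1}. closure {p. a t (fst p) (snd p) \<noteq> 0} \<subseteq> \<Omega>"
    and rho: "S10 0 (\<lambda>x \<xi>. \<rho> \<xi>)"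
    and phi_smooth: "smooth_on \<Omega> \<phi>"
    and phi_i: "\<exists>C1 C2. C1 > 0 \<and> C2 > 0 \<and> (\<forall>(x,\<xi>)\<in>\<Omega>.
                   C1 * norm \<xi> \<le> norm (grad_x \<phi> x \<xi>) \<and> norm (grad_x \<phi> x \<xi>) \<le> C2 * norm \<xi>)"
    and phi_ii_x: "\<forall>B. length B \<ge> 1 \<longrightarrow> (\<exists>C. \<forall>(x,\<xi>)\<in>\<Omega>. norm (dd [] B \<phi> x \<xi>) \<le> C * jbr \<xi>)"
    and phi_ii_mixed: "\<forall>G B. length G \<ge> 1 \<longrightarrow> length B \<ge> 1 \<longrightarrow>
               (\<exists>C. \<forall>(x,\<xi>)\<in>\<Omega>. norm (dd G B \<phi> x \<xi>) \<le> C * norm \<xi> powr (1 - real (length G)))"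
    and M: "M \<ge> 1"
  shows "\<exists>(s :: ('n \<Rightarrow> nat) \<Rightarrow> real \<Rightarrow> real^'n \<Rightarrow> real^'n \<Rightarrow> complex)
          (r :: real \<Rightarrow> real^'n \<Rightarrow> real^'n \<Rightarrow> complex).
     (\<forall>t\<in>{0<..<1}. \<forall>x \<xi>.
        sigma_amp (a t) \<rho> \<phi> t x \<xi> =
          \<rho> (t *\<^sub>R grad_x \<phi> x \<xi>) * a t x \<xi>
          + (\<Sum>\<alpha>\<in>{\<alpha>. 0 < mabs \<alpha> \<and> mabs \<alpha> < M}.
               of_real (t ^ mabs \<alpha> / real (mfact \<alpha>)) * s \<alpha> t x \<xi>)
          + of_real (t powr (real M * \<epsilon>)) * r t x \<xi>)
   \<and> (\<forall>\<alpha>. 0 < mabs \<alpha> \<and> mabs \<alpha> < M \<longrightarrow>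
        (\<forall>t\<in>{0<..<1}. smooth_on UNIV (s \<alpha> t)) \<and>
        (\<forall>G B. \<exists>C. \<forall>t\<in>{0<..<1}. \<forall>x \<xi>.
           norm (dd G B (s \<alpha> t) x \<xi>) \<le>
             C * t powr (real (mabs \<alpha>) * (\<epsilon> - 1))
               * jbr \<xi> powr (m - real (mabs \<alpha>) * (1/2 - \<epsilon>) - real (length G))))
   \<and> (\<forall>t\<in>{0<..<1}. smooth_on UNIV (r t))
   \<and> (\<forall>G B. \<exists>C. \<forall>t\<in>{0<..<1}. \<forall>x \<xi>.
        norm (dd G B (r t) x \<xi>) \<le> C * jbr \<xi> powr (m - real M * (1/2 - \<epsilon>) - real (length G)))"
proof -
  interpret symbol_setting a \<rho> \<phi> m
    by (rule symbol_setting.intro[OF m a_smooth a_symb a_supp[unfolded \<Omega>_def] rho phi_smooth[unfolded \<Omega>_def]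
          phi_i[unfolded \<Omega>_def] phi_ii_x[unfolded \<Omega>_def] phi_ii_mixed[unfolded \<Omega>_def]])
  note s = Sy_imp_dd[OF Sy_term_symbol[OF eps]]
  note r = Sy_imp_dd[OF Sy_rem_symbol[OF eps]]
  show ?thesis
  proof (intro exI[of _ "\<lambda>\<alpha> t x \<xi>. term_symbol \<alpha> t (x, \<xi>)"] exI[of _ "\<lambda>t x \<xi>. rem_symbol \<epsilon> M t (x, \<xi>)"] conjI ballI allI impI)
    fix t x \<xi> assume "t \<in> {0<..<1::real}"
    from expansion[OF eps this M, of "(x, \<xi>)"]
    show "sigma_amp (a t) \<rho> \<phi> t x \<xi> = \<rho> (t *\<^sub>R grad_x \<phi> x \<xi>) * a t x \<xi>
          + (\<Sum>\<alpha>\<in>{\<alpha>. 0 < mabs \<alpha> \<and> mabs \<alpha> < M}. of_real (t ^ mabs \<alpha> / real (mfact \<alpha>)) * term_symbol \<alpha> t (x, \<xi>))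
          + of_real (t powr (real M * \<epsilon>)) * rem_symbol \<epsilon> M t (x, \<xi>)"
      by (simp add: sg_def ze_def ac_def)
  next
    show "\<exists>C. \<forall>t\<in>{0<..<1}. \<forall>x \<xi>. norm (dd G B (\<lambda>x \<xi>. rem_symbol \<epsilon> M t (x, \<xi>)) x \<xi>) \<le> C * jbr \<xi> powr (m - real M * (1/2 - \<epsilon>) - real (length G))" for G B
      using Sy_imp_dd(2)[OF Sy_rem_symbol[OF eps, of M], of G B] by simp
  qed (use s r(1) in auto)
qed

end
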